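(* Let $M_p$ be a weight sequence satisfying $(M.1)$, $(M.2)'$, $(QA)$ and $p!\subset M_p$. Let $\Omega\subseteq\mathbb{R}^d$ be open. For every bounded set $B$ in $\mathcal{E}'^{\{M_p\}}(\Omega)$ there are a compact set $K\subset\Omega$ and measures $\mu_\alpha(f)\in C'(K)$, $\alpha\in\mathbb{N}^d$, $f\in B$, such that $$\sup_{f\in B}\sup_{\alpha\in\mathbb{N}^d}\frac{\|\mu_\alpha(f)\|_{C'(K)}M_\alpha}{h^{|\alpha|}}<\infty$$ for all $h>0$ and $$f=\sum_{\alpha\in\mathbb{N}^d}(\mu_\alpha(f))^{(\alpha)},\qquad f\in B.$$
   Context: $\mathbb{N}=\{0,1,2,\dots\}$. A weight sequence is a sequence $(M_p)_{p\in\mathbb{N}}$ of positive reals with $M_0=1$ and $m_p:=M_p/M_{p-1}\to\infty$. Conditions: $(M.1)$ $M_p^2\le M_{p-1}M_{p+1}$ for $p\ge1$; $(M.2)'$ there are $A,H\ge1$ with $M_{p+1}\le AH^{p+1}M_p$ for all $p\in\mathbb{N}$; $(QA)$ $\sum_{p\ge1}1/m_p=\infty$. $p!\subset M_p$ means that there are $C,h>0$ with $p!\le Ch^pM_p$ for all $p$. Put $M_\alpha=M_{|\alpha|}$ for $\alpha\in\mathbb{N}^d$. For a regular compact set $K\subset\mathbb{R}^d$ (i.e. $\overline{\operatorname{int}K}=K$) and $h>0$, $\mathcal{E}^{M_p,h}(K)$ is the Banach space of all $\varphi\in C^\infty(K)$ (smooth on $\operatorname{int}K$, all derivatives extending continuously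 to $K$) with $\|\varphi\|_{K,h}:=\sup_{\alpha}\sup_{x\in K}|\varphi^{(\alpha)}(x)|/(h^{|\alpha|}M_\alpha)<\infty$. For $\Omega\subseteq\mathbb{R}^d$ open, $\mathcal{E}^{\{M_p\}}(\Omega)=\varprojlim_{K\Subset\Omega}\varinjlim_{h\to\infty}\mathcal{E}^{M_p,h}(K)$ as a locally convex space, and $\mathcal{E}'^{\{M_p\}}(\Omega)$ is its topological dual with the strong topology. $C'(K)$ is the dual of the Banach space $C(K)$, i.e. the space of complex Borel measures on $K$ with the total variation norm. The identity $f=\sum_\alpha(\mu_\alpha(f))^{(\alpha)}$ means $\langle f,\varphi\rangle=\sum_{\alpha}(-1)^{|\alpha|}\int_K\varphi^{(\alpha)}\,d\mu_\alpha(f)$ for all $\varphi\in\mathcal{E}^{\{M_p\}}(\Omega)$. *)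

theory Defs
  imports "HOL-Analysis.Analysis"
begin

section \<open>Weight sequences\<close>

definition weight_sequence :: "(nat \<Rightarrow> real) \<Rightarrow> bool" where
  "weight_sequence M \<longleftrightarrow> (\<forall>p. M p > 0) \<and> M 0 = 1 \<and>
     filterlim (\<lambda>p. M (Suc p) / M p) at_top sequentially"

definition cond_M1 :: "(nat \<Rightarrow> real) \<Rightarrow> bool" where
  "cond_M1 M \<longleftrightarrow> (\<forall>p\<ge>1. (M p)\<^sup>2 \<le> M (p - 1) * M (p + 1))"

definition cond_M2' :: "(nat \<Rightarrow> real) \<Rightarrow> bool" where
  "cond_M2' M \<longleftrightarrow> (\<exists>A\<ge>1. \<exists>H\<ge>1. \<forall>p. M (p + 1) \<le> A * H ^ (p + 1) * M p)"

text \<open>The terms are positive, so a sum equal to infinity is a series that is not summable;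
  \<open>M (Suc p) / M p\<close> is \<open>m (p + 1)\<close>.\<close>

definition cond_QA :: "(nat \<Rightarrow> real) \<Rightarrow> bool" where
  "cond_QA M \<longleftrightarrow> \<not> summable (\<lambda>p. 1 / (M (Suc p) / M p))"

definition fact_subset :: "(nat \<Rightarrow> real) \<Rightarrow> bool" where
  "fact_subset M \<longleftrightarrow> (\<exists>C>0. \<exists>h>0. \<forall>p. fact p \<le> C * h ^ p * M p)"


section \<open>Locally convex spaces of complex-valued functions\<close>

text \<open>All spaces below are spaces of functions with complex values and pointwise operations.
  A space of functions on a set \<open>K\<close> is represented by functions on the whole type which are
  zero outside \<open>K\<close>, and a functional on a space \<open>V\<close> by one which is zero outside \<open>V\<close>.\<close>

definition restr :: "'b set \<Rightarrow> ('b \<Rightarrow> complex) \<Rightarrow> 'b \<Rightarrow> complex" where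
  "restr K \<phi> = (\<lambda>x. if x \<in> K then \<phi> x else 0)"

definition seminorm_on :: "('b \<Rightarrow> complex) set \<Rightarrow> (('b \<Rightarrow> complex) \<Rightarrow> real) \<Rightarrow> bool" where
  "seminorm_on V p \<longleftrightarrow>
     (\<forall>x\<in>V. 0 \<le> p x) \<and>
     (\<forall>x\<in>V. \<forall>y\<in>V. p (\<lambda>b. x b + y b) \<le> p x + p y) \<and>
     (\<forall>c. \<forall>x\<in>V. p (\<lambda>b. c * x b) = cmod c * p x)"

text \<open>The locally convex topology on \<open>V\<close> generated by a family \<open>P\<close> of seminorms.\<close>

definition lc_topology ::
  "('b \<Rightarrow> complex) set \<Rightarrow> (('b \<Rightarrow> complex) \<Rightarrow> real) set \<Rightarrow> ('b \<Rightarrow> complex) topology" where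
  "lc_topology V P = topology (\<lambda>U. U \<subseteq> V \<and>
     (\<forall>x\<in>U. \<exists>F \<epsilon>. finite F \<and> F \<subseteq> P \<and> \<epsilon> > 0 \<and> {y\<in>V. \<forall>p\<in>F. p (y - x) < \<epsilon>} \<subseteq> U))"

lemma openin_lc_topology:
  "openin (lc_topology V P) U \<longleftrightarrow> U \<subseteq> V \<and>
     (\<forall>x\<in>U. \<exists>F \<epsilon>. finite F \<and> F \<subseteq> P \<and> \<epsilon> > 0 \<and> {y\<in>V. \<forall>p\<in>F. p (y - x) < \<epsilon>} \<subseteq> U)"
proof -
  define N where "N U x F \<epsilon> \<longleftrightarrow>
      finite F \<and> F \<subseteq> P \<and> \<epsilon> > (0::real) \<and> {y\<in>V. \<forall>p\<in>F. p (y - x) < \<epsilon>} \<subseteq> U" for U x F \<epsilon>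
  have Int: "N (S \<inter> T) x (F \<union> G) (min \<epsilon> \<delta>)" if "N S x F \<epsilon>" "N T x G \<delta>" for S T x F G \<epsilon> \<delta>
    using that unfolding N_def by auto
  have mono: "N T x F \<epsilon>" if "N S x F \<epsilon>" "S \<subseteq> T" for S T x F \<epsilon>
    using that unfolding N_def by (meson subset_trans)
  have "istopology (\<lambda>U. U \<subseteq> V \<and> (\<forall>x\<in>U. \<exists>F \<epsilon>. N U x F \<epsilon>))"
    unfolding istopology_def
  proof (rule conjI; intro allI impI; rule conjI)
    fix S T
    assume S: "S \<subseteq> V \<and> (\<forall>x\<in>S. \<exists>F \<epsilon>. N S x F \<epsilon>)" and T: "T \<subseteq> V \<and> (\<forall>x\<in>T. \<exists>F \<epsilon>. N T x F \<epsilon>)"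
    show "S \<inter> T \<subseteq> V" using S by (meson inf.coboundedI1)
    show "\<forall>x\<in>S \<inter> T. \<exists>F \<epsilon>. N (S \<inter> T) x F \<epsilon>"
    proof
      fix x assume "x \<in> S \<inter> T"
      then have "x \<in> S" "x \<in> T" by simp_all
      then obtain F \<epsilon> G \<delta> where "N S x F \<epsilon>" "N T x G \<delta>"
        using S T by metis
      from Int[OF this] show "\<exists>F \<epsilon>. N (S \<inter> T) x F \<epsilon>" by (intro exI)
    qed
  next
    fix \<K>
    assume K: "\<forall>U\<in>\<K>. U \<subseteq> V \<and> (\<forall>x\<in>U. \<exists>F \<epsilon>. N U x F \<epsilon>)"
    show "\<Union>\<K> \<subseteq> V" using K by (meson Sup_least)
    show "\<forall>x\<in>\<Union>\<K>. \<exists>F \<epsilon>. N (\<Union>\<K>) x F \<epsilon>"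
    proof
      fix x assume "x \<in> \<Union>\<K>"
      then obtain U where U: "U \<in> \<K>" "x \<in> U" by (rule UnionE)
      then obtain F \<epsilon> where "N U x F \<epsilon>" using K by metis
      from mono[OF this Union_upper[OF U(1)]] show "\<exists>F \<epsilon>. N (\<Union>\<K>) x F \<epsilon>" by (intro exI)
    qed
  qed
  then show ?thesis
    unfolding lc_topology_def N_def by (subst topology_inverse') simp_all
qed

text \<open>Boundedness in the sense of von Neumann: \<open>S\<close> is absorbed by every neighbourhood of zero.\<close>

definition vN_bounded :: "('b \<Rightarrow> complex) topology \<Rightarrow> ('b \<Rightarrow> complex) set \<Rightarrow> bool" where
  "vN_bounded T S \<longleftrightarrow> S \<subseteq> topspace T \<and>
     (\<forall>U. openin T U \<and> (\<lambda>b. 0) \<in> U \<longrightarrow>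
       (\<exists>r>0. \<forall>t>r. \<forall>x\<in>S. (\<lambda>b. x b / complex_of_real t) \<in> U))"

definition top_dual :: "('b \<Rightarrow> complex) topology \<Rightarrow> (('b \<Rightarrow> complex) \<Rightarrow> complex) set" where
  "top_dual T = {f. continuous_map T euclidean f \<and>
     (\<forall>x\<in>topspace T. \<forall>y\<in>topspace T. f (\<lambda>b. x b + y b) = f x + f y) \<and>
     (\<forall>c. \<forall>x\<in>topspace T. f (\<lambda>b. c * x b) = c * f x) \<and>
     (\<forall>x. x \<notin> topspace T \<longrightarrow> f x = 0)}"

text \<open>The strong topology: uniform convergence on the bounded sets.\<close>

definition strong_dual_topology ::
  "('b \<Rightarrow> complex) topology \<Rightarrow> (('b \<Rightarrow> complex) \<Rightarrow> complex) topology" where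
  "strong_dual_topology T = lc_topology (top_dual T)
     {\<lambda>f. SUP x\<in>S. cmod (f x) | S. vN_bounded T S \<and> S \<noteq> {}}"


section \<open>Partial derivatives and smooth functions\<close>

definition partial :: "'d::finite \<Rightarrow> (real^'d \<Rightarrow> complex) \<Rightarrow> real^'d \<Rightarrow> complex" where
  "partial i \<phi> x = vector_derivative (\<lambda>t. \<phi> (x + t *\<^sub>R axis i 1)) (at 0)"

definition partials :: "'d::finite list \<Rightarrow> (real^'d \<Rightarrow> complex) \<Rightarrow> real^'d \<Rightarrow> complex" where
  "partials is = foldr partial is"

text \<open>Used for open sets \<open>U\<close>: all iterated partial derivatives are (totally) differentiable.\<close>

definition smooth_on :: "(real^'d::finite) set \<Rightarrow> (real^'d \<Rightarrow> complex) \<Rightarrow> bool" where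
  "smooth_on U \<phi> \<longleftrightarrow> (\<forall>is. \<forall>x\<in>U. partials is \<phi> differentiable (at x))"

type_synonym 'd multi_index = "'d \<Rightarrow> nat"

definition mi_abs :: "'d::finite multi_index \<Rightarrow> nat" where
  "mi_abs \<alpha> = (\<Sum>i\<in>UNIV. \<alpha> i)"

text \<open>The index type carries no order, so an arbitrary order of differentiation is chosen; for
  smooth functions the result does not depend on it.\<close>

definition mderiv :: "'d::finite multi_index \<Rightarrow> (real^'d \<Rightarrow> complex) \<Rightarrow> real^'d \<Rightarrow> complex" where
  "mderiv \<alpha> = partials (SOME is. \<forall>i. count_list is i = \<alpha> i)"


section \<open>Ultradifferentiable functions of Roumieu type\<close>

definition regular_compact :: "(real^'d::finite) set \<Rightarrow> bool" where
  "regular_compact K \<longleftrightarrow> compact K \<and> closure (interior K) = K"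

definition Cinf :: "(real^'d::finite) set \<Rightarrow> (real^'d \<Rightarrow> complex) set" where
  "Cinf K = {\<phi>. (\<forall>x. x \<notin> K \<longrightarrow> \<phi> x = 0) \<and> continuous_on K \<phi> \<and> smooth_on (interior K) \<phi> \<and>
     (\<forall>\<alpha>. \<exists>g. continuous_on K g \<and> (\<forall>x\<in>interior K. g x = mderiv \<alpha> \<phi> x))}"

text \<open>The continuous extension to \<open>K\<close> of the derivative on the interior.\<close>

definition ext_deriv ::
  "(real^'d::finite) set \<Rightarrow> 'd multi_index \<Rightarrow> (real^'d \<Rightarrow> complex) \<Rightarrow> real^'d \<Rightarrow> complex" where
  "ext_deriv K \<alpha> \<phi> x = Lim (at x within interior K) (mderiv \<alpha> \<phi>)"

definition E_norm ::
  "(nat \<Rightarrow> real) \<Rightarrow> (real^'d::finite) set \<Rightarrow> real \<Rightarrow> (real^'d \<Rightarrow> complex) \<Rightarrow> ennreal" where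
  "E_norm M K h \<phi> =
     (SUP \<alpha>. SUP x\<in>K. ennreal (cmod (ext_deriv K \<alpha> \<phi> x) / (h ^ mi_abs \<alpha> * M (mi_abs \<alpha>))))"

definition E_step ::
  "(nat \<Rightarrow> real) \<Rightarrow> (real^'d::finite) set \<Rightarrow> real \<Rightarrow> (real^'d \<Rightarrow> complex) set" where
  "E_step M K h = {\<phi> \<in> Cinf K. E_norm M K h \<phi> < \<infinity>}"

definition E_compact :: "(nat \<Rightarrow> real) \<Rightarrow> (real^'d::finite) set \<Rightarrow> (real^'d \<Rightarrow> complex) set" where
  "E_compact M K = (\<Union>h\<in>{0<..}. E_step M K h)"

text \<open>The locally convex inductive limit topology on \<open>E_compact M K\<close> is the finest locally convex
  topology for which all inclusions of the steps are continuous. Its continuous seminorms are those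
  whose restriction to each step is continuous, that is, bounded by a multiple of the norm.\<close>

definition E_compact_seminorms ::
  "(nat \<Rightarrow> real) \<Rightarrow> (real^'d::finite) set \<Rightarrow> ((real^'d \<Rightarrow> complex) \<Rightarrow> real) set" where
  "E_compact_seminorms M K = {p. seminorm_on (E_compact M K) p \<and>
     (\<forall>h>0. \<exists>C\<ge>0. \<forall>\<phi>\<in>E_step M K h. ennreal (p \<phi>) \<le> ennreal C * E_norm M K h \<phi>)}"

text \<open>The projective limit over \<open>K\<close>, a compatible family of functions on the sets \<open>K\<close> being
  identified with a function on \<open>\<Omega>\<close>. It carries the initial topology of the restriction maps.\<close>

definition E_open :: "(nat \<Rightarrow> real) \<Rightarrow> (real^'d::finite) set \<Rightarrow> (real^'d \<Rightarrow> complex) set" where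
  "E_open M \<Omega> = {\<phi>. (\<forall>x. x \<notin> \<Omega> \<longrightarrow> \<phi> x = 0) \<and>
     (\<forall>K. regular_compact K \<and> K \<subseteq> \<Omega> \<longrightarrow> restr K \<phi> \<in> E_compact M K)}"

definition E_topology ::
  "(nat \<Rightarrow> real) \<Rightarrow> (real^'d::finite) set \<Rightarrow> (real^'d \<Rightarrow> complex) topology" where
  "E_topology M \<Omega> = lc_topology (E_open M \<Omega>)
     {\<lambda>\<phi>. p (restr K \<phi>) | K p. regular_compact K \<and> K \<subseteq> \<Omega> \<and> p \<in> E_compact_seminorms M K}"


section \<open>Measures on a compact set as the dual of the continuous functions\<close>

definition C_space :: "(real^'d::finite) set \<Rightarrow> (real^'d \<Rightarrow> complex) set" where
  "C_space K = {g. continuous_on K g \<and> (\<forall>x. x \<notin> K \<longrightarrow> g x = 0)}"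

text \<open>Inserting zero only matters for empty \<open>K\<close>.\<close>

definition sup_norm :: "(real^'d::finite) set \<Rightarrow> (real^'d \<Rightarrow> complex) \<Rightarrow> real" where
  "sup_norm K g = Sup (insert 0 ((\<lambda>x. cmod (g x)) ` K))"

text \<open>A complex Borel measure \<open>\<mu>\<close> on \<open>K\<close> is given as the functional sending \<open>g\<close> to the integral
  of \<open>g\<close> with respect to \<open>\<mu>\<close>; the total variation norm is the dual norm.\<close>

definition C_dual :: "(real^'d::finite) set \<Rightarrow> ((real^'d \<Rightarrow> complex) \<Rightarrow> complex) set" where
  "C_dual K = top_dual (lc_topology (C_space K) {sup_norm K})"

definition C_dual_norm ::
  "(real^'d::finite) set \<Rightarrow> ((real^'d \<Rightarrow> complex) \<Rightarrow> complex) \<Rightarrow> real" where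
  "C_dual_norm K \<mu> = (SUP g\<in>{g \<in> C_space K. sup_norm K g \<le> 1}. cmod (\<mu> g))"

end

theory Submission
  imports Defs "HOL-Complex_Analysis.Cauchy_Integral_Formula"
begin

text \<open>By a gliding hump argument there are \<open>n\<close> and \<open>C\<close> such that every \<open>f \<in> B\<close> satisfies
  \<open>cmod (f \<phi>) \<le> C * c\<close> as soon as the derivatives of \<open>\<phi>\<close> on the \<open>m\<close>-th set of an exhaustion are
  at most \<open>c * (h m ^ p * M p)\<close> for all \<open>m \<le> n\<close>; here the rates \<open>h m\<close> can be prescribed in advance.
  A test function is approximated by localized trigonometric sums: its Fourier coefficients over a
  compact set are multiplied by iterated averages of indicator functions, and the kernels of these
  multipliers are exponentially small away from the origin. On a dyadic difference of such sums,
  \<open>f\<close> is a finite combination of Fourier coefficients of \<open>\<phi>\<close>; inserting a cutoff function and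
  integrating by parts \<open>q\<close> times in a dominant coordinate turns it into a sum of integrals of pure
  derivatives of \<open>\<phi>\<close> against explicit densities. The values of \<open>f\<close> on waves of frequency about
  \<open>2 ^ l\<close> are so small compared with the weights that one choice of the orders \<open>q l\<close> makes the
  densities summable with the required bounds for all \<open>h\<close> simultaneously. This represents \<open>f\<close> on
  all trigonometric sums, of whatever period, and these approximate every test function.\<close>

subsection \<open>Partial derivatives of smooth functions\<close>

text \<open>A quasianalytic class contains no nonzero function of compact support, so no cutoff
  stays inside the class. The cutoffs used are only q times differentiable, with derivatives of
  order j \<le> q at most (C * (q + 1)) ^ j; (M.1) and p! \<subset> M_p absorb these powers into a
  geometric multiple of M_q. With q adapted to the frequency 2 ^ l, the coefficients of a localized
  test function are at most a constant times the minimum over q of (b / 2 ^ l) ^ q * M_q. The order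
  of choices shapes the rest. A bound on f is available only once rates on all the compact sets are
  fixed; it decides how many of these sets matter, and only then can the unit \<tau> of frequency be
  chosen. Hence the rates must not depend on \<tau>. The densities are built for one \<tau> and for
  rate 1, so that \<open>K\<close> is common to all of \<open>B\<close>. A test function with other
  rates needs another bound, perhaps more sets and a smaller \<tau>. Its approximating sums have
  another period, but they grow with rate 1, because M_p dominates every geometric sequence, so the
  densities already represent f on them.\<close>

lemma partials_simps [simp]:
  "partials [] f = f" "partials (i # is) f = partial i (partials is f)"
  by (simp_all add: partials_def)

lemma line_tendsto:
  fixes x :: "real^'d::finite"
  assumes "open U" "x \<in> U"
  shows "\<forall>\<^sub>F t in nhds 0. x + t *\<^sub>R axis i 1 \<in> U"
proof -
  have "((\<lambda>t. x + t *\<^sub>R axis i 1) \<longlongrightarrow> x + 0 *\<^sub>R axis i 1) (nhds (0::real))"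
    by (intro tendsto_intros) (simp add: filterlim_ident)
  then show ?thesis
    using assms by (simp add: tendsto_def)
qed

lemma partial_cong_open:
  fixes f :: "real^'d::finite \<Rightarrow> complex"
  assumes "open U" "x \<in> U" "\<And>y. y \<in> U \<Longrightarrow> f y = g y"
  shows "partial i f x = partial i g x"
  unfolding partial_def
  by (intro vector_derivative_cong_eq eventually_mono[OF line_tendsto[OF assms(1,2), of i]])
     (use assms(3) in auto)

lemma partials_cong_open:
  fixes f :: "real^'d::finite \<Rightarrow> complex"
  assumes "open U" "\<And>y. y \<in> U \<Longrightarrow> f y = g y" "x \<in> U"
  shows "partials is f x = partials is g x"
  using assms(3)
proof (induction "is" arbitrary: x)
  case (Cons i js)
  then show ?case
    using partial_cong_open[OF assms(1) Cons.prems, of "partials js f" "partials js g"] by simp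
qed (use assms in simp)

lemma smooth_on_cong_open:
  assumes "open U" "\<And>y. y \<in> U \<Longrightarrow> f y = g y" "smooth_on U f"
  shows "smooth_on U g"
  unfolding smooth_on_def
proof (intro allI ballI)
  fix "is" x assume x: "x \<in> U"
  have "partials is f differentiable at x"
    using assms(3) x by (auto simp: smooth_on_def)
  then obtain D where "(partials is f has_derivative D) (at x)"
    by (auto simp: differentiable_def)
  then have "(partials is g has_derivative D) (at x)"
    by (rule has_derivative_transform_within_open[OF _ assms(1) x])
       (use partials_cong_open[OF assms(1,2)] in auto)
  then show "partials is g differentiable at x"
    by (auto simp: differentiable_def)
qed

lemma smooth_on_subset: "smooth_on U f \<Longrightarrow> V \<subseteq> U \<Longrightarrow> smooth_on V f"
  by (auto simp: smooth_on_def)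

lemma has_partial:
  fixes f :: "real^'d::finite \<Rightarrow> complex"
  assumes "f differentiable at x"
  shows "((\<lambda>t. f (x + t *\<^sub>R axis i 1)) has_vector_derivative partial i f x) (at 0)"
proof -
  have "(\<lambda>t::real. x + t *\<^sub>R axis i 1) differentiable at 0"
    by (intro derivative_intros)
  then have "(f \<circ> (\<lambda>t::real. x + t *\<^sub>R axis i 1)) differentiable at 0"
    by (intro differentiable_chain_at) (use assms in auto)
  then show ?thesis
    unfolding partial_def vector_derivative_works[symmetric] by (simp add: o_def)
qed

lemma partialI:
  "((\<lambda>t. f (x + t *\<^sub>R axis i 1)) has_vector_derivative D) (at 0) \<Longrightarrow> partial i f x = D"
  unfolding partial_def by (rule vector_derivative_at)

lemma smooth_on_has_partial:
  assumes "smooth_on U f" "x \<in> U"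
  shows "((\<lambda>t. partials is f (x + t *\<^sub>R axis i 1)) has_vector_derivative partials (i # is) f x) (at 0)"
  using assms has_partial[of "partials is f" x i] by (auto simp: smooth_on_def)

lemma smooth_on_lincomb:
  assumes "open U" "smooth_on U f" "smooth_on U g"
  shows "smooth_on U (\<lambda>x. a * f x + b * g x)"
    and "x \<in> U \<Longrightarrow> partials is (\<lambda>x. a * f x + b * g x) x = a * partials is f x + b * partials is g x"
proof -
  have *: "partials is (\<lambda>x. a * f x + b * g x) x = a * partials is f x + b * partials is g x"
    if "x \<in> U" for "is" x
    using that
  proof (induction "is" arbitrary: x)
    case (Cons i js)
    have "partial i (partials js (\<lambda>x. a * f x + b * g x)) x
        = partial i (\<lambda>x. a * partials js f x + b * partials js g x) x"
      by (rule partial_cong_open[OF assms(1) Cons.prems]) (rule Cons.IH)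
    also have "\<dots> = a * partials (i # js) f x + b * partials (i # js) g x"
      by (rule partialI)
         (rule has_vector_derivative_add[OF
            has_vector_derivative_mult_right[OF smooth_on_has_partial[OF assms(2) Cons.prems]]
            has_vector_derivative_mult_right[OF smooth_on_has_partial[OF assms(3) Cons.prems]]])
    finally show ?case by simp
  qed simp
  show "smooth_on U (\<lambda>x. a * f x + b * g x)"
    unfolding smooth_on_def
  proof (intro allI ballI)
    fix "is" x assume x: "x \<in> U"
    obtain D1 D2 where D: "(partials is f has_derivative D1) (at x)" "(partials is g has_derivative D2) (at x)"
      using assms(2,3) x unfolding smooth_on_def differentiable_def by meson
    have "((\<lambda>x. a * partials is f x + b * partials is g x) has_derivative (\<lambda>h. a * D1 h + b * D2 h)) (at x)"
      by (intro derivative_intros D)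
    then have "(partials is (\<lambda>x. a * f x + b * g x) has_derivative (\<lambda>h. a * D1 h + b * D2 h)) (at x)"
      by (rule has_derivative_transform_within_open[OF _ assms(1) x]) (use * in auto)
    then show "partials is (\<lambda>x. a * f x + b * g x) differentiable at x"
      by (auto simp: differentiable_def)
  qed
  show "x \<in> U \<Longrightarrow> partials is (\<lambda>x. a * f x + b * g x) x = a * partials is f x + b * partials is g x"
    by (rule *)
qed

lemma smooth_on_continuous:
  assumes "smooth_on U f" shows "continuous_on U (partials is f)"
  using assms unfolding smooth_on_def
  by (meson continuous_at_imp_continuous_on differentiable_imp_continuous_within)

section \<open>Multi-indices and lists of directions\<close>

definition mi_list :: "'d::finite multi_index \<Rightarrow> 'd list" where
  "mi_list \<alpha> = (SOME is. \<forall>i. count_list is i = \<alpha> i)"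

lemma mderiv_eq: "mderiv \<alpha> = partials (mi_list \<alpha>)"
  by (simp add: mderiv_def mi_list_def)

lemma count_list_append: "count_list (xs @ ys) i = count_list xs i + count_list ys i"
  by (induction xs) auto

lemma count_list_replicate: "count_list (replicate n x) i = (if i = x then n else 0)"
  by (induction n) auto

text \<open>The choice is meaningful because a list with any prescribed counts exists, built by
  adding one block of repetitions per coordinate. From here on only these counts enter.\<close>

lemma count_mi_list: "count_list (mi_list (\<alpha> :: 'd::finite multi_index)) i = \<alpha> i"
proof -
  have "\<exists>is. (\<forall>i\<in>S. count_list is i = \<alpha> i) \<and> (\<forall>i. i \<notin> S \<longrightarrow> count_list is i = 0)" if "finite S" for S
    using that
  proof (induction S)
    case empty
    show ?case by (rule exI[of _ "[]"]) simp
  next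
    case (insert s S)
    then obtain js where "(\<forall>i\<in>S. count_list js i = \<alpha> i) \<and> (\<forall>i. i \<notin> S \<longrightarrow> count_list js i = 0)"
      by blast
    then show ?case
      using insert by (intro exI[of _ "replicate (\<alpha> s) s @ js"])
        (auto simp: count_list_append count_list_replicate)
  qed
  from this[of UNIV] have "\<exists>is. \<forall>i. count_list is i = \<alpha> i" by auto
  then have "\<forall>i. count_list (mi_list \<alpha>) i = \<alpha> i"
    unfolding mi_list_def by (rule someI_ex)
  then show ?thesis by simp
qed

lemma prod_list_count:
  fixes f :: "'d::finite \<Rightarrow> 'a::comm_monoid_mult"
  shows "prod_list (map f is) = (\<Prod>i\<in>UNIV. f i ^ count_list is i)"
proof (induction "is")
  case (Cons a js)
  have "(\<Prod>i\<in>UNIV. f i ^ count_list (a # js) i) = (\<Prod>i\<in>UNIV. (if i = a then f i else 1) * f i ^ count_list js i)"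
    by (intro prod.cong) auto
  also have "\<dots> = f a * (\<Prod>i\<in>UNIV. f i ^ count_list js i)"
    by (simp add: prod.distrib prod.delta)
  finally show ?case using Cons by simp
qed simp

text \<open>Integrating by parts in a single coordinate produces only derivatives of this type, so
  the densities sit on these multi-indices alone.\<close>

definition pure :: "'d \<Rightarrow> nat \<Rightarrow> 'd multi_index" where
  "pure i j = (\<lambda>i'. if i' = i then j else 0)"

lemma mi_abs_pure [simp]: "mi_abs (pure i j) = j"
  by (simp add: mi_abs_def pure_def)

text \<open>Only one direction occurs, which forces the list that \<open>mderiv\<close> chooses. The
  derivatives in a one-variable Leibniz rule thereby become values of \<open>mderiv\<close>.\<close>

lemma mderiv_pure: "mderiv (pure i j) = partials (replicate j i)"
proof -
  have c: "count_list (mi_list (pure i j)) k = (if k = i then j else 0)" for k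
    by (simp add: count_mi_list pure_def)
  have *: "xs = replicate (count_list xs i) i" if "\<And>k. k \<noteq> i \<Longrightarrow> count_list xs k = 0" for xs
    using that
  proof (induction xs)
    case (Cons a xs)
    have "a = i" using Cons.prems[of a] by (metis add_is_0 count_list.simps(2) zero_neq_one)
    moreover have "xs = replicate (count_list xs i) i"
      by (rule Cons.IH) (metis Cons.prems add_is_0 count_list.simps(2))
    ultimately show ?case by (metis count_list.simps(2) Suc_eq_plus1 replicate_Suc)
  qed simp
  show ?thesis unfolding mderiv_eq using *[of "mi_list (pure i j)"] c by auto
qed

lemma mi_abs_0 [simp]: "mi_abs (\<lambda>i. 0) = 0"
  by (simp add: mi_abs_def)

subsection \<open>The spaces of ultradifferentiable functions\<close>

text \<open>A predicate instead of the extended norm \<open>E_norm\<close>: it speaks of the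
  function itself rather than of its restrictions, makes sense on any set, and carries its constant
  explicitly.\<close>

definition derivs_le :: "(nat \<Rightarrow> real) \<Rightarrow> (real^'d::finite) set \<Rightarrow> real \<Rightarrow> real \<Rightarrow> (real^'d \<Rightarrow> complex) \<Rightarrow> bool" where
  "derivs_le M U h C \<phi> \<longleftrightarrow> (\<forall>\<alpha>. \<forall>x\<in>U. cmod (mderiv \<alpha> \<phi> x) \<le> C * (h ^ mi_abs \<alpha> * M (mi_abs \<alpha>)))"

lemma derivs_leD: "derivs_le M U h C \<phi> \<Longrightarrow> x \<in> U \<Longrightarrow> cmod (mderiv \<alpha> \<phi> x) \<le> C * (h ^ mi_abs \<alpha> * M (mi_abs \<alpha>))"
  by (simp add: derivs_le_def)

lemma derivs_le_mono:
  assumes "derivs_le M U h C \<phi>" "V \<subseteq> U" "0 < h" "h \<le> h'" "0 \<le> C" "C \<le> C'" "\<And>p. M p > 0"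
  shows "derivs_le M V h' C' \<phi>"
  unfolding derivs_le_def
proof (intro allI ballI)
  fix \<alpha> x assume "x \<in> V"
  then have "cmod (mderiv \<alpha> \<phi> x) \<le> C * (h ^ mi_abs \<alpha> * M (mi_abs \<alpha>))"
    using assms by (auto simp: derivs_le_def)
  also have "\<dots> \<le> C' * (h' ^ mi_abs \<alpha> * M (mi_abs \<alpha>))"
    using assms by (intro mult_mono power_mono) (auto intro: less_imp_le)
  finally show "cmod (mderiv \<alpha> \<phi> x) \<le> C' * (h' ^ mi_abs \<alpha> * M (mi_abs \<alpha>))" .
qed

lemma smooth_on_mderiv_continuous: "smooth_on U f \<Longrightarrow> continuous_on U (mderiv \<alpha> f)"
  unfolding mderiv_eq by (rule smooth_on_continuous)

lemma derivs_le_closure: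
  assumes "smooth_on \<Omega> \<phi>" "closure U \<subseteq> \<Omega>" "derivs_le M U h C \<phi>"
  shows "derivs_le M (closure U) h C \<phi>"
  unfolding derivs_le_def
proof (intro allI ballI)
  fix \<alpha> x assume x: "x \<in> closure U"
  have "continuous_on (closure U) (mderiv \<alpha> \<phi>)"
    using smooth_on_mderiv_continuous[OF assms(1)] assms(2) continuous_on_subset by blast
  then show "cmod (mderiv \<alpha> \<phi> x) \<le> C * (h ^ mi_abs \<alpha> * M (mi_abs \<alpha>))"
    by (rule continuous_on_closure_norm_le) (use assms(3) x in \<open>auto simp: derivs_le_def\<close>)
qed

lemma mderiv_cong_open:
  assumes "open U" "\<And>y. y \<in> U \<Longrightarrow> f y = g y" "x \<in> U"
  shows "mderiv \<alpha> f x = mderiv \<alpha> g x"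
  unfolding mderiv_eq by (rule partials_cong_open[OF assms])

lemma mderiv_restr:
  assumes "x \<in> interior K" shows "mderiv \<alpha> (restr K \<phi>) x = mderiv \<alpha> \<phi> x"
  by (rule mderiv_cong_open[of "interior K"]) (use assms interior_subset in \<open>auto simp: restr_def\<close>)

text \<open>Regularity makes the filter nontrivial, so that \<open>Lim\<close> is determined; the
  limit is the derivative itself because \<phi> is smooth across the boundary of
  \<open>K\<close>.\<close>

lemma ext_deriv_restr:
  assumes "open \<Omega>" "smooth_on \<Omega> \<phi>" "regular_compact K" "K \<subseteq> \<Omega>" "x \<in> K"
  shows "ext_deriv K \<alpha> (restr K \<phi>) x = mderiv \<alpha> \<phi> x"
  unfolding ext_deriv_def
proof (rule tendsto_Lim)
  have "x \<in> closure (interior K)"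
    using assms by (simp add: regular_compact_def)
  moreover have "x islimpt interior K" if "x \<in> interior K"
    using that interior_limit_point by (metis interior_interior)
  ultimately show "at x within interior K \<noteq> bot"
    unfolding trivial_limit_within closure_def by auto
  have "isCont (mderiv \<alpha> \<phi>) x"
    using smooth_on_mderiv_continuous[OF assms(2)] assms(1,4,5)
    by (meson continuous_on_eq_continuous_at subsetD)
  then have "(mderiv \<alpha> \<phi> \<longlongrightarrow> mderiv \<alpha> \<phi> x) (at x within interior K)"
    by (meson continuous_at_imp_continuous_at_within continuous_within)
  moreover have "\<forall>\<^sub>F y in at x within interior K. mderiv \<alpha> (restr K \<phi>) y = mderiv \<alpha> \<phi> y"
    by (auto simp: eventually_at_filter mderiv_restr)
  ultimately show "(mderiv \<alpha> (restr K \<phi>) \<longlongrightarrow> mderiv \<alpha> \<phi> x) (at x within interior K)"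
    by (simp add: tendsto_cong)
qed

text \<open>The derivatives are continuous on a neighbourhood of \<open>K\<close>, so a bound on the
  interior extends to its closure, which is \<open>K\<close> by regularity.\<close>

lemma E_norm_restr_le_iff:
  assumes "open \<Omega>" "smooth_on \<Omega> \<phi>" "regular_compact K" "K \<subseteq> \<Omega>" "h > 0" "C \<ge> 0" "\<And>p. M p > 0"
  shows "E_norm M K h (restr K \<phi>) \<le> ennreal C \<longleftrightarrow> derivs_le M (interior K) h C \<phi>"
proof -
  have "E_norm M K h (restr K \<phi>) \<le> ennreal C \<longleftrightarrow>
      (\<forall>\<alpha>. \<forall>x\<in>K. cmod (mderiv \<alpha> \<phi> x) / (h ^ mi_abs \<alpha> * M (mi_abs \<alpha>)) \<le> C)"
    unfolding E_norm_def SUP_le_iff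
    using ext_deriv_restr[OF assms(1-4)] assms(6) by (simp add: ennreal_le_iff)
  also have "\<dots> \<longleftrightarrow> derivs_le M K h C \<phi>"
    unfolding derivs_le_def using assms(5,7) by (simp add: divide_le_eq)
  also have "\<dots> \<longleftrightarrow> derivs_le M (interior K) h C \<phi>"
  proof
    show "derivs_le M K h C \<phi> \<Longrightarrow> derivs_le M (interior K) h C \<phi>"
      unfolding derivs_le_def using interior_subset by blast
    have "closure (interior K) = K"
      using assms(3) by (simp add: regular_compact_def)
    then show "derivs_le M (interior K) h C \<phi> \<Longrightarrow> derivs_le M K h C \<phi>"
      using derivs_le_closure[OF assms(2), of "interior K"] assms(4) by simp
  qed
  finally show ?thesis .
qed

lemma restr_Cinf:
  assumes "open \<Omega>" "smooth_on \<Omega> \<phi>" "regular_compact K" "K \<subseteq> \<Omega>"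
  shows "restr K \<phi> \<in> Cinf K"
  unfolding Cinf_def
proof (intro CollectI conjI allI impI)
  have cont: "continuous_on K (mderiv \<alpha> \<phi>)" for \<alpha>
    using smooth_on_mderiv_continuous[OF assms(2)] assms(4) continuous_on_subset by blast
  have "continuous_on K (partials [] \<phi>)"
    using smooth_on_continuous[OF assms(2)] assms(4) continuous_on_subset by blast
  then show "continuous_on K (restr K \<phi>)"
    by (rule continuous_on_eq) (simp add: restr_def)
  show "smooth_on (interior K) (restr K \<phi>)"
  proof (rule smooth_on_cong_open[of _ \<phi>])
    show "smooth_on (interior K) \<phi>"
      by (rule smooth_on_subset[OF assms(2)]) (use assms(4) interior_subset in blast)
  qed (use interior_subset in \<open>auto simp: restr_def\<close>)
  show "\<exists>g. continuous_on K g \<and> (\<forall>x\<in>interior K. g x = mderiv \<alpha> (restr K \<phi>) x)" for \<alpha>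
    using cont[of \<alpha>] by (intro exI[of _ "mderiv \<alpha> \<phi>"]) (simp add: mderiv_restr)
qed (simp add: restr_def)

lemma regular_compact_cball: "e > 0 \<Longrightarrow> regular_compact (cball (x :: real^'d::finite) e)"
  by (simp add: regular_compact_def interior_cball)

text \<open>The working description of the space: the projective and the inductive limit disappear
  into quantifiers over \<open>K\<close> and \<open>h\<close>.\<close>

lemma E_open_iff:
  assumes "open \<Omega>" "\<And>p. M p > 0"
  shows "\<phi> \<in> E_open M \<Omega> \<longleftrightarrow> (\<forall>x. x \<notin> \<Omega> \<longrightarrow> \<phi> x = 0) \<and> smooth_on \<Omega> \<phi> \<and>
    (\<forall>K. regular_compact K \<and> K \<subseteq> \<Omega> \<longrightarrow> (\<exists>h>0. \<exists>C\<ge>0. derivs_le M (interior K) h C \<phi>))"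
    (is "?L \<longleftrightarrow> ?R")
proof
  assume L: ?L
  \<comment> \<open>Smoothness is local, and closed balls of positive radius are regular compact
    sets, so membership of the restrictions in \<open>Cinf\<close> is enough.\<close>
  have sm: "smooth_on \<Omega> \<phi>"
    unfolding smooth_on_def
  proof (intro allI ballI)
    fix "is" x assume "x \<in> \<Omega>"
    then obtain e where e: "e > 0" "cball x e \<subseteq> \<Omega>"
      using assms(1) open_contains_cball by blast
    then have "restr (cball x e) \<phi> \<in> Cinf (cball x e)"
      using L regular_compact_cball[OF e(1)] by (auto simp: E_open_def E_compact_def E_step_def)
    then have "smooth_on (interior (cball x e)) (restr (cball x e) \<phi>)"
      by (simp add: Cinf_def)
    then have "smooth_on (interior (cball x e)) \<phi>"
      by (rule smooth_on_cong_open[rotated 2]) (use interior_subset in \<open>auto simp: restr_def\<close>)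
    then show "partials is \<phi> differentiable at x"
      using e(1) by (auto simp: smooth_on_def interior_cball)
  qed
  have "\<exists>h>0. \<exists>C\<ge>0. derivs_le M (interior K) h C \<phi>" if K: "regular_compact K" "K \<subseteq> \<Omega>" for K
  proof -
    have "restr K \<phi> \<in> E_compact M K"
      using L K by (auto simp: E_open_def)
    then obtain h where h: "h > 0" "E_norm M K h (restr K \<phi>) < \<infinity>"
      by (auto simp: E_compact_def E_step_def)
    then have "E_norm M K h (restr K \<phi>) \<le> ennreal (enn2real (E_norm M K h (restr K \<phi>)))"
      by simp
    then have "derivs_le M (interior K) h (enn2real (E_norm M K h (restr K \<phi>))) \<phi>"
      using E_norm_restr_le_iff[OF assms(1) sm K h(1) enn2real_nonneg, of M] assms(2) by blast
    then show ?thesis using h(1) enn2real_nonneg by blast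
  qed
  then show ?R
    using L sm by (auto simp: E_open_def)
next
  assume R: ?R
  have "restr K \<phi> \<in> E_compact M K" if K: "regular_compact K" "K \<subseteq> \<Omega>" for K
  proof -
    obtain h C where h: "h > 0" "C \<ge> 0" "derivs_le M (interior K) h C \<phi>"
      using R K by blast
    then have "E_norm M K h (restr K \<phi>) \<le> ennreal C"
      using E_norm_restr_le_iff[OF assms(1) _ K h(1,2), of \<phi> M] assms(2) R by blast
    then have "E_norm M K h (restr K \<phi>) < \<infinity>"
      by (simp add: order_le_less_trans)
    then show ?thesis
      using restr_Cinf[OF assms(1) _ K, of \<phi>] R h(1) by (auto simp: E_compact_def E_step_def)
  qed
  then show ?L using R by (auto simp: E_open_def)
qed

lemma E_open_smooth:
  assumes "open \<Omega>" "\<And>p. M p > 0" "\<phi> \<in> E_open M \<Omega>"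
  shows "smooth_on \<Omega> \<phi>"
  using assms(3) unfolding E_open_iff[OF assms(1,2)] by (elim conjE)

lemma E_open_bd:
  assumes "open \<Omega>" "\<And>p. M p > 0" "\<phi> \<in> E_open M \<Omega>" "regular_compact K" "K \<subseteq> \<Omega>"
  obtains h C where "h > 0" "C \<ge> 0" "derivs_le M (interior K) h C \<phi>"
proof -
  have "\<forall>K. regular_compact K \<and> K \<subseteq> \<Omega> \<longrightarrow> (\<exists>h>0. \<exists>C\<ge>0. derivs_le M (interior K) h C \<phi>)"
    using assms(3) unfolding E_open_iff[OF assms(1,2)] by (elim conjE)
  then have "\<exists>h>0. \<exists>C\<ge>0. derivs_le M (interior K) h C \<phi>"
    using assms(4,5) by simp
  then show ?thesis using that by (elim exE conjE) 
qed

lemma derivs_le_lincomb: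
  assumes "open U" "smooth_on U f" "smooth_on U g" "derivs_le M U h C f" "derivs_le M U h D g"
  shows "derivs_le M U h (cmod a * C + cmod b * D) (\<lambda>x. a * f x + b * g x)"
  unfolding derivs_le_def
proof (intro allI ballI)
  fix \<alpha> x assume x: "x \<in> U"
  have "cmod (mderiv \<alpha> (\<lambda>x. a * f x + b * g x) x) \<le> cmod a * cmod (mderiv \<alpha> f x) + cmod b * cmod (mderiv \<alpha> g x)"
    unfolding mderiv_eq smooth_on_lincomb(2)[OF assms(1-3) x]
    by (metis norm_mult norm_triangle_ineq)
  also have "\<dots> \<le> cmod a * (C * (h ^ mi_abs \<alpha> * M (mi_abs \<alpha>))) + cmod b * (D * (h ^ mi_abs \<alpha> * M (mi_abs \<alpha>)))"
    using derivs_leD[OF assms(4) x, of \<alpha>] derivs_leD[OF assms(5) x, of \<alpha>]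
    by (intro add_mono mult_left_mono) auto
  finally show "cmod (mderiv \<alpha> (\<lambda>x. a * f x + b * g x) x)
      \<le> (cmod a * C + cmod b * D) * (h ^ mi_abs \<alpha> * M (mi_abs \<alpha>))"
    by (simp add: algebra_simps)
qed

lemma E_open_lincomb:
  assumes "open \<Omega>" "\<And>p. M p > 0" "f \<in> E_open M \<Omega>" "g \<in> E_open M \<Omega>"
  shows "(\<lambda>x. a * f x + b * g x) \<in> E_open M \<Omega>"
proof -
  have f: "\<forall>x. x \<notin> \<Omega> \<longrightarrow> f x = 0" "smooth_on \<Omega> f"
      "\<And>K. regular_compact K \<Longrightarrow> K \<subseteq> \<Omega> \<Longrightarrow> (\<exists>h>0. \<exists>C\<ge>0. derivs_le M (interior K) h C f)"
    and g: "\<forall>x. x \<notin> \<Omega> \<longrightarrow> g x = 0" "smooth_on \<Omega> g"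
      "\<And>K. regular_compact K \<Longrightarrow> K \<subseteq> \<Omega> \<Longrightarrow> (\<exists>h>0. \<exists>C\<ge>0. derivs_le M (interior K) h C g)"
    using assms(3,4) unfolding E_open_iff[OF assms(1,2)] by blast+
  have "\<exists>h>0. \<exists>C\<ge>0. derivs_le M (interior K) h C (\<lambda>x. a * f x + b * g x)"
    if K: "regular_compact K" "K \<subseteq> \<Omega>" for K
  proof -
    obtain h C where 1: "h > 0" "C \<ge> 0" "derivs_le M (interior K) h C f" using f(3)[OF K] by blast
    obtain h' D where 2: "h' > 0" "D \<ge> 0" "derivs_le M (interior K) h' D g" using g(3)[OF K] by blast
    have "derivs_le M (interior K) (max h h') C f" "derivs_le M (interior K) (max h h') D g"
      by (rule derivs_le_mono[OF 1(3)]; use 1 assms(2) in simp) (rule derivs_le_mono[OF 2(3)]; use 2 assms(2) in simp)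
    then have "derivs_le M (interior K) (max h h') (cmod a * C + cmod b * D) (\<lambda>x. a * f x + b * g x)"
      using f(2) g(2) smooth_on_subset K(2) interior_subset[of K]
      by (intro derivs_le_lincomb) (auto intro: smooth_on_subset)
    then show ?thesis using 1 2 by (intro exI[of _ "max h h'"] conjI exI[of _ "cmod a * C + cmod b * D"]) auto
  qed
  then show ?thesis
    unfolding E_open_iff[OF assms(1,2)] using f g smooth_on_lincomb(1)[OF assms(1) f(2) g(2)] by simp
qed

lemma E_open_zero:
  assumes "open \<Omega>" "\<And>p. M p > 0" shows "(\<lambda>x. 0) \<in> E_open M \<Omega>"
proof -
  have p: "partials is (\<lambda>x. 0) = (\<lambda>x. 0)" for "is" :: "'a list"
    by (induction "is") (auto simp: partial_def)
  have "derivs_le M (interior K) 1 0 (\<lambda>x. 0)" for K :: "(real^'a) set"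
    by (simp add: derivs_le_def mderiv_eq p)
  then show ?thesis
    unfolding E_open_iff[OF assms] smooth_on_def p
    using zero_less_one[where 'a=real] order_refl[of "0::real"] by (simp; blast)
qed

lemma E_open_scale:
  assumes "open \<Omega>" "\<And>p. M p > 0" "f \<in> E_open M \<Omega>"
  shows "(\<lambda>x. a * f x) \<in> E_open M \<Omega>"
  using E_open_lincomb[OF assms assms(3), where a=a and b=0] by simp


subsection \<open>Bounded sets and the gliding hump\<close>

lemma topspace_lc_topology: "topspace (lc_topology V P) = V"
proof -
  have "openin (lc_topology V P) V"
    unfolding openin_lc_topology by (auto intro!: exI[of _ "{}"] exI[of _ "1::real"])
  moreover have "openin (lc_topology V P) U \<Longrightarrow> U \<subseteq> V" for U
    unfolding openin_lc_topology by simp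
  ultimately show ?thesis
    by (metis openin_subset openin_topspace subset_antisym)
qed

lemma topspace_E_topology [simp]: "topspace (E_topology M \<Omega>) = E_open M \<Omega>"
  by (simp add: E_topology_def topspace_lc_topology)

text \<open>The supremum in a strong seminorm is taken in the reals and bounds its terms only if the
  image is bounded. The preimage of the unit disc is a neighbourhood of zero, which absorbs
  \<open>S\<close>.\<close>

lemma vN_bounded_image:
  assumes "f \<in> top_dual T" "vN_bounded T S" "(\<lambda>b. 0) \<in> topspace T"
  shows "bdd_above ((\<lambda>x. cmod (f x)) ` S)"
proof -
  have lin: "\<And>c x. x \<in> topspace T \<Longrightarrow> f (\<lambda>b. c * x b) = c * f x"
    and cont: "continuous_map T euclidean f"
    using assms(1) by (auto simp: top_dual_def)
  have f0: "f (\<lambda>b. 0) = 0" using lin[OF assms(3), of 0] by simp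
  define U where "U = {x \<in> topspace T. f x \<in> ball 0 1}"
  have "openin T U"
    unfolding U_def by (rule openin_continuous_map_preimage[OF cont]) simp
  moreover have "(\<lambda>b. 0) \<in> U"
    using assms(3) f0 by (simp add: U_def)
  ultimately have "\<exists>r>0. \<forall>t>r. \<forall>x\<in>S. (\<lambda>b. x b / complex_of_real t) \<in> U"
    using assms(2) by (simp add: vN_bounded_def)
  then obtain r where r: "r > 0" "\<And>t x. t > r \<Longrightarrow> x \<in> S \<Longrightarrow> (\<lambda>b. x b / complex_of_real t) \<in> U"
    by metis
  have "cmod (f x) \<le> r + 1" if x: "x \<in> S" for x
  proof -
    have "x \<in> topspace T" using x assms(2) by (auto simp: vN_bounded_def)
    then have "f (\<lambda>b. x b / complex_of_real (r + 1)) = f x / complex_of_real (r + 1)"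
      using lin[of x "1 / complex_of_real (r + 1)"] by simp
    then have "cmod (f x / complex_of_real (r + 1)) < 1"
      using r(2)[of "r + 1" x] x by (simp add: U_def)
    moreover have "cmod (complex_of_real (r + 1)) = r + 1"
      using r(1) unfolding norm_of_real by simp
    ultimately show ?thesis using r(1) by (simp add: norm_divide)
  qed
  then show ?thesis by (auto intro!: bdd_aboveI[of _ "r + 1"])
qed

text \<open>The open unit ball \<open>W\<close> of the seminorm belonging to \<open>S\<close> is a
  strong neighbourhood of zero, hence absorbs \<open>B\<close>.\<close>

lemma strong_bounded_imp_bounded_on:
  assumes B: "vN_bounded (strong_dual_topology T) B" and S: "vN_bounded T S" "S \<noteq> {}"
    and 0: "(\<lambda>b. 0) \<in> topspace T"
  shows "\<exists>C. \<forall>f\<in>B. \<forall>x\<in>S. cmod (f x) \<le> C"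
proof -
  define p where "p f = (SUP x\<in>S. cmod (f x))" for f
  have bdd: "bdd_above ((\<lambda>x. cmod (f x)) ` S)" if "f \<in> top_dual T" for f
    by (rule vN_bounded_image[OF that S(1) 0])
  define W where "W = {f \<in> top_dual T. p f < 1}"
  have zd: "(\<lambda>b. 0) \<in> top_dual T" by (simp add: top_dual_def)
  have trig_sum: "p g \<le> p (g - f) + p f" if fg: "f \<in> top_dual T" "g \<in> top_dual T" for f g
    unfolding p_def
  proof (rule cSUP_least[OF S(2)])
    fix x assume x: "x \<in> S"
    have b: "bdd_above ((\<lambda>x. cmod ((g - f) x)) ` S)"
    proof -
      obtain a b where "\<And>x. x \<in> S \<Longrightarrow> cmod (f x) \<le> a" "\<And>x. x \<in> S \<Longrightarrow> cmod (g x) \<le> b"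
        using bdd[OF fg(1)] bdd[OF fg(2)] unfolding bdd_above_def by auto
      then show ?thesis
        by (intro bdd_aboveI[of _ "b + a"]) (auto intro!: order_trans[OF norm_triangle_ineq4] add_mono)
    qed
    have "cmod (g x) \<le> cmod ((g - f) x) + cmod (f x)"
      using norm_triangle_sub[of "g x" "f x"] by simp
    also have "\<dots> \<le> (SUP x\<in>S. cmod ((g - f) x)) + (SUP x\<in>S. cmod (f x))"
      by (intro add_mono cSUP_upper x b bdd fg)
    finally show "cmod (g x) \<le> (SUP x\<in>S. cmod ((g - f) x)) + (SUP x\<in>S. cmod (f x))" .
  qed
  have "openin (strong_dual_topology T) W"
    unfolding strong_dual_topology_def openin_lc_topology
  proof (intro conjI ballI)
    show "W \<subseteq> top_dual T" by (auto simp: W_def)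
    fix f assume f: "f \<in> W"
    have "p \<in> {\<lambda>f. SUP x\<in>S. cmod (f x) | S. vN_bounded T S \<and> S \<noteq> {}}"
      using S by (auto simp: p_def[abs_def])
    moreover have "{y \<in> top_dual T. \<forall>q\<in>{p}. q (y - f) < 1 - p f} \<subseteq> W"
      using trig_sum f by (fastforce simp: W_def)
    ultimately show "\<exists>F \<epsilon>. finite F \<and> F \<subseteq> {\<lambda>f. SUP x\<in>S. cmod (f x) | S. vN_bounded T S \<and> S \<noteq> {}} \<and>
        0 < \<epsilon> \<and> {y \<in> top_dual T. \<forall>p\<in>F. p (y - f) < \<epsilon>} \<subseteq> W"
      using f by (intro exI[of _ "{p}"] exI[of _ "1 - p f"]) (auto simp: W_def)
  qed
  moreover have "(\<lambda>b. 0) \<in> W"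
    using zd S(2) by (simp add: W_def p_def)
  ultimately have "\<exists>r>0. \<forall>t>r. \<forall>f\<in>B. (\<lambda>b. f b / complex_of_real t) \<in> W"
    using B by (simp add: vN_bounded_def)
  then obtain r where r: "r > 0" "\<And>t f. t > r \<Longrightarrow> f \<in> B \<Longrightarrow> (\<lambda>b. f b / complex_of_real t) \<in> W"
    by metis
  have "cmod (f x) \<le> r + 1" if f: "f \<in> B" and x: "x \<in> S" for f x
  proof -
    let ?g = "\<lambda>b. f b / complex_of_real (r + 1)"
    have g: "?g \<in> top_dual T" "p ?g < 1" using r(2)[of "r + 1" f] f by (auto simp: W_def)
    have "cmod (?g x) \<le> p ?g" unfolding p_def by (rule cSUP_upper[OF x bdd[OF g(1)]])
    then have "cmod (f x) / cmod (complex_of_real (r + 1)) < 1"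
      using g(2) by (simp add: norm_divide)
    moreover have "cmod (complex_of_real (r + 1)) = r + 1"
      using r(1) unfolding norm_of_real by simp
    ultimately show ?thesis using r(1) by (simp add: divide_less_eq)
  qed
  then show ?thesis by blast
qed

text \<open>A defining seminorm sees only one \<open>K\<close>, and on each step it is at most a
  multiple of the norm of that step. It is therefore bounded on \<open>S\<close>, and division by a
  large \<open>t\<close> makes it small.\<close>

lemma vN_bounded_E_topologyI:
  assumes "open \<Omega>" "\<And>p. M p > 0" "S \<subseteq> E_open M \<Omega>"
    and "\<And>K. regular_compact K \<Longrightarrow> K \<subseteq> \<Omega> \<Longrightarrow> \<exists>h>0. \<exists>C\<ge>0. \<forall>\<phi>\<in>S. derivs_le M (interior K) h C \<phi>"
  shows "vN_bounded (E_topology M \<Omega>) S"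
  unfolding vN_bounded_def
proof (intro conjI allI impI)
  show "S \<subseteq> topspace (E_topology M \<Omega>)" using assms(3) by simp
  define P where "P = {\<lambda>\<phi>. p (restr K \<phi>) | K p. regular_compact K \<and> K \<subseteq> \<Omega> \<and> p \<in> E_compact_seminorms M K}"
  fix U assume U: "openin (E_topology M \<Omega>) U \<and> (\<lambda>b. 0) \<in> U"
  have "\<forall>x\<in>U. \<exists>F \<epsilon>. finite F \<and> F \<subseteq> P \<and> \<epsilon> > 0 \<and> {y\<in>E_open M \<Omega>. \<forall>p\<in>F. p (y - x) < \<epsilon>} \<subseteq> U"
    using U unfolding E_topology_def openin_lc_topology P_def[symmetric] by simp
  from bspec[OF this conjunct2[OF U]] obtain F \<epsilon> where F: "finite F" "F \<subseteq> P" "\<epsilon> > 0"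
      "{y\<in>E_open M \<Omega>. \<forall>p\<in>F. p (y - (\<lambda>b. 0)) < \<epsilon>} \<subseteq> U"
    by (elim exE conjE)
  have sm: "smooth_on \<Omega> \<phi>" if "\<phi> \<in> S" for \<phi>
    using E_open_smooth[OF assms(1,2)] that assms(3) by auto
  have "\<exists>D\<ge>0. \<forall>\<phi>\<in>S. \<forall>t>0. q (\<lambda>b. \<phi> b / complex_of_real t) \<le> D / t" if "q \<in> P" for q
  proof -
    obtain K p where q: "q = (\<lambda>\<phi>. p (restr K \<phi>))" and K: "regular_compact K" "K \<subseteq> \<Omega>"
      and p: "p \<in> E_compact_seminorms M K"
      using \<open>q \<in> P\<close> unfolding P_def mem_Collect_eq by (elim exE conjE) (rule that)
    obtain h C where h: "h > 0" "C \<ge> 0" "\<And>\<phi>. \<phi> \<in> S \<Longrightarrow> derivs_le M (interior K) h C \<phi>"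
      using assms(4)[OF K] by blast
    obtain C' where C': "C' \<ge> 0" "\<And>\<phi>. \<phi> \<in> E_step M K h \<Longrightarrow> ennreal (p \<phi>) \<le> ennreal C' * E_norm M K h \<phi>"
      using p h(1) unfolding E_compact_seminorms_def by auto
    have hom: "\<And>c x. x \<in> E_compact M K \<Longrightarrow> p (\<lambda>b. c * x b) = cmod c * p x"
      using p unfolding E_compact_seminorms_def seminorm_on_def by blast
    have "q (\<lambda>b. \<phi> b / complex_of_real t) \<le> (C' * C) / t" if phi: "\<phi> \<in> S" and t: "t > 0" for \<phi> t
    proof -
      have le: "E_norm M K h (restr K \<phi>) \<le> ennreal C"
        using E_norm_restr_le_iff[OF assms(1) sm[OF phi] K h(1,2), of M] assms(2) h(3)[OF phi] by blast
      then have st: "restr K \<phi> \<in> E_step M K h"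
        using restr_Cinf[OF assms(1) sm[OF phi] K] unfolding E_step_def by (simp add: order_le_less_trans)
      have "ennreal (p (restr K \<phi>)) \<le> ennreal C' * ennreal C"
        using C'(2)[OF st] le by (meson mult_left_mono order_trans zero_le)
      then have le: "p (restr K \<phi>) \<le> C' * C"
        using C'(1) h(2) by (simp add: ennreal_mult[symmetric] ennreal_le_iff)
      have "restr K (\<lambda>b. \<phi> b / complex_of_real t) = (\<lambda>b. (1 / complex_of_real t) * restr K \<phi> b)"
        by (auto simp: restr_def)
      then have "q (\<lambda>b. \<phi> b / complex_of_real t) = cmod (1 / complex_of_real t) * p (restr K \<phi>)"
        unfolding q using hom[of "restr K \<phi>" "1 / complex_of_real t"] st h(1) by (auto simp: E_compact_def)
      also have "\<dots> \<le> (C' * C) / t"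
        using le t by (simp add: norm_divide divide_right_mono)
      finally show ?thesis .
    qed
    then show ?thesis using C'(1) h(2) by (intro exI[of _ "C' * C"]) auto
  qed
  then obtain D where D: "\<And>q. q \<in> P \<Longrightarrow> D q \<ge> 0"
      "\<And>q \<phi> t. q \<in> P \<Longrightarrow> \<phi> \<in> S \<Longrightarrow> t > 0 \<Longrightarrow> q (\<lambda>b. \<phi> b / complex_of_real t) \<le> D q / t"
    by metis
  \<comment> \<open>Adding the finitely many bounds gives one threshold for all seminorms in
    \<open>F\<close>.\<close>
  define r where "r = (\<Sum>q\<in>F. D q) / \<epsilon> + 1"
  have sum0: "(\<Sum>q\<in>F. D q) \<ge> 0" using D(1) F(2) by (intro sum_nonneg) auto
  have r0: "r > 0" unfolding r_def using sum0 F(3) by (simp add: add_nonneg_pos)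
  have "(\<lambda>b. x b / complex_of_real t) \<in> U" if t: "t > r" and x: "x \<in> S" for t x
  proof -
    have "q ((\<lambda>b. x b / complex_of_real t) - (\<lambda>b. 0)) < \<epsilon>" if q: "q \<in> F" for q
    proof -
      have "q (\<lambda>b. x b / complex_of_real t) \<le> D q / t"
        using D(2)[of q x t] q F(2) x t r0 by auto
      also have "D q \<le> (\<Sum>q\<in>F. D q)"
        using q F(1,2) D(1) by (intro member_le_sum) auto
      also have "(\<Sum>q\<in>F. D q) / t < \<epsilon>"
      proof -
        have "(\<Sum>q\<in>F. D q) / \<epsilon> < t" using t unfolding r_def by simp
        then show ?thesis using F(3) t r0 by (simp add: divide_less_eq mult.commute)
      qed
      finally show ?thesis using t r0 by (simp add: divide_right_mono fun_diff_def)
    qed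
    moreover have "(\<lambda>b. x b / complex_of_real t) \<in> E_open M \<Omega>"
      using E_open_scale[OF assms(1,2), where a="1 / complex_of_real t" and f=x] x assms(3) by auto
    ultimately show ?thesis using F(4) by blast
  qed
  then show "\<exists>r>0. \<forall>t>r. \<forall>x\<in>S. (\<lambda>b. x b / complex_of_real t) \<in> U"
    using r0 by blast
qed

lemma strong_bounded_subset: "vN_bounded (strong_dual_topology T) B \<Longrightarrow> B \<subseteq> top_dual T"
  by (simp add: vN_bounded_def strong_dual_topology_def topspace_lc_topology)

lemma dual_linear:
  assumes "f \<in> top_dual (E_topology M \<Omega>)" "open \<Omega>" "\<And>p. M p > 0" "\<phi> \<in> E_open M \<Omega>" "\<psi> \<in> E_open M \<Omega>"
  shows "f (\<lambda>x. a * \<phi> x + b * \<psi> x) = a * f \<phi> + b * f \<psi>"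
proof -
  have "f (\<lambda>x. a * \<phi> x + b * \<psi> x) = f (\<lambda>x. a * \<phi> x) + f (\<lambda>x. b * \<psi> x)"
    using assms(1) E_open_scale[OF assms(2,3,4), of a] E_open_scale[OF assms(2,3,5), of b]
    by (simp add: top_dual_def)
  then show ?thesis
    using assms(1,4,5) by (simp add: top_dual_def)
qed

lemma dual_scale:
  assumes "f \<in> top_dual (E_topology M \<Omega>)" "\<phi> \<in> E_open M \<Omega>"
  shows "f (\<lambda>x. a * \<phi> x) = a * f \<phi>"
  using assms by (simp add: top_dual_def)

lemma regular_exhaustion:
  fixes \<Omega> :: "(real^'d::finite) set"
  assumes "open \<Omega>"
  obtains K where "\<And>n::nat. regular_compact (K n)" "\<And>n. K n \<subseteq> \<Omega>" "\<And>n. K n \<subseteq> interior (K (Suc n))"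
    "\<And>C. compact C \<Longrightarrow> C \<subseteq> \<Omega> \<Longrightarrow> \<exists>n. C \<subseteq> interior (K n)"
proof -
  obtain C where C: "\<And>n::nat. compact (C n)" "\<And>n. C n \<subseteq> \<Omega>" "\<And>n. C n \<subseteq> interior (C (Suc n))"
      "\<Union>(range C) = \<Omega>" "\<And>L. \<lbrakk>compact L; L \<subseteq> \<Omega>\<rbrakk> \<Longrightarrow> \<exists>N. \<forall>n\<ge>N. L \<subseteq> C n"
    using open_Union_compact_subsets[OF assms] by metis
  define K where "K n = closure (interior (C n))" for n
  have KC: "K n \<subseteq> C n" for n
    unfolding K_def using C(1) by (simp add: closure_minimal compact_imp_closed interior_subset)
  have iK: "interior (C n) \<subseteq> interior (K n)" for n
    unfolding K_def by (meson closure_subset interior_maximal open_interior)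
  have "regular_compact (K n)" for n
  proof -
    have "compact (K n)"
      using KC C(1) by (metis K_def closed_closure compact_Int_closed inf.absorb_iff2)
    moreover have "closure (interior (K n)) \<subseteq> K n"
      by (rule closure_minimal[OF interior_subset]) (simp add: K_def)
    moreover have "K n \<subseteq> closure (interior (K n))"
      using closure_mono[OF iK] by (simp add: K_def)
    ultimately show ?thesis by (auto simp: regular_compact_def)
  qed
  moreover have "K n \<subseteq> \<Omega>" for n using KC C(2) by blast
  moreover have "K n \<subseteq> interior (K (Suc n))" for n using KC C(3) iK by blast
  moreover have "\<exists>n. L \<subseteq> interior (K n)" if L: "compact L" "L \<subseteq> \<Omega>" for L
  proof -
    obtain N where "L \<subseteq> C N" using C(5)[OF L] by blast
    then have "L \<subseteq> interior (K (Suc N))" using C(3) iK by blast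
    then show ?thesis by blast
  qed
  ultimately show ?thesis using that by blast
qed

text \<open>Otherwise there are functions obeying more and more of the prescribed bounds on which
  members of \<open>B\<close> become larger and larger. On a fixed compact set all but finitely many
  of these functions obey one common bound, so they form a bounded set; but \<open>B\<close> is
  bounded on bounded sets.\<close>

lemma gliding_hump:
  assumes \<Omega>: "open \<Omega>" and M: "\<And>p. M p > 0"
    and B: "vN_bounded (strong_dual_topology (E_topology M \<Omega>)) B"
    and K: "\<And>n::nat. regular_compact (K n)" "\<And>n. K n \<subseteq> \<Omega>" "\<And>n. K n \<subseteq> interior (K (Suc n))"
      "\<And>C. compact C \<Longrightarrow> C \<subseteq> \<Omega> \<Longrightarrow> \<exists>n. C \<subseteq> interior (K n)"
    and h: "\<And>m. h m > 0"
  shows "\<exists>n C. C > 0 \<and> (\<forall>f\<in>B. \<forall>\<phi>\<in>E_open M \<Omega>. \<forall>c\<ge>0.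
    (\<forall>m\<le>n. derivs_le M (interior (K m)) (h m) c \<phi>) \<longrightarrow> cmod (f \<phi>) \<le> C * c)"
proof (rule ccontr)
  assume neg: "\<not> ?thesis"
  have dual: "f \<in> top_dual (E_topology M \<Omega>)" if "f \<in> B" for f
    using strong_bounded_subset[OF B] that by blast
  have "\<exists>f \<psi>. f \<in> B \<and> \<psi> \<in> E_open M \<Omega> \<and> (\<forall>m\<le>n. derivs_le M (interior (K m)) (h m) 1 \<psi>) \<and> cmod (f \<psi>) \<ge> real n" for n
  proof -
    \<comment> \<open>The same n counts the constraints and measures the size; n + 1 serves as the
      constant because it is positive for n = 0 too.\<close>
    have "\<not> (\<forall>f\<in>B. \<forall>\<phi>\<in>E_open M \<Omega>. \<forall>c\<ge>0.
        (\<forall>m\<le>n. derivs_le M (interior (K m)) (h m) c \<phi>) \<longrightarrow> cmod (f \<phi>) \<le> (real n + 1) * c)"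
      using neg by (metis add_nonneg_pos of_nat_0_le_iff zero_less_one)
    then obtain f \<phi> c where f: "f \<in> B" "\<phi> \<in> E_open M \<Omega>" "c \<ge> 0"
        "\<And>m. m \<le> n \<Longrightarrow> derivs_le M (interior (K m)) (h m) c \<phi>" "cmod (f \<phi>) > (real n + 1) * c"
      by (auto simp: not_le)
    have pos: "cmod (f \<phi>) > 0"
      using f(3,5) by (meson add_nonneg_nonneg le_less_trans mult_nonneg_nonneg of_nat_0_le_iff zero_le_one)
    \<comment> \<open>Scaling such that the functional takes the modulus n + 1 while the constant of
      the derivative bounds drops to at most 1.\<close>
    define s where "s = (real n + 1) / cmod (f \<phi>)"
    have s: "s > 0" "s * c \<le> 1"
      unfolding s_def using pos f(5) by (auto simp: add_nonneg_pos field_simps)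
    define \<psi> where "\<psi> = (\<lambda>x. complex_of_real s * \<phi> x)"
    have "\<psi> \<in> E_open M \<Omega>" unfolding \<psi>_def by (rule E_open_scale[OF \<Omega> M f(2)])
    moreover have "cmod (f \<psi>) \<ge> real n"
      unfolding \<psi>_def dual_scale[OF dual[OF f(1)] f(2)] norm_mult norm_of_real abs_of_pos[OF s(1)]
      using pos by (simp add: s_def)
    moreover have "derivs_le M (interior (K m)) (h m) 1 \<psi>" if "m \<le> n" for m
    proof -
      have sm: "smooth_on (interior (K m)) \<phi>"
        by (rule smooth_on_subset[OF E_open_smooth[OF \<Omega> M f(2)]]) (use K(2)[of m] interior_subset in blast)
      have "derivs_le M (interior (K m)) (h m) (cmod (complex_of_real s) * c + cmod 0 * c)
          (\<lambda>x. complex_of_real s * \<phi> x + 0 * \<phi> x)"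
        by (intro derivs_le_lincomb sm f(4) that) simp
      then have "derivs_le M (interior (K m)) (h m) (s * c) \<psi>"
        using s(1) by (simp add: \<psi>_def)
      then show ?thesis
        by (rule derivs_le_mono) (use s f(3) h M in auto)
    qed
    ultimately show ?thesis using f(1) by blast
  qed
  then obtain F \<psi> where F: "\<And>n. F n \<in> B" "\<And>n. \<psi> n \<in> E_open M \<Omega>"
      "\<And>n m. m \<le> n \<Longrightarrow> derivs_le M (interior (K m)) (h m) 1 (\<psi> n)" "\<And>n. cmod (F n (\<psi> n)) \<ge> real n"
    by metis
  have "\<exists>g>0. \<exists>C\<ge>0. \<forall>\<phi>\<in>range \<psi>. derivs_le M (interior L) g C \<phi>" if L: "regular_compact L" "L \<subseteq> \<Omega>" for L
  proof -
    obtain m where m: "L \<subseteq> interior (K m)"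
      using K(4)[of L] L by (auto simp: regular_compact_def)
    have "\<forall>n. \<exists>g>0. \<exists>C\<ge>0. derivs_le M (interior L) g C (\<psi> n)"
      using E_open_bd[OF \<Omega> M F(2) L] by metis
    then obtain g C where g: "\<And>n. g n > 0" "\<And>n. C n \<ge> 0" "\<And>n. derivs_le M (interior L) (g n) (C n) (\<psi> n)"
      by metis
    \<comment> \<open>From index m on the rate \<open>h m\<close> with constant 1 is valid on L; the
      maxima only take care of the first m functions.\<close>
    define g' where "g' = Max (insert (h m) (g ` {..<m}))"
    define C' where "C' = Max (insert 1 (C ` {..<m}))"
    have g': "h m \<le> g'" "\<And>n. n < m \<Longrightarrow> g n \<le> g'" and C': "1 \<le> C'" "\<And>n. n < m \<Longrightarrow> C n \<le> C'"
      unfolding g'_def C'_def by auto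
    have "derivs_le M (interior L) g' C' (\<psi> n)" for n
    proof (cases "n < m")
      case True
      show ?thesis by (rule derivs_le_mono[OF g(3)[of n]]) (use g C' g' M True in auto)
    next
      case False
      have "interior L \<subseteq> interior (K m)" using m interior_subset by blast
      then show ?thesis
        by (intro derivs_le_mono[OF F(3)[of m n]]) (use C' g' M h False in auto)
    qed
    moreover have "g' > 0" using g' h[of m] by linarith
    ultimately show ?thesis using C' by (intro exI[of _ g'] conjI exI[of _ C']) auto
  qed
  then have "vN_bounded (E_topology M \<Omega>) (range \<psi>)"
    by (intro vN_bounded_E_topologyI \<Omega> M) (use F(2) in auto)
  then obtain C where C: "\<And>f x. f \<in> B \<Longrightarrow> x \<in> range \<psi> \<Longrightarrow> cmod (f x) \<le> C"
    using strong_bounded_imp_bounded_on[OF B, of "range \<psi>"] E_open_zero[OF \<Omega> M] by auto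
  obtain n where "C < real n" using reals_Archimedean2 by blast
  then show False using C[OF F(1)[of n], of "\<psi> n"] F(4)[of n] by simp
qed

subsection \<open>Localized trigonometric kernels in one variable\<close>

text \<open>Convolution with the uniform distribution on {-w..w}. On the side of the kernels it
  becomes multiplication by a normalized Dirichlet kernel.\<close>

definition avg :: "nat \<Rightarrow> (int \<Rightarrow> real) \<Rightarrow> int \<Rightarrow> real" where
  "avg w \<psi> k = (\<Sum>j\<in>{-int w..int w}. \<psi> (k - j)) / (2 * real w + 1)"

definition iter_avg :: "nat \<Rightarrow> nat list \<Rightarrow> int \<Rightarrow> real" where
  "iter_avg R ws = foldr avg ws (\<lambda>k. if \<bar>k\<bar> \<le> int R then 1 else 0)"

text \<open>The argument is complex because derivatives on the real axis are estimated by Cauchy's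
  inequality on discs.\<close>

definition mult_sum_deriv :: "nat \<Rightarrow> (int \<Rightarrow> real) \<Rightarrow> nat \<Rightarrow> complex \<Rightarrow> complex" where
  "mult_sum_deriv B \<psi> a z = (\<Sum>k\<in>{-int B..int B}. of_real (\<psi> k) * (\<i> * of_int k) ^ a * exp (\<i> * of_int k * z))"

abbreviation mult_sum :: "nat \<Rightarrow> (int \<Rightarrow> real) \<Rightarrow> complex \<Rightarrow> complex" where
  "mult_sum B \<psi> \<equiv> mult_sum_deriv B \<psi> 0"

definition dirichlet :: "nat \<Rightarrow> complex \<Rightarrow> complex" where
  "dirichlet w z = (\<Sum>k\<in>{-int w..int w}. exp (\<i> * of_int k * z))"

lemma iter_avg_simps [simp]:
  "iter_avg R [] = (\<lambda>k. if \<bar>k\<bar> \<le> int R then 1 else 0)" "iter_avg R (w # ws) = avg w (iter_avg R ws)"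
  by (simp_all add: iter_avg_def)

lemma avg_const: "(\<And>j. \<bar>j\<bar> \<le> int w \<Longrightarrow> \<psi> (k - j) = c) \<Longrightarrow> avg w \<psi> k = c"
  by (simp add: avg_def abs_le_iff field_simps)

lemma iter_avg_bounds: "0 \<le> iter_avg R ws k \<and> iter_avg R ws k \<le> 1"
proof (induction ws arbitrary: k)
  case (Cons w ws)
  have "(\<Sum>j\<in>{-int w..int w}. iter_avg R ws (k - j)) \<le> (\<Sum>j\<in>{-int w..int w}. 1)"
    using Cons by (intro sum_mono) auto
  moreover have "0 \<le> (\<Sum>j\<in>{-int w..int w}. iter_avg R ws (k - j))"
    using Cons by (intro sum_nonneg) auto
  ultimately show ?case by (simp add: avg_def)
qed simp

lemma iter_avg_eq_0: "\<bar>k\<bar> > int R + int (sum_list ws) \<Longrightarrow> iter_avg R ws k = 0"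
proof (induction ws arbitrary: k)
  case (Cons w ws)
  show ?case unfolding iter_avg_simps by (rule avg_const, rule Cons.IH) (use Cons.prems in auto)
qed simp

lemma iter_avg_eq_1: "\<bar>k\<bar> + int (sum_list ws) \<le> int R \<Longrightarrow> iter_avg R ws k = 1"
proof (induction ws arbitrary: k)
  case (Cons w ws)
  show ?case unfolding iter_avg_simps by (rule avg_const, rule Cons.IH) (use Cons.prems in auto)
qed simp

text \<open>Convolution turns into a product after exchanging the sums and shifting k; A + w \<le> B
  keeps every shifted support within the range of summation.\<close>

lemma mult_sum_avg:
  assumes "\<And>k. \<bar>k\<bar> > int A \<Longrightarrow> \<psi> k = 0" "A + w \<le> B"
  shows "mult_sum B (avg w \<psi>) z = dirichlet w z / (2 * of_nat w + 1) * mult_sum A \<psi> z"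
proof -
  let ?e = "\<lambda>k. exp (\<i> * of_int k * z)"
  have shift: "(\<Sum>k\<in>{-int B..int B}. of_real (\<psi> (k - j)) * ?e k) = ?e j * mult_sum A \<psi> z"
    if j: "j \<in> {-int w..int w}" for j
  proof -
    have "(\<Sum>k\<in>{-int B..int B}. of_real (\<psi> (k - j)) * ?e k)
        = (\<Sum>k\<in>{-int B - j..int B - j}. of_real (\<psi> k) * ?e (k + j))"
      by (rule sum.reindex_bij_witness[of _ "\<lambda>k. k + j" "\<lambda>k. k - j"]) auto
    also have "\<dots> = (\<Sum>k\<in>{-int A..int A}. of_real (\<psi> k) * ?e (k + j))"
      using j assms by (intro sum.mono_neutral_right) auto
    also have "\<dots> = (\<Sum>k\<in>{-int A..int A}. ?e j * (of_real (\<psi> k) * ?e k))"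
      by (intro sum.cong) (simp_all add: distrib_left distrib_right exp_add mult_ac)
    finally show ?thesis by (simp add: mult_sum_deriv_def sum_distrib_left)
  qed
  have "mult_sum B (avg w \<psi>) z
      = (\<Sum>k\<in>{-int B..int B}. \<Sum>j\<in>{-int w..int w}. of_real (\<psi> (k - j)) * ?e k / (2 * of_nat w + 1))"
    by (simp add: mult_sum_deriv_def avg_def sum_distrib_right sum_divide_distrib)
  also have "\<dots> = (\<Sum>j\<in>{-int w..int w}. \<Sum>k\<in>{-int B..int B}. of_real (\<psi> (k - j)) * ?e k / (2 * of_nat w + 1))"
    by (rule sum.swap)
  also have "\<dots> = (\<Sum>j\<in>{-int w..int w}. ?e j * mult_sum A \<psi> z / (2 * of_nat w + 1))"
    by (intro sum.cong refl) (simp add: shift sum_divide_distrib[symmetric])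
  also have "\<dots> = dirichlet w z / (2 * of_nat w + 1) * mult_sum A \<psi> z"
    by (simp add: dirichlet_def sum_divide_distrib sum_distrib_right)
  finally show ?thesis .
qed

text \<open>Each average contributes its own Dirichlet factor, so the decay of the kernel can be
  collected factor by factor.\<close>

lemma mult_sum_mlt:
  assumes "R + sum_list ws \<le> B"
  shows "mult_sum B (iter_avg R ws) z = dirichlet R z * prod_list (map (\<lambda>w. dirichlet w z / (2 * of_nat w + 1)) ws)"
  using assms
proof (induction ws arbitrary: B)
  case Nil
  have "mult_sum B (iter_avg R []) z = (\<Sum>k\<in>{-int R..int R}. of_real (iter_avg R [] k) * exp (\<i> * of_int k * z))"
    unfolding mult_sum_deriv_def using Nil by (intro sum.mono_neutral_cong_right) auto
  also have "\<dots> = dirichlet R z" unfolding dirichlet_def by (intro sum.cong) auto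
  finally show ?case by simp
next
  case (Cons w ws)
  have "mult_sum B (iter_avg R (w # ws)) z = dirichlet w z / (2 * of_nat w + 1) * mult_sum (R + sum_list ws) (iter_avg R ws) z"
    unfolding iter_avg_simps using Cons.prems by (intro mult_sum_avg iter_avg_eq_0) auto
  then show ?case using Cons.IH[of "R + sum_list ws"] by simp
qed

lemma dirichlet_telescope:
  "(exp (\<i> * z) - 1) * dirichlet w z = exp (\<i> * of_nat (w + 1) * z) - exp (- (\<i> * of_nat w * z))"
proof (induction w)
  case 0
  show ?case by (simp add: dirichlet_def)
next
  case (Suc w)
  have "{-int (Suc w)..int (Suc w)} = insert (int (Suc w)) (insert (- int (Suc w)) {-int w..int w})"
    by auto
  then have "dirichlet (Suc w) z = exp (\<i> * of_int (int (Suc w)) * z) + (exp (\<i> * of_int (- int (Suc w)) * z) + dirichlet w z)"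
    by (simp add: dirichlet_def)
  then have "(exp (\<i> * z) - 1) * dirichlet (Suc w) z
     = (exp (\<i> * z) - 1) * exp (\<i> * of_int (int (Suc w)) * z)
       + (exp (\<i> * z) - 1) * exp (\<i> * of_int (- int (Suc w)) * z)
       + (exp (\<i> * of_nat (w + 1) * z) - exp (- (\<i> * of_nat w * z)))"
    using Suc by (simp add: distrib_left algebra_simps)
  also have "(exp (\<i> * z) - 1) * exp (\<i> * of_int (int (Suc w)) * z)
      = exp (\<i> * of_nat (Suc w + 1) * z) - exp (\<i> * of_nat (w + 1) * z)"
    by (simp add: left_diff_distrib exp_add[symmetric] algebra_simps)
  also have "(exp (\<i> * z) - 1) * exp (\<i> * of_int (- int (Suc w)) * z)
      = exp (- (\<i> * of_nat w * z)) - exp (- (\<i> * of_nat (Suc w) * z))"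
    by (simp add: left_diff_distrib exp_add[symmetric] algebra_simps)
  finally show ?case by simp
qed

section \<open>Dirichlet kernels in a strip\<close>

lemma norm_exp_ik_le:
  assumes "\<bar>Im z\<bar> \<le> r"
  shows "cmod (exp (\<i> * of_int k * z)) \<le> exp (real_of_int \<bar>k\<bar> * r)"
proof -
  have "- (real_of_int k * Im z) \<le> \<bar>real_of_int k\<bar> * \<bar>Im z\<bar>"
    by (metis abs_ge_minus_self abs_mult)
  also have "\<dots> \<le> real_of_int \<bar>k\<bar> * r"
    using assms by (simp add: mult_left_mono)
  finally show ?thesis by (simp add: norm_exp_eq_Re)
qed

lemma dirichlet_le:
  assumes "\<bar>Im z\<bar> \<le> r"
  shows "cmod (dirichlet w z) \<le> (2 * real w + 1) * exp (real w * r)"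
proof -
  have "r \<ge> 0" using assms by linarith
  have "cmod (dirichlet w z) \<le> (\<Sum>k\<in>{-int w..int w}. exp (real w * r))"
    unfolding dirichlet_def
  proof (rule order_trans[OF norm_sum], rule sum_mono)
    fix k assume "k \<in> {-int w..int w}"
    then have "\<bar>k\<bar> \<le> int w" by (simp add: abs_le_iff)
    then have "real_of_int \<bar>k\<bar> \<le> real w" by linarith
    then show "cmod (exp (\<i> * of_int k * z)) \<le> exp (real w * r)"
      using norm_exp_ik_le[OF assms, of k] \<open>r \<ge> 0\<close>
      by (meson exp_le_cancel_iff mult_right_mono order_trans)
  qed
  then show ?thesis by simp
qed

text \<open>The telescoped sum has only two terms. Where exp (i z) - 1 is bounded away from zero the
  linear growth in w is lost, so that division by 2 * w + 1 makes the factor small.\<close>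

lemma dirichlet_le2:
  assumes "\<bar>Im z\<bar> \<le> r"
  shows "cmod (exp (\<i> * z) - 1) * cmod (dirichlet w z) \<le> 2 * exp (real (w + 1) * r)"
proof -
  have "r \<ge> 0" using assms by linarith
  have "cmod (exp (\<i> * z) - 1) * cmod (dirichlet w z) = cmod (exp (\<i> * of_nat (w + 1) * z) - exp (- (\<i> * of_nat w * z)))"
    unfolding dirichlet_telescope[symmetric] norm_mult ..
  also have "\<dots> \<le> cmod (exp (\<i> * of_nat (w + 1) * z)) + cmod (exp (- (\<i> * of_nat w * z)))"
    by (rule norm_triangle_ineq4)
  also have "\<dots> \<le> exp (real (w + 1) * r) + exp (real w * r)"
    using norm_exp_ik_le[OF assms, of "int (w + 1)"] norm_exp_ik_le[OF assms, of "- int w"]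
    by (intro add_mono) (simp_all add: algebra_simps)
  also have "exp (real w * r) \<le> exp (real (w + 1) * r)"
    using \<open>r \<ge> 0\<close> by (simp add: mult_right_mono)
  finally show ?thesis by simp
qed

text \<open>First order Taylor expansion: the remainder is at most (1 + 1/2 + 1/4) * 1/2 = 7/8 of
  the modulus of z, and 1/8 of it remains.\<close>

lemma norm_exp_minus_1_ge:
  assumes "cmod z \<le> 1/2" shows "cmod z / 8 \<le> cmod (exp (\<i> * z) - 1)"
proof -
  have "cmod (exp (\<i> * z) - (\<Sum>k\<le>1. (\<i> * z) ^ k / fact k)) \<le> exp \<bar>Re (\<i> * z)\<bar> * cmod (\<i> * z) ^ Suc 1 / fact 1"
    by (rule Taylor_exp)
  then have "cmod (exp (\<i> * z) - 1 - \<i> * z) \<le> exp \<bar>Im z\<bar> * (cmod z)\<^sup>2"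
    by (simp add: norm_mult power2_eq_square diff_diff_eq)
  also have "\<dots> \<le> (1 + 1/2 + (1/2)\<^sup>2) * (cmod z * (1/2))"
  proof (rule mult_mono)
    have "exp \<bar>Im z\<bar> \<le> exp (1/2)"
      using abs_Im_le_cmod[of z] assms by simp
    also have "\<dots> \<le> 1 + 1/2 + (1/2)\<^sup>2"
      by (rule exp_bound) auto
    finally show "exp \<bar>Im z\<bar> \<le> 1 + 1/2 + (1/2)\<^sup>2" .
    show "(cmod z)\<^sup>2 \<le> cmod z * (1/2)"
      unfolding power2_eq_square by (rule mult_left_mono[OF assms]) simp
  qed auto
  finally have "cmod (exp (\<i> * z) - 1 - \<i> * z) \<le> 7/8 * cmod z" by (simp add: power2_eq_square)
  moreover have "cmod (\<i> * z) - cmod (exp (\<i> * z) - 1 - \<i> * z) \<le> cmod (exp (\<i> * z) - 1)"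
    by (metis norm_minus_commute norm_triangle_sub add.commute diff_le_eq add_diff_cancel diff_add_cancel norm_triangle_ineq2 diff_diff_eq2)
  ultimately show ?thesis by (simp add: norm_mult)
qed

text \<open>Beyond 1/2 the distance of exp (i s) from 1 increases up to pi, so its value at 1/2, at
  least 1/16, is a lower bound there; pi < 4 then gives the denominator 64.\<close>

lemma norm_cis_minus_1_ge:
  fixes s :: real
  assumes "\<bar>s\<bar> \<le> pi" shows "\<bar>s\<bar> / 64 \<le> cmod (exp (\<i> * of_real s) - 1)"
proof (cases "\<bar>s\<bar> \<le> 1/2")
  case True
  then show ?thesis using norm_exp_minus_1_ge[of "of_real s"] by simp
next
  case False
  have sq: "(cmod (exp (\<i> * of_real t) - 1))\<^sup>2 = 2 - 2 * cos t" for t :: real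
  proof -
    have "(cmod (exp (\<i> * of_real t) - 1))\<^sup>2 = (cos t - 1)\<^sup>2 + (sin t)\<^sup>2"
      by (simp add: cmod_power2 Re_exp Im_exp)
    also have "\<dots> = (cos t)\<^sup>2 + (sin t)\<^sup>2 + 1 - 2 * cos t"
      by (simp add: power2_eq_square algebra_simps)
    finally show ?thesis by simp
  qed
  have "cos \<bar>s\<bar> \<le> cos (1/2)"
    using False assms by (intro cos_monotone_0_pi_le) auto
  then have "(cmod (exp (\<i> * of_real (1/2)) - 1))\<^sup>2 \<le> (cmod (exp (\<i> * of_real s) - 1))\<^sup>2"
    unfolding sq by simp
  then have "cmod (exp (\<i> * of_real (1/2)) - 1) \<le> cmod (exp (\<i> * of_real s) - 1)"
    by (rule power2_le_imp_le) simp
  moreover have "1/16 \<le> cmod (exp (\<i> * of_real (1/2)) - 1)"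
    using norm_exp_minus_1_ge[of "of_real (1/2)"] by (simp add: norm_divide)
  moreover have "\<bar>s\<bar> / 64 \<le> 1/16"
    using assms pi_less_4 by simp
  ultimately show ?thesis by linarith
qed

section \<open>Cauchy estimates for multiplier sums\<close>

lemma mult_sum_deriv_deriv: "(deriv ^^ a) (mult_sum B \<psi>) = mult_sum_deriv B \<psi> a"
proof (induction a)
  case (Suc a)
  have "deriv (mult_sum_deriv B \<psi> a) z = mult_sum_deriv B \<psi> (Suc a) z" for z
    unfolding mult_sum_deriv_def
    by (rule DERIV_imp_deriv) (auto intro!: derivative_eq_intros sum.cong simp: mult_ac)
  then show ?case using Suc by auto
qed simp

lemma mult_sum_deriv_holomorphic: "mult_sum B \<psi> holomorphic_on S"
  unfolding mult_sum_deriv_def by (intro holomorphic_intros)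

text \<open>This trades \<open>a\<close> derivatives for fact a / r ^ a, and p! \<subset> M_p will
  pay for the factorial.\<close>

lemma mult_sum_deriv_Cauchy:
  assumes "0 < r" "\<And>z. cmod (z - s) = r \<Longrightarrow> cmod (mult_sum B \<psi> z) \<le> b"
  shows "cmod (mult_sum_deriv B \<psi> a s) \<le> fact a * b / r ^ a"
proof -
  have "cmod ((deriv ^^ a) (mult_sum B \<psi>) s) \<le> fact a * b / r ^ a"
    by (rule Cauchy_inequality[OF mult_sum_deriv_holomorphic holomorphic_on_imp_continuous_on[OF mult_sum_deriv_holomorphic] assms(1)])
      (rule assms(2), simp add: norm_minus_commute)
  then show ?thesis by (simp only: mult_sum_deriv_deriv)
qed

lemma norm_two_w: "cmod (2 * of_nat w + 1) = 2 * real w + 1"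
proof -
  have "2 * of_nat w + 1 = (of_nat (2 * w + 1) :: complex)" by simp
  then have "cmod (2 * of_nat w + 1) = real (2 * w + 1)" by (simp only: norm_of_nat)
  then show ?thesis by simp
qed

lemma dirichlet_avg_le: "\<bar>Im z\<bar> \<le> r \<Longrightarrow> cmod (dirichlet w z / (2 * of_nat w + 1)) \<le> exp (real w * r)"
proof -
  have n: "cmod (2 * of_nat w + 1) = 2 * real w + 1"
    by (rule norm_two_w)
  show "\<bar>Im z\<bar> \<le> r \<Longrightarrow> ?thesis"
    using dirichlet_le[of z r w] unfolding norm_divide n by (simp add: divide_le_eq mult.commute)
qed

text \<open>Factors of the distinguished width \<open>v\<close> carry an additional exp (-1), the
  others only the growth in the strip. Repetition of \<open>v\<close> thus becomes exponential
  decay.\<close>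

lemma prod_list_le_exp:
  assumes "\<And>w. w \<in> set ws \<Longrightarrow> cmod (g w) \<le> exp (real w * r - (if w = v then 1 else 0))"
  shows "cmod (prod_list (map g ws)) \<le> exp (real (sum_list ws) * r - real (count_list ws v))"
  using assms
proof (induction ws)
  case (Cons w ws)
  have "cmod (prod_list (map g (w # ws))) = cmod (g w) * cmod (prod_list (map g ws))"
    by (simp add: norm_mult)
  also have "\<dots> \<le> exp (real w * r - (if w = v then 1 else 0)) * exp (real (sum_list ws) * r - real (count_list ws v))"
    using Cons by (intro mult_mono) auto
  also have "\<dots> = exp (real (sum_list (w # ws)) * r - real (count_list (w # ws) v))"
    by (auto simp: exp_add[symmetric] algebra_simps)
  finally show ?case .
qed simp

lemma prod_list_le_exp0:
  assumes "\<And>w. w \<in> set ws \<Longrightarrow> cmod (g w) \<le> exp (real w * r)"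
  shows "cmod (prod_list (map g ws)) \<le> exp (real (sum_list ws) * r)"
  using assms
proof (induction ws)
  case (Cons w ws)
  have "cmod (prod_list (map g (w # ws))) \<le> exp (real w * r) * exp (real (sum_list ws) * r)"
    unfolding list.map prod_list.Cons norm_mult using Cons by (intro mult_mono) auto
  then show ?case by (simp add: exp_add[symmetric] algebra_simps)
qed simp

lemma mult_sum_le_trivial:
  assumes "R + sum_list ws \<le> B" "\<bar>Im z\<bar> \<le> r"
  shows "cmod (mult_sum B (iter_avg R ws) z) \<le> (2 * real R + 1) * exp (real (R + sum_list ws) * r)"
proof -
  have "cmod (mult_sum B (iter_avg R ws) z) \<le> ((2 * real R + 1) * exp (real R * r)) * exp (real (sum_list ws) * r)"
    unfolding mult_sum_mlt[OF assms(1)] norm_mult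
    by (intro mult_mono dirichlet_le prod_list_le_exp0 dirichlet_avg_le assms) auto
  then show ?thesis by (simp add: exp_add[symmetric] algebra_simps)
qed

text \<open>At distance \<sigma> from the origin, every factor of width \<open>v\<close> beats its
  trivial bound by a factor e, provided that v * \<sigma> is large enough.\<close>

lemma mult_sum_le_tail:
  assumes "R + sum_list ws \<le> B" "\<bar>Im z\<bar> \<le> r" "r \<le> 1/2" "cmod z \<le> 1/2" "\<sigma> / 2 \<le> cmod z" "0 < \<sigma>" "real v * \<sigma> \<ge> 96"
  shows "cmod (mult_sum B (iter_avg R ws) z) \<le> (2 * real R + 1) * exp (real (R + sum_list ws) * r - real (count_list ws v))"
proof -
  have n: "cmod (2 * of_nat v + 1) = 2 * real v + 1"
    by (rule norm_two_w)
  have r0: "r \<ge> 0" using assms(2) by linarith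
  have "\<sigma> / 16 \<le> cmod (exp (\<i> * z) - 1)"
    using norm_exp_minus_1_ge[OF assms(4)] assms(5) by linarith
  then have "\<sigma> / 16 * cmod (dirichlet v z) \<le> 2 * exp (real (v + 1) * r)"
    using dirichlet_le2[OF assms(2), of v] by (meson mult_right_mono norm_ge_zero order_trans)
  then have "cmod (dirichlet v z) \<le> 32 * exp (real (v + 1) * r) / \<sigma>"
    using assms(6) by (simp add: field_simps)
  also have "exp (real (v + 1) * r) = exp (real v * r) * exp r"
    by (simp add: exp_add[symmetric] algebra_simps)
  also have "\<dots> \<le> exp (real v * r) * 2"
  proof -
    have "exp r \<le> 1 + r + r\<^sup>2" using r0 assms(3) by (intro exp_bound) auto
    also have "\<dots> \<le> 1 + 1/2 + (1/2)\<^sup>2" using r0 assms(3) by (intro add_mono power_mono) auto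
    finally show ?thesis by (simp add: power2_eq_square)
  qed
  finally have "cmod (dirichlet v z) \<le> 64 * exp (real v * r) / \<sigma>"
    using assms(6) by (simp add: divide_right_mono)
  then have "cmod (dirichlet v z / (2 * of_nat v + 1)) \<le> 64 * exp (real v * r) / \<sigma> / (2 * real v + 1)"
    unfolding norm_divide n by (rule divide_right_mono) simp
  also have "\<dots> = exp (real v * r) * (64 / (\<sigma> * (2 * real v + 1)))"
    by simp
  also have "\<dots> \<le> exp (real v * r) * exp (-1)"
  proof (rule mult_left_mono)
    \<comment> \<open>Origin of the threshold 96: the factor is at most exp (-1) as soon as 64 * e,
      which is below 192, is at most 2 * v * \<sigma>.\<close>
    have "64 * exp 1 \<le> (64 * 3 :: real)" using exp_le by simp
    also have "\<dots> \<le> \<sigma> * (2 * real v + 1)" using assms(6,7) by (simp add: algebra_simps)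
    finally have "64 / (\<sigma> * (2 * real v + 1)) \<le> 64 / (64 * exp 1)"
      by (intro divide_left_mono) (use assms(6) in auto)
    also have "\<dots> = exp (-1)" by (simp add: exp_minus field_simps)
    finally show "64 / (\<sigma> * (2 * real v + 1)) \<le> exp (-1)" .
  qed simp
  finally have v: "cmod (dirichlet v z / (2 * of_nat v + 1)) \<le> exp (real v * r - 1)"
    by (simp add: exp_diff exp_minus field_simps)
  have "cmod (mult_sum B (iter_avg R ws) z)
      \<le> ((2 * real R + 1) * exp (real R * r)) * exp (real (sum_list ws) * r - real (count_list ws v))"
    unfolding mult_sum_mlt[OF assms(1)] norm_mult
    by (intro mult_mono dirichlet_le prod_list_le_exp) (use v dirichlet_avg_le[OF assms(2)] assms(2) in auto)
  also have "\<dots> = (2 * real R + 1) * (exp (real R * r) * exp (real (sum_list ws) * r - real (count_list ws v)))"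
    by simp
  also have "exp (real R * r) * exp (real (sum_list ws) * r - real (count_list ws v))
      = exp (real (R + sum_list ws) * r - real (count_list ws v))"
    by (subst exp_add[symmetric]) (simp add: algebra_simps)
  finally show ?thesis .
qed

lemma mult_sum_deriv_le_trivial:
  assumes "R + sum_list ws \<le> B" "0 < r"
  shows "cmod (mult_sum_deriv B (iter_avg R ws) a (of_real s)) \<le> fact a * ((2 * real R + 1) * exp (real (R + sum_list ws) * r)) / r ^ a"
proof (rule mult_sum_deriv_Cauchy[OF assms(2)], rule mult_sum_le_trivial[OF assms(1)])
  fix z assume "cmod (z - of_real s) = r"
  then show "\<bar>Im z\<bar> \<le> r" using abs_Im_le_cmod[of "z - of_real s"] by simp
qed

text \<open>With r \<le> \<sigma> / 2 the Cauchy disc stays at distance \<sigma> / 2 from the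
  origin, and with r and the modulus of s at most 1/4 it stays where
  \<open>norm_exp_minus_1_ge\<close> applies.\<close>

lemma mult_sum_deriv_le_tail:
  assumes "R + sum_list ws \<le> B" "0 < r" "r \<le> 1/4" "r \<le> \<sigma> / 2" "\<bar>s\<bar> \<le> 1/4" "\<sigma> \<le> \<bar>s\<bar>" "0 < \<sigma>" "real v * \<sigma> \<ge> 96"
  shows "cmod (mult_sum_deriv B (iter_avg R ws) a (of_real s))
    \<le> fact a * ((2 * real R + 1) * exp (real (R + sum_list ws) * r - real (count_list ws v))) / r ^ a"
proof (rule mult_sum_deriv_Cauchy[OF assms(2)], rule mult_sum_le_tail[OF assms(1) _ _ _ _ assms(7,8)])
  fix z assume z: "cmod (z - of_real s) = r"
  then show "\<bar>Im z\<bar> \<le> r" using abs_Im_le_cmod[of "z - of_real s"] by simp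
  have "cmod z \<le> cmod (z - of_real s) + cmod (of_real s :: complex)"
    using norm_triangle_ineq[of "z - of_real s" "of_real s"] by simp
  then show "cmod z \<le> 1/2" using z assms by simp
  have "cmod (of_real s :: complex) \<le> cmod (z - of_real s) + cmod z"
    using norm_triangle_ineq4[of z "z - of_real s"] by simp
  then show "\<sigma> / 2 \<le> cmod z" using z assms by simp
qed (use assms in simp)

text \<open>The two Dirichlet factors of widths 3 * la and la each gain a power of 1 / s; combined
  with the trivial bound this is a Lorentz profile of mass independent of \<open>la\<close>. The
  other factors are at most 1 on the real axis.\<close>

lemma mult_sum_real_le:
  fixes s :: real
  assumes "4 * la + sum_list ws \<le> B" "\<bar>s\<bar> \<le> pi" "la \<ge> 1"
  shows "cmod (mult_sum B (iter_avg (3 * la) (la # ws)) (of_real s)) \<le> 16384 * (real la / (1 + (real la * s)\<^sup>2))"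
proof -
  define e where "e = cmod (exp (\<i> * complex_of_real s) - 1)"
  have e: "\<bar>s\<bar> / 64 \<le> e" unfolding e_def by (rule norm_cis_minus_1_ge[OF assms(2)])
  have n: "cmod (2 * of_nat la + 1) = 2 * real la + 1"
    by (rule norm_two_w)
  let ?z = "complex_of_real s"
  define T where "T = cmod (mult_sum B (iter_avg (3 * la) (la # ws)) ?z)"
  have "T = cmod (dirichlet (3 * la) ?z) * cmod (dirichlet la ?z / (2 * of_nat la + 1)) *
      cmod (prod_list (map (\<lambda>w. dirichlet w ?z / (2 * of_nat w + 1)) ws))"
    unfolding T_def using assms(1) by (subst mult_sum_mlt) (auto simp: norm_mult norm_divide)
  moreover have "cmod (prod_list (map (\<lambda>w. dirichlet w ?z / (2 * of_nat w + 1)) ws)) \<le> 1"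
    using prod_list_le_exp0[of ws "\<lambda>w. dirichlet w ?z / (2 * of_nat w + 1)" 0] dirichlet_avg_le[of ?z 0] by simp
  ultimately have T: "T \<le> cmod (dirichlet (3 * la) ?z) * cmod (dirichlet la ?z / (2 * of_nat la + 1))"
    by (simp only:) (rule mult_left_le, simp_all)
  have "cmod (dirichlet la ?z / (2 * of_nat la + 1)) \<le> 1" using dirichlet_avg_le[of ?z 0 la] by simp
  moreover have "cmod (dirichlet (3 * la) ?z) \<le> 7 * real la"
    using dirichlet_le[of ?z 0 "3 * la"] assms(3) by simp
  ultimately have T1: "T \<le> 7 * real la"
    using T by (smt (verit, best) mult_left_le norm_ge_zero)
  have "e * cmod (dirichlet (3 * la) ?z) \<le> 2" "e * cmod (dirichlet la ?z) \<le> 2"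
    using dirichlet_le2[of ?z 0] by (simp_all add: e_def)
  then have "(e * cmod (dirichlet (3 * la) ?z)) * (e * cmod (dirichlet la ?z)) \<le> 2 * 2"
    using e by (intro mult_mono) auto
  then have "e\<^sup>2 * (cmod (dirichlet (3 * la) ?z) * cmod (dirichlet la ?z)) \<le> 4"
    by (simp add: power2_eq_square mult_ac)
  moreover have "(2 * real la + 1) * T \<le> cmod (dirichlet (3 * la) ?z) * cmod (dirichlet la ?z)"
    using T unfolding norm_divide n by (simp add: field_simps)
  ultimately have "e\<^sup>2 * ((2 * real la + 1) * T) \<le> 4"
    by (meson mult_left_mono order_trans zero_le_power2)
  moreover have "(s / 64)\<^sup>2 \<le> e\<^sup>2"
    using power_mono[OF e, of 2] by (simp add: power_divide)
  moreover have "0 \<le> (2 * real la + 1) * T" by (simp add: T_def)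
  ultimately have "(s / 64)\<^sup>2 * ((2 * real la + 1) * T) \<le> 4"
    by (meson mult_right_mono order_trans)
  moreover have "2 * real la * T \<le> (2 * real la + 1) * T"
    by (rule mult_right_mono) (auto simp: T_def)
  ultimately have "(s / 64)\<^sup>2 * (2 * real la * T) \<le> 4"
    by (meson mult_left_mono order_trans zero_le_power2)
  \<comment> \<open>The constant is 4 * 64 * 64 / 2: two factors 64 come from the lower bound for
    \<open>e\<close>, the 2 from the width 2 * la.\<close>
  then have T2: "s\<^sup>2 * real la * T \<le> 8192" by (simp add: power_divide mult_ac)
  have "T * (1 + (real la * s)\<^sup>2) = T + real la * (s\<^sup>2 * real la * T)"
    by (simp add: power2_eq_square algebra_simps)
  also have "\<dots> \<le> 7 * real la + real la * 8192"
    by (intro add_mono T1 mult_left_mono T2) simp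
  also have "\<dots> \<le> 16384 * real la" by simp
  finally show ?thesis
    unfolding T_def[symmetric] by (simp add: le_divide_eq add_pos_nonneg)
qed

subsection \<open>Integrals over Euclidean space\<close>

text \<open>Fubini's theorem for product functions: Lebesgue measure is an image of the product
  measure over \<open>Basis\<close>, and \<open>axis\<close> identifies \<open>Basis\<close> with
  the coordinates.\<close>

lemma integral_prod_vec:
  fixes f :: "'d::finite \<Rightarrow> real \<Rightarrow> 'b::{real_normed_field,banach,second_countable_topology}"
  assumes "\<And>i. integrable lborel (f i)"
  shows "integrable lborel (\<lambda>x::real^'d. \<Prod>i\<in>UNIV. f i (x $ i))"
    and "(LINT x|lborel. (\<Prod>i\<in>UNIV. f i ((x::real^'d) $ i))) = (\<Prod>i\<in>UNIV. LINT t|lborel. f i t)"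
proof -
  interpret product_sigma_finite "\<lambda>b::real^'d. lborel :: real measure" ..
  let ?ax = "\<lambda>i::'d. axis i (1::real)"
  have inj: "inj ?ax" by (auto simp: inj_on_def axis_eq_axis)
  have B: "Basis = range ?ax" by (auto simp: Basis_vec_def)
  define F where "F b = f (inv ?ax b)" for b
  have F: "F (?ax i) = f i" for i by (simp add: F_def inv_f_f[OF inj])
  have intF: "integrable lborel (F b)" for b by (simp add: F_def assms)
  let ?T = "\<lambda>g::real^'d \<Rightarrow> real. \<Sum>b\<in>Basis. g b *\<^sub>R b"
  have T: "?T g $ i = g (?ax i)" for g i
  proof -
    have "?T g $ i = ?T g \<bullet> axis i 1" by (simp add: inner_axis)
    also have "\<dots> = g (?ax i)"
      by (subst inner_sum_left_Basis) auto
    finally show ?thesis .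
  qed
  have pr: "(\<Prod>i\<in>UNIV. f i (?T g $ i)) = (\<Prod>b\<in>Basis. F b (g b))" for g
  proof -
    have "(\<Prod>b\<in>Basis. F b (g b)) = (\<Prod>i\<in>UNIV. F (?ax i) (g (?ax i)))"
      unfolding B by (subst prod.reindex[OF inj]) simp
    then show ?thesis by (simp only: F T)
  qed
  have mT: "?T \<in> measurable (\<Pi>\<^sub>M b\<in>Basis. lborel) borel" by measurable
  have [measurable]: "f i \<in> borel_measurable borel" for i
    using borel_measurable_integrable[OF assms[of i]] by simp
  have meas: "(\<lambda>x::real^'d. \<Prod>i\<in>UNIV. f i (x $ i)) \<in> borel_measurable borel"
    by (intro borel_measurable_prod measurable_compose[OF borel_measurable_nth]) simp
  show "integrable lborel (\<lambda>x::real^'d. \<Prod>i\<in>UNIV. f i (x $ i))"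
    by (subst lborel_eq, subst integrable_distr_eq[OF mT meas], unfold pr)
      (intro product_integrable_prod finite_Basis intF)
  show "(LINT x|lborel. (\<Prod>i\<in>UNIV. f i ((x::real^'d) $ i))) = (\<Prod>i\<in>UNIV. LINT t|lborel. f i t)"
  proof -
    have "(LINT x|lborel. (\<Prod>i\<in>UNIV. f i ((x::real^'d) $ i)))
        = (LINT g|(\<Pi>\<^sub>M b\<in>Basis. lborel). (\<Prod>b\<in>Basis. F b (g b)))"
      by (subst lborel_eq, subst integral_distr[OF mT meas], unfold pr) simp
    also have "\<dots> = (\<Prod>b\<in>Basis. LINT t|lborel. F b t)"
      by (intro product_integral_prod finite_Basis intF)
    also have "\<dots> = (\<Prod>i\<in>UNIV. LINT t|lborel. f i t)"
      unfolding B by (subst prod.reindex[OF inj]) (simp add: F)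
    finally show ?thesis .
  qed
qed

lemma integral_translate:
  fixes f :: "'a::euclidean_space \<Rightarrow> 'b::{banach,second_countable_topology}"
  assumes "f \<in> borel_measurable borel"
  shows "(LINT x|lborel. f (c + x)) = (LINT x|lborel. f x)"
proof -
  have "(LINT x|lborel. f x) = (LINT x|distr lborel borel ((+) c). f x)"
    by (simp add: lborel_distr_plus)
  also have "\<dots> = (LINT x|lborel. f (c + x))"
    by (rule integral_distr) (use assms in auto)
  finally show ?thesis ..
qed

lemma integrable_translate:
  fixes f :: "'a::euclidean_space \<Rightarrow> 'b::{banach,second_countable_topology}"
  assumes "integrable lborel f"
  shows "integrable lborel (\<lambda>x. f (c + x))"
proof -
  have "integrable (distr lborel borel ((+) c)) f"
    using assms by (simp add: lborel_distr_plus)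
  then show ?thesis
    using borel_measurable_integrable[OF assms] by (subst (asm) integrable_distr_eq) auto
qed

lemma integrable_compact_support:
  fixes f :: "'a::euclidean_space \<Rightarrow> 'b::{banach,second_countable_topology}"
  assumes "compact S" "continuous_on S f" "\<And>x. x \<notin> S \<Longrightarrow> f x = 0"
  shows "integrable lborel f"
proof -
  have "(\<lambda>x. indicator S x *\<^sub>R f x) = f" using assms(3) by (auto simp: indicator_def)
  then show ?thesis using borel_integrable_compact[OF assms(1,2)] by simp
qed

section \<open>Integration along a coordinate direction\<close>

lemma line_derivative_shift:
  fixes g :: "real^'d::finite \<Rightarrow> complex"
  assumes "\<And>x. ((\<lambda>t. g (x + t *\<^sub>R axis i 1)) has_vector_derivative g' x) (at 0)"
  shows "((\<lambda>t. g (x + t *\<^sub>R axis i 1)) has_vector_derivative g' (x + s *\<^sub>R axis i 1)) (at s)"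
proof -
  have "((\<lambda>t. g ((x + s *\<^sub>R axis i 1) + t *\<^sub>R axis i 1)) \<circ> (\<lambda>t. t - s) has_vector_derivative 1 *\<^sub>R g' (x + s *\<^sub>R axis i 1)) (at s)"
    by (rule vector_diff_chain_at) (auto intro!: derivative_eq_intros assms)
  moreover have "(\<lambda>t. g ((x + s *\<^sub>R axis i 1) + t *\<^sub>R axis i 1)) \<circ> (\<lambda>t. t - s) = (\<lambda>t. g (x + t *\<^sub>R axis i 1))"
    by (auto simp: fun_eq_iff algebra_simps simp flip: scaleR_add_left)
  ultimately show ?thesis by simp
qed

lemma line_derivative_bound:
  fixes g :: "real^'d::finite \<Rightarrow> complex"
  assumes "\<And>x. ((\<lambda>t. g (x + t *\<^sub>R axis i 1)) has_vector_derivative g' x) (at 0)"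
    and "\<And>x. cmod (g' x) \<le> C" "h \<ge> 0"
  shows "cmod (g (x + h *\<^sub>R axis i 1) - g x) \<le> C * h"
proof -
  have "cmod ((\<lambda>t. g (x + t *\<^sub>R axis i 1)) h - (\<lambda>t. g (x + t *\<^sub>R axis i 1)) 0) \<le> C * norm (h - 0)"
  proof (rule differentiable_bound[where S="{0..h}" and f'="\<lambda>s r. r *\<^sub>R g' (x + s *\<^sub>R axis i 1)"])
    show "((\<lambda>t. g (x + t *\<^sub>R axis i 1)) has_derivative (\<lambda>r. r *\<^sub>R g' (x + s *\<^sub>R axis i 1))) (at s within {0..h})" for s
      using has_vector_derivative_at_within[OF line_derivative_shift[OF assms(1)]]
      unfolding has_vector_derivative_def .
    show "onorm (\<lambda>r. r *\<^sub>R g' (x + s *\<^sub>R axis i 1)) \<le> C" for s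
      by (rule onorm_le) (use assms(2) in \<open>auto simp: mult.commute[of C] intro: mult_left_mono\<close>)
  qed (use assms in auto)
  then show ?thesis using assms(3) by simp
qed

lemma derivative_zero_outside:
  fixes g :: "real^'d::finite \<Rightarrow> complex"
  assumes "\<And>x. ((\<lambda>t. g (x + t *\<^sub>R axis i 1)) has_vector_derivative g' x) (at 0)"
    and "closed S" "\<And>x. x \<notin> S \<Longrightarrow> g x = 0" "x \<notin> S"
  shows "g' x = 0"
proof -
  have "\<forall>\<^sub>F t in nhds 0. x + t *\<^sub>R axis i 1 \<in> - S"
    using assms(2,4) by (intro line_tendsto) auto
  then have ev: "\<forall>\<^sub>F t in nhds 0. g (x + t *\<^sub>R axis i 1) = 0"
    by (rule eventually_mono) (use assms(3) in auto)
  have "vector_derivative (\<lambda>t. g (x + t *\<^sub>R axis i 1)) (at 0) = vector_derivative (\<lambda>t. 0) (at (0::real))"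
    by (rule vector_derivative_cong_eq) (use ev in \<open>auto elim: eventually_mono\<close>)
  then show ?thesis
    using vector_derivative_at[OF assms(1)[of x]] by simp
qed

lemma continuous_compact_support_bounded:
  fixes f :: "'a::euclidean_space \<Rightarrow> complex"
  assumes "compact S" "continuous_on UNIV f" "\<And>x. x \<notin> S \<Longrightarrow> f x = 0"
  obtains C where "C \<ge> 0" "\<And>x. cmod (f x) \<le> C"
proof -
  have "compact (f ` S)"
    using assms(1,2) compact_continuous_image continuous_on_subset by blast
  then obtain C where C: "\<And>x. x \<in> S \<Longrightarrow> cmod (f x) \<le> C"
    using compact_imp_bounded bounded_iff by (metis imageI)
  have "cmod (f x) \<le> max C 0" for x
    using C[of x] assms(3)[of x] by (cases "x \<in> S") auto
  then show ?thesis using that[of "max C 0"] by auto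
qed

text \<open>By translation invariance all difference quotients in direction i have integral zero,
  and they converge to g' with an integrable majorant. No iterated integration is involved.\<close>

lemma integral_line_derivative_zero:
  fixes g :: "real^'d::finite \<Rightarrow> complex"
  assumes der: "\<And>x. ((\<lambda>t. g (x + t *\<^sub>R axis i 1)) has_vector_derivative g' x) (at 0)"
    and cont: "continuous_on UNIV g" "continuous_on UNIV g'"
    and S: "compact S" "\<And>x. x \<notin> S \<Longrightarrow> g x = 0"
  shows "(LINT x|lborel. g' x) = 0"
proof -
  have g'0: "g' x = 0" if "x \<notin> S" for x
    by (rule derivative_zero_outside[OF der compact_imp_closed[OF S(1)] S(2) that])
  obtain C where C: "C \<ge> 0" "\<And>x. cmod (g' x) \<le> C"
    by (rule continuous_compact_support_bounded[OF S(1) cont(2) g'0]) (assumption, rule that)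
  obtain b where "\<forall>x\<in>S. norm x \<le> b"
    using compact_imp_bounded[OF S(1)] unfolding bounded_iff by (elim exE)
  then have b: "S \<subseteq> cball 0 b" by auto
  have [measurable]: "g \<in> borel_measurable borel" "g' \<in> borel_measurable borel"
    using cont by (simp_all add: borel_measurable_continuous_onI)
  have ig: "integrable lborel g"
    by (rule integrable_compact_support[OF S(1) continuous_on_subset[OF cont(1)] S(2)]) auto
  define s where "s n x = (real (Suc n)) *\<^sub>R (g (x + (1 / real (Suc n)) *\<^sub>R axis i 1) - g x)" for n x
  have s0: "(LINT x|lborel. s n x) = 0" for n
  proof -
    have "(LINT x|lborel. g (x + (1 / real (Suc n)) *\<^sub>R axis i 1)) = (LINT x|lborel. g x)"
      using integral_translate[of g "(1 / real (Suc n)) *\<^sub>R axis i 1"] by (simp add: add.commute)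
    moreover have "integrable lborel (\<lambda>x. g (x + (1 / real (Suc n)) *\<^sub>R axis i 1))"
      using integrable_translate[OF ig, of "(1 / real (Suc n)) *\<^sub>R axis i 1"] by (simp add: add.commute)
    ultimately show ?thesis unfolding s_def using ig by simp
  qed
  have "(\<lambda>n. LINT x|lborel. s n x) \<longlonglongrightarrow> (LINT x|lborel. g' x)"
  \<comment> \<open>The increments are at most 1, so every quotient vanishes outside the ball of
    radius b + 1, and the mean value inequality bounds it by C.\<close>
  proof (rule integral_dominated_convergence[where w="\<lambda>x. C * indicator (cball 0 (b + 1)) x"])
    show "integrable lborel (\<lambda>x. C * indicator (cball 0 (b + 1)) x :: real)"
      by (intro integrable_mult_right integrable_real_indicator) (simp_all add: emeasure_compact_finite[OF compact_cball, simplified])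
    show "AE x in lborel. (\<lambda>n. s n x) \<longlonglongrightarrow> g' x"
    proof (rule AE_I2)
      fix x
      have "((\<lambda>t. (1 / norm (t - 0)) *\<^sub>R (g (x + t *\<^sub>R axis i 1) - (g (x + 0 *\<^sub>R axis i 1) + (t - 0) *\<^sub>R g' x))) \<longlongrightarrow> 0) (at 0)"
        using der[of x] unfolding has_vector_derivative_def has_derivative_within by (elim conjE)
      moreover have "filterlim (\<lambda>n. 1 / real (Suc n)) (at 0) sequentially"
        unfolding filterlim_at using LIMSEQ_inverse_real_of_nat by (auto simp: inverse_eq_divide)
      ultimately have "(\<lambda>n. (1 / norm (1 / real (Suc n) - 0)) *\<^sub>R (g (x + (1 / real (Suc n)) *\<^sub>R axis i 1)
          - (g (x + 0 *\<^sub>R axis i 1) + (1 / real (Suc n) - 0) *\<^sub>R g' x))) \<longlonglongrightarrow> 0"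
        by (rule filterlim_compose)
      also have "(\<lambda>n. (1 / norm (1 / real (Suc n) - 0)) *\<^sub>R (g (x + (1 / real (Suc n)) *\<^sub>R axis i 1)
          - (g (x + 0 *\<^sub>R axis i 1) + (1 / real (Suc n) - 0) *\<^sub>R g' x))) = (\<lambda>n. s n x - g' x)"
        unfolding s_def by (intro ext) (simp add: scaleR_right_diff_distrib scaleR_add_right)
      finally show "(\<lambda>n. s n x) \<longlonglongrightarrow> g' x" by (rule LIM_zero_cancel)
    qed
    show "AE x in lborel. norm (s n x) \<le> C * indicator (cball 0 (b + 1)) x" for n
    proof (rule AE_I2)
      fix x
      show "norm (s n x) \<le> C * indicator (cball 0 (b + 1)) x"
      proof (cases "x \<in> cball 0 (b + 1)")
        case True
        have "cmod (g (x + (1 / real (Suc n)) *\<^sub>R axis i 1) - g x) \<le> C * (1 / real (Suc n))"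
          by (rule line_derivative_bound[OF der C(2)]) simp
        then have "norm (s n x) \<le> real (Suc n) * (C * (1 / real (Suc n)))"
          unfolding s_def norm_scaleR by (intro mult_mono) auto
        then show ?thesis using True by simp
      next
        case False
        have "norm x - 1 / real (Suc n) \<le> norm (x + (1 / real (Suc n)) *\<^sub>R axis i 1)"
          using norm_triangle_ineq4[of "x + (1 / real (Suc n)) *\<^sub>R axis i 1" "(1 / real (Suc n)) *\<^sub>R axis i (1::real)"]
          by (simp add: norm_axis_1)
        moreover have "1 / real (Suc n) \<le> 1" by simp
        ultimately have "norm (x + (1 / real (Suc n)) *\<^sub>R axis i 1) \<ge> norm x - 1" by linarith
        then have "x + (1 / real (Suc n)) *\<^sub>R axis i 1 \<notin> S" "x \<notin> S"
          using False b by auto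
        then show ?thesis using S(2) C(1) by (simp add: s_def)
      qed
    qed
  qed (simp_all add: s_def[abs_def])
  then show ?thesis unfolding s0 by (simp add: LIMSEQ_const_iff)
qed


subsection \<open>Trigonometric sums\<close>

text \<open>Periodic with period 2 * pi / \<tau> in each coordinate; a small \<tau> places a given
  compact set in a small part of the period cell.\<close>

definition wave :: "real \<Rightarrow> ('d::finite \<Rightarrow> int) \<Rightarrow> real^'d \<Rightarrow> complex" where
  "wave \<tau> k x = exp (\<i> * of_real (\<tau> * (\<Sum>i\<in>UNIV. of_int (k i) * x $ i)))"

definition freq_box :: "nat \<Rightarrow> ('d::finite \<Rightarrow> int) set" where
  "freq_box B = PiE UNIV (\<lambda>_. {-int B..int B})"

definition trig_sum :: "nat \<Rightarrow> real \<Rightarrow> (('d::finite \<Rightarrow> int) \<Rightarrow> complex) \<Rightarrow> real^'d \<Rightarrow> complex" where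
  "trig_sum B \<tau> A x = (\<Sum>k\<in>freq_box B. A k * wave \<tau> k x)"

lemma finite_KS [simp]: "finite (freq_box B)"
  unfolding freq_box_def by (intro finite_PiE) auto

lemma freq_box_iff: "k \<in> freq_box B \<longleftrightarrow> (\<forall>i. \<bar>k i\<bar> \<le> int B)"
  by (auto simp: freq_box_def PiE_iff abs_le_iff) (metis minus_le_iff)+

lemma card_KS: "card (freq_box B :: ('d::finite \<Rightarrow> int) set) = (2 * B + 1) ^ CARD('d)"
proof -
  have "nat (2 * int B + 1) = 2 * B + 1" by simp
  then show ?thesis unfolding freq_box_def by (simp add: card_PiE)
qed

lemma wave_add: "wave \<tau> k (x + y) = wave \<tau> k x * wave \<tau> k y"
  by (simp add: wave_def distrib_left sum.distrib exp_add)

lemma wave_prod: "wave \<tau> k x = (\<Prod>i\<in>UNIV. exp (\<i> * of_int (k i) * of_real (\<tau> * x $ i)))"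
  unfolding exp_sum[symmetric, OF finite] wave_def
  by (simp add: sum_distrib_left mult_ac)

lemma norm_ee [simp]: "cmod (wave \<tau> k x) = 1"
  by (simp add: wave_def)

lemma continuous_ee [continuous_intros]: "continuous_on S f \<Longrightarrow> continuous_on S (\<lambda>x. wave \<tau> k (f x))"
  unfolding wave_def by (intro continuous_intros)

lemma wave_line: "wave \<tau> k (x + t *\<^sub>R axis i 1) = wave \<tau> k x * exp (\<i> * of_real (\<tau> * (of_int (k i) * t)))"
proof -
  have "(\<Sum>j\<in>UNIV. of_int (k j) * ((t *\<^sub>R axis i 1) :: real^'a) $ j) = of_int (k i) * t"
    by (subst sum.remove[of _ i]) (auto simp: axis_def)
  then show ?thesis unfolding wave_add by (simp add: wave_def)
qed

lemma wave_line_derivative: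
  "((\<lambda>t. wave \<tau> k (x + t *\<^sub>R axis i 1)) has_vector_derivative (\<i> * of_real \<tau> * of_int (k i)) * wave \<tau> k x) (at 0)"
proof -
  have "((\<lambda>t::real. wave \<tau> k x * exp (\<i> * of_real (\<tau> * (of_int (k i) * t)))) has_vector_derivative
      wave \<tau> k x * (\<i> * of_real \<tau> * of_int (k i))) (at 0)"
  proof (intro has_vector_derivative_mult_right)
    have "((\<lambda>z. exp (\<i> * (of_real \<tau> * (of_int (k i) * z)))) has_field_derivative \<i> * of_real \<tau> * of_int (k i)) (at (of_real 0))"
      by (auto intro!: derivative_eq_intros)
    from has_vector_derivative_real_field[OF this]
    show "((\<lambda>t::real. exp (\<i> * of_real (\<tau> * (of_int (k i) * t)))) has_vector_derivative \<i> * of_real \<tau> * of_int (k i)) (at 0)"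
      by simp
  qed
  then show ?thesis unfolding wave_line by (simp add: mult_ac)
qed

lemma wave_differentiable: "wave \<tau> k differentiable at x"
proof -
  have "linear (\<lambda>x. \<i> * complex_of_real (\<tau> * (\<Sum>i\<in>UNIV. of_int (k i) * x $ i)))"
    by (rule linearI) (simp_all add: distrib_left sum.distrib sum_distrib_left scaleR_conv_of_real[where 'a=complex] mult_ac)
  then have "((\<lambda>x. \<i> * complex_of_real (\<tau> * (\<Sum>i\<in>UNIV. of_int (k i) * x $ i))) has_derivative
      (\<lambda>x. \<i> * complex_of_real (\<tau> * (\<Sum>i\<in>UNIV. of_int (k i) * x $ i)))) (at x)"
    by (intro bounded_linear_imp_has_derivative) (simp add: linear_conv_bounded_linear)
  from has_derivative_compose[OF this DERIV_exp[unfolded has_field_derivative_def]]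
  show ?thesis unfolding wave_def[abs_def] differentiable_def by blast
qed

lemma trig_sum_differentiable: "trig_sum B \<tau> A differentiable at x"
  unfolding trig_sum_def[abs_def] by (intro differentiable_sum finite_KS ballI differentiable_mult differentiable_const wave_differentiable)

lemma partial_tri: "partial i (trig_sum B \<tau> A) = trig_sum B \<tau> (\<lambda>k. A k * (\<i> * of_real \<tau> * of_int (k i)))"
proof
  fix x
  show "partial i (trig_sum B \<tau> A) x = trig_sum B \<tau> (\<lambda>k. A k * (\<i> * of_real \<tau> * of_int (k i))) x"
    unfolding trig_sum_def mult.assoc[of "A _"]
    by (intro partialI has_vector_derivative_sum has_vector_derivative_mult_right) (rule wave_line_derivative)
qed

lemma partials_tri:
  "partials is (trig_sum B \<tau> A) = trig_sum B \<tau> (\<lambda>k. A k * prod_list (map (\<lambda>i. \<i> * of_real \<tau> * of_int (k i)) is))"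
  by (induction "is") (auto simp: partial_tri mult_ac)

lemma mderiv_tri:
  "mderiv \<alpha> (trig_sum B \<tau> A) = trig_sum B \<tau> (\<lambda>k. A k * (\<Prod>i\<in>UNIV. (\<i> * of_real \<tau> * of_int (k i)) ^ \<alpha> i))"
  unfolding mderiv_eq partials_tri prod_list_count count_mi_list ..

lemma smooth_on_tri: "smooth_on U (trig_sum B \<tau> A)"
  unfolding smooth_on_def partials_tri by (auto intro: trig_sum_differentiable)

lemma freq_box_mono: "B \<le> B' \<Longrightarrow> freq_box B \<subseteq> freq_box B'"
  by (auto simp: subset_eq freq_box_iff intro: order_trans[of _ "int B" "int B'"])

lemma trig_sum_extend:
  assumes "B \<le> B'" "\<And>k. k \<notin> freq_box B \<Longrightarrow> A k = 0" shows "trig_sum B' \<tau> A = trig_sum B \<tau> A"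
  unfolding trig_sum_def fun_eq_iff
  by (intro allI sum.mono_neutral_right finite_KS freq_box_mono assms(1)) (auto simp: assms(2))

lemma norm_freq_le:
  assumes "k \<in> freq_box B" "\<tau> \<ge> 0"
  shows "cmod (\<Prod>i\<in>UNIV. (\<i> * of_real \<tau> * of_int (k i)) ^ \<alpha> i) \<le> (\<tau> * real B) ^ mi_abs \<alpha>"
proof -
  have "cmod (\<i> * of_real \<tau> * of_int (k i)) \<le> \<tau> * real B" for i
  proof -
    have "\<bar>k i\<bar> \<le> int B" using assms(1) by (simp add: freq_box_iff)
    then have "real_of_int \<bar>k i\<bar> \<le> real B" by linarith
    then show ?thesis using assms(2) by (simp add: norm_mult mult_left_mono)
  qed
  then have "cmod (\<Prod>i\<in>UNIV. (\<i> * of_real \<tau> * of_int (k i)) ^ \<alpha> i) \<le> (\<Prod>i\<in>UNIV. (\<tau> * real B) ^ \<alpha> i)"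
    unfolding prod_norm[symmetric] norm_power by (intro prod_mono conjI power_mono) auto
  then show ?thesis by (simp add: mi_abs_def power_sum)
qed


subsection \<open>Fourier coefficients\<close>

text \<open>The integral runs over the whole space. For g supported in one period cell these are the
  usual Fourier coefficients with respect to \<open>wave\<close>.\<close>

definition fourier_coeff :: "real \<Rightarrow> (real^'d::finite \<Rightarrow> complex) \<Rightarrow> ('d \<Rightarrow> int) \<Rightarrow> complex" where
  "fourier_coeff \<tau> g k = of_real ((\<tau> / (2 * pi)) ^ CARD('d)) * (LINT y|lborel. g y * wave \<tau> k (- y))"

lemma wave_measurable [measurable]: "(\<lambda>y. wave \<tau> k (c + y)) \<in> borel_measurable borel" "(\<lambda>y. wave \<tau> k (- y)) \<in> borel_measurable borel"
  by (intro borel_measurable_continuous_onI continuous_intros)+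

lemma integrable_ee:
  assumes "integrable lborel g" shows "integrable lborel (\<lambda>y. g y * wave \<tau> k (- y))"
  by (rule Bochner_Integration.integrable_bound[OF integrable_norm[OF assms]])
     (use borel_measurable_integrable[OF assms] in \<open>auto simp: norm_mult\<close>)

lemma fourier_coeff_le:
  fixes g :: "real^'d::finite \<Rightarrow> complex"
  assumes "integrable lborel g" "\<tau> \<ge> 0"
  shows "cmod (fourier_coeff \<tau> g k) \<le> (\<tau> / (2 * pi)) ^ CARD('d) * (LINT y|lborel. cmod (g y))"
proof -
  have "cmod (LINT y|lborel. g y * wave \<tau> k (- y)) \<le> (LINT y|lborel. cmod (g y * wave \<tau> k (- y)))"
    by (rule integral_norm_bound)
  then show ?thesis
    unfolding fourier_coeff_def norm_mult norm_of_real using assms(2) by (simp add: norm_mult mult_left_mono)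
qed

text \<open>The product of g with the conjugate wave has compact support, so the integral of its
  derivative vanishes; this is one integration by parts.\<close>

lemma fourier_coeff_derivative:
  fixes g :: "real^'d::finite \<Rightarrow> complex"
  assumes der: "\<And>x. ((\<lambda>t. g (x + t *\<^sub>R axis i 1)) has_vector_derivative g' x) (at 0)"
    and cont: "continuous_on UNIV g" "continuous_on UNIV g'"
    and S: "compact S" "\<And>x. x \<notin> S \<Longrightarrow> g x = 0"
  shows "fourier_coeff \<tau> g' k = \<i> * of_real \<tau> * of_int (k i) * fourier_coeff \<tau> g k"
proof -
  let ?c = "\<i> * of_real \<tau> * of_int (k i) :: complex"
  have m: "wave \<tau> k (- y) = wave \<tau> (\<lambda>i. - k i) y" for y
    by (simp add: wave_def sum_negf)
  have g'0: "g' x = 0" if "x \<notin> S" for x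
    by (rule derivative_zero_outside[OF der compact_imp_closed[OF S(1)] S(2) that])
  have i: "integrable lborel g" "integrable lborel g'"
    by (rule integrable_compact_support[OF S(1) continuous_on_subset[OF cont(1)] S(2)], auto)
       (rule integrable_compact_support[OF S(1) continuous_on_subset[OF cont(2)] g'0], auto)
  have "(LINT x|lborel. g' x * wave \<tau> k (- x) - ?c * (g x * wave \<tau> k (- x))) = 0"
  proof (rule integral_line_derivative_zero[where g="\<lambda>x. g x * wave \<tau> k (- x)"])
    fix x
    have "((\<lambda>t. g (x + t *\<^sub>R axis i 1) * wave \<tau> (\<lambda>i. - k i) (x + t *\<^sub>R axis i 1)) has_vector_derivative
       g (x + 0 *\<^sub>R axis i 1) * ((\<i> * of_real \<tau> * of_int (- k i)) * wave \<tau> (\<lambda>i. - k i) x) + g' x * wave \<tau> (\<lambda>i. - k i) (x + 0 *\<^sub>R axis i 1)) (at 0)"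
      by (intro has_vector_derivative_mult der wave_line_derivative[where k="\<lambda>i. - k i"])
    then show "((\<lambda>t. g (x + t *\<^sub>R axis i 1) * wave \<tau> k (- (x + t *\<^sub>R axis i 1))) has_vector_derivative
        g' x * wave \<tau> k (- x) - ?c * (g x * wave \<tau> k (- x))) (at 0)"
      unfolding m by (simp add: algebra_simps)
  qed (use S in \<open>auto intro!: continuous_intros cont\<close>)
  moreover have "(LINT x|lborel. g' x * wave \<tau> k (- x) - ?c * (g x * wave \<tau> k (- x)))
      = (LINT x|lborel. g' x * wave \<tau> k (- x)) - ?c * (LINT x|lborel. g x * wave \<tau> k (- x))"
    by (subst Bochner_Integration.integral_diff) (auto intro!: integrable_ee i integrable_mult_right)
  ultimately show ?thesis unfolding fourier_coeff_def by (simp add: algebra_simps)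
qed

lemma fourier_coeff_derivatives:
  fixes g :: "nat \<Rightarrow> real^'d::finite \<Rightarrow> complex"
  assumes der: "\<And>j x. j < q \<Longrightarrow> ((\<lambda>t. g j (x + t *\<^sub>R axis i 1)) has_vector_derivative g (Suc j) x) (at 0)"
    and cont: "\<And>j. j \<le> q \<Longrightarrow> continuous_on UNIV (g j)"
    and S: "compact S" "\<And>x. x \<notin> S \<Longrightarrow> g 0 x = 0"
  shows "j \<le> q \<Longrightarrow> fourier_coeff \<tau> (g j) k = (\<i> * of_real \<tau> * of_int (k i)) ^ j * fourier_coeff \<tau> (g 0) k \<and> (\<forall>x. x \<notin> S \<longrightarrow> g j x = 0)"
proof (induction j)
  case (Suc j)
  then have IH: "fourier_coeff \<tau> (g j) k = (\<i> * of_real \<tau> * of_int (k i)) ^ j * fourier_coeff \<tau> (g 0) k" "\<And>x. x \<notin> S \<Longrightarrow> g j x = 0"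
    by auto
  have "fourier_coeff \<tau> (g (Suc j)) k = \<i> * of_real \<tau> * of_int (k i) * fourier_coeff \<tau> (g j) k"
    by (rule fourier_coeff_derivative[OF der cont cont S(1) IH(2)]) (use Suc.prems in auto)
  moreover have "\<forall>x. x \<notin> S \<longrightarrow> g (Suc j) x = 0"
    using derivative_zero_outside[OF der compact_imp_closed[OF S(1)] IH(2)] Suc.prems by auto
  ultimately show ?case using IH(1) by simp
qed (use S in simp)

subsection \<open>Frequency cutoffs\<close>

text \<open>The width \<open>w m\<close> is used about \<open>2 ^ l / (2 ^ Suc m * w m)\<close> times: the widths add up to at most
  \<open>2 ^ l\<close>, and still each of them gives a decay of the kernel which is exponential in \<open>2 ^ l\<close> at
  the distance belonging to \<open>m\<close>.\<close>

definition avg_widths :: "(nat \<Rightarrow> nat) \<Rightarrow> nat \<Rightarrow> nat \<Rightarrow> nat list" where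
  "avg_widths w N l = concat (map (\<lambda>m. replicate (2 ^ l div (2 ^ Suc m * w m)) (w m)) [0..<N])"

text \<open>In units of 2 ^ l: radius 3, one average of width 1 and further widths adding up to at
  most 1, hence the value 1 up to 1 and the value 0 beyond 5. The separate average of width 2 ^ l
  supplies the second Dirichlet factor of \<open>mult_sum_real_le\<close>.\<close>

definition freq_cutoff :: "(nat \<Rightarrow> nat) \<Rightarrow> nat \<Rightarrow> nat \<Rightarrow> int \<Rightarrow> real" where
  "freq_cutoff w n l = iter_avg (3 * 2 ^ l) (2 ^ l # avg_widths w (Suc n) l)"

lemma avg_widths_Suc: "avg_widths w (Suc N) l = avg_widths w N l @ replicate (2 ^ l div (2 ^ Suc N * w N)) (w N)"
  by (simp add: avg_widths_def)

lemma sum_list_wsum_le: "real (sum_list (avg_widths w N l)) \<le> 2 ^ l * (1 - 1 / 2 ^ N)"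
proof (induction N)
  case 0
  show ?case by (simp add: avg_widths_def)
next
  case (Suc N)
  have "real ((2 ^ l div (2 ^ Suc N * w N)) * w N) \<le> 2 ^ l / 2 ^ Suc N"
  proof (cases "w N = 0")
    case False
    have "real (2 ^ l div (2 ^ Suc N * w N)) \<le> real (2 ^ l) / real (2 ^ Suc N * w N)"
      by (rule of_nat_div_le_of_nat)
    then have "real (2 ^ l div (2 ^ Suc N * w N)) * real (w N) \<le> real (2 ^ l) / real (2 ^ Suc N * w N) * real (w N)"
      by (rule mult_right_mono) simp
    also have "\<dots> = 2 ^ l / 2 ^ Suc N" using False by simp
    finally show ?thesis by simp
  qed simp
  then show ?case
    using Suc by (simp add: avg_widths_Suc sum_list_replicate field_simps)
qed

lemma sum_list_wsum: "sum_list (avg_widths w N l) \<le> 2 ^ l"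
proof -
  have "real (sum_list (avg_widths w N l)) \<le> 2 ^ l * 1"
    by (rule order_trans[OF sum_list_wsum_le]) (intro mult_left_mono, auto)
  then have "real (sum_list (avg_widths w N l)) \<le> real (2 ^ l)" by simp
  then show ?thesis by (simp only: of_nat_le_iff)
qed

lemma count_list_wsum: "m < N \<Longrightarrow> count_list (avg_widths w N l) (w m) \<ge> 2 ^ l div (2 ^ Suc m * w m)"
proof (induction N)
  case (Suc N)
  then show ?case
    by (cases "m = N") (auto simp: avg_widths_Suc count_list_append count_list_replicate)
qed simp

lemma freq_cutoff_bounds: "0 \<le> freq_cutoff w n l k" "freq_cutoff w n l k \<le> 1"
  unfolding freq_cutoff_def by (rule iter_avg_bounds[THEN conjunct1], rule iter_avg_bounds[THEN conjunct2])

lemma freq_cutoff_eq_1: "\<bar>k\<bar> \<le> 2 ^ l \<Longrightarrow> freq_cutoff w n l k = 1"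
  unfolding freq_cutoff_def
proof (rule iter_avg_eq_1)
  assume "\<bar>k\<bar> \<le> 2 ^ l"
  moreover have "int (sum_list (avg_widths w (Suc n) l)) \<le> 2 ^ l"
    using sum_list_wsum[of w "Suc n" l] by (metis of_nat_le_iff of_nat_numeral of_nat_power)
  ultimately show "\<bar>k\<bar> + int (sum_list (2 ^ l # avg_widths w (Suc n) l)) \<le> int (3 * 2 ^ l)"
    unfolding sum_list.Cons of_nat_add of_nat_mult of_nat_power of_nat_numeral by linarith
qed

lemma freq_cutoff_eq_0: "\<bar>k\<bar> > 5 * 2 ^ l \<Longrightarrow> freq_cutoff w n l k = 0"
  unfolding freq_cutoff_def
proof (rule iter_avg_eq_0)
  assume "\<bar>k\<bar> > 5 * 2 ^ l"
  moreover have "int (sum_list (avg_widths w (Suc n) l)) \<le> 2 ^ l"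
    using sum_list_wsum[of w "Suc n" l] by (metis of_nat_le_iff of_nat_numeral of_nat_power)
  ultimately show "\<bar>k\<bar> > int (3 * 2 ^ l) + int (sum_list (2 ^ l # avg_widths w (Suc n) l))"
    unfolding sum_list.Cons of_nat_add of_nat_mult of_nat_power of_nat_numeral by linarith
qed

section \<open>Multipliers and kernels in several variables\<close>

definition box_mult :: "(nat \<Rightarrow> nat) \<Rightarrow> nat \<Rightarrow> nat \<Rightarrow> ('d::finite \<Rightarrow> int) \<Rightarrow> real" where
  "box_mult w n l k = (\<Prod>i\<in>UNIV. freq_cutoff w n l (k i))"

lemma box_mult_bounds: "0 \<le> box_mult w n l k" "box_mult w n l k \<le> 1"
  unfolding box_mult_def by (auto intro!: prod_nonneg prod_le_1 simp: freq_cutoff_bounds)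

lemma box_mult_eq_1: "k \<in> freq_box (2 ^ l) \<Longrightarrow> box_mult w n l k = 1"
  unfolding box_mult_def by (intro prod.neutral ballI freq_cutoff_eq_1) (simp add: freq_box_iff)

lemma box_mult_eq_0: "k \<notin> freq_box (5 * 2 ^ l) \<Longrightarrow> box_mult w n l k = 0"
  unfolding box_mult_def by (rule prod_zero) (auto simp: freq_box_iff not_le intro: freq_cutoff_eq_0)

definition trig_approx :: "(nat \<Rightarrow> nat) \<Rightarrow> nat \<Rightarrow> real \<Rightarrow> nat \<Rightarrow> (real^'d::finite \<Rightarrow> complex) \<Rightarrow> real^'d \<Rightarrow> complex" where
  "trig_approx w n \<tau> l g = trig_sum (5 * 2 ^ l) \<tau> (\<lambda>k. of_real (box_mult w n l k) * fourier_coeff \<tau> g k)"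

text \<open>The convolution kernel belonging to the product multiplier, differentiated \<alpha>
  times, without the normalizing power of \<tau> / (2 * pi). It factors over the coordinates because
  the multiplier does.\<close>

definition trig_kernel :: "real \<Rightarrow> nat \<Rightarrow> (int \<Rightarrow> real) \<Rightarrow> 'd::finite multi_index \<Rightarrow> real^'d \<Rightarrow> complex" where
  "trig_kernel \<tau> B \<psi> \<alpha> z = (\<Prod>i\<in>UNIV. of_real \<tau> ^ \<alpha> i * mult_sum_deriv B \<psi> (\<alpha> i) (of_real (\<tau> * z $ i)))"

lemma trig_kernel_expand:
  "trig_kernel \<tau> B \<psi> \<alpha> z = (\<Sum>k\<in>freq_box B. of_real (\<Prod>i\<in>UNIV. \<psi> (k i)) * (\<Prod>i\<in>UNIV. (\<i> * of_real \<tau> * of_int (k i)) ^ \<alpha> i) * wave \<tau> k z)"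
proof -
  have "trig_kernel \<tau> B \<psi> \<alpha> z = (\<Prod>i\<in>UNIV. \<Sum>k\<in>{-int B..int B}.
      of_real (\<psi> k) * (\<i> * of_real \<tau> * of_int k) ^ \<alpha> i * exp (\<i> * of_int k * of_real (\<tau> * z $ i)))"
    unfolding trig_kernel_def mult_sum_deriv_def by (simp add: sum_distrib_left power_mult_distrib mult_ac)
  also have "\<dots> = (\<Sum>k\<in>freq_box B. \<Prod>i\<in>UNIV.
      of_real (\<psi> (k i)) * (\<i> * of_real \<tau> * of_int (k i)) ^ \<alpha> i * exp (\<i> * of_int (k i) * of_real (\<tau> * z $ i)))"
    unfolding freq_box_def by (rule prod_sum_PiE) auto
  finally show ?thesis by (simp add: prod.distrib wave_prod)
qed

lemma mderiv_tri_ck: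
  fixes g :: "real^'d::finite \<Rightarrow> complex"
  assumes "integrable lborel g"
  shows "mderiv \<alpha> (trig_sum B \<tau> (\<lambda>k. of_real (\<Prod>i\<in>UNIV. \<psi> (k i)) * fourier_coeff \<tau> g k)) x
      = of_real ((\<tau> / (2 * pi)) ^ CARD('d)) * (LINT y|lborel. g y * trig_kernel \<tau> B \<psi> \<alpha> (x - y))"
proof -
  let ?c = "complex_of_real ((\<tau> / (2 * pi)) ^ CARD('d))"
  let ?a = "\<lambda>k. of_real (\<Prod>i\<in>UNIV. \<psi> (k i)) * (\<Prod>i\<in>UNIV. (\<i> * of_real \<tau> * of_int (k i)) ^ \<alpha> i) * wave \<tau> k x"
  have "(LINT y|lborel. g y * trig_kernel \<tau> B \<psi> \<alpha> (x - y)) = (LINT y|lborel. (\<Sum>k\<in>freq_box B. ?a k * (g y * wave \<tau> k (- y))))"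
    unfolding trig_kernel_expand diff_conv_add_uminus wave_add by (simp add: sum_distrib_left mult_ac)
  also have "\<dots> = (\<Sum>k\<in>freq_box B. ?a k * (LINT y|lborel. g y * wave \<tau> k (- y)))"
    by (subst Bochner_Integration.integral_sum) (auto intro!: integrable_mult_right integrable_ee assms)
  finally have I: "(LINT y|lborel. g y * trig_kernel \<tau> B \<psi> \<alpha> (x - y)) = (\<Sum>k\<in>freq_box B. ?a k * (LINT y|lborel. g y * wave \<tau> k (- y)))" .
  show ?thesis unfolding I mderiv_tri unfolding trig_sum_def fourier_coeff_def sum_distrib_left
    by (intro sum.cong) (simp_all only: mult_ac)
qed

lemma prod_fact_le: "finite A \<Longrightarrow> (\<Prod>i\<in>A. fact (\<alpha> i) :: real) \<le> fact (\<Sum>i\<in>A. \<alpha> i)"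
proof (induction A rule: finite_induct)
  case (insert a A)
  have "(fact (\<alpha> a) * fact (sum \<alpha> A) :: nat) \<le> fact (\<alpha> a + sum \<alpha> A)"
    by (intro dvd_imp_le fact_fact_dvd_fact) simp
  then have "real (fact (\<alpha> a) * fact (sum \<alpha> A)) \<le> real (fact (\<alpha> a + sum \<alpha> A))"
    by (simp only: of_nat_le_iff)
  then have "(fact (\<alpha> a) :: real) * fact (sum \<alpha> A) \<le> fact (\<alpha> a + sum \<alpha> A)" by simp
  moreover have "(fact (\<alpha> a) :: real) * (\<Prod>i\<in>A. fact (\<alpha> i)) \<le> fact (\<alpha> a) * fact (sum \<alpha> A)"
    by (rule mult_left_mono[OF insert.IH]) simp
  ultimately have "(fact (\<alpha> a) :: real) * (\<Prod>i\<in>A. fact (\<alpha> i)) \<le> fact (\<alpha> a + sum \<alpha> A)"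
    by linarith
  then show ?case using insert(1,2) by simp
qed simp

lemma real_div_le: "real a / real b \<le> real (a div b) + 1"
proof (cases "b = 0")
  case False
  have "a = b * (a div b) + a mod b" by simp
  then have "real a = real b * real (a div b) + real (a mod b)"
    by (metis of_nat_add of_nat_mult)
  moreover have "real (a mod b) \<le> real b" using False by (simp add: less_imp_le)
  ultimately have "real a \<le> real b * (real (a div b) + 1)" by (simp add: algebra_simps)
  then show ?thesis using False by (simp add: divide_le_eq mult.commute)
qed simp

text \<open>One coordinate of size \<delta> suffices: its factor contributes exp (- N), where N
  counts the averages of width \<open>w m\<close>. Against this stands the growth in the Cauchy
  discs of all coordinates, and the radius is chosen so that the growth uses up about half of the
  decay.\<close>

lemma trig_kernel_tail:
  fixes z :: "real^'d::finite"
  assumes \<tau>: "0 < \<tau>" and w: "1 \<le> w m" "real (w m) * (\<tau> * \<delta>) \<ge> 96" and \<delta>: "0 < \<delta>" and m: "m \<le> n"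
    and z: "\<And>i. \<bar>\<tau> * z $ i\<bar> \<le> 1/4" "\<delta> \<le> \<bar>z $ i0\<bar>"
  shows "cmod (trig_kernel \<tau> (5 * 2 ^ l) (freq_cutoff w n l) \<alpha> z) \<le>
    (7 * 2 ^ l) ^ CARD('d) * (3 * exp (- (2 ^ l / (2 ^ (m + 2) * real (w m))))) *
    (fact (mi_abs \<alpha>) * (\<tau> * (2 ^ (m + 2) * real (w m) * (5 * real CARD('d)))) ^ mi_abs \<alpha>)"
proof -
  define d where "d = real CARD('d)"
  define \<kappa> where "\<kappa> = 1 / (2 ^ (m + 2) * real (w m))"
  \<comment> \<open>With this radius the growth exp (5 * 2 ^ l * r) of all d coordinates multiplies
    to exp (\<kappa> * 2 ^ l).\<close>
  define r where "r = \<kappa> / (5 * d)"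
  define N where "N = count_list (2 ^ l # avg_widths w (Suc n) l) (w m)"
  have d1: "d \<ge> 1" unfolding d_def by simp
  have w1: "real (w m) \<ge> 1" using w(1) by simp
  have \<kappa>0: "\<kappa> > 0" unfolding \<kappa>_def using w1 by simp
  have r0: "r > 0" unfolding r_def using \<kappa>0 d1 by simp
  have "1 * real (w m) \<le> 2 ^ (m + 2) * real (w m)"
    by (intro mult_right_mono one_le_power) auto
  then have "\<kappa> \<le> 1 / real (w m)"
    unfolding \<kappa>_def using w1 by (intro divide_left_mono) auto
  moreover have "r \<le> \<kappa> / 5"
    unfolding r_def using \<kappa>0 d1 by (intro divide_left_mono) auto
  ultimately have r_le: "r \<le> 1 / (5 * real (w m))" by simp
  have "1 / (5 * real (w m)) \<le> 1/5"
    using w1 by (simp add: divide_le_eq)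
  then have r4: "r \<le> 1/4" using r_le by linarith
  have "1 / real (w m) \<le> \<tau> * \<delta> / 96"
    using w(2) w1 by (simp add: field_simps)
  then have r\<sigma>: "r \<le> \<tau> * \<delta> / 2" proof -
    have "1 / (5 * real (w m)) = 1 / real (w m) / 5" by simp
    moreover have "\<tau> * \<delta> > 0" using \<tau> \<delta> by simp
    ultimately show ?thesis using r_le \<open>1 / real (w m) \<le> \<tau> * \<delta> / 96\<close> by linarith
  qed
  have B: "3 * 2 ^ l + sum_list (2 ^ l # avg_widths w (Suc n) l) \<le> 5 * 2 ^ l"
    using sum_list_wsum[of w "Suc n" l] by simp
  define E where "E = exp (5 * 2 ^ l * r)"
  have le7: "2 * real (3 * 2 ^ l) + 1 \<le> 7 * 2 ^ l"
    using one_le_power[of "2::real" l] by simp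
  have eE: "exp (real (3 * 2 ^ l + sum_list (2 ^ l # avg_widths w (Suc n) l)) * r) \<le> E"
  proof -
    have "real (3 * 2 ^ l + sum_list (2 ^ l # avg_widths w (Suc n) l)) \<le> real (5 * 2 ^ l)"
      using B by (simp only: of_nat_le_iff)
    then show ?thesis unfolding E_def using r0 by (simp add: mult_right_mono)
  qed
  \<comment> \<open>The decay is twice the growth up to the rounding in \<open>div\<close>, which
    loses at most one repetition and later appears as the factor 3 \<ge> e.\<close>
  have N: "real N \<ge> 2 * (\<kappa> * 2 ^ l) - 1"
  proof -
    have "2 ^ l div (2 ^ Suc m * w m) \<le> N"
      using count_list_wsum[of m "Suc n" l w] m unfolding N_def by (auto intro: le_SucI)
    then have "real (2 ^ l div (2 ^ Suc m * w m)) \<le> real N" by simp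
    moreover have "real (2 ^ l) / real (2 ^ Suc m * w m) \<le> real (2 ^ l div (2 ^ Suc m * w m)) + 1"
      using real_div_le[of "2 ^ l" "2 ^ Suc m * w m"] by linarith
    moreover have "real (2 ^ l) / real (2 ^ Suc m * w m) = 2 * (\<kappa> * 2 ^ l)"
      unfolding \<kappa>_def using w1 by simp
    ultimately show ?thesis by linarith
  qed
  have each: "cmod (of_real \<tau> ^ \<alpha> i * mult_sum_deriv (5 * 2 ^ l) (freq_cutoff w n l) (\<alpha> i) (of_real (\<tau> * z $ i)))
      \<le> (7 * 2 ^ l * E) * fact (\<alpha> i) * (\<tau> / r) ^ \<alpha> i * (if i = i0 then exp (- real N) else 1)" for i
  proof -
    have "cmod (mult_sum_deriv (5 * 2 ^ l) (freq_cutoff w n l) (\<alpha> i) (of_real (\<tau> * z $ i)))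
        \<le> fact (\<alpha> i) * ((7 * 2 ^ l) * (E * (if i = i0 then exp (- real N) else 1))) / r ^ \<alpha> i"
    proof (cases "i = i0")
      case True
      have "\<tau> * \<delta> \<le> \<bar>\<tau> * z $ i\<bar>" using z(2) \<tau> True by (simp add: abs_mult)
      then have "cmod (mult_sum_deriv (5 * 2 ^ l) (freq_cutoff w n l) (\<alpha> i) (of_real (\<tau> * z $ i)))
        \<le> fact (\<alpha> i) * ((2 * real (3 * 2 ^ l) + 1) * exp (real (3 * 2 ^ l + sum_list (2 ^ l # avg_widths w (Suc n) l)) * r - real N)) / r ^ \<alpha> i"
        unfolding freq_cutoff_def N_def
        by (intro mult_sum_deriv_le_tail[OF B r0 r4 r\<sigma> z(1) _ _ w(2)]) (use \<tau> \<delta> in auto)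
      also have "\<dots> \<le> fact (\<alpha> i) * ((7 * 2 ^ l) * (E * exp (- real N))) / r ^ \<alpha> i"
        unfolding diff_conv_add_uminus exp_add
        by (intro divide_right_mono mult_left_mono mult_mono mult_right_mono le7 eE) (use r0 in \<open>auto simp: E_def\<close>)
      finally show ?thesis using True by simp
    next
      case False
      have "cmod (mult_sum_deriv (5 * 2 ^ l) (freq_cutoff w n l) (\<alpha> i) (of_real (\<tau> * z $ i)))
        \<le> fact (\<alpha> i) * ((2 * real (3 * 2 ^ l) + 1) * exp (real (3 * 2 ^ l + sum_list (2 ^ l # avg_widths w (Suc n) l)) * r)) / r ^ \<alpha> i"
        unfolding freq_cutoff_def by (rule mult_sum_deriv_le_trivial[OF B r0])
      also have "\<dots> \<le> fact (\<alpha> i) * ((7 * 2 ^ l) * E) / r ^ \<alpha> i"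
        by (intro divide_right_mono mult_left_mono mult_mono le7 eE) (use r0 in \<open>auto simp: E_def\<close>)
      finally show ?thesis using False by simp
    qed
    then have "\<tau> ^ \<alpha> i * cmod (mult_sum_deriv (5 * 2 ^ l) (freq_cutoff w n l) (\<alpha> i) (of_real (\<tau> * z $ i)))
        \<le> \<tau> ^ \<alpha> i * (fact (\<alpha> i) * ((7 * 2 ^ l) * (E * (if i = i0 then exp (- real N) else 1))) / r ^ \<alpha> i)"
      using \<tau> by (intro mult_left_mono) auto
    then show ?thesis
      using \<tau> by (simp add: norm_mult norm_power power_divide mult_ac)
  qed
  have "cmod (trig_kernel \<tau> (5 * 2 ^ l) (freq_cutoff w n l) \<alpha> z)
      \<le> (\<Prod>i\<in>UNIV. (7 * 2 ^ l * E) * fact (\<alpha> i) * (\<tau> / r) ^ \<alpha> i * (if i = i0 then exp (- real N) else 1))"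
    unfolding trig_kernel_def prod_norm[symmetric] by (intro prod_mono conjI each) auto
  also have "\<dots> = (7 * 2 ^ l) ^ CARD('d) * (E ^ CARD('d) * exp (- real N)) * ((\<Prod>i\<in>UNIV. fact (\<alpha> i)) * (\<tau> / r) ^ mi_abs \<alpha>)"
    by (simp add: prod.distrib power_mult_distrib mi_abs_def power_sum)
  also have "\<dots> \<le> (7 * 2 ^ l) ^ CARD('d) * (3 * exp (- (\<kappa> * 2 ^ l))) * (fact (mi_abs \<alpha>) * (\<tau> / r) ^ mi_abs \<alpha>)"
  proof -
    have "E ^ CARD('d) * exp (- real N) = exp (\<kappa> * 2 ^ l - real N)"
    proof -
      have "E ^ CARD('d) = exp (\<kappa> * 2 ^ l)"
        unfolding E_def exp_of_nat_mult[symmetric] d_def[symmetric] r_def using d1 by (simp add: d_def[symmetric])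
      then show ?thesis by (simp add: exp_diff exp_minus field_simps)
    qed
    also have "\<dots> \<le> exp (1 + - (\<kappa> * 2 ^ l))" using N by simp
    also have "\<dots> \<le> 3 * exp (- (\<kappa> * 2 ^ l))"
      unfolding exp_add using exp_le by simp
    finally have 1: "E ^ CARD('d) * exp (- real N) \<le> 3 * exp (- (\<kappa> * 2 ^ l))" .
    have 2: "(\<Prod>i\<in>UNIV. fact (\<alpha> i)) \<le> (fact (mi_abs \<alpha>) :: real)"
      unfolding mi_abs_def by (rule prod_fact_le) simp
    show ?thesis
      by (rule mult_mono[OF mult_left_mono[OF 1] mult_right_mono[OF 2]])
        (use \<tau> r0 in \<open>auto intro!: prod_nonneg mult_nonneg_nonneg\<close>)
  qed
  finally have fin: "cmod (trig_kernel \<tau> (5 * 2 ^ l) (freq_cutoff w n l) \<alpha> z) \<le>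
      (7 * 2 ^ l) ^ CARD('d) * (3 * exp (- (\<kappa> * 2 ^ l))) * (fact (mi_abs \<alpha>) * (\<tau> / r) ^ mi_abs \<alpha>)" .
  have "\<tau> / r = \<tau> * (2 ^ (m + 2) * real (w m) * (5 * real CARD('d)))"
    unfolding r_def \<kappa>_def d_def using w1 by simp
  moreover have "\<kappa> * 2 ^ l = 2 ^ l / (2 ^ (m + 2) * real (w m))"
    unfolding \<kappa>_def by simp
  ultimately show ?thesis using fin by (simp only:)
qed

lemma power_le_fact_exp:
  fixes x :: real assumes "x \<ge> 0" shows "x ^ n \<le> fact n * exp x"
proof -
  have "(\<Sum>k\<in>{n}. x ^ k /\<^sub>R fact k) \<le> (\<Sum>k. x ^ k /\<^sub>R fact k)"
    by (rule sum_le_suminf) (use assms summable_exp_generic[of x] in auto)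
  then show ?thesis by (simp add: exp_def field_simps)
qed

text \<open>The exponential beats the power d + 1 of 2 ^ l, one more than the prefactor contains;
  the surplus is the denominator 2 ^ l.\<close>

lemma poly_exp_decay:
  fixes \<kappa> :: real
  assumes "\<kappa> > 0"
  shows "\<exists>C\<ge>0. \<forall>l. (7 * 2 ^ l) ^ d * (3 * exp (- (2 ^ l / \<kappa>))) \<le> C / 2 ^ (l::nat)"
proof -
  define C where "C = 7 ^ d * 3 * (\<kappa> ^ Suc d * fact (Suc d))"
  have "(7 * 2 ^ l) ^ d * (3 * exp (- (2 ^ l / \<kappa>))) \<le> C / 2 ^ l" for l :: nat
  proof -
    define x :: real where "x = 2 ^ l"
    have x: "x > 0" by (simp add: x_def)
    have "(x / \<kappa>) ^ Suc d \<le> fact (Suc d) * exp (x / \<kappa>)"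
      using x assms by (intro power_le_fact_exp) simp
    then have "(x / \<kappa>) ^ Suc d * exp (- (x / \<kappa>)) \<le> fact (Suc d) * exp (x / \<kappa>) * exp (- (x / \<kappa>))"
      by (rule mult_right_mono) simp
    then have "(x / \<kappa>) ^ Suc d * exp (- (x / \<kappa>)) \<le> fact (Suc d)"
      by (simp only: mult.assoc exp_minus_inverse mult_1_right)
    then have "\<kappa> ^ Suc d * ((x / \<kappa>) ^ Suc d * exp (- (x / \<kappa>))) \<le> \<kappa> ^ Suc d * fact (Suc d)"
      using assms by (intro mult_left_mono) auto
    then have "x ^ Suc d * exp (- (x / \<kappa>)) \<le> \<kappa> ^ Suc d * fact (Suc d)"
      using assms by (simp add: power_divide)
    then have "7 ^ d * 3 * (x ^ Suc d * exp (- (x / \<kappa>))) \<le> C"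
      unfolding C_def by (intro mult_left_mono) auto
    then have "(7 * x) ^ d * (3 * exp (- (x / \<kappa>))) * x \<le> C"
      by (simp add: power_mult_distrib mult_ac)
    then show ?thesis using x unfolding x_def[symmetric] by (simp add: le_divide_eq)
  qed
  moreover have "C \<ge> 0" unfolding C_def using assms by simp
  ultimately show ?thesis by blast
qed

lemma mderiv_tri_shift:
  "mderiv \<alpha> (trig_sum B \<tau> (\<lambda>k. of_real (\<Prod>i\<in>UNIV. \<psi> (k i)) * wave \<tau> k (- y))) x = trig_kernel \<tau> B \<psi> \<alpha> (x - y)"
  unfolding trig_kernel_expand mderiv_tri diff_conv_add_uminus wave_add unfolding trig_sum_def
  by (intro sum.cong) (simp_all only: mult_ac)

text \<open>The width only just reaches the threshold of the tail estimate, so \<tau> * w m is at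
  most 97 / \<delta>. Therefore the admissible rate \<open>h\<close> does not involve \<tau>; only
  the constant C does.\<close>

lemma trig_kernel_tail_M:
  fixes M :: "nat \<Rightarrow> real"
  assumes \<tau>: "0 < \<tau>" and \<delta>: "0 < \<delta>" "\<tau> * \<delta> \<le> 1" and w: "w m = nat \<lceil>96 / (\<tau> * \<delta>)\<rceil>" and m: "m \<le> n"
    and M: "\<And>p. M p > 0" "\<And>p. fact p \<le> C0 * H0 ^ p * M p" "C0 > 0" "H0 > 0"
    and h: "H0 * (2 ^ (m + 2) * 97 * (5 * real CARD('d)) / \<delta>) \<le> h"
  shows "\<exists>C\<ge>0. \<forall>l \<alpha>. \<forall>z::real^'d::finite. (\<forall>i. \<bar>\<tau> * z $ i\<bar> \<le> 1/4) \<longrightarrow> (\<exists>i. \<delta> \<le> \<bar>z $ i\<bar>) \<longrightarrow>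
    cmod (trig_kernel \<tau> (5 * 2 ^ l) (freq_cutoff w n l) \<alpha> z) \<le> C / 2 ^ l * (h ^ mi_abs \<alpha> * M (mi_abs \<alpha>))"
proof -
  have pos: "\<tau> * \<delta> > 0" using \<tau> \<delta> by simp
  have "96 / (\<tau> * \<delta>) \<ge> 96" using pos \<delta>(2) by (simp add: le_divide_eq)
  then have w96: "real (w m) \<ge> 96 / (\<tau> * \<delta>)" and w1: "w m \<ge> 1" and wle: "real (w m) \<le> 96 / (\<tau> * \<delta>) + 1"
    unfolding w by linarith+
  have "1 \<le> 1 / (\<tau> * \<delta>)" using pos \<delta>(2) by (simp add: le_divide_eq)
  then have w97: "real (w m) \<le> 97 / (\<tau> * \<delta>)"
  proof -
    have "real (w m) \<le> 96 / (\<tau> * \<delta>) + 1 / (\<tau> * \<delta>)"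
      by (rule order_trans[OF wle add_left_mono]) fact
    then show ?thesis by (simp add: add_divide_distrib[symmetric])
  qed
  have \<kappa>: "2 ^ (m + 2) * real (w m) > 0" using w1 by simp
  obtain C where C: "C \<ge> 0" "\<And>l::nat. (7 * 2 ^ l) ^ CARD('d) * (3 * exp (- (2 ^ l / (2 ^ (m + 2) * real (w m))))) \<le> C / 2 ^ l"
    using poly_exp_decay[OF \<kappa>, of "CARD('d)"] by blast
  have "cmod (trig_kernel \<tau> (5 * 2 ^ l) (freq_cutoff w n l) \<alpha> z) \<le> C * C0 / 2 ^ l * (h ^ mi_abs \<alpha> * M (mi_abs \<alpha>))"
    if z: "\<And>i. \<bar>\<tau> * z $ i\<bar> \<le> 1/4" "\<delta> \<le> \<bar>z $ i0\<bar>" for l \<alpha> i0 and z :: "real^'d"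
  proof -
    define a where "a = mi_abs \<alpha>"
    define t where "t = \<tau> * (2 ^ (m + 2) * real (w m) * (5 * real CARD('d)))"
    have t0: "t \<ge> 0" unfolding t_def using \<tau> by simp
    have "t \<le> \<tau> * (2 ^ (m + 2) * (97 / (\<tau> * \<delta>)) * (5 * real CARD('d)))"
      unfolding t_def using \<tau> w97 by (intro mult_left_mono mult_right_mono) auto
    also have "\<dots> = 2 ^ (m + 2) * 97 * (5 * real CARD('d)) / \<delta>"
      using \<tau> by simp
    finally have "H0 * t \<le> h" using h M(4) by (meson mult_left_mono less_imp_le order_trans)
    then have ht: "(H0 * t) ^ a \<le> h ^ a" using t0 M(4) by (intro power_mono) auto
    have "96 \<le> real (w m) * (\<tau> * \<delta>)" using w96 pos by (simp add: divide_le_eq)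
    from trig_kernel_tail[where w=w and m=m and n=n and z=z and l=l and \<alpha>=\<alpha>, OF \<tau> w1 this \<delta>(1) m z]
    have "cmod (trig_kernel \<tau> (5 * 2 ^ l) (freq_cutoff w n l) \<alpha> z)
        \<le> (7 * 2 ^ l) ^ CARD('d) * (3 * exp (- (2 ^ l / (2 ^ (m + 2) * real (w m))))) * (fact a * t ^ a)"
      unfolding a_def t_def .
    also have "\<dots> \<le> C / 2 ^ l * ((C0 * H0 ^ a * M a) * t ^ a)"
      by (intro mult_mono C(2) mult_right_mono M(2)) (use C(1) t0 in auto)
    also have "\<dots> = C * C0 / 2 ^ l * ((H0 * t) ^ a * M a)"
      by (simp add: power_mult_distrib)
    also have "\<dots> \<le> C * C0 / 2 ^ l * (h ^ a * M a)"
      using C(1) M(1)[of a] M(3) by (intro mult_left_mono mult_right_mono ht) auto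
    finally show ?thesis unfolding a_def .
  qed
  then show ?thesis using C(1) M(3) by (intro exI[of _ "C * C0"]) auto
qed

lemma mderiv_0 [simp]: "mderiv (\<lambda>i. 0) f = (f :: real^'d::finite \<Rightarrow> complex)"
proof -
  have "mderiv (pure undefined 0) f = f" by (simp add: mderiv_pure)
  moreover have "pure (undefined :: 'd) 0 = (\<lambda>i. 0)" by (auto simp: pure_def)
  ultimately show ?thesis by simp
qed

lemma mderiv_Top:
  fixes g :: "real^'d::finite \<Rightarrow> complex"
  assumes "integrable lborel g"
  shows "mderiv \<alpha> (trig_approx w n \<tau> l g) x
    = of_real ((\<tau> / (2 * pi)) ^ CARD('d)) * (LINT y|lborel. g y * trig_kernel \<tau> (5 * 2 ^ l) (freq_cutoff w n l) \<alpha> (x - y))"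
  unfolding trig_approx_def box_mult_def by (rule mderiv_tri_ck[OF assms])

lemma trig_approx_tail:
  fixes g :: "real^'d::finite \<Rightarrow> complex"
  assumes g: "integrable lborel g" and \<tau>: "\<tau> > 0" and b: "b \<ge> 0"
    and K: "\<And>y. g y \<noteq> 0 \<Longrightarrow> cmod (trig_kernel \<tau> (5 * 2 ^ l) (freq_cutoff w n l) \<alpha> (x - y)) \<le> b"
  shows "cmod (mderiv \<alpha> (trig_approx w n \<tau> l g) x) \<le> (\<tau> / (2 * pi)) ^ CARD('d) * ((LINT y|lborel. cmod (g y)) * b)"
proof -
  have "cmod (LINT y|lborel. g y * trig_kernel \<tau> (5 * 2 ^ l) (freq_cutoff w n l) \<alpha> (x - y)) \<le> (LINT y|lborel. cmod (g y) * b)"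
  proof (rule order_trans[OF integral_norm_bound integral_mono'])
    show "integrable lborel (\<lambda>y. cmod (g y) * b)" using g by auto
    show "cmod (g y * trig_kernel \<tau> (5 * 2 ^ l) (freq_cutoff w n l) \<alpha> (x - y)) \<le> cmod (g y) * b" for y
      by (cases "g y = 0") (simp_all add: norm_mult K mult_left_mono)
  qed (use b in simp)
  then show ?thesis
    unfolding mderiv_Top[OF g] norm_mult norm_of_real using \<tau> by (simp add: mult_left_mono)
qed


subsection \<open>Pointwise convergence\<close>

lemma integral_reflect:
  fixes f :: "'a::euclidean_space \<Rightarrow> 'b::{banach,second_countable_topology}"
  assumes "f \<in> borel_measurable borel"
  shows "(LINT z|lborel. f (x - z)) = (LINT y|lborel. f y)"
proof -
  have "lborel = density (distr lborel borel (\<lambda>z. x + (-1) *\<^sub>R z)) (\<lambda>_. \<bar>-1 :: real\<bar> ^ DIM('a))"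
    by (rule lborel_affine) simp
  then have "lborel = distr lborel borel (\<lambda>z::'a. x + (-1) *\<^sub>R z)" by (simp add: density_1)
  then have "(LINT y|lborel. f y) = (LINT y|distr lborel borel (\<lambda>z::'a. x + (-1) *\<^sub>R z). f y)" by simp
  also have "\<dots> = (LINT z|lborel. f (x - z))"
    by (subst integral_distr) (use assms in auto)
  finally show ?thesis ..
qed

lemma integral_exp_period:
  assumes "\<tau> > 0"
  shows "(LINT t|lborel. indicator {-pi/\<tau>..pi/\<tau>} t *\<^sub>R exp (\<i> * of_int k * of_real (\<tau> * t)))
    = (if k = 0 then complex_of_real (2 * pi / \<tau>) else 0)"
proof -
  have le: "-pi/\<tau> \<le> pi/\<tau>" using assms by (simp add: divide_right_mono)
  show ?thesis
  proof (cases "k = 0")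
    case True
    have "(LINT t|lborel. indicator {-pi/\<tau>..pi/\<tau>} t *\<^sub>R (1::complex)) = of_real (pi/\<tau>) - of_real (-pi/\<tau>)"
      by (rule integral_FTC_atLeastAtMost[OF le])
        (auto intro!: derivative_eq_intros simp: has_vector_derivative_def scaleR_conv_of_real)
    then show ?thesis using True by simp
  next
    case False
    let ?c = "\<i> * of_int k * of_real \<tau> :: complex"
    let ?F = "\<lambda>t::real. exp (?c * of_real t) / ?c"
    have c: "?c \<noteq> 0" using False assms by simp
    have "(LINT t|lborel. indicator {-pi/\<tau>..pi/\<tau>} t *\<^sub>R exp (?c * of_real t)) = ?F (pi/\<tau>) - ?F (-pi/\<tau>)"
    proof (rule integral_FTC_atLeastAtMost[OF le])
      fix t
      have "((\<lambda>z. exp (?c * z) / ?c) has_field_derivative exp (?c * of_real t)) (at (of_real t))"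
        using c by (auto intro!: derivative_eq_intros)
      then show "(?F has_vector_derivative exp (?c * of_real t)) (at t within {-pi/\<tau>..pi/\<tau>})"
        by (intro has_vector_derivative_real_field[THEN has_vector_derivative_at_within])
    qed (intro continuous_intros)
    moreover have "?F (pi/\<tau>) = ?F (-pi/\<tau>)"
    proof -
      have "?c * of_real (pi/\<tau>) = \<i> * of_real (real_of_int k * pi)"
        "?c * of_real (-pi/\<tau>) = - (\<i> * of_real (real_of_int k * pi))"
        using assms by (simp_all add: field_simps)
      moreover have "exp (\<i> * complex_of_real (real_of_int k * pi)) = exp (- (\<i> * complex_of_real (real_of_int k * pi)))"
      proof -
        have "sin (real_of_int k * pi) = 0" unfolding sin_zero_iff_int2 by blast
        moreover have "exp (\<i> * complex_of_real (real_of_int k * pi)) = cis (real_of_int k * pi)"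
          "exp (- (\<i> * complex_of_real (real_of_int k * pi))) = cis (- (real_of_int k * pi))"
          by (simp_all add: cis_conv_exp)
        ultimately show ?thesis by (simp add: complex_eq_iff)
      qed
      ultimately show ?thesis by simp
    qed
    ultimately have "(LINT t|lborel. indicator {-pi/\<tau>..pi/\<tau>} t *\<^sub>R exp (?c * of_real t)) = 0" by simp
    then show ?thesis using False by (simp add: mult_ac)
  qed
qed

lemma integral_tp_period:
  assumes "\<tau> > 0"
  shows "(LINT t|lborel. indicator {-pi/\<tau>..pi/\<tau>} t *\<^sub>R mult_sum B \<psi> (of_real (\<tau> * t))) = of_real (2 * pi / \<tau> * \<psi> 0)"
proof -
  have i: "integrable lborel (\<lambda>t. indicator {-pi/\<tau>..pi/\<tau>} t *\<^sub>R exp (\<i> * of_int k * of_real (\<tau> * t)))" for k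
    by (intro borel_integrable_compact continuous_intros) simp
  have "(LINT t|lborel. indicator {-pi/\<tau>..pi/\<tau>} t *\<^sub>R mult_sum B \<psi> (of_real (\<tau> * t)))
      = (LINT t|lborel. (\<Sum>k\<in>{-int B..int B}. of_real (\<psi> k) * (indicator {-pi/\<tau>..pi/\<tau>} t *\<^sub>R exp (\<i> * of_int k * of_real (\<tau> * t)))))"
    by (simp add: mult_sum_deriv_def scaleR_sum_right)
  also have "\<dots> = (\<Sum>k\<in>{-int B..int B}. of_real (\<psi> k) * (if k = 0 then complex_of_real (2 * pi / \<tau>) else 0))"
    by (subst Bochner_Integration.integral_sum[OF integrable_mult_right[OF i]])
      (simp only: integral_mult_right_zero integral_exp_period[OF assms])
  also have "\<dots> = of_real (2 * pi / \<tau> * \<psi> 0)"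
    by (subst sum.remove[of _ 0]) auto
  finally show ?thesis .
qed

text \<open>The mass is computed with arctan as primitive. For the second moment, the integrand is
  at most 1 / (L * \<tau> ^ 2) pointwise, so it decreases like 1 / L while the mass stays
  bounded.\<close>

lemma integral_lorentz:
  fixes L :: real
  assumes "\<tau> > 0" "L > 0"
  shows "integrable lborel (\<lambda>t. indicator {-pi/\<tau>..pi/\<tau>} t *\<^sub>R (L / (1 + (L * (\<tau> * t))\<^sup>2)))"
    and "(LINT t|lborel. indicator {-pi/\<tau>..pi/\<tau>} t *\<^sub>R (L / (1 + (L * (\<tau> * t))\<^sup>2))) \<le> pi / \<tau>"
    and "integrable lborel (\<lambda>t. t\<^sup>2 * (indicator {-pi/\<tau>..pi/\<tau>} t *\<^sub>R (L / (1 + (L * (\<tau> * t))\<^sup>2))))"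
    and "(LINT t|lborel. t\<^sup>2 * (indicator {-pi/\<tau>..pi/\<tau>} t *\<^sub>R (L / (1 + (L * (\<tau> * t))\<^sup>2)))) \<le> 2 * pi / \<tau> ^ 3 / L"
proof -
  let ?f = "\<lambda>t. L / (1 + (L * (\<tau> * t))\<^sup>2)"
  have nz: "1 + (L * (\<tau> * t))\<^sup>2 \<noteq> 0" for t by (simp add: add_pos_nonneg less_imp_neq[symmetric])
  have nz': "1 + (L * (\<tau> * t))\<^sup>2 > 0" for t by (simp add: add_pos_nonneg)
  have le: "-pi/\<tau> \<le> pi/\<tau>" using assms by (simp add: divide_right_mono)
  have c: "continuous_on S ?f" for S by (intro continuous_intros) (use nz in auto)
  show "integrable lborel (\<lambda>t. indicator {-pi/\<tau>..pi/\<tau>} t *\<^sub>R ?f t)"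
    by (intro borel_integrable_compact c) simp
  have e: "(\<lambda>t. t\<^sup>2 * (indicator {-pi/\<tau>..pi/\<tau>} t *\<^sub>R ?f t)) = (\<lambda>t. indicator {-pi/\<tau>..pi/\<tau>} t *\<^sub>R (t\<^sup>2 * ?f t))"
    by (auto simp: fun_eq_iff)
  show i2: "integrable lborel (\<lambda>t. t\<^sup>2 * (indicator {-pi/\<tau>..pi/\<tau>} t *\<^sub>R ?f t))"
    unfolding e by (intro borel_integrable_compact continuous_intros c) (use nz in auto)
  have "(LINT t|lborel. indicator {-pi/\<tau>..pi/\<tau>} t *\<^sub>R ?f t) = arctan (L * (\<tau> * (pi/\<tau>))) / \<tau> - arctan (L * (\<tau> * (-pi/\<tau>))) / \<tau>"
  proof (rule integral_FTC_atLeastAtMost[OF le _ c])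
    fix t
    have "((\<lambda>t. arctan (L * (\<tau> * t)) / \<tau>) has_real_derivative ?f t) (at t)"
      using assms nz[of t] by (auto intro!: derivative_eq_intros simp: divide_simps)
    then show "((\<lambda>t. arctan (L * (\<tau> * t)) / \<tau>) has_vector_derivative ?f t) (at t within {-pi/\<tau>..pi/\<tau>})"
      unfolding has_real_derivative_iff_has_vector_derivative by (rule has_vector_derivative_at_within)
  qed
  also have "\<dots> \<le> (pi/2) / \<tau> - (- (pi/2)) / \<tau>"
    using assms arctan_ubound[of "L * (\<tau> * (pi/\<tau>))"] arctan_lbound[of "L * (\<tau> * (-pi/\<tau>))"]
    by (intro diff_mono divide_right_mono) auto
  finally show "(LINT t|lborel. indicator {-pi/\<tau>..pi/\<tau>} t *\<^sub>R ?f t) \<le> pi / \<tau>" by simp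
  have "(LINT t|lborel. t\<^sup>2 * (indicator {-pi/\<tau>..pi/\<tau>} t *\<^sub>R ?f t)) \<le> (LINT t|lborel. indicator {-pi/\<tau>..pi/\<tau>} t * (1 / (L * \<tau>\<^sup>2)))"
  proof (rule integral_mono[OF i2])
    show "integrable lborel (\<lambda>t. indicator {-pi/\<tau>..pi/\<tau>} t * (1 / (L * \<tau>\<^sup>2)) :: real)"
      by (intro integrable_mult_left integrable_real_indicator)
        (use emeasure_compact_finite[of "{-pi/\<tau>..pi/\<tau>}"] in simp_all)
    fix t
    have "t\<^sup>2 * ?f t \<le> 1 / (L * \<tau>\<^sup>2)"
      using assms nz'[of t] by (simp add: divide_simps power2_eq_square mult_ac)
    then show "t\<^sup>2 * (indicator {-pi/\<tau>..pi/\<tau>} t *\<^sub>R ?f t) \<le> indicator {-pi/\<tau>..pi/\<tau>} t * (1 / (L * \<tau>\<^sup>2))"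
      by (auto simp: indicator_def)
  qed
  also have "\<dots> = (2 * pi / \<tau>) * (1 / (L * \<tau>\<^sup>2))"
    using le by (simp add: measure_def)
  also have "\<dots> = 2 * pi / \<tau> ^ 3 / L"
    by (simp add: power3_eq_cube power2_eq_square)
  finally show "(LINT t|lborel. t\<^sup>2 * (indicator {-pi/\<tau>..pi/\<tau>} t *\<^sub>R ?f t)) \<le> 2 * pi / \<tau> ^ 3 / L" .
qed

lemma continuous_KK [continuous_intros]: "continuous_on S (trig_kernel \<tau> B \<psi> \<alpha>)"
  unfolding trig_kernel_expand[abs_def] by (intro continuous_intros)

text \<open>An approximate identity without positivity: the kernel is dominated by a product of
  Lorentz profiles of uniformly bounded mass, and concentration at the origin is expressed by second
  moments of order 1 / 2 ^ l.\<close>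

lemma trig_approx_tendsto:
  fixes f :: "real^'d::finite \<Rightarrow> complex" and x :: "real^'d"
  assumes \<tau>: "\<tau> > 0" and f: "continuous_on UNIV f" and S: "compact S" "\<And>x. x \<notin> S \<Longrightarrow> f x = 0"
    and small: "\<And>(y::real^'d) i. y \<in> S \<Longrightarrow> \<bar>\<tau> * y $ i\<bar> \<le> 1/8" "\<And>i. \<bar>\<tau> * x $ i\<bar> \<le> 1/8"
  shows "(\<lambda>l. trig_approx w n \<tau> l f x) \<longlonglongrightarrow> f x"
proof -
  define J where "J = {-pi/\<tau>..pi/\<tau>}"
  define d where "d = CARD('d)"
  define c where "c = (\<tau> / (2 * pi)) ^ d"
  define u where "u l t = indicator J t *\<^sub>R mult_sum (5 * 2 ^ l) (freq_cutoff w n l) (of_real (\<tau> * t))" for l t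
  define b where "b l t = 16384 * (indicator J t *\<^sub>R (2 ^ l / (1 + (2 ^ l * (\<tau> * t))\<^sup>2)))" for l :: nat and t :: real
  define Cb where "Cb = 16384 * (pi / \<tau>)"
  define D where "D = 16384 * (2 * pi / \<tau> ^ 3)"
  have c0: "c > 0" unfolding c_def using \<tau> by simp
  have Cb0: "Cb > 0" unfolding Cb_def using \<tau> by simp
  have b0: "b l t \<ge> 0" for l t unfolding b_def by (simp add: indicator_def)
  have ub: "cmod (u l t) \<le> b l t" for l t
  proof (cases "t \<in> J")
    case True
    then have "\<bar>\<tau> * t\<bar> \<le> pi" using \<tau> by (auto simp: J_def abs_le_iff field_simps)
    moreover have "4 * 2 ^ l + sum_list (avg_widths w (Suc n) l) \<le> 5 * 2 ^ l"
      using sum_list_wsum[of w "Suc n" l] by simp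
    ultimately have "cmod (mult_sum (5 * 2 ^ l) (freq_cutoff w n l) (of_real (\<tau> * t))) \<le> 16384 * (real (2 ^ l) / (1 + (real (2 ^ l) * (\<tau> * t))\<^sup>2))"
      unfolding freq_cutoff_def by (intro mult_sum_real_le) auto
    then show ?thesis using True by (simp add: u_def b_def)
  qed (simp add: u_def b_def)
  have iu: "integrable lborel (u l)" for l
    unfolding u_def[abs_def] J_def mult_sum_deriv_def by (intro borel_integrable_compact continuous_intros) auto
  have ib: "integrable lborel (b l)" for l
    unfolding b_def[abs_def] J_def using integral_lorentz(1)[OF \<tau>, of "2 ^ l"] by (intro integrable_mult_right) auto
  have Ib: "(LINT t|lborel. b l t) \<le> Cb" for l
    unfolding b_def J_def Cb_def integral_mult_right_zero using integral_lorentz(2)[OF \<tau>, of "2 ^ l"] by simp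
  have Ib0: "(LINT t|lborel. b l t) \<ge> 0" for l by (rule integral_nonneg_AE) (simp add: b0)
  have e2: "t\<^sup>2 * b l t = 16384 * (t\<^sup>2 * (indicator {-pi/\<tau>..pi/\<tau>} t *\<^sub>R (2 ^ l / (1 + (2 ^ l * (\<tau> * t))\<^sup>2))))" for l t
    unfolding b_def J_def by simp
  have ib2: "integrable lborel (\<lambda>t. t\<^sup>2 * b l t)" for l
    unfolding e2 using integral_lorentz(3)[OF \<tau>, of "2 ^ l"] by (intro integrable_mult_right) auto
  have Ib2: "(LINT t|lborel. t\<^sup>2 * b l t) \<le> D / 2 ^ l" for l
    unfolding e2 D_def integral_mult_right_zero using integral_lorentz(4)[OF \<tau>, of "2 ^ l"] by simp
  have Ib20: "(LINT t|lborel. t\<^sup>2 * b l t) \<ge> 0" for l by (rule integral_nonneg_AE) (simp add: b0)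
  \<comment> \<open>The kernel truncated to one period cell; outside it the Lorentz bound would fail
    by periodicity.\<close>
  define P where "P l z = (\<Prod>i\<in>UNIV. u l (z $ i))" for l and z :: "real^'d"
  define Q where "Q l z = (\<Prod>i\<in>UNIV. b l (z $ i))" for l and z :: "real^'d"
  define R where "R l i z = (\<Prod>j\<in>UNIV. (if j = i then (\<lambda>t. t\<^sup>2 * b l t) else b l) (z $ j))" for l i and z :: "real^'d"
  have iP: "integrable lborel (P l)" for l unfolding P_def[abs_def] by (rule integral_prod_vec(1)[OF iu])
  have Iu: "(LINT t|lborel. u l t) = of_real (2 * pi / \<tau> * freq_cutoff w n l 0)" for l
    unfolding u_def J_def by (rule integral_tp_period[OF \<tau>])
  have IP: "of_real c * (LINT z|lborel. P l z) = 1" for l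
  proof -
    have "(LINT z|lborel. P l z) = (\<Prod>i\<in>(UNIV::'d set). complex_of_real (2 * pi / \<tau> * freq_cutoff w n l 0))"
      unfolding P_def integral_prod_vec(2)[OF iu] by (simp only: Iu)
    also have "\<dots> = of_real ((2 * pi / \<tau>) ^ d)"
      by (simp add: freq_cutoff_eq_1 d_def)
    finally have "of_real c * (LINT z|lborel. P l z) = complex_of_real (c * (2 * pi / \<tau>) ^ d)"
      by (simp only: of_real_mult)
    moreover have "c * (2 * pi / \<tau>) ^ d = 1"
      unfolding c_def power_mult_distrib[symmetric] using \<tau> by simp
    ultimately show ?thesis by simp
  qed
  have iQ: "integrable lborel (Q l)" for l unfolding Q_def[abs_def] by (rule integral_prod_vec(1)[OF ib])
  have IQ: "(LINT z|lborel. Q l z) \<le> Cb ^ d" for l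
    unfolding Q_def integral_prod_vec(2)[OF ib] d_def prod_constant[symmetric]
    by (intro prod_mono conjI Ib Ib0)
  have iif: "integrable lborel (if j = i then (\<lambda>t. t\<^sup>2 * b l t) else b l)" for i j :: 'd and l
    using ib ib2 by simp
  have iR: "integrable lborel (R l i)" for l i unfolding R_def[abs_def] by (rule integral_prod_vec(1)[OF iif])
  have IR: "(LINT z|lborel. R l i z) \<le> D / 2 ^ l * Cb ^ (d - 1)" for l i
  proof -
    have "(LINT z|lborel. R l i z) \<le> (\<Prod>j\<in>UNIV. if j = i then D / 2 ^ l else Cb)"
      unfolding R_def integral_prod_vec(2)[OF iif] by (intro prod_mono) (auto simp: Ib2 Ib20 Ib Ib0)
    also have "\<dots> = D / 2 ^ l * Cb ^ (d - 1)"
      by (subst prod.remove[of _ i]) (auto simp: d_def card_Diff_singleton)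
    finally show ?thesis .
  qed
  have PQ: "cmod (P l z) \<le> Q l z" for l z
    unfolding P_def Q_def prod_norm[symmetric] by (intro prod_mono conjI ub) auto
  have RQ: "R l i z = (z $ i)\<^sup>2 * Q l z" for l i z
    unfolding R_def Q_def by (subst (1 2) prod.remove[of _ i]) (auto simp: mult_ac intro!: prod.cong)
  have Q0: "Q l z \<ge> 0" for l z unfolding Q_def by (intro prod_nonneg) (simp add: b0)
  obtain F where F: "F \<ge> 0" "\<And>y. cmod (f y) \<le> F"
    by (rule continuous_compact_support_bounded[OF S(1) f S(2)]) (assumption, rule that)
  have fm [measurable]: "f \<in> borel_measurable borel" using f by (rule borel_measurable_continuous_onI)
  have intf: "integrable lborel f" by (rule integrable_compact_support[OF S(1) continuous_on_subset[OF f] S(2)]) auto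
  have ifP: "integrable lborel (\<lambda>z. f (x - z) * P l z)" for l
  proof (rule Bochner_Integration.integrable_bound[OF integrable_mult_right[OF integrable_norm[OF iP[of l]], of F]])
    show "(\<lambda>z. f (x - z) * P l z) \<in> borel_measurable lborel"
      using borel_measurable_integrable[OF iP[of l]] by measurable
    show "AE z in lborel. cmod (f (x - z) * P l z) \<le> norm (F * cmod (P l z))"
      using F by (auto simp: norm_mult intro!: mult_right_mono)
  qed
  have diff: "trig_approx w n \<tau> l f x - f x = of_real c * (LINT z|lborel. (f (x - z) - f x) * P l z)" for l
  proof -
    have "trig_approx w n \<tau> l f x = of_real c * (LINT y|lborel. f y * trig_kernel \<tau> (5 * 2 ^ l) (freq_cutoff w n l) (\<lambda>i. 0) (x - y))"
      using mderiv_Top[OF intf, of "\<lambda>i. 0" w n \<tau> l x] unfolding c_def d_def by simp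
    also have "(LINT y|lborel. f y * trig_kernel \<tau> (5 * 2 ^ l) (freq_cutoff w n l) (\<lambda>i. 0) (x - y))
        = (LINT z|lborel. f (x - z) * trig_kernel \<tau> (5 * 2 ^ l) (freq_cutoff w n l) (\<lambda>i. 0) z)"
    proof -
      have "continuous_on UNIV (\<lambda>y. f y * trig_kernel \<tau> (5 * 2 ^ l) (freq_cutoff w n l) (\<lambda>i. 0) (x - y))"
        by (intro continuous_intros f continuous_on_compose2[OF continuous_KK[of UNIV]]) auto
      from integral_reflect[OF borel_measurable_continuous_onI[OF this], of x] show ?thesis by simp
    qed
    \<comment> \<open>If f (x - z) is nonzero, both x and x - z are in the small region, so z lies
      in the cell and the truncation changes nothing.\<close>
    also have "\<dots> = (LINT z|lborel. f (x - z) * P l z)"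
    proof (rule Bochner_Integration.integral_cong[OF refl])
      fix z
      show "f (x - z) * trig_kernel \<tau> (5 * 2 ^ l) (freq_cutoff w n l) (\<lambda>i. 0) z = f (x - z) * P l z"
      proof (cases "x - z \<in> S")
        case True
        have "z $ i \<in> J" for i
        proof -
          have "\<bar>\<tau> * z $ i\<bar> \<le> 1/4"
          proof -
            have "\<bar>\<tau> * x $ i - \<tau> * z $ i\<bar> \<le> 1/8"
              using small(1)[OF True, of i] by (simp add: right_diff_distrib)
            then show ?thesis using small(2)[of i] by linarith
          qed
          then have "\<bar>\<tau> * z $ i\<bar> \<le> pi" using pi_ge_two by linarith
          then show ?thesis using \<tau> by (auto simp: J_def abs_le_iff field_simps)
        qed
        then show ?thesis by (simp add: trig_kernel_def P_def u_def)
      qed (simp add: S(2))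
    qed
    finally have "trig_approx w n \<tau> l f x = of_real c * (LINT z|lborel. f (x - z) * P l z)" .
    then have "trig_approx w n \<tau> l f x - f x
        = of_real c * (LINT z|lborel. f (x - z) * P l z) - of_real c * (LINT z|lborel. P l z) * f x"
      by (simp add: IP)
    also have "\<dots> = of_real c * ((LINT z|lborel. f (x - z) * P l z) - (LINT z|lborel. f x * P l z))"
      by (simp add: algebra_simps)
    also have "\<dots> = of_real c * (LINT z|lborel. (f (x - z) - f x) * P l z)"
      by (subst Bochner_Integration.integral_diff[symmetric]) (use ifP iP in \<open>auto simp: left_diff_distrib\<close>)
    finally show ?thesis .
  qed
  show ?thesis
  proof (rule LIMSEQ_I)
    fix e :: real assume e: "e > 0"
    define \<epsilon> where "\<epsilon> = e / (2 * (c * Cb ^ d + 1))"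
    have pos: "c * Cb ^ d + 1 > 0" using c0 Cb0 by (simp add: add_pos_pos)
    have \<epsilon>: "\<epsilon> > 0" unfolding \<epsilon>_def using e pos by simp
    have ce: "c * (\<epsilon> * Cb ^ d) \<le> e / 2"
    proof -
      have "c * (\<epsilon> * Cb ^ d) = (e / 2) * (c * Cb ^ d / (c * Cb ^ d + 1))" by (simp add: \<epsilon>_def)
      also have "\<dots> \<le> (e / 2) * 1" using e pos by (intro mult_left_mono) (auto simp: divide_le_eq_1)
      finally show ?thesis by simp
    qed
    obtain \<eta> where \<eta>: "\<eta> > 0" "\<And>y. dist y x < \<eta> \<Longrightarrow> dist (f y) (f x) < \<epsilon>"
      using f \<epsilon> unfolding continuous_on_iff by (metis UNIV_I)
    \<comment> \<open>Beyond radius \<eta> the sum of squares is at least \<eta> ^ 2, so the trivial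
      bound 2 * F is dominated by a quadratic function, whose integral is a sum of second
      moments.\<close>
    have fz: "cmod (f (x - z) - f x) \<le> \<epsilon> + 2 * F / \<eta>\<^sup>2 * (\<Sum>i\<in>UNIV. (z $ i)\<^sup>2)" for z
    proof (cases "norm z < \<eta>")
      case True
      then have "cmod (f (x - z) - f x) < \<epsilon>" using \<eta>(2)[of "x - z"] by (simp add: dist_norm)
      moreover have "2 * F / \<eta>\<^sup>2 * (\<Sum>i\<in>UNIV. (z $ i)\<^sup>2) \<ge> 0"
        using F(1) by (intro mult_nonneg_nonneg sum_nonneg) auto
      ultimately show ?thesis by linarith
    next
      case False
      have "(\<Sum>i\<in>UNIV. (z $ i)\<^sup>2) = (norm z)\<^sup>2"
        by (simp add: norm_vec_def L2_set_def sum_nonneg)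
      then have "\<eta>\<^sup>2 \<le> (\<Sum>i\<in>UNIV. (z $ i)\<^sup>2)" using False \<eta>(1) by (simp add: power_mono)
      then have "2 * F / \<eta>\<^sup>2 * \<eta>\<^sup>2 \<le> 2 * F / \<eta>\<^sup>2 * (\<Sum>i\<in>UNIV. (z $ i)\<^sup>2)"
        using F(1) by (intro mult_left_mono) auto
      moreover have "cmod (f (x - z) - f x) \<le> F + F"
        using norm_triangle_ineq4[of "f (x - z)" "f x"] F(2)[of "x - z"] F(2)[of x] by linarith
      ultimately show ?thesis using \<eta>(1) \<epsilon> by simp
    qed
    define G where "G = c * (2 * F / \<eta>\<^sup>2 * (real d * (D * Cb ^ (d - 1))))"
    have le: "cmod (trig_approx w n \<tau> l f x - f x) \<le> e / 2 + G / 2 ^ l" for l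
    proof -
      have iG: "integrable lborel (\<lambda>z. \<epsilon> * Q l z + 2 * F / \<eta>\<^sup>2 * (\<Sum>i\<in>UNIV. R l i z))"
        by (intro Bochner_Integration.integrable_add integrable_mult_right Bochner_Integration.integrable_sum iQ iR)
      have "cmod (LINT z|lborel. (f (x - z) - f x) * P l z)
          \<le> (LINT z|lborel. \<epsilon> * Q l z + 2 * F / \<eta>\<^sup>2 * (\<Sum>i\<in>UNIV. R l i z))"
      proof (rule order_trans[OF integral_norm_bound integral_mono'[OF iG]])
        fix z
        have "cmod ((f (x - z) - f x) * P l z) \<le> (\<epsilon> + 2 * F / \<eta>\<^sup>2 * (\<Sum>i\<in>UNIV. (z $ i)\<^sup>2)) * Q l z"
          unfolding norm_mult by (intro mult_mono fz PQ order_trans[OF norm_ge_zero fz]) auto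
        also have "\<dots> = \<epsilon> * Q l z + 2 * F / \<eta>\<^sup>2 * (\<Sum>i\<in>UNIV. R l i z)"
          unfolding RQ sum_distrib_right[symmetric] by (simp add: algebra_simps)
        finally show "cmod ((f (x - z) - f x) * P l z) \<le> \<epsilon> * Q l z + 2 * F / \<eta>\<^sup>2 * (\<Sum>i\<in>UNIV. R l i z)" .
        show "0 \<le> \<epsilon> * Q l z + 2 * F / \<eta>\<^sup>2 * (\<Sum>i\<in>UNIV. R l i z)"
          unfolding RQ using \<epsilon> F(1) Q0 by (intro add_nonneg_nonneg mult_nonneg_nonneg sum_nonneg) auto
      qed
      also have "\<dots> = \<epsilon> * (LINT z|lborel. Q l z) + 2 * F / \<eta>\<^sup>2 * (\<Sum>i\<in>UNIV. LINT z|lborel. R l i z)"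
        by (subst Bochner_Integration.integral_add)
          (simp_all add: iQ iR Bochner_Integration.integral_sum integrable_mult_right)
      also have "\<dots> \<le> \<epsilon> * Cb ^ d + 2 * F / \<eta>\<^sup>2 * (\<Sum>i\<in>(UNIV::'d set). D / 2 ^ l * Cb ^ (d - 1))"
        using \<epsilon> F(1) by (intro add_mono mult_left_mono sum_mono IQ IR) auto
      finally have "cmod (LINT z|lborel. (f (x - z) - f x) * P l z)
          \<le> \<epsilon> * Cb ^ d + 2 * F / \<eta>\<^sup>2 * (real d * (D / 2 ^ l * Cb ^ (d - 1)))"
        by (simp add: d_def)
      then have "c * cmod (LINT z|lborel. (f (x - z) - f x) * P l z)
          \<le> c * (\<epsilon> * Cb ^ d + 2 * F / \<eta>\<^sup>2 * (real d * (D / 2 ^ l * Cb ^ (d - 1))))"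
        using c0 by (intro mult_left_mono) auto
      also have "\<dots> = c * (\<epsilon> * Cb ^ d) + G / 2 ^ l"
        unfolding G_def by (simp add: algebra_simps)
      also have "\<dots> \<le> e / 2 + G / 2 ^ l" using ce by simp
      finally show ?thesis unfolding diff norm_mult using c0 by simp
    qed
    have "(\<lambda>l. G * (1/2) ^ l) \<longlonglongrightarrow> G * 0"
      by (intro tendsto_intros LIMSEQ_power_zero) simp
    then have "\<forall>\<^sub>F l in sequentially. G * (1/2) ^ l < e / 2"
      using e by (intro order_tendstoD(2)) auto
    then obtain L where "\<And>l. l \<ge> L \<Longrightarrow> G * (1/2) ^ l < e / 2"
      unfolding eventually_sequentially by blast
    moreover have "G / 2 ^ l = G * (1/2) ^ l" for l by (simp add: power_one_over)
    ultimately have "cmod (trig_approx w n \<tau> l f x - f x) < e" if "l \<ge> L" for l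
      using le[of l] that by fastforce
    then show "\<exists>no. \<forall>l\<ge>no. norm (trig_approx w n \<tau> l f x - f x) < e" by blast
  qed
qed

subsection \<open>Cutoff functions\<close>

lemma antiderivative:
  fixes f :: "real \<Rightarrow> real"
  assumes "continuous_on UNIV f"
  shows "\<exists>F. \<forall>x. (F has_real_derivative f x) (at x)"
proof -
  define F where "F x = (LBINT t=ereal 0..ereal x. f t)" for x :: real
  have "(F has_real_derivative f x) (at x)" for x
  proof -
    define a b where "a = - \<bar>x\<bar> - 1" and "b = \<bar>x\<bar> + 1"
    have "((\<lambda>u. LBINT t=ereal 0..ereal u. f t) has_vector_derivative f x) (at x within {a..b})"
      by (rule interval_integral_FTC2[of a 0 b f x])
        (use assms continuous_on_subset in \<open>auto simp: a_def b_def\<close>)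
    then show ?thesis
      unfolding F_def[abs_def] has_real_derivative_iff_has_vector_derivative
      by (subst (asm) at_within_interior) (auto simp: a_def b_def)
  qed
  then show ?thesis by blast
qed

text \<open>Here g j is the j-th derivative of g 0. The transition from 0 to 1 starts as [1/4, 3/4]
  and is widened by \<epsilon> at both ends with each of the q averages.\<close>

definition smooth_step :: "real \<Rightarrow> nat \<Rightarrow> (nat \<Rightarrow> real \<Rightarrow> real) \<Rightarrow> bool" where
  "smooth_step \<epsilon> q g \<longleftrightarrow> (\<forall>j\<le>q. continuous_on UNIV (g j)) \<and>
    (\<forall>j<q. \<forall>x. (g j has_real_derivative g (Suc j) x) (at x)) \<and>
    (\<forall>j\<le>q. \<forall>x. \<bar>g j x\<bar> \<le> (1 / \<epsilon>) ^ j) \<and> (\<forall>x. 0 \<le> g 0 x) \<and>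
    (\<forall>x. x \<le> 1/4 - real q * \<epsilon> \<longrightarrow> g 0 x = 0) \<and> (\<forall>x. x \<ge> 3/4 + real q * \<epsilon> \<longrightarrow> g 0 x = 1)"

text \<open>Averaging over an interval of length \<open>2 * \<epsilon>\<close> gains one derivative and costs a factor
  \<open>1 / \<epsilon>\<close>.\<close>

lemma smooth_step_exists:
  assumes "\<epsilon> > 0" shows "\<exists>g. smooth_step \<epsilon> q g"
proof (induction q)
  case 0
  \<comment> \<open>A linear ramp of slope 2 between 1/4 and 3/4; order 0 asks only for
    continuity.\<close>
  have "smooth_step \<epsilon> 0 (\<lambda>j x. max 0 (min 1 (2 * x - 1/2)))"
    unfolding smooth_step_def by (auto intro!: continuous_intros)
  then show ?case by blast
next
  case (Suc q)
  then obtain g where g: "smooth_step \<epsilon> q g" by blast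
  have gc: "\<And>j. j \<le> q \<Longrightarrow> continuous_on UNIV (g j)"
    and gd: "\<And>j x. j < q \<Longrightarrow> (g j has_real_derivative g (Suc j) x) (at x)"
    and gb: "\<And>j x. j \<le> q \<Longrightarrow> \<bar>g j x\<bar> \<le> (1 / \<epsilon>) ^ j"
    and g0: "\<And>x. 0 \<le> g 0 x" "\<And>x. x \<le> 1/4 - real q * \<epsilon> \<Longrightarrow> g 0 x = 0" "\<And>x. x \<ge> 3/4 + real q * \<epsilon> \<Longrightarrow> g 0 x = 1"
    using g unfolding smooth_step_def by auto
  obtain F where F: "\<And>x. (F has_real_derivative g 0 x) (at x)"
    using antiderivative[OF gc[of 0]] by auto
  define D where "D f x = (f (x + \<epsilon>) - f (x - \<epsilon>)) / (2 * \<epsilon>)" for f :: "real \<Rightarrow> real" and x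
  \<comment> \<open>The average of g 0 is the symmetric difference quotient of a primitive F; its
    derivative of order k + 1 is the same quotient of the old derivative of order k.\<close>
  define h where "h j = (case j of 0 \<Rightarrow> D F | Suc k \<Rightarrow> D (g k))" for j
  have Dd: "(D f has_real_derivative D f' x) (at x)" if "\<And>x. (f has_real_derivative f' x) (at x)" for f f' x
    unfolding D_def[abs_def] using assms
    by (auto intro!: derivative_eq_intros DERIV_chain2[OF that] simp: field_simps)
  have Dc: "continuous_on UNIV (D f)" if "continuous_on UNIV f" for f
    unfolding D_def[abs_def] using assms
    by (intro continuous_intros continuous_on_compose2[OF that]) auto
  have Fc: "continuous_on UNIV F"
    using F by (meson DERIV_continuous_on has_field_derivative_at_within)
  \<comment> \<open>The average is a value of g 0 at a point closer than \<epsilon>, so the range is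
    inherited and the regions of constancy shrink by \<epsilon>.\<close>
  have mvt: "\<exists>y. x - \<epsilon> < y \<and> y < x + \<epsilon> \<and> D F x = g 0 y" for x
  proof -
    obtain y where "x - \<epsilon> < y" "y < x + \<epsilon>" "F (x + \<epsilon>) - F (x - \<epsilon>) = (x + \<epsilon> - (x - \<epsilon>)) * g 0 y"
      using MVT2[of "x - \<epsilon>" "x + \<epsilon>" F "g 0"] F assms by auto
    then show ?thesis using assms by (intro exI[of _ y]) (auto simp: D_def)
  qed
  have "smooth_step \<epsilon> (Suc q) h"
    unfolding smooth_step_def
  proof (intro conjI allI impI)
    show "continuous_on UNIV (h j)" if "j \<le> Suc q" for j
      using that by (cases j) (auto simp: h_def intro!: Dc Fc gc)
    show "(h j has_real_derivative h (Suc j) x) (at x)" if "j < Suc q" for j x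
      using that by (cases j) (auto simp: h_def intro!: Dd F gd)
    show "\<bar>h j x\<bar> \<le> (1 / \<epsilon>) ^ j" if j: "j \<le> Suc q" for j x
    proof (cases j)
      case 0
      obtain y where "D F x = g 0 y" using mvt by blast
      then show ?thesis using gb[of 0 y] 0 by (simp add: h_def)
    next
      case (Suc k)
      have "\<bar>g k (x + \<epsilon>) - g k (x - \<epsilon>)\<bar> \<le> (1 / \<epsilon>) ^ k + (1 / \<epsilon>) ^ k"
        using gb[of k "x + \<epsilon>"] gb[of k "x - \<epsilon>"] j Suc by (simp add: abs_le_iff)
      then have "\<bar>g k (x + \<epsilon>) - g k (x - \<epsilon>)\<bar> / (2 * \<epsilon>) \<le> (2 * (1 / \<epsilon>) ^ k) / (2 * \<epsilon>)"
        using assms by (intro divide_right_mono) auto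
      then show ?thesis using Suc assms by (simp add: h_def D_def abs_divide)
    qed
    show "0 \<le> h 0 x" for x using mvt[of x] g0(1) by (auto simp: h_def)
    show "h 0 x = 0" if "x \<le> 1/4 - real (Suc q) * \<epsilon>" for x
    proof -
      obtain y where y: "y < x + \<epsilon>" "D F x = g 0 y" using mvt by blast
      have "y \<le> 1/4 - real q * \<epsilon>" using y(1) that by (simp add: algebra_simps)
      then show ?thesis using y g0(2) by (simp add: h_def)
    qed
    show "h 0 x = 1" if "x \<ge> 3/4 + real (Suc q) * \<epsilon>" for x
    proof -
      obtain y where y: "x - \<epsilon> < y" "D F x = g 0 y" using mvt by blast
      have "y \<ge> 3/4 + real q * \<epsilon>" using y(1) that by (simp add: algebra_simps)
      then show ?thesis using y g0(3) by (simp add: h_def)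
    qed
  qed
  then show ?case by blast
qed

section \<open>Cutoffs with controlled derivatives in the coordinate directions\<close>

lemma leibniz_sum:
  fixes a b :: "nat \<Rightarrow> 'a::comm_semiring_1"
  shows "(\<Sum>k\<le>j. of_nat (j choose k) * (a (Suc k) * b (j - k) + a k * b (Suc (j - k))))
    = (\<Sum>k\<le>Suc j. of_nat (Suc j choose k) * (a k * b (Suc j - k)))"
proof -
  have "(\<Sum>k\<le>Suc j. of_nat (Suc j choose k) * (a k * b (Suc j - k)))
      = a 0 * b (Suc j) + (\<Sum>k\<le>j. of_nat (Suc j choose Suc k) * (a (Suc k) * b (j - k)))"
    by (subst sum.atMost_Suc_shift) simp
  also have "\<dots> = (\<Sum>k\<le>j. of_nat (j choose k) * (a (Suc k) * b (j - k)))
      + (a 0 * b (Suc j) + (\<Sum>k\<le>j. of_nat (j choose Suc k) * (a (Suc k) * b (j - k))))"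
    by (simp add: distrib_right sum.distrib add_ac)
  also have "a 0 * b (Suc j) + (\<Sum>k\<le>j. of_nat (j choose Suc k) * (a (Suc k) * b (j - k)))
      = (\<Sum>k\<le>Suc j. of_nat (j choose k) * (a k * b (Suc j - k)))"
    by (subst sum.atMost_Suc_shift) simp
  also have "\<dots> = (\<Sum>k\<le>j. of_nat (j choose k) * (a k * b (Suc (j - k))))"
    by (simp add: Suc_diff_le binomial_eq_0)
  finally show ?thesis by (simp add: distrib_left sum.distrib)
qed

text \<open>The bounds are pure powers A ^ j without a leading constant. The Leibniz rule and the
  binomial theorem then simply add the numbers A of the factors of a product.\<close>

definition deriv_seq :: "nat \<Rightarrow> real \<Rightarrow> 'd::finite \<Rightarrow> (nat \<Rightarrow> real^'d \<Rightarrow> real) \<Rightarrow> bool" where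
  "deriv_seq q A i g \<longleftrightarrow> (\<forall>j\<le>q. continuous_on UNIV (g j)) \<and>
    (\<forall>j<q. \<forall>x. ((\<lambda>t. g j (x + t *\<^sub>R axis i 1)) has_real_derivative g (Suc j) x) (at 0)) \<and>
    (\<forall>j\<le>q. \<forall>x. \<bar>g j x\<bar> \<le> A ^ j)"

text \<open>Only pure derivatives are recorded, as every integration by parts stays in one
  coordinate.\<close>

definition cutoff_class :: "nat \<Rightarrow> real \<Rightarrow> (real^'d::finite \<Rightarrow> real) \<Rightarrow> bool" where
  "cutoff_class q A \<theta> \<longleftrightarrow> (\<forall>i. \<exists>g. g 0 = \<theta> \<and> deriv_seq q A i g)"

lemma cutoff_class_mult:
  assumes "cutoff_class q A f" "cutoff_class q B g" "A \<ge> 0" "B \<ge> 0"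
  shows "cutoff_class q (A + B) (\<lambda>x. f x * g x)"
  unfolding cutoff_class_def
proof
  fix i
  obtain a where a: "a 0 = f" "deriv_seq q A i a" using assms(1) by (auto simp: cutoff_class_def)
  obtain b where b: "b 0 = g" "deriv_seq q B i b" using assms(2) by (auto simp: cutoff_class_def)
  define h where "h j x = (\<Sum>k\<le>j. of_nat (j choose k) * (a k x * b (j - k) x))" for j x
  have "deriv_seq q (A + B) i h"
    unfolding deriv_seq_def
  proof (intro conjI allI impI)
    show "continuous_on UNIV (h j)" if "j \<le> q" for j
      unfolding h_def[abs_def] by (intro continuous_intros) (use a b that in \<open>auto simp: deriv_seq_def\<close>)
    show "((\<lambda>t. h j (x + t *\<^sub>R axis i 1)) has_real_derivative h (Suc j) x) (at 0)" if j: "j < q" for j x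
    proof -
      have "((\<lambda>t. h j (x + t *\<^sub>R axis i 1)) has_real_derivative
          (\<Sum>k\<le>j. of_nat (j choose k) * (a (Suc k) x * b (j - k) (x + 0 *\<^sub>R axis i 1) + b (Suc (j - k)) x * a k (x + 0 *\<^sub>R axis i 1)))) (at 0)"
        unfolding h_def
        by (intro DERIV_sum DERIV_cmult DERIV_mult) (use a b j in \<open>auto simp: deriv_seq_def\<close>)
      then show ?thesis
        using leibniz_sum[of j "\<lambda>k. a k x" "\<lambda>k. b k x"] by (simp add: h_def mult.commute)
    qed
    show "\<bar>h j x\<bar> \<le> (A + B) ^ j" if j: "j \<le> q" for j x
    proof -
      have "\<bar>h j x\<bar> \<le> (\<Sum>k\<le>j. of_nat (j choose k) * (A ^ k * B ^ (j - k)))"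
        unfolding h_def
      proof (rule order_trans[OF sum_abs sum_mono])
        fix k assume "k \<in> {..j}"
        then have "\<bar>a k x\<bar> \<le> A ^ k" "\<bar>b (j - k) x\<bar> \<le> B ^ (j - k)"
          using a b j by (auto simp: deriv_seq_def)
        then show "\<bar>of_nat (j choose k) * (a k x * b (j - k) x)\<bar> \<le> of_nat (j choose k) * (A ^ k * B ^ (j - k))"
          unfolding abs_mult using assms(3,4) by (intro mult_mono) auto
      qed
      then show ?thesis by (simp add: binomial_ring mult.assoc)
    qed
  qed
  moreover have "h 0 = (\<lambda>x. f x * g x)" by (simp add: h_def[abs_def] a b)
  ultimately show "\<exists>g'. g' 0 = (\<lambda>x. f x * g x) \<and> deriv_seq q (A + B) i g'" by blast
qed

lemma cutoff_class_const: "A \<ge> 0 \<Longrightarrow> \<bar>c\<bar> \<le> 1 \<Longrightarrow> cutoff_class q A (\<lambda>x. c)"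
  unfolding cutoff_class_def deriv_seq_def
  by (intro allI exI[of _ "\<lambda>j x. if j = 0 then c else 0"]) auto

lemma cutoff_class_compl:
  assumes "cutoff_class q A f" "\<And>x. 0 \<le> f x" "\<And>x. f x \<le> 1"
  shows "cutoff_class q A (\<lambda>x. 1 - f x)"
  unfolding cutoff_class_def
proof
  fix i
  obtain a where a: "a 0 = f" "deriv_seq q A i a" using assms(1) by (auto simp: cutoff_class_def)
  define h where "h j x = (if j = 0 then 1 - a 0 x else - a j x)" for j :: nat and x
  have "deriv_seq q A i h"
    unfolding deriv_seq_def
  proof (intro conjI allI impI)
    show "continuous_on UNIV (h j)" if "j \<le> q" for j
      unfolding h_def[abs_def] using a that by (cases "j = 0") (auto simp: deriv_seq_def intro!: continuous_intros)
    show "((\<lambda>t. h j (x + t *\<^sub>R axis i 1)) has_real_derivative h (Suc j) x) (at 0)" if j: "j < q" for j x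
    proof -
      have d: "((\<lambda>t. a j (x + t *\<^sub>R axis i 1)) has_real_derivative a (Suc j) x) (at 0)"
        using a j by (auto simp: deriv_seq_def)
      show ?thesis unfolding h_def by (cases "j = 0") (use d in \<open>auto intro!: derivative_eq_intros\<close>)
    qed
    show "\<bar>h j x\<bar> \<le> A ^ j" if j: "j \<le> q" for j x
      unfolding h_def using a assms(2,3)[of x] j by (auto simp: deriv_seq_def)
  qed
  moreover have "h 0 = (\<lambda>x. 1 - f x)" by (simp add: h_def[abs_def] a)
  ultimately show "\<exists>g'. g' 0 = (\<lambda>x. 1 - f x) \<and> deriv_seq q A i g'" by blast
qed

lemma cutoff_class_prod:
  assumes "finite I" "\<And>i. i \<in> I \<Longrightarrow> cutoff_class q A (f i)" "A \<ge> 0"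
  shows "cutoff_class q (real (card I) * A) (\<lambda>x. \<Prod>i\<in>I. f i x)"
  using assms
proof (induction I rule: finite_induct)
  case empty
  show ?case using cutoff_class_const[of 0 1 q] by simp
next
  case (insert i I)
  have "cutoff_class q (A + real (card I) * A) (\<lambda>x. f i x * (\<Prod>i\<in>I. f i x))"
    using insert by (intro cutoff_class_mult) auto
  then show ?case using insert by (simp add: algebra_simps)
qed

lemma cutoff_class_coord:
  assumes "smooth_step \<epsilon> q g" "\<epsilon> > 0"
  shows "cutoff_class q (\<bar>s\<bar> / \<epsilon>) (\<lambda>x. g 0 ((x $ i - a) * s))"
  unfolding cutoff_class_def
proof
  fix i'
  have gc: "\<And>j. j \<le> q \<Longrightarrow> continuous_on UNIV (g j)"
    and gd: "\<And>j x. j < q \<Longrightarrow> (g j has_real_derivative g (Suc j) x) (at x)"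
    and gb: "\<And>j x. j \<le> q \<Longrightarrow> \<bar>g j x\<bar> \<le> (1 / \<epsilon>) ^ j"
    using assms(1) unfolding smooth_step_def by auto
  define h where "h j x = (if i' = i then s ^ j * g j ((x $ i - a) * s) else if j = 0 then g 0 ((x $ i - a) * s) else 0)"
    for j and x :: "real^'a"
  have cc: "continuous_on UNIV (\<lambda>x::real^'a. g j ((x $ i - a) * s))" if "j \<le> q" for j
    by (rule continuous_on_compose2[OF gc[OF that]]) (auto intro!: continuous_intros)
  have "deriv_seq q (\<bar>s\<bar> / \<epsilon>) i' h"
    unfolding deriv_seq_def
  proof (intro conjI allI impI)
    show "continuous_on UNIV (h j)" if "j \<le> q" for j
      unfolding h_def[abs_def] using cc[OF that] by (cases "i' = i"; cases "j = 0") (auto intro!: continuous_intros)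
    show "((\<lambda>t. h j (x + t *\<^sub>R axis i' 1)) has_real_derivative h (Suc j) x) (at 0)" if j: "j < q" for j x
    proof (cases "i' = i")
      case True
      have "((\<lambda>t. s ^ j * g j ((x $ i + t - a) * s)) has_real_derivative s ^ j * (g (Suc j) ((x $ i + 0 - a) * s) * s)) (at 0)"
        by (intro DERIV_cmult DERIV_chain2[OF gd[OF j]]) (auto intro!: derivative_eq_intros)
      then show ?thesis using True by (simp add: h_def axis_def mult_ac)
    next
      case False
      then show ?thesis by (cases "j = 0") (simp_all add: h_def axis_def)
    qed
    show "\<bar>h j x\<bar> \<le> (\<bar>s\<bar> / \<epsilon>) ^ j" if j: "j \<le> q" for j x
    proof (cases "i' = i")
      case True
      have "\<bar>s ^ j * g j ((x $ i - a) * s)\<bar> \<le> \<bar>s\<bar> ^ j * (1 / \<epsilon>) ^ j"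
        unfolding abs_mult power_abs by (intro mult_left_mono gb j) auto
      then show ?thesis using True by (simp add: h_def power_divide)
    next
      case False
      then show ?thesis using gb[of 0] assms(2) by (auto simp: h_def)
    qed
  qed
  moreover have "h 0 = (\<lambda>x. g 0 ((x $ i - a) * s))" by (auto simp: h_def[abs_def])
  ultimately show "\<exists>g'. g' 0 = (\<lambda>x. g 0 ((x $ i - a) * s)) \<and> deriv_seq q (\<bar>s\<bar> / \<epsilon>) i' g'" by blast
qed

text \<open>Bumps around finitely many centres are glued by 1 - \<Prod> (1 - c z). Each
  one-dimensional step costs a multiple of q + 1 per derivative, and the number of steps depends on
  K, \<delta> and the dimension only; hence C is independent of q.\<close>

lemma cutoff_exists:
  fixes K :: "(real^'d::finite) set"
  assumes K: "compact K" and \<delta>: "\<delta> > 0"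
  shows "\<exists>C\<ge>0. \<forall>q. \<exists>\<theta>. cutoff_class q (C * (real q + 1)) \<theta> \<and> (\<forall>x. 0 \<le> \<theta> x \<and> \<theta> x \<le> 1) \<and>
    (\<forall>x. (\<exists>y\<in>K. \<forall>i. \<bar>x $ i - y $ i\<bar> \<le> \<delta>) \<longrightarrow> \<theta> x = 1) \<and>
    (\<forall>x. (\<forall>y\<in>K. \<exists>i. 2 * \<delta> \<le> \<bar>x $ i - y $ i\<bar>) \<longrightarrow> \<theta> x = 0)"
proof -
  have "K \<subseteq> (\<Union>z\<in>K. ball z (\<delta>/4))" using \<delta> by force
  then obtain Z where Z: "Z \<subseteq> K" "finite Z" "K \<subseteq> (\<Union>z\<in>Z. ball z (\<delta>/4))"
    using compactE_image[OF K, of K "\<lambda>z. ball z (\<delta>/4)"] by auto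
  define d where "d = real CARD('d)"
  define C where "C = real (card Z) * (d * (16 / \<delta>))"
  have C0: "C \<ge> 0" unfolding C_def d_def using \<delta> by simp
  have "\<exists>\<theta>. cutoff_class q (C * (real q + 1)) \<theta> \<and> (\<forall>x. 0 \<le> \<theta> x \<and> \<theta> x \<le> 1) \<and>
    (\<forall>x. (\<exists>y\<in>K. \<forall>i. \<bar>x $ i - y $ i\<bar> \<le> \<delta>) \<longrightarrow> \<theta> x = 1) \<and>
    (\<forall>x. (\<forall>y\<in>K. \<exists>i. 2 * \<delta> \<le> \<bar>x $ i - y $ i\<bar>) \<longrightarrow> \<theta> x = 0)" for q
  proof -
    \<comment> \<open>All q averages together widen the ramp by at most 1/4 on each side, so the
      transition fits into [0, 1].\<close>
    define \<epsilon> where "\<epsilon> = 1 / (4 * (real q + 1))"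
    have \<epsilon>: "\<epsilon> > 0" "real q * \<epsilon> \<le> 1/4" unfolding \<epsilon>_def by (auto simp: field_simps)
    obtain g where g: "smooth_step \<epsilon> q g" using smooth_step_exists[OF \<epsilon>(1)] by blast
    have g0: "\<And>x. 0 \<le> g 0 x" "\<And>x. g 0 x \<le> 1" "\<And>x. x \<le> 0 \<Longrightarrow> g 0 x = 0" "\<And>x. x \<ge> 1 \<Longrightarrow> g 0 x = 1"
      using g \<epsilon>(2) unfolding smooth_step_def by (auto simp: abs_le_iff)
    define A where "A = (2 / \<delta>) / \<epsilon>"
    have A: "A = 8 / \<delta> * (real q + 1)" unfolding A_def \<epsilon>_def by simp
    have A0: "A \<ge> 0" unfolding A using \<delta> by simp
    \<comment> \<open>A plateau in one coordinate: 1 within 3/2 * \<delta> of the centre and 0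
      beyond 2 * \<delta>. The ramps have length \<delta> / 2, whence the slopes 2 /
      \<delta>.\<close>
    define p where "p z i x = g 0 ((x $ i - (z $ i + 2 * \<delta>)) * (- 2 / \<delta>)) * g 0 ((x $ i - (z $ i - 2 * \<delta>)) * (2 / \<delta>))"
      for z :: "real^'d" and i and x :: "real^'d"
    have p: "cutoff_class q (A + A) (p z i)" for z i
    proof -
      have e: "\<bar>- 2 / \<delta>\<bar> / \<epsilon> = A" "\<bar>2 / \<delta>\<bar> / \<epsilon> = A" using \<delta> by (simp_all add: A_def)
      show ?thesis
        unfolding p_def[abs_def]
        by (rule cutoff_class_mult[OF cutoff_class_coord[OF g \<epsilon>(1), of "- 2 / \<delta>", unfolded e]
              cutoff_class_coord[OF g \<epsilon>(1), of "2 / \<delta>", unfolded e] A0 A0])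
    qed
    have p01: "0 \<le> p z i x" "p z i x \<le> 1" for z i x
      unfolding p_def using g0 by (auto intro: mult_le_one)
    have p1: "p z i x = 1" if "\<bar>x $ i - z $ i\<bar> \<le> 3/2 * \<delta>" for z i x
    proof -
      have "(x $ i - (z $ i + 2 * \<delta>)) * (- 2 / \<delta>) \<ge> 1" "(x $ i - (z $ i - 2 * \<delta>)) * (2 / \<delta>) \<ge> 1"
      proof -
        have "x $ i - z $ i \<le> 3/2 * \<delta>" "z $ i - x $ i \<le> 3/2 * \<delta>" using that by linarith+
        then show "(x $ i - (z $ i + 2 * \<delta>)) * (- 2 / \<delta>) \<ge> 1" "(x $ i - (z $ i - 2 * \<delta>)) * (2 / \<delta>) \<ge> 1"
          using \<delta> by (auto simp: field_simps)
      qed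
      then show ?thesis unfolding p_def using g0(4) by simp
    qed
    have p0: "p z i x = 0" if "2 * \<delta> \<le> \<bar>x $ i - z $ i\<bar>" for z i x
    proof -
      have "(x $ i - (z $ i + 2 * \<delta>)) * (- 2 / \<delta>) \<le> 0 \<or> (x $ i - (z $ i - 2 * \<delta>)) * (2 / \<delta>) \<le> 0"
        using that \<delta> by (auto simp: abs_if mult_le_0_iff divide_le_0_iff split: if_splits)
      then show ?thesis unfolding p_def using g0(3) by auto
    qed
    define c where "c z x = (\<Prod>i\<in>UNIV. p z i x)" for z x
    have c: "cutoff_class q (d * (A + A)) (c z)" for z
      unfolding c_def[abs_def] d_def by (intro cutoff_class_prod p) (use A0 in auto)
    have c01: "0 \<le> c z x" "c z x \<le> 1" for z x
      unfolding c_def using p01 by (auto intro!: prod_nonneg prod_le_1)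
    define \<theta> where "\<theta> x = 1 - (\<Prod>z\<in>Z. 1 - c z x)" for x
    have m01: "0 \<le> (\<Prod>z\<in>Z. 1 - c z x)" "(\<Prod>z\<in>Z. 1 - c z x) \<le> 1" for x
      using c01 by (auto intro!: prod_nonneg prod_le_1)
    have "cutoff_class q (real (card Z) * (d * (A + A))) \<theta>"
      unfolding \<theta>_def[abs_def]
      by (intro cutoff_class_compl cutoff_class_prod c Z m01 c01) (use A0 in \<open>auto simp: d_def\<close>)
    moreover have "real (card Z) * (d * (A + A)) = C * (real q + 1)"
      unfolding A C_def by simp
    ultimately have "cutoff_class q (C * (real q + 1)) \<theta>" by simp
    moreover have "\<theta> x = 1" if xy: "y \<in> K" "\<And>i. \<bar>x $ i - y $ i\<bar> \<le> \<delta>" for x y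
    proof -
      obtain z where z: "z \<in> Z" "dist z y < \<delta>/4" using Z(3) xy(1) by auto
      have "\<bar>x $ i - z $ i\<bar> \<le> 3/2 * \<delta>" for i
      proof -
        have "\<bar>(z - y) $ i\<bar> \<le> norm (z - y)" by (rule component_le_norm_cart)
        then have "\<bar>z $ i - y $ i\<bar> < \<delta>/4" using z(2) by (simp add: dist_norm)
        then show ?thesis using xy(2)[of i] \<delta> by linarith
      qed
      then have "c z x = 1" unfolding c_def using p1 by simp
      then have "(\<Prod>z\<in>Z. 1 - c z x) = 0"
        using z(1) by (intro prod_zero[OF Z(2)]) auto
      then show ?thesis unfolding \<theta>_def by simp
    qed
    moreover have "\<theta> x = 0" if x: "\<And>y. y \<in> K \<Longrightarrow> \<exists>i. 2 * \<delta> \<le> \<bar>x $ i - y $ i\<bar>" for x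
    proof -
      have "c z x = 0" if zZ: "z \<in> Z" for z
      proof -
        obtain i where "2 * \<delta> \<le> \<bar>x $ i - z $ i\<bar>" using x[of z] zZ Z(1) by blast
        then show ?thesis unfolding c_def using p0 by (intro prod_zero) auto
      qed
      then show ?thesis unfolding \<theta>_def by simp
    qed
    moreover have "0 \<le> \<theta> x \<and> \<theta> x \<le> 1" for x unfolding \<theta>_def using m01 by auto
    ultimately show ?thesis by (intro exI[of _ \<theta>]) auto
  qed
  then show ?thesis using C0 by blast
qed

subsection \<open>Weight sequences\<close>

lemma weight_pos: "weight_sequence M \<Longrightarrow> M p > 0" and weight_0: "weight_sequence M \<Longrightarrow> M 0 = 1"
  by (simp_all add: weight_sequence_def)

lemma weight_ratio_mono:
  assumes "weight_sequence M" "cond_M1 M" "p \<le> q"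
  shows "M (Suc p) / M p \<le> M (Suc q) / M q"
  using assms(3)
proof (induction rule: dec_induct)
  case (step q)
  have "(M (Suc q))\<^sup>2 \<le> M q * M (Suc (Suc q))"
    using assms(2)[unfolded cond_M1_def, rule_format, of "Suc q"] by simp
  then have "M (Suc q) / M q \<le> M (Suc (Suc q)) / M (Suc q)"
    using weight_pos[OF assms(1), of q] weight_pos[OF assms(1), of "Suc q"]
    by (simp add: power2_eq_square field_simps)
  then show ?case using step.IH by linarith
qed simp

text \<open>Logarithmic convexity makes the ratios increase, and M 0 = 1 starts the
  induction.\<close>

lemma weight_mult:
  assumes "weight_sequence M" "cond_M1 M"
  shows "M j * M k \<le> M (j + k)"
proof (induction j)
  case 0
  show ?case by (simp add: weight_0[OF assms(1)])
next
  case (Suc j)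
  note pos = weight_pos[OF assms(1)]
  have "M (Suc j) / M j \<le> M (Suc (j + k)) / M (j + k)"
    by (rule weight_ratio_mono[OF assms]) simp
  then have "M (Suc j) / M j * (M j * M k) \<le> M (Suc (j + k)) / M (j + k) * M (j + k)"
    using Suc pos by (intro mult_mono) (auto intro: less_imp_le divide_nonneg_nonneg)
  then show ?case using pos[of j] pos[of "j + k"] by simp
qed

text \<open>Iterating (M.2)' costs a constant and a geometric factor. The shifts will win powers of
  1 / 2 ^ l against the number of frequencies in a shell.\<close>

lemma weight_shift:
  assumes "weight_sequence M" "cond_M2' M"
  shows "\<exists>A>0. \<exists>H\<ge>1. \<forall>p. M (p + e) \<le> A * H ^ p * M p"
proof (induction e)
  case 0
  show ?case by (intro exI[of _ 1]) auto
next
  case (Suc e)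
  then obtain A H where A: "A > 0" "H \<ge> 1" "\<And>p. M (p + e) \<le> A * H ^ p * M p" by blast
  obtain A' H' where A': "A' \<ge> 1" "H' \<ge> 1" "\<And>p. M (p + 1) \<le> A' * H' ^ (p + 1) * M p"
    using assms(2) unfolding cond_M2'_def by blast
  have "M (p + Suc e) \<le> (A' * H' ^ (e + 1) * A) * (H' * H) ^ p * M p" for p
  proof -
    have "M (p + Suc e) \<le> A' * H' ^ (p + e + 1) * M (p + e)" using A'(3)[of "p + e"] by simp
    also have "\<dots> \<le> A' * H' ^ (p + e + 1) * (A * H ^ p * M p)"
      using A' by (intro mult_left_mono A(3)) auto
    finally show ?thesis by (simp add: power_add power_mult_distrib mult_ac)
  qed
  moreover have "A' * H' ^ (e + 1) * A > 0" using A A' by (intro mult_pos_pos zero_less_power) auto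
  moreover have "H' * H \<ge> 1" using A(2) A'(2) mult_mono[of 1 H' 1 H] by simp
  ultimately show ?case by blast
qed

text \<open>The ratios tend to infinity, so the terms eventually increase and the infimum is
  attained. The minimizer is the optimal number of integrations by parts at a frequency of order 1 /
  s.\<close>

lemma weight_argmin:
  assumes "weight_sequence M" "s > 0"
  shows "\<exists>q. \<forall>p. s ^ q * M q \<le> s ^ p * M p"
proof -
  note pos = weight_pos[OF assms(1)]
  have "\<forall>\<^sub>F p in sequentially. 1 / s \<le> M (Suc p) / M p"
    using assms(1) unfolding weight_sequence_def filterlim_at_top by blast
  then obtain P where P: "\<And>p. p \<ge> P \<Longrightarrow> 1 / s \<le> M (Suc p) / M p"
    unfolding eventually_sequentially by blast
  have inc: "s ^ P * M P \<le> s ^ p * M p" if "P \<le> p" for p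
    using that
  proof (induction rule: dec_induct)
    case (step p)
    have "M p \<le> s * M (Suc p)"
      using P[OF step(1)] pos[of p] assms(2) by (simp add: field_simps)
    then have "s ^ p * M p \<le> s ^ p * (s * M (Suc p))" using assms(2) by (intro mult_left_mono) auto
    then show ?case using step.IH by (simp add: mult_ac)
  qed simp
  define v where "v p = s ^ p * M p" for p
  obtain q where q: "q \<in> {..P}" "v q = Min (v ` {..P})"
    using Min_in[of "v ` {..P}"] by fastforce
  have "v q \<le> v p" for p
  proof (cases "p \<le> P")
    case False
    then have "v P \<le> v p" using inc[of p] by (simp add: v_def)
    moreover have "v q \<le> v P" using q by simp
    ultimately show ?thesis by simp
  qed (use q in simp)
  then show ?thesis unfolding v_def by blast
qed

text \<open>The minimum for s = 1 / \<rho> is positive. This is why exponentials of any frequency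
  satisfy derivative bounds with rate 1.\<close>

lemma weight_growth:
  assumes "weight_sequence M" "\<rho> > 0"
  shows "\<exists>C>0. \<forall>j. \<rho> ^ j \<le> C * M j"
proof -
  obtain q where q: "\<And>p. (1 / \<rho>) ^ q * M q \<le> (1 / \<rho>) ^ p * M p"
    using weight_argmin[OF assms(1), of "1 / \<rho>"] assms(2) by auto
  define v where "v = (1 / \<rho>) ^ q * M q"
  have v: "v > 0" unfolding v_def using assms weight_pos[OF assms(1)] by simp
  have "\<rho> ^ j \<le> 1 / v * M j" for j
  proof -
    have "v \<le> M j / \<rho> ^ j" using q[of j] unfolding v_def by (simp add: power_one_over)
    then show ?thesis using v assms(2) by (simp add: field_simps)
  qed
  then show ?thesis using v by (intro exI[of _ "1 / v"]) auto
qed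

text \<open>Put q = m + l. Then (q + 1) ^ m is at most m! * e ^ (q + 1), the factorial is absorbed
  by M_m, and M_m * M_l \<le> M_q. This is how the dependence of the cutoffs on q is paid
  for.\<close>

lemma weight_leibniz_term:
  fixes C :: real
  assumes "weight_sequence M" "cond_M1 M" and F: "\<And>p. fact p \<le> C0 * H0 ^ p * M p" "C0 > 0" "H0 > 0" and C: "C \<ge> 0"
  shows "(C * (real (m + l) + 1)) ^ m * M l \<le> 3 * C0 * 3 ^ (m + l) * (C * H0) ^ m * M (m + l)"
proof -
  note pos = weight_pos[OF assms(1)]
  have "(real (m + l) + 1) ^ m \<le> fact m * exp (real (m + l) + 1)"
    by (rule power_le_fact_exp) simp
  also have "exp (real (m + l) + 1) = exp 1 ^ Suc (m + l)"
    by (subst exp_of_nat_mult[symmetric]) (simp add: algebra_simps)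
  also have "\<dots> \<le> 3 ^ Suc (m + l)"
    using exp_le by (intro power_mono) auto
  finally have "(real (m + l) + 1) ^ m \<le> fact m * 3 ^ Suc (m + l)" by simp
  also have "\<dots> \<le> (C0 * H0 ^ m * M m) * 3 ^ Suc (m + l)"
    by (intro mult_right_mono F(1)) simp
  finally have "C ^ m * (real (m + l) + 1) ^ m * M l \<le> C ^ m * ((C0 * H0 ^ m * M m) * 3 ^ Suc (m + l)) * M l"
    using C pos[of l] by (intro mult_right_mono mult_left_mono) auto
  also have "\<dots> = (C ^ m * C0 * H0 ^ m * 3 ^ Suc (m + l)) * (M m * M l)" by (simp add: mult_ac)
  also have "\<dots> \<le> (C ^ m * C0 * H0 ^ m * 3 ^ Suc (m + l)) * M (m + l)"
    using C F by (intro mult_left_mono weight_mult[OF assms(1,2)]) auto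
  finally show ?thesis by (simp add: power_mult_distrib mult_ac)
qed

text \<open>Each term is estimated with the same M_q, and the remaining geometric factors add up by
  the binomial theorem.\<close>

lemma weight_leibniz_sum:
  fixes C :: real
  assumes "weight_sequence M" "cond_M1 M" and F: "\<And>p. fact p \<le> C0 * H0 ^ p * M p" "C0 > 0" "H0 > 0" and C: "C \<ge> 0" "h \<ge> 0"
  shows "(\<Sum>k\<le>q. real (q choose k) * ((C * (real q + 1)) ^ k * (h ^ (q - k) * M (q - k)))) \<le> 3 * C0 * (3 * (C * H0 + h)) ^ q * M q"
proof -
  have "(\<Sum>k\<le>q. real (q choose k) * ((C * (real q + 1)) ^ k * (h ^ (q - k) * M (q - k))))
      \<le> (\<Sum>k\<le>q. 3 * C0 * 3 ^ q * M q * (real (q choose k) * (C * H0) ^ k * h ^ (q - k)))"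
  proof (rule sum_mono)
    fix k assume "k \<in> {..q}"
    then have "(C * (real q + 1)) ^ k * M (q - k) \<le> 3 * C0 * 3 ^ q * (C * H0) ^ k * M q"
      using weight_leibniz_term[OF assms(1,2) F C(1), of k "q - k"] by simp
    then have "(real (q choose k) * h ^ (q - k)) * ((C * (real q + 1)) ^ k * M (q - k))
        \<le> (real (q choose k) * h ^ (q - k)) * (3 * C0 * 3 ^ q * (C * H0) ^ k * M q)"
      using C by (intro mult_left_mono) auto
    then show "real (q choose k) * ((C * (real q + 1)) ^ k * (h ^ (q - k) * M (q - k)))
        \<le> 3 * C0 * 3 ^ q * M q * (real (q choose k) * (C * H0) ^ k * h ^ (q - k))"
      by (simp add: mult_ac)
  qed
  also have "\<dots> = 3 * C0 * 3 ^ q * M q * (C * H0 + h) ^ q"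
    unfolding sum_distrib_left[symmetric] binomial_ring ..
  finally show ?thesis by (simp only: power_mult_distrib mult_ac)
qed


subsection \<open>Fourier coefficients of localized smooth functions\<close>

text \<open>The j-th derivative of g 0 * \<phi> in direction i, written out by the Leibniz rule and
  extended by zero, since nothing is known of \<phi> outside \<Omega>.\<close>

definition leibniz_prod :: "(real^'d::finite) set \<Rightarrow> (nat \<Rightarrow> real^'d \<Rightarrow> real) \<Rightarrow> (real^'d \<Rightarrow> complex) \<Rightarrow> 'd \<Rightarrow> nat \<Rightarrow> real^'d \<Rightarrow> complex" where
  "leibniz_prod \<Omega> g \<phi> i j x = (if x \<in> \<Omega> then
    (\<Sum>k\<le>j. of_nat (j choose k) * (of_real (g k x) * partials (replicate (j - k) i) \<phi> x)) else 0)"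

lemma deriv_seq_zero_outside:
  assumes "deriv_seq q A i g" "closed S" "\<And>x. x \<notin> S \<Longrightarrow> g 0 x = 0"
  shows "j \<le> q \<Longrightarrow> x \<notin> S \<Longrightarrow> g j x = 0"
proof (induction j arbitrary: x)
  case (Suc j)
  have "complex_of_real (g (Suc j) x) = 0"
  proof (rule derivative_zero_outside[where g="\<lambda>x. complex_of_real (g j x)" and g'="\<lambda>x. complex_of_real (g (Suc j) x)"])
    show "((\<lambda>t. complex_of_real (g j (y + t *\<^sub>R axis i 1))) has_vector_derivative complex_of_real (g (Suc j) y)) (at 0)" for y
      by (rule has_vector_derivative_of_real)
        (use assms(1) Suc.prems in \<open>auto simp: deriv_seq_def has_real_derivative_iff_has_vector_derivative\<close>)
  qed (use assms(2) Suc in auto)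
  then show ?case by simp
qed (use assms in simp)

text \<open>The open sets \<Omega> and - S cover the space: on the first the Leibniz rule applies,
  on the second everything vanishes.\<close>

lemma leibniz_prod_props:
  fixes \<phi> :: "real^'d::finite \<Rightarrow> complex"
  assumes \<Omega>: "open \<Omega>" and \<phi>: "smooth_on \<Omega> \<phi>" and S: "compact S" "S \<subseteq> \<Omega>"
    and g: "deriv_seq q A i g" "\<And>x. x \<notin> S \<Longrightarrow> g 0 x = 0"
  shows "j \<le> q \<Longrightarrow> x \<notin> S \<Longrightarrow> leibniz_prod \<Omega> g \<phi> i j x = 0"
    and "j \<le> q \<Longrightarrow> continuous_on UNIV (leibniz_prod \<Omega> g \<phi> i j)"
    and "j < q \<Longrightarrow> ((\<lambda>t. leibniz_prod \<Omega> g \<phi> i j (x + t *\<^sub>R axis i 1)) has_vector_derivative leibniz_prod \<Omega> g \<phi> i (Suc j) x) (at 0)"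
proof -
  have cS: "closed S" using S(1) compact_imp_closed by blast
  have g0: "g k x = 0" if "k \<le> q" "x \<notin> S" for k x
    by (rule deriv_seq_zero_outside[OF g(1) cS g(2) that])
  show z: "leibniz_prod \<Omega> g \<phi> i j x = 0" if "j \<le> q" "x \<notin> S" for j x
    unfolding leibniz_prod_def using g0 that by (auto intro!: sum.neutral)
  have gc: "continuous_on UNIV (g k)" if "k \<le> q" for k using g(1) that by (auto simp: deriv_seq_def)
  show "continuous_on UNIV (leibniz_prod \<Omega> g \<phi> i j)" if j: "j \<le> q"
  proof -
    have "continuous_on \<Omega> (\<lambda>x. \<Sum>k\<le>j. of_nat (j choose k) * (of_real (g k x) * partials (replicate (j - k) i) \<phi> x))"
      using j by (intro continuous_intros smooth_on_continuous[OF \<phi>] continuous_on_subset[OF gc]) auto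
    then have "continuous_on \<Omega> (leibniz_prod \<Omega> g \<phi> i j)"
      by (rule continuous_on_eq) (simp add: leibniz_prod_def)
    moreover have "continuous_on (- S) (leibniz_prod \<Omega> g \<phi> i j)"
      by (rule continuous_on_eq[OF continuous_on_const[of _ 0]]) (use z[OF j] in auto)
    ultimately have "continuous_on (\<Omega> \<union> - S) (leibniz_prod \<Omega> g \<phi> i j)"
      using \<Omega> cS by (intro continuous_on_open_Un) auto
    moreover have "\<Omega> \<union> - S = UNIV" using S(2) by auto
    ultimately show ?thesis by simp
  qed
  show "((\<lambda>t. leibniz_prod \<Omega> g \<phi> i j (x + t *\<^sub>R axis i 1)) has_vector_derivative leibniz_prod \<Omega> g \<phi> i (Suc j) x) (at 0)" if j: "j < q"
  proof (cases "x \<in> \<Omega>")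
    case True
    let ?s = "\<lambda>x. \<Sum>k\<le>j. of_nat (j choose k) * (of_real (g k x) * partials (replicate (j - k) i) \<phi> x)"
    have "((\<lambda>t. ?s (x + t *\<^sub>R axis i 1)) has_vector_derivative
        (\<Sum>k\<le>j. of_nat (j choose k) * (of_real (g k (x + 0 *\<^sub>R axis i 1)) * partials (i # replicate (j - k) i) \<phi> x
          + of_real (g (Suc k) x) * partials (replicate (j - k) i) \<phi> (x + 0 *\<^sub>R axis i 1)))) (at 0)"
      by (intro has_vector_derivative_sum has_vector_derivative_mult_right has_vector_derivative_mult
          has_vector_derivative_of_real smooth_on_has_partial[OF \<phi> True])
        (use g(1) j in \<open>auto simp: deriv_seq_def has_real_derivative_iff_has_vector_derivative\<close>)
    also have "(\<Sum>k\<le>j. of_nat (j choose k) * (of_real (g k (x + 0 *\<^sub>R axis i 1)) * partials (i # replicate (j - k) i) \<phi> x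
          + of_real (g (Suc k) x) * partials (replicate (j - k) i) \<phi> (x + 0 *\<^sub>R axis i 1))) = leibniz_prod \<Omega> g \<phi> i (Suc j) x"
      using leibniz_sum[of j "\<lambda>k. complex_of_real (g k x)" "\<lambda>k. partials (replicate k i) \<phi> x"] True
      by (simp add: leibniz_prod_def add.commute)
    finally have d: "((\<lambda>t. ?s (x + t *\<^sub>R axis i 1)) has_vector_derivative leibniz_prod \<Omega> g \<phi> i (Suc j) x) (at 0)" .
    have "\<forall>\<^sub>F t in nhds 0. x + t *\<^sub>R axis i 1 \<in> \<Omega>" by (rule line_tendsto[OF \<Omega> True])
    then obtain T where T: "open T" "0 \<in> T" "\<And>t. t \<in> T \<Longrightarrow> x + t *\<^sub>R axis i 1 \<in> \<Omega>"
      unfolding eventually_nhds by blast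
    show ?thesis
      by (rule has_vector_derivative_transform_within_open[OF d T(1,2)]) (simp add: leibniz_prod_def T(3))
  next
    case False
    then have xS: "x \<in> - S" using S(2) by auto
    have "\<forall>\<^sub>F t in nhds 0. x + t *\<^sub>R axis i 1 \<in> - S"
      using cS by (intro line_tendsto xS) auto
    then obtain T where T: "open T" "0 \<in> T" "\<And>t. t \<in> T \<Longrightarrow> x + t *\<^sub>R axis i 1 \<in> - S"
      unfolding eventually_nhds by blast
    have "((\<lambda>t. 0) has_vector_derivative leibniz_prod \<Omega> g \<phi> i (Suc j) x) (at 0)"
      using False by (simp add: leibniz_prod_def)
    then show ?thesis
      by (rule has_vector_derivative_transform_within_open[OF _ T(1,2)]) (use z[of j] T(3) j in auto)
  qed
qed

lemma leibniz_prod_ck: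
  fixes \<phi> :: "real^'d::finite \<Rightarrow> complex"
  assumes "open \<Omega>" "smooth_on \<Omega> \<phi>" "compact S" "S \<subseteq> \<Omega>"
    and g: "deriv_seq q A i g" "\<And>x. x \<notin> S \<Longrightarrow> g 0 x = 0"
  shows "fourier_coeff \<tau> (leibniz_prod \<Omega> g \<phi> i q) k = (\<i> * of_real \<tau> * of_int (k i)) ^ q * fourier_coeff \<tau> (\<lambda>x. of_real (g 0 x) * \<phi> x) k"
proof -
  have "leibniz_prod \<Omega> g \<phi> i 0 = (\<lambda>x. of_real (g 0 x) * \<phi> x)"
    using assms(4) g(2) by (auto simp: leibniz_prod_def fun_eq_iff)
  moreover have "fourier_coeff \<tau> (leibniz_prod \<Omega> g \<phi> i q) k = (\<i> * of_real \<tau> * of_int (k i)) ^ q * fourier_coeff \<tau> (leibniz_prod \<Omega> g \<phi> i 0) k"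
    using fourier_coeff_derivatives[of q "leibniz_prod \<Omega> g \<phi> i" i S q \<tau> k] leibniz_prod_props[OF assms(1-4) g] assms(3) by blast
  ultimately show ?thesis by simp
qed

lemma integral_compact_bound:
  fixes f :: "real^'d::finite \<Rightarrow> complex"
  assumes S: "compact S" "\<And>x. x \<notin> S \<Longrightarrow> f x = 0" "\<And>x. x \<in> S \<Longrightarrow> cmod (f x) \<le> b"
  shows "(LINT x|lborel. cmod (f x)) \<le> b * measure lborel S"
proof -
  have fin: "emeasure lborel S < \<infinity>" by (rule emeasure_compact_finite[OF S(1)])
  have Sb: "S \<in> sets lborel" using S(1) by (simp add: borel_compact)
  have "(LINT x|lborel. cmod (f x)) \<le> (LINT x|lborel. b * indicator S x)"
  proof (cases "S = {}")
    case True then show ?thesis using S(2) by simp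
  next
    case False
    then have b: "b \<ge> 0" using S(3) by (meson equals0I norm_ge_zero order_trans)
    show ?thesis
    proof (rule integral_mono')
      show "integrable lborel (\<lambda>x. b * indicator S x :: real)"
        by (intro integrable_mult_right integrable_real_indicator Sb fin)
    qed (use S b in \<open>auto simp: indicator_def\<close>)
  qed
  also have "\<dots> = b * measure lborel S" using Sb fin by simp
  finally show ?thesis .
qed

text \<open>After q integrations by parts in coordinate i the Leibniz sum is bounded by a geometric
  multiple of M q, and the division by (\<tau> * L) ^ q leaves the quantity that is minimized over q
  later.\<close>

lemma fourier_coeff_localized_le:
  fixes \<phi> :: "real^'d::finite \<Rightarrow> complex"
  assumes W: "weight_sequence M" "cond_M1 M" and F: "\<And>p. fact p \<le> C0 * H0 ^ p * M p" "C0 > 0" "H0 > 0"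
    and \<Omega>: "open \<Omega>" "smooth_on \<Omega> \<phi>" "compact S" "S \<subseteq> \<Omega>"
    and \<theta>: "cutoff_class q (C * (real q + 1)) \<theta>" "\<And>x. x \<notin> S \<Longrightarrow> \<theta> x = 0" and C: "C \<ge> 0" "h \<ge> 0" "c \<ge> 0"
    and b: "\<And>j x i. x \<in> S \<Longrightarrow> cmod (mderiv (pure i j) \<phi> x) \<le> c * (h ^ j * M j)"
    and \<tau>: "\<tau> > 0" and k: "L \<le> \<bar>real_of_int (k i)\<bar>" "L > 0"
  shows "cmod (fourier_coeff \<tau> (\<lambda>x. of_real (\<theta> x) * \<phi> x) k)
    \<le> (\<tau> / (2 * pi)) ^ CARD('d) * (c * (3 * C0) * measure lborel S) * ((3 * (C * H0 + h) / (\<tau> * L)) ^ q * M q)"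
proof -
  obtain g where g: "g 0 = \<theta>" "deriv_seq q (C * (real q + 1)) i g"
    using \<theta>(1) unfolding cutoff_class_def by blast
  have g0: "\<And>x. x \<notin> S \<Longrightarrow> g 0 x = 0" using \<theta>(2) g(1) by simp
  note leibniz_prod = leibniz_prod_props[OF \<Omega> g(2) g0]
  define X where "X = 3 * C0 * (3 * (C * H0 + h)) ^ q * M q"
  have "cmod (leibniz_prod \<Omega> g \<phi> i q x) \<le> c * X" if x: "x \<in> S" for x
  proof -
    have "cmod (leibniz_prod \<Omega> g \<phi> i q x) \<le> (\<Sum>k\<le>q. real (q choose k) * ((C * (real q + 1)) ^ k * (c * (h ^ (q - k) * M (q - k)))))"
      unfolding leibniz_prod_def using x \<Omega>(4)
    proof (simp add: subset_iff, intro order_trans[OF norm_sum] sum_mono)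
      fix k assume k: "k \<in> {..q}"
      have "cmod (partials (replicate (q - k) i) \<phi> x) \<le> c * (h ^ (q - k) * M (q - k))"
        using b[OF x, of i "q - k"] by (simp add: mderiv_pure)
      moreover have "\<bar>g k x\<bar> \<le> (C * (real q + 1)) ^ k" using g(2) k by (auto simp: deriv_seq_def)
      ultimately show "cmod (of_nat (q choose k) * (of_real (g k x) * partials (replicate (q - k) i) \<phi> x))
          \<le> real (q choose k) * ((C * (real q + 1)) ^ k * (c * (h ^ (q - k) * M (q - k))))"
        unfolding norm_mult norm_of_nat norm_of_real using C by (intro mult_left_mono mult_mono) auto
    qed
    also have "\<dots> = c * (\<Sum>k\<le>q. real (q choose k) * ((C * (real q + 1)) ^ k * (h ^ (q - k) * M (q - k))))"
      by (simp add: sum_distrib_left mult_ac)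
    also have "\<dots> \<le> c * X"
      unfolding X_def by (intro mult_left_mono weight_leibniz_sum[OF W F C(1,2)] C(3))
    finally show ?thesis .
  qed
  then have I: "(LINT x|lborel. cmod (leibniz_prod \<Omega> g \<phi> i q x)) \<le> c * X * measure lborel S"
    by (intro integral_compact_bound[OF \<Omega>(3)] leibniz_prod(1)) auto
  have int: "integrable lborel (leibniz_prod \<Omega> g \<phi> i q)"
    by (rule integrable_compact_support[OF \<Omega>(3) continuous_on_subset[OF leibniz_prod(2)] leibniz_prod(1)]) auto
  let ?P = "(\<tau> / (2 * pi)) ^ CARD('d)"
  have "cmod (fourier_coeff \<tau> (leibniz_prod \<Omega> g \<phi> i q) k) \<le> ?P * (c * X * measure lborel S)"
    by (rule order_trans[OF fourier_coeff_le[OF int]]) (use \<tau> I in \<open>auto intro!: mult_left_mono\<close>)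
  moreover have "cmod (fourier_coeff \<tau> (leibniz_prod \<Omega> g \<phi> i q) k) = (\<tau> * \<bar>real_of_int (k i)\<bar>) ^ q * cmod (fourier_coeff \<tau> (\<lambda>x. of_real (\<theta> x) * \<phi> x) k)"
    using leibniz_prod_ck[OF \<Omega> g(2) g0, of \<tau> k] \<tau> g(1) by (simp add: norm_mult norm_power)
  moreover have "(\<tau> * L) ^ q * cmod (fourier_coeff \<tau> (\<lambda>x. of_real (\<theta> x) * \<phi> x) k) \<le> (\<tau> * \<bar>real_of_int (k i)\<bar>) ^ q * cmod (fourier_coeff \<tau> (\<lambda>x. of_real (\<theta> x) * \<phi> x) k)"
    using \<tau> k by (intro mult_right_mono power_mono mult_left_mono) auto
  ultimately have "(\<tau> * L) ^ q * cmod (fourier_coeff \<tau> (\<lambda>x. of_real (\<theta> x) * \<phi> x) k) \<le> ?P * (c * X * measure lborel S)"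
    by linarith
  then have "cmod (fourier_coeff \<tau> (\<lambda>x. of_real (\<theta> x) * \<phi> x) k) \<le> ?P * (c * X * measure lborel S) / (\<tau> * L) ^ q"
    using \<tau> k(2) by (simp add: le_divide_eq mult.commute)
  also have "\<dots> = ?P * (c * (3 * C0) * measure lborel S) * ((3 * (C * H0 + h) / (\<tau> * L)) ^ q * M q)"
    unfolding X_def by (simp add: power_divide mult_ac)
  finally show ?thesis .
qed


section \<open>Dyadic frequency shells\<close>

definition shell_mult :: "(nat \<Rightarrow> nat) \<Rightarrow> nat \<Rightarrow> nat \<Rightarrow> ('d::finite \<Rightarrow> int) \<Rightarrow> real" where
  "shell_mult w n l k = box_mult w n (Suc l) k - box_mult w n l k"

lemma shell_mult_le: "\<bar>shell_mult w n l k\<bar> \<le> 1"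
  unfolding shell_mult_def using box_mult_bounds[of w n l k] box_mult_bounds[of w n "Suc l" k] by linarith

lemma shell_mult_eq_0: "k \<in> freq_box (2 ^ l) \<Longrightarrow> shell_mult w n l k = 0"
  unfolding shell_mult_def using freq_box_mono[of "2 ^ l" "2 ^ Suc l"] by (auto simp: box_mult_eq_1)

text \<open>By minimality of q, the coefficient bound also holds with p + d + 1 in place of q, where
  p is the order of differentiation and d the dimension. The p powers of 1 / 2 ^ l compensate the
  derivative, d of them compensate the (21 * 2 ^ l) ^ d frequencies, and the last one
  remains.\<close>

lemma trig_sum_localized_le:
  fixes A :: "('d::finite \<Rightarrow> int) \<Rightarrow> complex"
  assumes W: "weight_sequence M" and sh: "\<And>p. M (p + (CARD('d) + 1)) \<le> A1 * H1 ^ p * M p" "A1 > 0" "H1 \<ge> 1"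
    and \<tau>: "\<tau> > 0" and b: "b > 0" "V \<ge> 0"
    and q: "\<And>p. (b / (\<tau> * 2 ^ l)) ^ q * M q \<le> (b / (\<tau> * 2 ^ l)) ^ p * M p"
    and A: "\<And>k. cmod (A k) \<le> V * ((b / (\<tau> * 2 ^ l)) ^ q * M q)"
  shows "cmod (mderiv \<alpha> (trig_sum (10 * 2 ^ l) \<tau> A) x)
    \<le> V * 21 ^ CARD('d) * (b / \<tau>) ^ (CARD('d) + 1) * A1 / 2 ^ l * ((10 * H1 * b) ^ mi_abs \<alpha> * M (mi_abs \<alpha>))"
proof -
  define p where "p = mi_abs \<alpha>"
  define d where "d = CARD('d)"
  define s where "s = b / (\<tau> * 2 ^ l)"
  have s: "s > 0" unfolding s_def using b \<tau> by simp
  note pos = weight_pos[OF W]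
  have "cmod (A k) \<le> V * (s ^ (d + 1) * (A1 * (H1 * s) ^ p * M p))" for k
  proof -
    have "cmod (A k) \<le> V * (s ^ (p + (d + 1)) * M (p + (d + 1)))"
      using A[of k] q[of "p + (d + 1)"] b(2) unfolding s_def by (meson mult_left_mono order_trans)
    also have "\<dots> \<le> V * (s ^ (p + (d + 1)) * (A1 * H1 ^ p * M p))"
      using sh(1)[of p] s b(2) unfolding d_def by (intro mult_left_mono) auto
    finally show ?thesis by (simp add: power_add power_mult_distrib mult_ac)
  qed
  then have each: "cmod (A k * (\<Prod>i\<in>UNIV. (\<i> * of_real \<tau> * of_int (k i)) ^ \<alpha> i) * wave \<tau> k x)
      \<le> V * (s ^ (d + 1) * (A1 * (H1 * s) ^ p * M p)) * (\<tau> * real (10 * 2 ^ l)) ^ p" if "k \<in> freq_box (10 * 2 ^ l)" for k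
    unfolding norm_mult[of "_ * _"] norm_mult[of "A k"] norm_ee mult_1_right p_def
    using norm_freq_le[OF that, of \<tau> \<alpha>] \<tau> b(2) s sh pos
    by (intro mult_mono) (auto intro!: mult_nonneg_nonneg less_imp_le[OF pos])
  have "cmod (mderiv \<alpha> (trig_sum (10 * 2 ^ l) \<tau> A) x)
      \<le> (\<Sum>k\<in>(freq_box (10 * 2 ^ l) :: ('d \<Rightarrow> int) set). V * (s ^ (d + 1) * (A1 * (H1 * s) ^ p * M p)) * (\<tau> * real (10 * 2 ^ l)) ^ p)"
    unfolding mderiv_tri unfolding trig_sum_def by (intro order_trans[OF norm_sum] sum_mono each)
  also have "\<dots> = real ((2 * (10 * 2 ^ l) + 1) ^ d) * (V * (s ^ (d + 1) * (A1 * (H1 * s) ^ p * M p)) * (\<tau> * real (10 * 2 ^ l)) ^ p)"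
    by (simp add: card_KS d_def)
  also have "\<dots> \<le> (21 * 2 ^ l) ^ d * (V * (s ^ (d + 1) * (A1 * (H1 * s) ^ p * M p)) * (\<tau> * real (10 * 2 ^ l)) ^ p)"
  proof (rule mult_right_mono)
    have "real (2 * (10 * 2 ^ l) + 1) \<le> 21 * 2 ^ l" using one_le_power[of "2::real" l] by simp
    then show "real ((2 * (10 * 2 ^ l) + 1) ^ d) \<le> (21 * 2 ^ l) ^ d"
      unfolding of_nat_power by (rule power_mono) simp
  qed (use b s sh \<tau> pos in \<open>auto intro!: mult_nonneg_nonneg less_imp_le[OF pos]\<close>)
  also have "\<dots> = V * 21 ^ d * (b / \<tau>) ^ (d + 1) * A1 / 2 ^ l * ((10 * H1 * b) ^ p * M p)"
  proof -
    have "(H1 * s) ^ p * (\<tau> * real (10 * 2 ^ l)) ^ p = (10 * H1 * b) ^ p"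
      unfolding power_mult_distrib[symmetric] s_def using \<tau> by (simp add: mult_ac)
    moreover have "(21 * 2 ^ l) ^ d * s ^ (d + 1) = 21 ^ d * (b / \<tau>) ^ (d + 1) / 2 ^ l"
    proof -
      have "s = (b / \<tau>) / 2 ^ l" unfolding s_def by simp
      then have "s ^ (d + 1) = (b / \<tau>) ^ (d + 1) / (2 ^ l) ^ (d + 1)" by (simp only: power_divide)
      then show ?thesis by (simp add: power_mult_distrib)
    qed
    moreover have "(21 * 2 ^ l) ^ d * (V * (s ^ (d + 1) * (A1 * (H1 * s) ^ p * M p)) * (\<tau> * real (10 * 2 ^ l)) ^ p)
        = V * A1 * M p * ((21 * 2 ^ l) ^ d * s ^ (d + 1)) * ((H1 * s) ^ p * (\<tau> * real (10 * 2 ^ l)) ^ p)"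
      by (simp only: mult_ac)
    ultimately show ?thesis by (simp add: mult_ac)
  qed
  finally show ?thesis unfolding p_def d_def .
qed

subsection \<open>Convergence of the localized trigonometric sums\<close>

text \<open>Restricted to a coordinate segment this is differentiation of a sequence whose
  derivatives converge uniformly.\<close>

lemma partial_limit:
  fixes v :: "nat \<Rightarrow> real^'d::finite \<Rightarrow> complex"
  assumes U: "open U" "x \<in> U" and dv: "\<And>l y. y \<in> U \<Longrightarrow> v l differentiable at y"
    and lim: "\<And>y. y \<in> U \<Longrightarrow> (\<lambda>l. v l y) \<longlonglongrightarrow> w y"
    and e: "\<And>l y. y \<in> U \<Longrightarrow> cmod (partial i (v l) y - V y) \<le> e l" "e \<longlonglongrightarrow> 0"
  shows "partial i w x = V x"
proof -
  have "\<forall>\<^sub>F t in nhds 0. x + t *\<^sub>R axis i 1 \<in> U" by (rule line_tendsto[OF U])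
  then obtain \<eta> where \<eta>: "\<eta> > 0" "\<And>t::real. dist t 0 < \<eta> \<Longrightarrow> x + t *\<^sub>R axis i 1 \<in> U"
    unfolding eventually_nhds_metric by blast
  define T where "T = ball (0::real) \<eta>"
  have T: "t \<in> T \<Longrightarrow> x + t *\<^sub>R axis i 1 \<in> U" for t using \<eta>(2)[of t] by (simp add: T_def dist_commute)
  have "\<exists>g. \<forall>t\<in>T. (\<lambda>l. v l (x + t *\<^sub>R axis i 1)) \<longlonglongrightarrow> g t \<and> (g has_derivative (\<lambda>h. h *\<^sub>R V (x + t *\<^sub>R axis i 1))) (at t within T)"
  proof (rule has_derivative_sequence[where ?x0.0=0])
    show "convex T" by (simp add: T_def)
    show "0 \<in> T" using \<eta>(1) by (simp add: T_def)
    show "(\<lambda>l. v l (x + 0 *\<^sub>R axis i 1)) \<longlonglongrightarrow> w x" using lim[OF U(2)] by simp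
    show "((\<lambda>t. v l (x + t *\<^sub>R axis i 1)) has_derivative (\<lambda>h. h *\<^sub>R partial i (v l) (x + t *\<^sub>R axis i 1))) (at t within T)"
      if "t \<in> T" for l t
    proof -
      have "((\<lambda>s. v l ((x + t *\<^sub>R axis i 1) + s *\<^sub>R axis i 1)) \<circ> (\<lambda>s. s - t) has_vector_derivative 1 *\<^sub>R partial i (v l) (x + t *\<^sub>R axis i 1)) (at t)"
        by (rule vector_diff_chain_at) (auto intro!: derivative_eq_intros has_partial dv T that)
      moreover have "(\<lambda>s. v l ((x + t *\<^sub>R axis i 1) + s *\<^sub>R axis i 1)) \<circ> (\<lambda>s. s - t) = (\<lambda>s. v l (x + s *\<^sub>R axis i 1))"
        by (auto simp: fun_eq_iff algebra_simps simp flip: scaleR_add_left)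
      ultimately have "((\<lambda>s. v l (x + s *\<^sub>R axis i 1)) has_vector_derivative partial i (v l) (x + t *\<^sub>R axis i 1)) (at t within T)"
        by (simp add: has_vector_derivative_at_within)
      then show ?thesis by (simp add: has_vector_derivative_def)
    qed
    fix r :: real assume r: "r > 0"
    have "\<forall>\<^sub>F l in sequentially. e l < r" using e(2) r by (rule order_tendstoD(2))
    then show "\<forall>\<^sub>F l in sequentially. \<forall>t\<in>T. \<forall>h. norm (h *\<^sub>R partial i (v l) (x + t *\<^sub>R axis i 1) - h *\<^sub>R V (x + t *\<^sub>R axis i 1)) \<le> r * norm h"
    proof (rule eventually_mono, intro ballI allI)
      fix l t h assume l: "e l < r" and t: "t \<in> T"
      have "norm (h *\<^sub>R partial i (v l) (x + t *\<^sub>R axis i 1) - h *\<^sub>R V (x + t *\<^sub>R axis i 1)) = \<bar>h\<bar> * cmod (partial i (v l) (x + t *\<^sub>R axis i 1) - V (x + t *\<^sub>R axis i 1))"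
        by (simp flip: scaleR_right_diff_distrib)
      also have "\<dots> \<le> \<bar>h\<bar> * r" using e(1)[OF T[OF t], of l] l by (intro mult_left_mono) auto
      finally show "norm (h *\<^sub>R partial i (v l) (x + t *\<^sub>R axis i 1) - h *\<^sub>R V (x + t *\<^sub>R axis i 1)) \<le> r * norm h"
        by (simp add: mult.commute)
    qed
  qed
  then obtain g where g: "\<And>t. t \<in> T \<Longrightarrow> (\<lambda>l. v l (x + t *\<^sub>R axis i 1)) \<longlonglongrightarrow> g t"
      "\<And>t. t \<in> T \<Longrightarrow> (g has_derivative (\<lambda>h. h *\<^sub>R V (x + t *\<^sub>R axis i 1))) (at t within T)" by blast
  have 0: "0 \<in> T" "open T" using \<eta>(1) by (simp_all add: T_def)
  have gw: "g t = w (x + t *\<^sub>R axis i 1)" if "t \<in> T" for t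
    using LIMSEQ_unique[OF g(1)[OF that] lim[OF T[OF that]]] .
  have "(g has_vector_derivative V x) (at 0)"
    using g(2)[OF 0(1)] at_within_open[OF 0] by (simp add: has_vector_derivative_def)
  then have "((\<lambda>t. w (x + t *\<^sub>R axis i 1)) has_vector_derivative V x) (at 0)"
    by (rule has_vector_derivative_transform_within_open[OF _ 0(2,1)]) (rule gw)
  then show ?thesis by (rule partialI)
qed

lemma geometric_tail_le:
  fixes a :: "nat \<Rightarrow> complex"
  assumes "\<And>l. cmod (a (Suc l) - a l) \<le> C / 2 ^ l" "C \<ge> 0"
  shows "l \<le> L \<Longrightarrow> cmod (a L - a l) \<le> 2 * C / 2 ^ l - 2 * C / 2 ^ L"
proof (induction L rule: dec_induct)
  case (step L)
  have "cmod (a (Suc L) - a l) \<le> cmod (a (Suc L) - a L) + cmod (a L - a l)"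
    using norm_triangle_ineq[of "a (Suc L) - a L" "a L - a l"] by simp
  also have "\<dots> \<le> C / 2 ^ L + (2 * C / 2 ^ l - 2 * C / 2 ^ L)"
    by (rule add_mono[OF assms(1) step.IH])
  finally show ?case by simp
qed simp

lemma geometric_Cauchy:
  fixes a :: "nat \<Rightarrow> complex"
  assumes "\<And>l. cmod (a (Suc l) - a l) \<le> C / 2 ^ l" "C \<ge> 0"
  obtains b where "a \<longlonglongrightarrow> b" "\<And>l. cmod (b - a l) \<le> 2 * C / 2 ^ l"
proof -
  have le: "cmod (a L - a l) \<le> 2 * C * (1/2) ^ l" if "l \<le> L" for l L
  proof -
    have "0 \<le> 2 * C / 2 ^ L" using assms(2) by simp
    then show ?thesis using geometric_tail_le[OF assms that] by (simp add: power_one_over)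
  qed
  have t0: "(\<lambda>l. 2 * C * (1/2) ^ l) \<longlonglongrightarrow> 2 * C * 0" by (intro tendsto_intros LIMSEQ_power_zero) simp
  have "Cauchy a"
  proof (rule metric_CauchyI)
    fix e :: real assume "e > 0"
    then have "\<forall>\<^sub>F l in sequentially. 2 * C * (1/2) ^ l < e / 2" using t0 by (intro order_tendstoD(2)) auto
    then obtain N where N: "2 * C * (1/2) ^ N < e / 2" unfolding eventually_sequentially by blast
    have "dist (a m) (a n) < e" if "m \<ge> N" "n \<ge> N" for m n
    proof -
      have "dist (a m) (a n) \<le> dist (a m) (a N) + dist (a n) (a N)" by (rule dist_triangle2)
      then show ?thesis using le[OF that(1)] le[OF that(2)] N by (simp add: dist_norm)
    qed
    then show "\<exists>N. \<forall>m\<ge>N. \<forall>n\<ge>N. dist (a m) (a n) < e" by blast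
  qed
  then obtain b where b: "a \<longlonglongrightarrow> b" using Cauchy_convergent_iff convergent_def by blast
  have "cmod (b - a l) \<le> 2 * C / 2 ^ l" for l
  proof (rule LIMSEQ_le_const2)
    show "(\<lambda>L. cmod (a L - a l)) \<longlonglongrightarrow> cmod (b - a l)" by (intro tendsto_intros b)
    show "\<exists>N. \<forall>n\<ge>N. cmod (a n - a l) \<le> 2 * C / 2 ^ l" using le by (auto simp: power_one_over)
  qed
  then show ?thesis using that b by blast
qed

text \<open>Stated for lists of directions because the induction strips off one partial derivative
  at a time. Geometric increments make every derivative a uniform Cauchy sequence; the 2 is the sum
  of the geometric tail.\<close>

lemma partials_limit:
  fixes u :: "nat \<Rightarrow> real^'d::finite \<Rightarrow> complex"
  assumes U: "open U" and sm: "\<And>l. smooth_on U (u l)"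
    and lim: "\<And>x. x \<in> U \<Longrightarrow> (\<lambda>l. u l x) \<longlonglongrightarrow> \<phi> x"
    and b: "\<And>is l x. x \<in> U \<Longrightarrow> cmod (partials is (u (Suc l)) x - partials is (u l) x) \<le> W (length is) / 2 ^ l" "\<And>j. W j \<ge> 0"
  shows "x \<in> U \<Longrightarrow> cmod (partials is \<phi> x - partials is (u l) x) \<le> 2 * W (length is) / 2 ^ l"
proof -
  define V where "V is x = lim (\<lambda>l. partials is (u l) x)" for "is" x
  have V: "(\<lambda>l. partials is (u l) x) \<longlonglongrightarrow> V is x"
      "cmod (V is x - partials is (u l) x) \<le> 2 * W (length is) / 2 ^ l" if x: "x \<in> U" for "is" x l
  proof -
    obtain c where c: "(\<lambda>l. partials is (u l) x) \<longlonglongrightarrow> c"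
        "\<And>l. cmod (c - partials is (u l) x) \<le> 2 * W (length is) / 2 ^ l"
      by (rule geometric_Cauchy[OF b(1)[of x "is", OF x] b(2)]) (rule that)
    then have "V is x = c" unfolding V_def by (intro limI)
    then show "(\<lambda>l. partials is (u l) x) \<longlonglongrightarrow> V is x"
      "cmod (V is x - partials is (u l) x) \<le> 2 * W (length is) / 2 ^ l" using c by simp_all
  qed
  have VP: "V is x = partials is \<phi> x" if "x \<in> U" for "is" x
    using that
  proof (induction "is" arbitrary: x)
    case Nil
    then show ?case using LIMSEQ_unique[OF V(1)[of x "[]"] ] lim[of x] by simp
  next
    case (Cons i js)
    have "partial i (partials js \<phi>) x = V (i # js) x"
    proof (rule partial_limit[OF U Cons.prems, where v="\<lambda>l. partials js (u l)"])
      show "partials js (u l) differentiable at y" if "y \<in> U" for l y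
        using sm that by (auto simp: smooth_on_def)
      show "(\<lambda>l. partials js (u l) y) \<longlonglongrightarrow> partials js \<phi> y" if "y \<in> U" for y
        using V(1)[OF that, of js] Cons.IH[OF that] by simp
      show "cmod (partial i (partials js (u l)) y - V (i # js) y) \<le> 2 * W (Suc (length js)) * (1/2) ^ l" if "y \<in> U" for l y
        using V(2)[OF that, of "i # js" l] by (simp add: norm_minus_commute power_one_over)
      have "(\<lambda>l. 2 * W (Suc (length js)) * (1/2) ^ l) \<longlonglongrightarrow> 2 * W (Suc (length js)) * 0"
        by (intro tendsto_intros LIMSEQ_power_zero) simp
      then show "(\<lambda>l. 2 * W (Suc (length js)) * (1/2) ^ l) \<longlonglongrightarrow> 0" by simp
    qed
    then show ?case by simp
  qed
  show "x \<in> U \<Longrightarrow> cmod (partials is \<phi> x - partials is (u l) x) \<le> 2 * W (length is) / 2 ^ l"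
    using V(2)[of x "is" l] VP[of x "is"] by simp
qed

section \<open>Linear operations on coefficients and approximants\<close>

lemma partials_tri_mderiv: "partials is (trig_sum B \<tau> A) = mderiv (count_list is) (trig_sum B \<tau> A)"
  unfolding mderiv_tri partials_tri prod_list_count ..

lemma mi_abs_count_list: "mi_abs (count_list is) = length is"
proof (induction "is")
  case (Cons a js)
  have "(\<Sum>i\<in>UNIV. count_list (a # js) i) = (\<Sum>i\<in>UNIV. (if i = a then 1 else 0) + count_list js i)"
    by (intro sum.cong) auto
  also have "\<dots> = 1 + (\<Sum>i\<in>UNIV. count_list js i)"
    unfolding sum.distrib by simp
  finally show ?case using Cons by (simp add: mi_abs_def)
qed (simp add: mi_abs_def)

lemma length_mi_list: "length (mi_list \<alpha>) = mi_abs \<alpha>"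
proof -
  have "count_list (mi_list \<alpha>) = \<alpha>" by (auto simp: count_mi_list)
  then show ?thesis using mi_abs_count_list[of "mi_list \<alpha>"] by simp
qed

lemma fourier_coeff_add:
  assumes "integrable lborel f" "integrable lborel g"
  shows "fourier_coeff \<tau> (\<lambda>x. f x + g x) k = fourier_coeff \<tau> f k + fourier_coeff \<tau> g k"
  unfolding fourier_coeff_def distrib_right
  by (subst Bochner_Integration.integral_add) (auto intro!: integrable_ee assms simp: distrib_left)

lemma trig_sum_add: "trig_sum B \<tau> (\<lambda>k. A k + A' k) x = trig_sum B \<tau> A x + trig_sum B \<tau> A' x"
  by (simp add: trig_sum_def distrib_right sum.distrib)

lemma mderiv_tri_add: "mderiv \<alpha> (trig_sum B \<tau> (\<lambda>k. A k + A' k)) x = mderiv \<alpha> (trig_sum B \<tau> A) x + mderiv \<alpha> (trig_sum B \<tau> A') x"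
  unfolding mderiv_tri distrib_right by (rule trig_sum_add)

lemma mderiv_tri_diff: "mderiv \<alpha> (trig_sum B \<tau> (\<lambda>k. A k - A' k)) x = mderiv \<alpha> (trig_sum B \<tau> A) x - mderiv \<alpha> (trig_sum B \<tau> A') x"
  unfolding mderiv_tri unfolding trig_sum_def by (simp add: left_diff_distrib sum_subtractf)

lemma mderiv_Top_diff:
  "mderiv \<alpha> (trig_sum (10 * 2 ^ l) \<tau> (\<lambda>k. of_real (shell_mult w n l k) * fourier_coeff \<tau> g k)) x
    = mderiv \<alpha> (trig_approx w n \<tau> (Suc l) g) x - mderiv \<alpha> (trig_approx w n \<tau> l g) x"
proof -
  have e: "trig_sum (10 * 2 ^ l) \<tau> (\<lambda>k. of_real (box_mult w n l k) * fourier_coeff \<tau> g k) = trig_approx w n \<tau> l g"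
    unfolding trig_approx_def by (rule trig_sum_extend) (auto simp: box_mult_eq_0)
  have e': "trig_sum (10 * 2 ^ l) \<tau> (\<lambda>k. of_real (box_mult w n (Suc l) k) * fourier_coeff \<tau> g k) = trig_approx w n \<tau> (Suc l) g"
    unfolding trig_approx_def by simp
  show ?thesis
    unfolding e[symmetric] e'[symmetric] mderiv_tri_diff[symmetric] shell_mult_def by (simp add: left_diff_distrib)
qed

text \<open>The restriction to \<open>Ks\<close> may jump at the boundary, which spoils the decay of
  its Fourier coefficients. On \<open>U\<close> a splitting repairs this: the part cut off by
  \<theta> has small coefficients on the shell, and the rest lives at distance \<delta> from
  \<open>U\<close>, where the kernel is small. The cutoff may change with l, since the two parts
  always add up to the same function.\<close>

lemma localized_convergence:
  fixes \<phi> :: "real^'d::finite \<Rightarrow> complex"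
  assumes W: "weight_sequence M" "cond_M1 M" and F: "\<And>p. fact p \<le> C0 * H0 ^ p * M p" "C0 > 0" "H0 > 0"
    and sh: "\<And>p. M (p + (CARD('d) + 1)) \<le> A1 * H1 ^ p * M p" "A1 > 0" "H1 \<ge> 1"
    and \<tau>: "\<tau> > 0"
    and tail: "C1 \<ge> 0" "\<And>l \<alpha> (z::real^'d). (\<forall>i. \<bar>\<tau> * z $ i\<bar> \<le> 1/4) \<Longrightarrow> (\<exists>i. \<delta> \<le> \<bar>z $ i\<bar>) \<Longrightarrow>
      cmod (trig_kernel \<tau> (5 * 2 ^ l) (freq_cutoff w n l) \<alpha> z) \<le> C1 / 2 ^ l * (h ^ mi_abs \<alpha> * M (mi_abs \<alpha>))"
    and \<Omega>: "open \<Omega>" "smooth_on \<Omega> \<phi>" and S: "compact S" "S \<subseteq> Ks" and Ks: "compact Ks" "Ks \<subseteq> \<Omega>"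
    and small: "\<And>(y::real^'d) i. y \<in> Ks \<Longrightarrow> \<bar>\<tau> * y $ i\<bar> \<le> 1/8"
    and U: "open U" "U \<subseteq> S"
    and cut: "\<And>q. \<exists>\<theta>. cutoff_class q (C * (real q + 1)) \<theta> \<and> (\<forall>x. 0 \<le> \<theta> x \<and> \<theta> x \<le> 1) \<and>
      (\<forall>x. (\<exists>y\<in>U. \<forall>i. \<bar>x $ i - y $ i\<bar> \<le> \<delta>) \<longrightarrow> \<theta> x = 1) \<and> (\<forall>x. x \<notin> S \<longrightarrow> \<theta> x = 0)" "C \<ge> 0"
    and bnd: "\<And>j x i. x \<in> S \<Longrightarrow> cmod (mderiv (pure i j) \<phi> x) \<le> c * (g ^ j * M j)" "c \<ge> 0" "g > 0"
    and \<delta>: "\<delta> > 0" and h: "10 * H1 * (3 * (C * H0 + g)) \<le> h"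
  shows "\<exists>D\<ge>0. \<forall>l. derivs_le M U h (D / 2 ^ l) (\<lambda>x. \<phi> x - trig_approx w n \<tau> l (restr Ks \<phi>) x)"
proof -
  define gg where "gg = restr Ks \<phi>"
  define b where "b = 3 * (C * H0 + g)"
  have b0: "b > 0" unfolding b_def using cut(2) F(3) bnd(3) by (simp add: add_nonneg_pos)
  have h0: "h > 0" using h b0 sh(3) unfolding b_def[symmetric] by (smt (verit) mult_pos_pos)
  note pos = weight_pos[OF W(1)]
  have cphi: "continuous_on \<Omega> \<phi>" using smooth_on_continuous[OF \<Omega>(2), of "[]"] by simp
  have cgg: "continuous_on Ks gg"
    by (rule continuous_on_eq[OF continuous_on_subset[OF cphi Ks(2)]]) (simp add: gg_def restr_def)
  have igg: "integrable lborel gg"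
    by (rule integrable_compact_support[OF Ks(1) cgg]) (simp add: gg_def restr_def)
  define I where "I = (LINT y|lborel. cmod (gg y))"
  have I0: "I \<ge> 0" unfolding I_def by (rule integral_nonneg_AE) simp
  define P where "P = (\<tau> / (2 * pi)) ^ CARD('d)"
  have P0: "P \<ge> 0" unfolding P_def using \<tau> by simp
  define V where "V = P * (c * (3 * C0) * measure lborel S)"
  have V0: "V \<ge> 0" unfolding V_def using P0 bnd(2) F(2) by simp
  define D1 where "D1 = V * 21 ^ CARD('d) * (b / \<tau>) ^ (CARD('d) + 1) * A1 + 2 * (P * (I * C1))"
  have D10: "D1 \<ge> 0"
    unfolding D1_def using V0 b0 \<tau> sh(2) P0 I0 tail(1) by (intro add_nonneg_nonneg mult_nonneg_nonneg) auto
  \<comment> \<open>The decomposition for each order q; the bound on the far part does not depend on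
    q because 0 \<le> \<theta> \<le> 1.\<close>
  have split: "\<exists>\<theta>. cutoff_class q (C * (real q + 1)) \<theta> \<and> (\<forall>x. x \<notin> S \<longrightarrow> \<theta> x = 0) \<and> (\<forall>x\<in>U. \<theta> x = 1) \<and>
      integrable lborel (\<lambda>x. of_real (\<theta> x) * \<phi> x) \<and> continuous_on UNIV (\<lambda>x. of_real (\<theta> x) * \<phi> x) \<and>
      integrable lborel (\<lambda>x. of_real (1 - \<theta> x) * gg x) \<and> gg = (\<lambda>x. of_real (\<theta> x) * \<phi> x + of_real (1 - \<theta> x) * gg x) \<and>
      (\<forall>l \<alpha>. \<forall>x\<in>U. cmod (mderiv \<alpha> (trig_approx w n \<tau> l (\<lambda>x. of_real (1 - \<theta> x) * gg x)) x)
         \<le> P * (I * C1) / 2 ^ l * (h ^ mi_abs \<alpha> * M (mi_abs \<alpha>)))" for q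
  proof -
    obtain \<theta> where \<theta>: "cutoff_class q (C * (real q + 1)) \<theta>" "\<And>x. 0 \<le> \<theta> x" "\<And>x. \<theta> x \<le> 1"
        "\<And>x y. y \<in> U \<Longrightarrow> (\<And>i. \<bar>x $ i - y $ i\<bar> \<le> \<delta>) \<Longrightarrow> \<theta> x = 1" "\<And>x. x \<notin> S \<Longrightarrow> \<theta> x = 0"
      using cut(1)[of q] by blast
    obtain a where a: "a 0 = \<theta>" "deriv_seq q (C * (real q + 1)) undefined a" using \<theta>(1) unfolding cutoff_class_def by blast
    have S\<Omega>: "S \<subseteq> \<Omega>" using S(2) Ks(2) by blast
    have a0: "\<And>x. x \<notin> S \<Longrightarrow> a 0 x = 0" using \<theta>(5) a(1) by simp
    have lp0: "leibniz_prod \<Omega> a \<phi> undefined 0 = (\<lambda>x. of_real (\<theta> x) * \<phi> x)"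
      using S\<Omega> a0 a(1) by (auto simp: leibniz_prod_def fun_eq_iff)
    have c1: "continuous_on UNIV (\<lambda>x. of_real (\<theta> x) * \<phi> x)"
      using leibniz_prod_props(2)[OF \<Omega> S(1) S\<Omega> a(2) a0, of 0] lp0 by simp
    have i1: "integrable lborel (\<lambda>x. of_real (\<theta> x) * \<phi> x)"
      by (rule integrable_compact_support[OF S(1) continuous_on_subset[OF c1]]) (use \<theta>(5) in auto)
    have e: "gg = (\<lambda>x. of_real (\<theta> x) * \<phi> x + of_real (1 - \<theta> x) * gg x)"
    proof
      fix x
      show "gg x = of_real (\<theta> x) * \<phi> x + of_real (1 - \<theta> x) * gg x"
        using \<theta>(5)[of x] S(2) by (cases "x \<in> Ks") (auto simp: gg_def restr_def algebra_simps)
    qed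
    have e2: "(\<lambda>x. of_real (1 - \<theta> x) * gg x) = (\<lambda>x. gg x - of_real (\<theta> x) * \<phi> x)"
    proof
      fix x
      show "of_real (1 - \<theta> x) * gg x = gg x - of_real (\<theta> x) * \<phi> x"
        using fun_cong[OF e, of x] by (simp add: eq_diff_eq add.commute)
    qed
    have i2: "integrable lborel (\<lambda>x. of_real (1 - \<theta> x) * gg x)"
      unfolding e2 by (rule Bochner_Integration.integrable_diff[OF igg i1])
    have I2: "(LINT y|lborel. cmod (of_real (1 - \<theta> y) * gg y)) \<le> I"
      unfolding I_def
    proof (rule integral_mono[OF integrable_norm[OF i2] integrable_norm[OF igg]])
      fix x
      show "cmod (of_real (1 - \<theta> x) * gg x) \<le> cmod (gg x)"
        unfolding norm_mult norm_of_real using \<theta>(2,3)[of x] by (intro mult_left_le_one_le) auto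
    qed
    have \<theta>1: "\<theta> x = 1" if "x \<in> U" for x
      using \<theta>(4)[OF that, of x] \<delta> by simp
    have tl: "cmod (mderiv \<alpha> (trig_approx w n \<tau> l (\<lambda>x. of_real (1 - \<theta> x) * gg x)) x)
         \<le> P * (I * C1) / 2 ^ l * (h ^ mi_abs \<alpha> * M (mi_abs \<alpha>))" if x: "x \<in> U" for l \<alpha> x
    proof -
      define B where "B = C1 / 2 ^ l * (h ^ mi_abs \<alpha> * M (mi_abs \<alpha>))"
      have B0: "B \<ge> 0" unfolding B_def using tail(1) h0 less_imp_le[OF pos] by simp
      have "cmod (mderiv \<alpha> (trig_approx w n \<tau> l (\<lambda>x. of_real (1 - \<theta> x) * gg x)) x)
          \<le> P * ((LINT y|lborel. cmod (of_real (1 - \<theta> y) * gg y)) * B)"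
        unfolding P_def
      proof (rule trig_approx_tail[OF i2 \<tau> B0])
        fix y assume "of_real (1 - \<theta> y) * gg y \<noteq> 0"
        then have y: "y \<in> Ks" "\<theta> y \<noteq> 1" by (auto simp: gg_def restr_def split: if_splits)
        have xK: "x \<in> Ks" using x U(2) S(2) by blast
        have "\<bar>\<tau> * (x - y) $ i\<bar> \<le> 1/4" for i
        proof -
          have "\<tau> * (x - y) $ i = \<tau> * x $ i - \<tau> * y $ i" by (simp add: right_diff_distrib)
          then show ?thesis using small[OF xK, of i] small[OF y(1), of i] by linarith
        qed
        moreover obtain i where "\<not> \<bar>y $ i - x $ i\<bar> \<le> \<delta>" using \<theta>(4)[OF x, of y] y(2) by blast
        then have "\<exists>i. \<delta> \<le> \<bar>(x - y) $ i\<bar>" by (intro exI[of _ i]) (simp add: abs_minus_commute)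
        ultimately show "cmod (trig_kernel \<tau> (5 * 2 ^ l) (freq_cutoff w n l) \<alpha> (x - y)) \<le> B"
          unfolding B_def by (intro tail(2)) auto
      qed
      also have "\<dots> \<le> P * (I * B)" by (intro mult_left_mono mult_right_mono I2 B0 P0)
      finally show ?thesis unfolding B_def by simp
    qed
    show ?thesis using \<theta>(1,5) \<theta>1 i1 c1 i2 e tl by blast
  qed
  have step: "cmod (mderiv \<alpha> (trig_approx w n \<tau> (Suc l) gg) x - mderiv \<alpha> (trig_approx w n \<tau> l gg) x)
      \<le> D1 * (h ^ mi_abs \<alpha> * M (mi_abs \<alpha>)) / 2 ^ l" if x: "x \<in> U" for l \<alpha> x
  proof -
    \<comment> \<open>The order of the cutoff is adapted to the shell: q minimizes the coefficient
      bound at frequency 2 ^ l.\<close>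
    have "b / (\<tau> * 2 ^ l) > 0" using b0 \<tau> by simp
    then obtain q where q: "\<And>p. (b / (\<tau> * 2 ^ l)) ^ q * M q \<le> (b / (\<tau> * 2 ^ l)) ^ p * M p"
      using weight_argmin[OF W(1)] by blast
    obtain \<theta> where \<theta>: "cutoff_class q (C * (real q + 1)) \<theta>" "\<And>x. x \<notin> S \<Longrightarrow> \<theta> x = 0"
      "integrable lborel (\<lambda>x. of_real (\<theta> x) * \<phi> x)" "integrable lborel (\<lambda>x. of_real (1 - \<theta> x) * gg x)"
      "gg = (\<lambda>x. of_real (\<theta> x) * \<phi> x + of_real (1 - \<theta> x) * gg x)"
      and tl: "\<And>l \<alpha> x. x \<in> U \<Longrightarrow> cmod (mderiv \<alpha> (trig_approx w n \<tau> l (\<lambda>x. of_real (1 - \<theta> x) * gg x)) x)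
         \<le> P * (I * C1) / 2 ^ l * (h ^ mi_abs \<alpha> * M (mi_abs \<alpha>))"
      using split[of q] by (elim exE conjE) (rule that, auto)
    let ?g0 = "\<lambda>x. of_real (\<theta> x) * \<phi> x" and ?g1 = "\<lambda>x. of_real (1 - \<theta> x) * gg x"
    define X where "X = h ^ mi_abs \<alpha> * M (mi_abs \<alpha>)"
    have X0: "X \<ge> 0" unfolding X_def using h0 less_imp_le[OF pos] by simp
    have ckk: "fourier_coeff \<tau> gg k = fourier_coeff \<tau> ?g0 k + fourier_coeff \<tau> ?g1 k" for k
      by (subst \<theta>(5)) (rule fourier_coeff_add[OF \<theta>(3,4)])
    have "mderiv \<alpha> (trig_approx w n \<tau> (Suc l) gg) x - mderiv \<alpha> (trig_approx w n \<tau> l gg) x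
        = mderiv \<alpha> (trig_sum (10 * 2 ^ l) \<tau> (\<lambda>k. of_real (shell_mult w n l k) * fourier_coeff \<tau> ?g0 k)) x
        + (mderiv \<alpha> (trig_approx w n \<tau> (Suc l) ?g1) x - mderiv \<alpha> (trig_approx w n \<tau> l ?g1) x)"
      unfolding mderiv_Top_diff[symmetric] mderiv_tri_add[symmetric] ckk distrib_left ..
    then have "cmod (mderiv \<alpha> (trig_approx w n \<tau> (Suc l) gg) x - mderiv \<alpha> (trig_approx w n \<tau> l gg) x)
        \<le> cmod (mderiv \<alpha> (trig_sum (10 * 2 ^ l) \<tau> (\<lambda>k. of_real (shell_mult w n l k) * fourier_coeff \<tau> ?g0 k)) x)
        + (cmod (mderiv \<alpha> (trig_approx w n \<tau> (Suc l) ?g1) x) + cmod (mderiv \<alpha> (trig_approx w n \<tau> l ?g1) x))"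
      by (simp only:) (rule order_trans[OF norm_triangle_ineq add_left_mono[OF norm_triangle_ineq4]])
    also have "\<dots> \<le> V * 21 ^ CARD('d) * (b / \<tau>) ^ (CARD('d) + 1) * A1 / 2 ^ l * X + (P * (I * C1) / 2 ^ l * X + P * (I * C1) / 2 ^ l * X)"
    proof (intro add_mono)
      have "cmod (mderiv \<alpha> (trig_sum (10 * 2 ^ l) \<tau> (\<lambda>k. of_real (shell_mult w n l k) * fourier_coeff \<tau> ?g0 k)) x)
        \<le> V * 21 ^ CARD('d) * (b / \<tau>) ^ (CARD('d) + 1) * A1 / 2 ^ l * ((10 * H1 * b) ^ mi_abs \<alpha> * M (mi_abs \<alpha>))"
      proof (rule trig_sum_localized_le[OF W(1) sh \<tau> b0 V0 q])
        fix k :: "'d \<Rightarrow> int"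
        show "cmod (of_real (shell_mult w n l k) * fourier_coeff \<tau> ?g0 k) \<le> V * ((b / (\<tau> * 2 ^ l)) ^ q * M q)"
        proof (cases "k \<in> freq_box (2 ^ l)")
          case True
          then show ?thesis using V0 b0 \<tau> less_imp_le[OF pos] by (simp add: shell_mult_eq_0)
        next
          case False
          then obtain i where i: "\<bar>k i\<bar> > 2 ^ l" by (auto simp: freq_box_iff not_le)
          then have "real_of_int (2 ^ l) < real_of_int \<bar>k i\<bar>" by (simp only: of_int_less_iff)
          then have i: "2 ^ l \<le> \<bar>real_of_int (k i)\<bar>" by simp
          have "cmod (fourier_coeff \<tau> ?g0 k) \<le> V * ((b / (\<tau> * 2 ^ l)) ^ q * M q)"
            unfolding V_def P_def b_def
            by (rule fourier_coeff_localized_le[where i=i and k=k and L="2 ^ l" and S=S and \<phi>=\<phi> and h=g and c=c and C=C and M=M, OF W F \<Omega> S(1) _ \<theta>(1,2) cut(2) less_imp_le[OF bnd(3)] bnd(2) bnd(1) \<tau> i])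
              (use S(2) Ks(2) in auto)
          moreover have "cmod (of_real (shell_mult w n l k) * fourier_coeff \<tau> ?g0 k) \<le> cmod (fourier_coeff \<tau> ?g0 k)"
            unfolding norm_mult norm_of_real using shell_mult_le by (intro mult_left_le_one_le) auto
          ultimately show ?thesis by linarith
        qed
      qed
      also have "\<dots> \<le> V * 21 ^ CARD('d) * (b / \<tau>) ^ (CARD('d) + 1) * A1 / 2 ^ l * X"
        unfolding X_def using h b0 sh V0 \<tau> less_imp_le[OF pos] unfolding b_def[symmetric]
        by (intro mult_left_mono mult_right_mono power_mono) auto
      finally show "cmod (mderiv \<alpha> (trig_sum (10 * 2 ^ l) \<tau> (\<lambda>k. of_real (shell_mult w n l k) * fourier_coeff \<tau> ?g0 k)) x)
        \<le> V * 21 ^ CARD('d) * (b / \<tau>) ^ (CARD('d) + 1) * A1 / 2 ^ l * X" .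
      show "cmod (mderiv \<alpha> (trig_approx w n \<tau> l ?g1) x) \<le> P * (I * C1) / 2 ^ l * X"
        using tl[OF x, of \<alpha> l] unfolding X_def .
      have "cmod (mderiv \<alpha> (trig_approx w n \<tau> (Suc l) ?g1) x) \<le> P * (I * C1) / 2 ^ Suc l * X"
        using tl[OF x, of \<alpha> "Suc l"] unfolding X_def .
      also have "\<dots> \<le> P * (I * C1) / 2 ^ l * X"
        using P0 I0 tail(1) X0 by (intro mult_right_mono divide_left_mono) auto
      finally show "cmod (mderiv \<alpha> (trig_approx w n \<tau> (Suc l) ?g1) x) \<le> P * (I * C1) / 2 ^ l * X" .
    qed
    also have "\<dots> = D1 * X / 2 ^ l" unfolding D1_def by (simp add: add_divide_distrib algebra_simps)
    finally show ?thesis unfolding X_def .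
  qed
  \<comment> \<open>The increments only show convergence; the limit is identified with one cutoff of
    order 0, kept fixed for all l.\<close>
  have lim: "(\<lambda>l. trig_approx w n \<tau> l gg x) \<longlonglongrightarrow> \<phi> x" if x: "x \<in> U" for x
  proof -
    obtain \<theta> where \<theta>: "\<And>x. x \<notin> S \<Longrightarrow> \<theta> x = 0" "\<And>x. x \<in> U \<Longrightarrow> \<theta> x = 1"
      "integrable lborel (\<lambda>x. of_real (\<theta> x) * \<phi> x)" "continuous_on UNIV (\<lambda>x. of_real (\<theta> x) * \<phi> x)"
      "integrable lborel (\<lambda>x. of_real (1 - \<theta> x) * gg x)"
      "gg = (\<lambda>x. of_real (\<theta> x) * \<phi> x + of_real (1 - \<theta> x) * gg x)"
      and tl: "\<And>l \<alpha> x. x \<in> U \<Longrightarrow> cmod (mderiv \<alpha> (trig_approx w n \<tau> l (\<lambda>x. of_real (1 - \<theta> x) * gg x)) x)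
         \<le> P * (I * C1) / 2 ^ l * (h ^ mi_abs \<alpha> * M (mi_abs \<alpha>))"
      using split[of 0] by (elim exE conjE) (rule that, auto)
    let ?g0 = "\<lambda>x. of_real (\<theta> x) * \<phi> x" and ?g1 = "\<lambda>x. of_real (1 - \<theta> x) * gg x"
    have ckk: "fourier_coeff \<tau> gg k = fourier_coeff \<tau> ?g0 k + fourier_coeff \<tau> ?g1 k" for k
      by (subst \<theta>(6)) (rule fourier_coeff_add[OF \<theta>(3,5)])
    have e: "trig_approx w n \<tau> l gg x = trig_approx w n \<tau> l ?g0 x + trig_approx w n \<tau> l ?g1 x" for l
      unfolding trig_approx_def ckk distrib_left trig_sum_add ..
    have "(\<lambda>l. trig_approx w n \<tau> l ?g0 x) \<longlonglongrightarrow> of_real (\<theta> x) * \<phi> x"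
      by (rule trig_approx_tendsto[OF \<tau> \<theta>(4) S(1)]) (use \<theta>(1) small S(2) U(2) x in auto)
    moreover have "(\<lambda>l. trig_approx w n \<tau> l ?g1 x) \<longlonglongrightarrow> 0"
    proof (rule Lim_null_comparison)
      show "\<forall>\<^sub>F l in sequentially. cmod (trig_approx w n \<tau> l ?g1 x) \<le> P * (I * C1) * M 0 * (1/2) ^ l"
        using tl[OF x, of "\<lambda>i. 0"] by (simp add: power_one_over mult_ac)
      have "(\<lambda>l. P * (I * C1) * M 0 * (1/2) ^ l) \<longlonglongrightarrow> P * (I * C1) * M 0 * 0"
        by (intro tendsto_intros LIMSEQ_power_zero) simp
      then show "(\<lambda>l. P * (I * C1) * M 0 * (1/2) ^ l) \<longlonglongrightarrow> 0" by simp
    qed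
    ultimately have "(\<lambda>l. trig_approx w n \<tau> l gg x) \<longlonglongrightarrow> of_real (\<theta> x) * \<phi> x + 0"
      unfolding e by (rule tendsto_add)
    then show ?thesis using \<theta>(2)[OF x] by simp
  qed
  have smT: "smooth_on U (trig_approx w n \<tau> l gg)" for l unfolding trig_approx_def by (rule smooth_on_tri)
  have smp: "smooth_on U \<phi>" using smooth_on_subset[OF \<Omega>(2)] U(2) S(2) Ks(2) by blast
  have fin: "cmod (partials is \<phi> x - partials is (trig_approx w n \<tau> l gg) x) \<le> 2 * (D1 * (h ^ length is * M (length is))) / 2 ^ l"
    if "x \<in> U" for "is" l x
  proof (rule partials_limit[OF U(1) smT lim _ _ that])
    fix js l y assume "y \<in> U"
    have "partials js (trig_approx w n \<tau> l gg) = mderiv (count_list js) (trig_approx w n \<tau> l gg)" for l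
      unfolding trig_approx_def by (rule partials_tri_mderiv)
    then show "cmod (partials js (trig_approx w n \<tau> (Suc l) gg) y - partials js (trig_approx w n \<tau> l gg) y) \<le> D1 * (h ^ length js * M (length js)) / 2 ^ l"
      using step[OF \<open>y \<in> U\<close>, of "count_list js" l] by (simp add: mi_abs_count_list)
  qed (use D10 h0 less_imp_le[OF pos] in auto)
  have "derivs_le M U h (2 * D1 / 2 ^ l) (\<lambda>x. \<phi> x - trig_approx w n \<tau> l gg x)" for l
    unfolding derivs_le_def
  proof (intro allI ballI)
    fix \<alpha> x assume x: "x \<in> U"
    have "mderiv \<alpha> (\<lambda>x. 1 * \<phi> x + (-1) * trig_approx w n \<tau> l gg x) x = mderiv \<alpha> \<phi> x - mderiv \<alpha> (trig_approx w n \<tau> l gg) x"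
      unfolding mderiv_eq smooth_on_lincomb(2)[OF U(1) smp smT x] by simp
    then show "cmod (mderiv \<alpha> (\<lambda>x. \<phi> x - trig_approx w n \<tau> l gg x) x) \<le> 2 * D1 / 2 ^ l * (h ^ mi_abs \<alpha> * M (mi_abs \<alpha>))"
      using fin[OF x, of "mi_list \<alpha>" l] by (simp add: mderiv_eq length_mi_list)
  qed
  then show ?thesis unfolding gg_def using D10 by (intro exI[of _ "2 * D1"]) auto
qed

subsection \<open>Measures with bounded densities\<close>

text \<open>Integration against r with respect to Lebesgue measure; the case distinction follows the
  convention that functionals vanish off their space.\<close>

definition dens :: "(real^'d::finite) set \<Rightarrow> (real^'d \<Rightarrow> complex) \<Rightarrow> (real^'d \<Rightarrow> complex) \<Rightarrow> complex" where
  "dens K r g = (if g \<in> C_space K then LINT y|lborel. g y * r y else 0)"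

lemma C_space_bdd:
  fixes K :: "(real^'d::finite) set"
  assumes "compact K" "g \<in> C_space K"
  shows "bdd_above (insert 0 ((\<lambda>x. cmod (g x)) ` K))"
proof -
  have "compact ((\<lambda>x. cmod (g x)) ` K)"
    using assms by (intro compact_continuous_image continuous_intros) (auto simp: C_space_def)
  from bounded_imp_bdd_above[OF compact_imp_bounded[OF this]] show ?thesis by simp
qed

lemma sup_norm_upper:
  fixes K :: "(real^'d::finite) set"
  assumes "compact K" "g \<in> C_space K"
  shows "cmod (g x) \<le> sup_norm K g" "0 \<le> sup_norm K g"
proof -
  note b = C_space_bdd[OF assms]
  show 0: "0 \<le> sup_norm K g" unfolding sup_norm_def by (rule cSup_upper[OF _ b]) simp
  show "cmod (g x) \<le> sup_norm K g"
  proof (cases "x \<in> K")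
    case True
    then show ?thesis unfolding sup_norm_def by (intro cSup_upper[OF _ b]) simp
  next
    case False
    then show ?thesis using assms(2) 0 by (simp add: C_space_def)
  qed
qed

lemma integrable_density:
  fixes K :: "(real^'d::finite) set"
  assumes K: "compact K" and r: "r \<in> borel_measurable borel" "\<And>y. y \<in> K \<Longrightarrow> cmod (r y) \<le> R"
    and g: "continuous_on K g" "\<And>x. x \<notin> K \<Longrightarrow> g x = 0"
  shows "integrable lborel (\<lambda>y. g y * r y)"
proof (rule Bochner_Integration.integrable_bound)
  have i: "integrable lborel g" by (rule integrable_compact_support[OF K g])
  show "integrable lborel (\<lambda>y. cmod (g y) * R)" using i by auto
  have [measurable]: "g \<in> borel_measurable borel" using borel_measurable_integrable[OF i] by simp
  show "(\<lambda>y. g y * r y) \<in> borel_measurable lborel" using r(1) by simp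
  show "AE y in lborel. cmod (g y * r y) \<le> norm (cmod (g y) * R)"
  proof (rule AE_I2)
    fix y
    show "cmod (g y * r y) \<le> norm (cmod (g y) * R)"
    proof (cases "y \<in> K")
      case True
      then have "cmod (g y * r y) \<le> cmod (g y) * R" unfolding norm_mult by (intro mult_left_mono r(2)) auto
      then show ?thesis by simp
    qed (simp add: g(2))
  qed
qed

lemma density_bound:
  fixes K :: "(real^'d::finite) set"
  assumes K: "compact K" and r: "\<And>y. y \<in> K \<Longrightarrow> cmod (r y) \<le> R"
    and g: "\<And>x. x \<notin> K \<Longrightarrow> g x = 0" "\<And>x. x \<in> K \<Longrightarrow> cmod (g x) \<le> b" "b \<ge> 0"
  shows "cmod (LINT y|lborel. g y * r y) \<le> b * R * measure lborel K"
proof (rule order_trans[OF integral_norm_bound integral_compact_bound[OF K]])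
  show "cmod (g x * r x) \<le> b * R" if "x \<in> K" for x
    unfolding norm_mult by (intro mult_mono g(2) r that) (use g(3) in auto)
qed (use g(1) in simp)

lemma C_space_lincomb:
  "f \<in> C_space K \<Longrightarrow> g \<in> C_space K \<Longrightarrow> (\<lambda>x. a * f x + b * g x) \<in> C_space K"
  unfolding C_space_def by (auto intro!: continuous_intros)

text \<open>One estimate, of the integral of the modulus of the density by R times the volume of
  \<open>K\<close>, gives both continuity and the norm.\<close>

lemma dens_dual:
  fixes K :: "(real^'d::finite) set"
  assumes K: "compact K" and r: "r \<in> borel_measurable borel" "\<And>y. y \<in> K \<Longrightarrow> cmod (r y) \<le> R" "R \<ge> 0"
  shows "dens K r \<in> C_dual K" and "C_dual_norm K (dens K r) \<le> R * measure lborel K"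
proof -
  define T where "T = lc_topology (C_space K) {sup_norm K}"
  define m where "m = R * measure lborel K"
  have m0: "m \<ge> 0" unfolding m_def using r(3) by simp
  have top: "topspace T = C_space K" unfolding T_def by (rule topspace_lc_topology)
  have int: "integrable lborel (\<lambda>y. g y * r y)" if "g \<in> C_space K" for g
    by (rule integrable_density[OF K r(1,2)]) (use that in \<open>auto simp: C_space_def\<close>)
  have lin: "dens K r (\<lambda>x. a * f x + b * g x) = a * dens K r f + b * dens K r g"
    if "f \<in> C_space K" "g \<in> C_space K" for a b f g
  proof -
    have "(\<lambda>y. (a * f y + b * g y) * r y) = (\<lambda>y. a * (f y * r y) + b * (g y * r y))"
      by (auto simp: algebra_simps)
    then show ?thesis
      unfolding dens_def using that C_space_lincomb[OF that, of a b]
      by (simp add: int integrable_mult_right)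
  qed
  have bound: "cmod (dens K r g) \<le> sup_norm K g * m" if "g \<in> C_space K" for g
    unfolding dens_def m_def mult.assoc[symmetric] using that sup_norm_upper[OF K that]
    by (simp, intro density_bound[OF K r(2)]) (auto simp: C_space_def)
  have "continuous_map T euclidean (dens K r)"
    unfolding continuous_map_def
  proof (intro conjI allI impI)
    fix U :: "complex set" assume "openin euclidean U"
    then have U: "open U" by simp
    show "openin T {x \<in> topspace T. dens K r x \<in> U}"
      unfolding top unfolding T_def openin_lc_topology
    proof (intro conjI ballI)
      fix x assume x: "x \<in> {x \<in> C_space K. dens K r x \<in> U}"
      obtain e where e: "e > 0" "ball (dens K r x) e \<subseteq> U" using U x unfolding open_contains_ball by blast
      have "{y \<in> C_space K. \<forall>p\<in>{sup_norm K}. p (y - x) < e / (m + 1)} \<subseteq> {x \<in> C_space K. dens K r x \<in> U}"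
      proof clarsimp
        fix y assume y: "y \<in> C_space K" "sup_norm K (y - x) < e / (m + 1)"
        have yx: "y - x = (\<lambda>z. 1 * y z + (-1) * x z)" by (auto simp: fun_diff_def)
        have yxC: "y - x \<in> C_space K" unfolding yx using x y by (intro C_space_lincomb) auto
        have "dens K r (y - x) = dens K r y - dens K r x"
          unfolding yx using lin[of y x 1 "-1"] x y by simp
        then have "cmod (dens K r y - dens K r x) \<le> sup_norm K (y - x) * m" using bound[OF yxC] by simp
        also have "\<dots> \<le> sup_norm K (y - x) * (m + 1)"
          using sup_norm_upper(2)[OF K yxC] by (intro mult_left_mono) auto
        also have "\<dots> < e" using y(2) m0 by (simp add: pos_less_divide_eq)
        finally have "dens K r y \<in> ball (dens K r x) e" by (simp add: dist_norm norm_minus_commute)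
        then show "dens K r y \<in> U" using e(2) by blast
      qed
      then show "\<exists>F \<epsilon>. finite F \<and> F \<subseteq> {sup_norm K} \<and> 0 < \<epsilon> \<and>
          {y \<in> C_space K. \<forall>p\<in>F. p (y - x) < \<epsilon>} \<subseteq> {x \<in> C_space K. dens K r x \<in> U}"
        using e(1) m0 by (intro exI[of _ "{sup_norm K}"] exI[of _ "e / (m + 1)"]) auto
    qed auto
  qed simp
  then show "dens K r \<in> C_dual K"
    unfolding C_dual_def T_def[symmetric] top_dual_def top
    using lin[of _ _ 1 1] lin[of _ _ _ 0] by (auto simp: dens_def)
  have z: "(\<lambda>x. 0) \<in> {g \<in> C_space K. sup_norm K g \<le> 1}"
  proof -
    have "sup_norm K (\<lambda>x. 0) = 0"
      unfolding sup_norm_def by (cases "K = {}") (auto simp: image_constant_conv)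
    then show ?thesis by (simp add: C_space_def)
  qed
  show "C_dual_norm K (dens K r) \<le> R * measure lborel K"
    unfolding C_dual_norm_def m_def[symmetric]
  proof (rule cSUP_least)
    show "{g \<in> C_space K. sup_norm K g \<le> 1} \<noteq> {}" using z by blast
    fix g assume "g \<in> {g \<in> C_space K. sup_norm K g \<le> 1}"
    then have "cmod (dens K r g) \<le> sup_norm K g * m" "sup_norm K g * m \<le> 1 * m"
      using bound mult_right_mono[OF _ m0, of "sup_norm K g" 1] by auto
    then show "cmod (dens K r g) \<le> m" by simp
  qed
qed


subsection \<open>Regrouping\<close>

text \<open>A finite set of multi-indices lies in a cube, over which the sum is a product of
  geometric sums, each at most 2.\<close>

lemma multi_index_summable: "(\<lambda>\<alpha>::'d::finite multi_index. (1/2::real) ^ mi_abs \<alpha>) summable_on UNIV"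
proof (rule nonneg_bdd_above_summable_on)
  show "bdd_above (sum (\<lambda>\<alpha>::'d multi_index. (1/2::real) ^ mi_abs \<alpha>) ` {F. F \<subseteq> UNIV \<and> finite F})"
  proof (rule bdd_aboveI2)
    fix F :: "'d multi_index set" assume "F \<in> {F. F \<subseteq> UNIV \<and> finite F}"
    then have F: "finite F" by simp
    define N where "N = Max (insert 0 (mi_abs ` F))"
    have "\<alpha> i \<le> N" if "\<alpha> \<in> F" for \<alpha> i
    proof -
      have "\<alpha> i \<le> mi_abs \<alpha>" unfolding mi_abs_def by (rule member_le_sum) auto
      also have "\<dots> \<le> N" unfolding N_def using F that by (intro Max_ge) auto
      finally show ?thesis .
    qed
    then have sub: "F \<subseteq> PiE UNIV (\<lambda>_. {..N})" by auto
    have "sum (\<lambda>\<alpha>. (1/2::real) ^ mi_abs \<alpha>) F \<le> sum (\<lambda>\<alpha>::'d multi_index. (1/2::real) ^ mi_abs \<alpha>) (PiE UNIV (\<lambda>_. {..N}))"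
      by (rule sum_mono2[OF _ sub]) (auto intro: finite_PiE)
    also have "\<dots> = (\<Sum>\<alpha>\<in>PiE (UNIV::'d set) (\<lambda>_. {..N}). \<Prod>i\<in>UNIV. (1/2::real) ^ \<alpha> i)"
      by (simp add: mi_abs_def power_sum)
    also have "\<dots> = (\<Prod>i\<in>(UNIV::'d set). \<Sum>j\<le>N. (1/2::real) ^ j)"
      by (rule prod_sum_PiE[symmetric]) auto
    also have "\<dots> \<le> (\<Prod>i\<in>(UNIV::'d set). 2)"
    proof (rule prod_mono)
      have "(\<Sum>j\<le>N. (1/2::real) ^ j) \<le> (\<Sum>j. (1/2::real) ^ j)"
        by (rule sum_le_suminf) (auto simp: summable_geometric)
      then show "0 \<le> (\<Sum>j\<le>N. (1/2::real) ^ j) \<and> (\<Sum>j\<le>N. (1/2::real) ^ j) \<le> 2" for i :: 'd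
        by (auto simp: suminf_geometric intro: sum_nonneg)
    qed
    finally show "sum (\<lambda>\<alpha>. (1/2::real) ^ mi_abs \<alpha>) F \<le> (\<Prod>i\<in>(UNIV::'d set). 2)" .
  qed
qed simp

text \<open>The family is absolutely summable over the pairs (l, \<alpha>), so finite sums along
  \<alpha> followed by the series in l agree with series in l followed by the sum over \<alpha>. The
  bound on the total is kept for a later passage to the limit.\<close>

lemma regroup_sums:
  fixes a :: "nat \<Rightarrow> 'd::finite multi_index \<Rightarrow> complex"
  assumes bound: "\<And>l \<alpha>. cmod (a l \<alpha>) \<le> B * (1/2) ^ l * (1/2) ^ mi_abs \<alpha>" "B \<ge> 0"
    and fin: "\<And>l. finite (A l)" "\<And>l \<alpha>. \<alpha> \<notin> A l \<Longrightarrow> a l \<alpha> = 0"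
    and s: "\<And>\<alpha>. (\<lambda>l. a l \<alpha>) sums b \<alpha>"
  shows "\<exists>S. (b has_sum S) UNIV \<and> (\<lambda>l. \<Sum>\<alpha>\<in>A l. a l \<alpha>) sums S \<and>
    cmod S \<le> B * (2 * (\<Sum>\<^sub>\<infinity>\<alpha>::'d multi_index. (1/2::real) ^ mi_abs \<alpha>))"
proof -
  define z where "z \<alpha> = (1/2::real) ^ mi_abs \<alpha>" for \<alpha> :: "'d multi_index"
  define Z where "Z = (\<Sum>\<^sub>\<infinity>\<alpha>. z \<alpha>)"
  have zs: "(z has_sum Z) UNIV" unfolding Z_def z_def using multi_index_summable by (rule has_sum_infsum)
  have geo: "(\<lambda>l. B * Z * (1/2) ^ l) sums (B * Z * 2)"
    using geometric_sums[of "1/2::real"] by (intro sums_mult) simp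
  have Z0: "Z \<ge> 0" unfolding Z_def z_def by (rule infsum_nonneg) simp
  define G where "G = (\<lambda>(l::nat, \<alpha>). B * (1/2) ^ l * z \<alpha>)"
  have inner: "((\<lambda>\<alpha>. G (l, \<alpha>)) has_sum (B * (1/2) ^ l * Z)) UNIV" for l
    unfolding G_def using has_sum_cmult_right[OF zs, of "B * (1/2) ^ l"] by simp
  have "G summable_on (Sigma UNIV (\<lambda>_. UNIV))"
  proof (rule summable_on_SigmaI[OF inner])
    show "(\<lambda>l. B * (1/2) ^ l * Z) summable_on UNIV"
      using geo bound(2) Z0 by (subst summable_on_UNIV_nonneg_real_iff) (auto simp: mult_ac sums_iff)
  qed (use bound(2) in \<open>auto simp: G_def z_def\<close>)
  then have "(\<lambda>x. norm (G x)) summable_on (Sigma UNIV (\<lambda>_. UNIV))"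
    using bound(2) by (simp add: G_def z_def case_prod_unfold)
  then have "(\<lambda>x. norm ((\<lambda>(l, \<alpha>). a l \<alpha>) x)) summable_on (Sigma UNIV (\<lambda>_. UNIV))"
    by (rule Infinite_Sum.abs_summable_on_comparison_test[where g=G and f="\<lambda>(l, \<alpha>). a l \<alpha>"])
      (use bound in \<open>auto simp: G_def z_def\<close>)
  from has_sum_infsum[OF abs_summable_summable[OF this]]
  obtain S where S: "((\<lambda>(l, \<alpha>). a l \<alpha>) has_sum S) (UNIV \<times> UNIV)" by blast
  have A: "((\<lambda>\<alpha>. a l \<alpha>) has_sum (\<Sum>\<alpha>\<in>A l. a l \<alpha>)) UNIV" for l
    by (rule has_sum_cong_neutral[THEN iffD1, OF _ _ _ has_sum_finite[OF fin(1)]]) (use fin(2) in auto)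
  have "((\<lambda>l. \<Sum>\<alpha>\<in>A l. a l \<alpha>) has_sum S) UNIV"
    by (rule has_sum_SigmaD[OF S]) (use A in simp)
  then have s1: "(\<lambda>l. \<Sum>\<alpha>\<in>A l. a l \<alpha>) sums S" by (rule has_sum_imp_sums)
  have col: "((\<lambda>l. a l \<alpha>) has_sum b \<alpha>) UNIV" for \<alpha>
  proof (rule norm_summable_imp_has_sum[OF _ s])
    have "summable (\<lambda>l. B * z \<alpha> * (1/2) ^ l)" by (intro summable_mult summable_geometric) simp
    then show "summable (\<lambda>l. cmod (a l \<alpha>))"
      by (rule summable_comparison_test[rotated]) (use bound in \<open>auto simp: z_def mult_ac\<close>)
  qed
  have "((\<lambda>(\<alpha>, l). a l \<alpha>) has_sum S) (UNIV \<times> UNIV)"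
    using S by (subst (asm) has_sum_swap) (simp add: case_prod_unfold)
  then have s2: "(b has_sum S) UNIV"
    by (rule has_sum_SigmaD) (use col in simp)
  have "cmod (\<Sum>\<alpha>\<in>A l. a l \<alpha>) \<le> B * Z * (1/2) ^ l" for l
  proof -
    have "cmod (\<Sum>\<alpha>\<in>A l. a l \<alpha>) \<le> (\<Sum>\<alpha>\<in>A l. B * (1/2) ^ l * z \<alpha>)"
      using bound by (intro sum_norm_le) (simp add: z_def)
    also have "\<dots> = B * (1/2) ^ l * (\<Sum>\<alpha>\<in>A l. z \<alpha>)" by (simp add: sum_distrib_left)
    also have "\<dots> \<le> B * (1/2) ^ l * Z"
    proof (rule mult_left_mono)
      have "(\<Sum>\<alpha>\<in>A l. z \<alpha>) \<le> infsum z UNIV"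
        by (rule finite_sum_le_infsum[OF has_sum_imp_summable[OF zs] fin(1)]) (auto simp: z_def)
      then show "(\<Sum>\<alpha>\<in>A l. z \<alpha>) \<le> Z" by (simp add: Z_def)
    qed (use bound(2) in simp)
    finally show ?thesis by (simp add: mult_ac)
  qed
  then have "cmod (\<Sum>l. \<Sum>\<alpha>\<in>A l. a l \<alpha>) \<le> (\<Sum>l. B * Z * (1/2) ^ l)"
    using geo by (intro norm_suminf_le) (auto simp: sums_iff)
  then have "cmod S \<le> B * Z * 2" using s1 geo by (simp add: sums_iff)
  then show ?thesis using s1 s2 unfolding Z_def z_def by (intro exI[of _ S]) (simp add: mult_ac)
qed

text \<open>The density rate 1 / (2 * g) against the derivative rate g leaves (1/2) ^ |\<alpha>|,
  which is summable over all multi-indices. The final estimate, linear in \<open>c\<close>,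
  expresses continuity of the series in \<phi>.\<close>

lemma density_series:
  fixes \<rho> :: "nat \<Rightarrow> 'd::finite multi_index \<Rightarrow> real^'d \<Rightarrow> complex"
  assumes M: "\<And>p. M p > 0" and K: "compact K" "K \<subseteq> \<Omega>" and \<Omega>: "open \<Omega>" "smooth_on \<Omega> \<phi>"
    and \<rho>: "\<And>l \<alpha>. \<rho> l \<alpha> \<in> borel_measurable borel" "\<And>l. finite (A l)" "\<And>l \<alpha> y. \<alpha> \<notin> A l \<Longrightarrow> \<rho> l \<alpha> y = 0"
    and \<rho>b: "\<And>l \<alpha> y. y \<in> K \<Longrightarrow> cmod (\<rho> l \<alpha> y) \<le> C / 2 ^ l * ((1 / (2 * g)) ^ mi_abs \<alpha> / M (mi_abs \<alpha>))" "C \<ge> 0" "g > 0"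
    and b: "derivs_le M K g c \<phi>" "c \<ge> 0"
  shows "\<exists>S. ((\<lambda>\<alpha>. LINT y|lborel. restr K (mderiv \<alpha> \<phi>) y * (\<Sum>l. \<rho> l \<alpha> y)) has_sum S) UNIV \<and>
    (\<lambda>l. \<Sum>\<alpha>\<in>A l. LINT y|lborel. restr K (mderiv \<alpha> \<phi>) y * \<rho> l \<alpha> y) sums S \<and>
    cmod S \<le> c * C * measure lborel K * (2 * (\<Sum>\<^sub>\<infinity>\<alpha>::'d multi_index. (1/2::real) ^ mi_abs \<alpha>))"
proof (rule regroup_sums)
  have cont: "continuous_on K (restr K (mderiv \<alpha> \<phi>))" for \<alpha>
    by (rule continuous_on_eq[OF continuous_on_subset[OF smooth_on_mderiv_continuous[OF \<Omega>(2)] K(2)]]) (simp add: restr_def)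
  have int: "integrable lborel (\<lambda>y. restr K (mderiv \<alpha> \<phi>) y * \<rho> l \<alpha> y)" for l \<alpha>
    by (rule integrable_density[OF K(1) \<rho>(1) \<rho>b(1) cont]) (simp_all add: restr_def)
  have gM: "(g ^ mi_abs \<alpha> * M (mi_abs \<alpha>)) * ((1 / (2 * g)) ^ mi_abs \<alpha> / M (mi_abs \<alpha>)) = (1/2) ^ mi_abs \<alpha>" for \<alpha> :: "'d multi_index"
  proof -
    have "g * (1 / (2 * g)) = 1/2" using \<rho>b(3) by simp
    then have "g ^ mi_abs \<alpha> * (1 / (2 * g)) ^ mi_abs \<alpha> = (1/2) ^ mi_abs \<alpha>"
      by (simp only: power_mult_distrib[symmetric])
    moreover have "(g ^ mi_abs \<alpha> * M (mi_abs \<alpha>)) * ((1 / (2 * g)) ^ mi_abs \<alpha> / M (mi_abs \<alpha>))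
        = (g ^ mi_abs \<alpha> * (1 / (2 * g)) ^ mi_abs \<alpha>) * (M (mi_abs \<alpha>) / M (mi_abs \<alpha>))"
      by (simp only: times_divide_eq_right times_divide_eq_left mult_ac)
    ultimately show ?thesis using M[of "mi_abs \<alpha>"] by simp
  qed
  have bb: "cmod (restr K (mderiv \<alpha> \<phi>) y) \<le> c * (g ^ mi_abs \<alpha> * M (mi_abs \<alpha>))" if "y \<in> K" for y \<alpha>
    using derivs_leD[OF b(1) that, of \<alpha>] that by (simp add: restr_def)
  have ptw: "cmod (restr K (mderiv \<alpha> \<phi>) y * \<rho> l \<alpha> y) \<le> c * C / 2 ^ l * (1/2) ^ mi_abs \<alpha>" if y: "y \<in> K" for l \<alpha> y
  proof -
    have "cmod (restr K (mderiv \<alpha> \<phi>) y * \<rho> l \<alpha> y)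
        \<le> (c * (g ^ mi_abs \<alpha> * M (mi_abs \<alpha>))) * (C / 2 ^ l * ((1 / (2 * g)) ^ mi_abs \<alpha> / M (mi_abs \<alpha>)))"
      unfolding norm_mult by (intro mult_mono bb[OF y] \<rho>b(1)[OF y]) (use b(2) \<rho>b(3) less_imp_le[OF M] in auto)
    also have "\<dots> = c * C / 2 ^ l * ((g ^ mi_abs \<alpha> * M (mi_abs \<alpha>)) * ((1 / (2 * g)) ^ mi_abs \<alpha> / M (mi_abs \<alpha>)))"
      by simp
    finally show ?thesis unfolding gM .
  qed
  have nI: "(LINT y|lborel. cmod (restr K (mderiv \<alpha> \<phi>) y * \<rho> l \<alpha> y)) \<le> c * C / 2 ^ l * (1/2) ^ mi_abs \<alpha> * measure lborel K" for l \<alpha>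
    by (rule integral_compact_bound[OF K(1) _ ptw]) (simp add: restr_def)
  show "cmod (LINT y|lborel. restr K (mderiv \<alpha> \<phi>) y * \<rho> l \<alpha> y) \<le> (c * C * measure lborel K) * (1/2) ^ l * (1/2) ^ mi_abs \<alpha>" for l \<alpha>
    using order_trans[OF integral_norm_bound nI, of \<alpha> l] by (simp add: power_one_over mult_ac)
  show "(\<lambda>l. LINT y|lborel. restr K (mderiv \<alpha> \<phi>) y * \<rho> l \<alpha> y) sums (LINT y|lborel. restr K (mderiv \<alpha> \<phi>) y * (\<Sum>l. \<rho> l \<alpha> y))" for \<alpha>
  proof -
    have su: "summable (\<lambda>l. cmod (restr K (mderiv \<alpha> \<phi>) y * \<rho> l \<alpha> y))" for y
    proof (cases "y \<in> K")
      case True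
      have "summable (\<lambda>l. c * C * (1/2) ^ mi_abs \<alpha> * (1/2) ^ l)" by (intro summable_mult summable_geometric) simp
      then show ?thesis
        by (rule summable_comparison_test[rotated]) (use ptw[OF True] in \<open>auto simp: power_one_over mult_ac\<close>)
    qed (simp add: restr_def)
    have "summable (\<lambda>l. c * C * (1/2) ^ mi_abs \<alpha> * measure lborel K * (1/2) ^ l)" by (intro summable_mult summable_geometric) simp
    then have "summable (\<lambda>l. LINT y|lborel. cmod (restr K (mderiv \<alpha> \<phi>) y * \<rho> l \<alpha> y))"
      by (rule summable_comparison_test[rotated])
        (use nI in \<open>auto simp: power_one_over mult_ac intro!: exI[of _ 0] integral_nonneg_AE\<close>)
    from sums_integral[OF int _ this]
    have "(\<lambda>l. LINT y|lborel. restr K (mderiv \<alpha> \<phi>) y * \<rho> l \<alpha> y) sums (LINT y|lborel. (\<Sum>l. restr K (mderiv \<alpha> \<phi>) y * \<rho> l \<alpha> y))"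
      using su by simp
    also have "(LINT y|lborel. (\<Sum>l. restr K (mderiv \<alpha> \<phi>) y * \<rho> l \<alpha> y)) = (LINT y|lborel. restr K (mderiv \<alpha> \<phi>) y * (\<Sum>l. \<rho> l \<alpha> y))"
    proof (rule Bochner_Integration.integral_cong[OF refl])
      fix y
      show "(\<Sum>l. restr K (mderiv \<alpha> \<phi>) y * \<rho> l \<alpha> y) = restr K (mderiv \<alpha> \<phi>) y * (\<Sum>l. \<rho> l \<alpha> y)"
      proof (cases "restr K (mderiv \<alpha> \<phi>) y = 0")
        case False
        have "summable (\<lambda>l. \<rho> l \<alpha> y)"
          using summable_norm_cancel[OF su[of y]] False by (simp add: summable_mult_D)
        then show ?thesis by (rule suminf_mult)
      qed simp
    qed
    finally show ?thesis .
  qed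
qed (use \<rho>(2,3) b(2) \<rho>b(2) in auto)

subsection \<open>Functionals on trigonometric sums\<close>

lemma derivs_le_restr:
  assumes "U \<subseteq> \<Omega>" "open \<Omega>" shows "derivs_le M U h C (restr \<Omega> f) \<longleftrightarrow> derivs_le M U h C f"
proof -
  have "mderiv \<alpha> (restr \<Omega> f) x = mderiv \<alpha> f x" if "x \<in> U" for \<alpha> x
    by (rule mderiv_restr) (use that assms in \<open>auto simp: interior_open\<close>)
  then show ?thesis by (simp add: derivs_le_def)
qed

text \<open>Derivatives of order p grow at most geometrically, and M_p dominates every geometric
  sequence. The constant is uniform in \<open>U\<close>, so one bound serves a whole
  exhaustion.\<close>

lemma trig_sum_bd:
  fixes A :: "('d::finite \<Rightarrow> int) \<Rightarrow> complex"
  assumes W: "weight_sequence M" and \<tau>: "\<tau> \<ge> 0"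
  shows "\<exists>C\<ge>0. \<forall>U. derivs_le M U 1 C (trig_sum B \<tau> A)"
proof -
  obtain C where C: "C > 0" "\<And>j. (\<tau> * real B + 1) ^ j \<le> C * M j"
    using weight_growth[OF W, of "\<tau> * real B + 1"] \<tau> by (auto simp: add_nonneg_pos)
  define D where "D = (\<Sum>k\<in>(freq_box B :: ('d \<Rightarrow> int) set). cmod (A k))"
  have D0: "D \<ge> 0" unfolding D_def by (rule sum_nonneg) simp
  have "cmod (mderiv \<alpha> (trig_sum B \<tau> A) x) \<le> D * C * (1 ^ mi_abs \<alpha> * M (mi_abs \<alpha>))" for \<alpha> x
  proof -
    have "cmod (mderiv \<alpha> (trig_sum B \<tau> A) x) \<le> (\<Sum>k\<in>(freq_box B :: ('d \<Rightarrow> int) set). cmod (A k) * (\<tau> * real B) ^ mi_abs \<alpha>)"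
      unfolding mderiv_tri unfolding trig_sum_def
    proof (rule order_trans[OF norm_sum sum_mono])
      fix k :: "'d \<Rightarrow> int" assume "k \<in> freq_box B"
      then show "cmod (A k * (\<Prod>i\<in>UNIV. (\<i> * of_real \<tau> * of_int (k i)) ^ \<alpha> i) * wave \<tau> k x) \<le> cmod (A k) * (\<tau> * real B) ^ mi_abs \<alpha>"
        unfolding norm_mult[of "_ * _"] norm_mult[of "A k"] norm_ee mult_1_right
        by (intro mult_left_mono norm_freq_le \<tau>) auto
    qed
    also have "\<dots> = D * (\<tau> * real B) ^ mi_abs \<alpha>" by (simp add: D_def sum_distrib_right)
    also have "\<dots> \<le> D * (\<tau> * real B + 1) ^ mi_abs \<alpha>"
      using \<tau> D0 by (intro mult_left_mono power_mono) auto
    also have "\<dots> \<le> D * (C * M (mi_abs \<alpha>))" by (intro mult_left_mono C D0)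
    finally show ?thesis by simp
  qed
  then show ?thesis using D0 C(1) by (intro exI[of _ "D * C"]) (auto simp: derivs_le_def)
qed

lemma restr_tri_E_open:
  assumes W: "weight_sequence M" and \<Omega>: "open \<Omega>" and \<tau>: "\<tau> \<ge> 0"
  shows "restr \<Omega> (trig_sum B \<tau> A) \<in> E_open M \<Omega>"
proof -
  obtain C where C: "C \<ge> 0" "\<And>U. derivs_le M U 1 C (trig_sum B \<tau> A)" using trig_sum_bd[OF W \<tau>] by blast
  have "smooth_on \<Omega> (restr \<Omega> (trig_sum B \<tau> A))"
    by (rule smooth_on_cong_open[OF \<Omega> _ smooth_on_tri]) (simp add: restr_def)
  moreover have "derivs_le M (interior K) 1 C (restr \<Omega> (trig_sum B \<tau> A))" if "K \<subseteq> \<Omega>" for K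
    using derivs_le_restr[OF _ \<Omega>, of "interior K"] C(2) that interior_subset by blast
  ultimately show ?thesis
    unfolding E_open_iff[OF \<Omega> weight_pos[OF W]]
    using C(1) by (intro conjI allI impI exI[of _ "1::real"] exI[of _ C]) (auto simp: restr_def)
qed

definition wave_on :: "(real^'d::finite) set \<Rightarrow> real \<Rightarrow> ('d \<Rightarrow> int) \<Rightarrow> real^'d \<Rightarrow> complex" where
  "wave_on \<Omega> \<tau> k = restr \<Omega> (wave \<tau> k)"

lemma wave_tri: "k \<in> freq_box B \<Longrightarrow> wave \<tau> k = trig_sum B \<tau> (\<lambda>k'. if k' = k then 1 else 0)"
proof
  fix x assume k: "k \<in> freq_box B"
  have "trig_sum B \<tau> (\<lambda>k'. if k' = k then 1 else 0) x = (\<Sum>k'\<in>freq_box B. if k' = k then wave \<tau> k' x else 0)"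
    unfolding trig_sum_def by (intro sum.cong) auto
  then show "wave \<tau> k x = trig_sum B \<tau> (\<lambda>k'. if k' = k then 1 else 0) x"
    using k by (simp add: sum.delta)
qed

lemma freq_box_exhaust: "\<exists>B. k \<in> freq_box B"
proof -
  have "\<bar>k i\<bar> \<le> int (nat (\<Sum>i\<in>UNIV. \<bar>k i\<bar>))" for i
    using member_le_sum[of i UNIV "\<lambda>i. \<bar>k i\<bar>"] by (simp add: sum_nonneg)
  then have "k \<in> freq_box (nat (\<Sum>i\<in>UNIV. \<bar>k i\<bar>))" unfolding freq_box_iff by blast
  then show ?thesis by blast
qed

lemma wave_on_E_open:
  assumes "weight_sequence M" "open \<Omega>" "\<tau> \<ge> 0" shows "wave_on \<Omega> \<tau> k \<in> E_open M \<Omega>"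
  using freq_box_exhaust[of k] restr_tri_E_open[OF assms] unfolding wave_on_def by (metis wave_tri)

lemma dual_tri:
  fixes \<Omega> :: "(real^'d::finite) set"
  assumes W: "weight_sequence M" and \<Omega>: "open \<Omega>" and \<tau>: "\<tau> \<ge> 0" and f: "f \<in> top_dual (E_topology M \<Omega>)"
  shows "f (restr \<Omega> (trig_sum B \<tau> A)) = (\<Sum>k\<in>freq_box B. A k * f (wave_on \<Omega> \<tau> k))"
proof -
  note M = weight_pos[OF W]
  have "(\<lambda>x. \<Sum>k\<in>X. A k * wave_on \<Omega> \<tau> k x) \<in> E_open M \<Omega> \<and> f (\<lambda>x. \<Sum>k\<in>X. A k * wave_on \<Omega> \<tau> k x) = (\<Sum>k\<in>X. A k * f (wave_on \<Omega> \<tau> k))"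
    if "finite X" for X
    using that
  proof (induction X)
    case empty
    then show ?case using E_open_zero[OF \<Omega> M] dual_scale[OF f E_open_zero[OF \<Omega> M], of 0] by simp
  next
    case (insert k X)
    let ?s = "\<lambda>x. \<Sum>k\<in>X. A k * wave_on \<Omega> \<tau> k x"
    have e: "(\<lambda>x. \<Sum>k\<in>insert k X. A k * wave_on \<Omega> \<tau> k x) = (\<lambda>x. A k * wave_on \<Omega> \<tau> k x + 1 * ?s x)"
      using insert by simp
    show ?case
      unfolding e using insert dual_linear[OF f \<Omega> M wave_on_E_open[OF W \<Omega> \<tau>], of ?s "A k" k 1]
        E_open_lincomb[OF \<Omega> M wave_on_E_open[OF W \<Omega> \<tau>], of ?s "A k" k 1] by simp
  qed
  from conjunct2[OF this[OF finite_KS]]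
  have "f (\<lambda>x. \<Sum>k\<in>freq_box B. A k * wave_on \<Omega> \<tau> k x) = (\<Sum>k\<in>freq_box B. A k * f (wave_on \<Omega> \<tau> k))" .
  moreover have "restr \<Omega> (trig_sum B \<tau> A) = (\<lambda>x. \<Sum>k\<in>freq_box B. A k * wave_on \<Omega> \<tau> k x)"
    by (auto simp: restr_def trig_sum_def wave_on_def fun_eq_iff)
  ultimately show ?thesis by simp
qed

text \<open>Let s = N / 2 ^ l and let v be the minimum over p of s ^ p * M_p, attained at q. A wave
  with frequencies up to 10 * 2 ^ l has rate \<open>h\<close> with the constant s ^ e * A2 / v, and
  the bound on \<open>B\<close> transfers this to the values of f.\<close>

lemma exponential_growth:
  fixes \<Omega> :: "(real^'d::finite) set" and K :: "nat \<Rightarrow> (real^'d) set"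
  assumes W: "weight_sequence M" and sh: "\<And>p. M (p + (CARD('d) + 2)) \<le> A2 * H2 ^ p * M p" "A2 > 0" "H2 \<ge> 1"
    and \<Omega>: "open \<Omega>" and \<tau>: "\<tau> > 0" and K: "\<And>m. K m \<subseteq> \<Omega>"
    and G: "\<And>h. (\<And>m. h m > 0) \<Longrightarrow> \<exists>n C. C > 0 \<and> (\<forall>f\<in>B. \<forall>\<phi>\<in>E_open M \<Omega>. \<forall>c\<ge>0.
      (\<forall>m\<le>n. derivs_le M (interior (K m)) (h m) c \<phi>) \<longrightarrow> cmod (f \<phi>) \<le> C * c)"
    and N: "N > 0"
  shows "\<exists>C\<ge>0. \<forall>l. \<exists>q. \<forall>f\<in>B. \<forall>k\<in>freq_box (10 * 2 ^ l).
    (2 ^ l) ^ CARD('d) * cmod (f (wave_on \<Omega> \<tau> k)) * ((N / 2 ^ l) ^ q * M q) \<le> C / 4 ^ l"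
proof -
  note M = weight_pos[OF W]
  \<comment> \<open>The product of 10 * \<tau> * 2 ^ l, s and H2. It depends on N, so n and C do as
    well, which makes the diagonal choice below necessary.\<close>
  define h where "h = 10 * \<tau> * N * H2"
  have h0: "h > 0" unfolding h_def using \<tau> N sh(3) by simp
  obtain n C where C: "C > 0" "\<And>f \<phi> c. f \<in> B \<Longrightarrow> \<phi> \<in> E_open M \<Omega> \<Longrightarrow> c \<ge> 0 \<Longrightarrow>
      (\<And>m. m \<le> n \<Longrightarrow> derivs_le M (interior (K m)) h c \<phi>) \<Longrightarrow> cmod (f \<phi>) \<le> C * c"
    using G[of "\<lambda>_. h"] h0 by metis
  \<comment> \<open>CARD('d) powers of 1 / 2 ^ l cancel the weight (2 ^ l) ^ CARD('d), and two more
    give 1 / 4 ^ l.\<close>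
  define e where "e = CARD('d) + 2"
  have "\<exists>q. \<forall>f\<in>B. \<forall>k\<in>freq_box (10 * 2 ^ l).
      (2 ^ l) ^ CARD('d) * cmod (f (wave_on \<Omega> \<tau> k)) * ((N / 2 ^ l) ^ q * M q) \<le> C * A2 * N ^ e / 4 ^ l" for l
  proof -
    define s where "s = N / 2 ^ l"
    have s: "s > 0" unfolding s_def using N by simp
    obtain q where q: "\<And>p. s ^ q * M q \<le> s ^ p * M p" using weight_argmin[OF W s] by blast
    define v where "v = s ^ q * M q"
    have v: "v > 0" unfolding v_def using s M by simp
    define c where "c = s ^ e * A2 / v"
    have c0: "c \<ge> 0" unfolding c_def using s v sh(2) by simp
    have "(2 ^ l) ^ CARD('d) * cmod (f (wave_on \<Omega> \<tau> k)) * v \<le> C * A2 * N ^ e / 4 ^ l"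
      if f: "f \<in> B" and k: "k \<in> freq_box (10 * 2 ^ l)" for f k
    proof -
      have "derivs_le M (interior (K m)) h c (wave_on \<Omega> \<tau> k)" for m
      proof -
        have "interior (K m) \<subseteq> \<Omega>" using K interior_subset by blast
        moreover have "derivs_le M (interior (K m)) h c (wave \<tau> k)"
          unfolding derivs_le_def
        proof (intro allI ballI)
          fix \<alpha> :: "'d multi_index" and x
          define p where "p = mi_abs \<alpha>"
          have "cmod (mderiv \<alpha> (wave \<tau> k) x) \<le> (\<tau> * real (10 * 2 ^ l)) ^ p"
            unfolding wave_tri[OF k] mderiv_tri unfolding trig_sum_def p_def
            using norm_freq_le[OF k less_imp_le[OF \<tau>], of \<alpha>] k
            by (simp add: if_distrib[of "\<lambda>x. x * _"] sum.delta norm_mult cong: if_cong)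
          also have "\<dots> \<le> c * (h ^ p * M p)"
          proof -
            have "v \<le> s ^ (p + e) * M (p + e)" unfolding v_def by (rule q)
            also have "\<dots> \<le> s ^ (p + e) * (A2 * H2 ^ p * M p)"
              using s sh(1)[of p] unfolding e_def by (intro mult_left_mono) auto
            finally have "(\<tau> * real (10 * 2 ^ l)) ^ p * v \<le> (\<tau> * real (10 * 2 ^ l)) ^ p * (s ^ (p + e) * (A2 * H2 ^ p * M p))"
              using \<tau> by (intro mult_left_mono) auto
            also have "\<dots> = s ^ e * A2 * ((\<tau> * real (10 * 2 ^ l) * s * H2) ^ p * M p)"
              by (simp add: power_add power_mult_distrib mult_ac)
            also have "\<tau> * real (10 * 2 ^ l) * s * H2 = h" unfolding h_def s_def by simp
            finally show ?thesis using v unfolding c_def by (simp add: le_divide_eq)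
          qed
          finally show "cmod (mderiv \<alpha> (wave \<tau> k) x) \<le> c * (h ^ mi_abs \<alpha> * M (mi_abs \<alpha>))" unfolding p_def .
        qed
        ultimately show ?thesis unfolding wave_on_def using derivs_le_restr[OF _ \<Omega>] by blast
      qed
      then have "cmod (f (wave_on \<Omega> \<tau> k)) \<le> C * c"
        by (intro C(2)[OF f wave_on_E_open[OF W \<Omega> less_imp_le[OF \<tau>]] c0])
      then have "(2 ^ l) ^ CARD('d) * cmod (f (wave_on \<Omega> \<tau> k)) * v \<le> (2 ^ l) ^ CARD('d) * (C * c) * v"
        using v by (intro mult_right_mono mult_left_mono) auto
      also have "\<dots> = C * A2 * ((2 ^ l) ^ CARD('d) * s ^ e)" using v by (simp add: c_def)
      also have "(2 ^ l) ^ CARD('d) * s ^ e = N ^ e / 4 ^ l"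
      proof -
        have "(4::real) ^ l = (2 ^ l)\<^sup>2" by (simp add: power2_eq_square power_mult_distrib[symmetric])
        then show ?thesis unfolding s_def e_def by (simp add: power_divide power_add power2_eq_square)
      qed
      finally show ?thesis by simp
    qed
    then show ?thesis unfolding v_def s_def by blast
  qed
  moreover have "C * A2 * N ^ e \<ge> 0" using C(1) sh(2) N by simp
  ultimately show ?thesis by blast
qed

text \<open>Diagonal choice of the order of differentiation on the frequency shell \<open>l\<close>, which makes the
  estimate of the previous lemma effective for all \<open>N\<close> at once.\<close>

lemma diagonal_orders:
  fixes F :: "nat \<Rightarrow> real set"
  assumes M: "\<And>p. M p > 0" and F0: "\<And>l x. x \<in> F l \<Longrightarrow> x \<ge> 0"
    and ex: "\<And>N::real. N > 0 \<Longrightarrow> \<exists>C\<ge>0. \<forall>l. \<exists>q. \<forall>x\<in>F l. x * ((N / 2 ^ l) ^ q * M q) \<le> C / 4 ^ l"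
  shows "\<exists>q. \<forall>H>0. \<exists>C\<ge>0. \<forall>l. \<forall>x\<in>F l. x * ((H / 2 ^ l) ^ q l * M (q l)) \<le> C / 2 ^ (l::nat)"
proof -
  have "\<forall>N::nat. \<exists>C\<ge>0. \<forall>l. \<exists>q. \<forall>x\<in>F l. x * ((real (Suc N) / 2 ^ l) ^ q * M q) \<le> C / 4 ^ l"
    using ex by (simp del: of_nat_Suc)
  then obtain C q where C: "\<And>N. C N \<ge> 0"
      "\<And>N l x. x \<in> F l \<Longrightarrow> x * ((real (Suc N) / 2 ^ l) ^ q N l * M (q N l)) \<le> C N / 4 ^ l"
    by metis
  define T where "T l = {N. N \<le> l \<and> C N \<le> 2 ^ l}" for l :: nat
  define n where "n l = Max (insert 0 (T l))" for l
  have fT: "finite (T l)" for l unfolding T_def by (rule finite_subset[of _ "{..l}"]) auto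
  define Q where "Q l = q (n l) l" for l
  have "\<exists>D\<ge>0. \<forall>l. \<forall>x\<in>F l. x * ((H / 2 ^ l) ^ Q l * M (Q l)) \<le> D / 2 ^ l" if H: "H > 0" for H
  proof -
    obtain N where N: "H \<le> real (Suc N)" using real_arch_simple[of H] by (metis le_SucI of_nat_mono order_trans of_nat_le_iff le_add2 plus_1_eq_Suc)
    obtain L0 where L0: "C N \<le> 2 ^ L0" using real_arch_pow[of 2 "C N"] by (auto intro: less_imp_le)
    define L where "L = max N L0"
    have big: "x * ((H / 2 ^ l) ^ Q l * M (Q l)) \<le> 1 / 2 ^ l" if l: "l \<ge> L" and x: "x \<in> F l" for l x
    proof -
      have "C N \<le> 2 ^ l" using L0 l power_increasing[of L0 l "2::real"] unfolding L_def by linarith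
      then have NT: "N \<in> T l" using l unfolding T_def L_def by simp
      then have "N \<le> n l" unfolding n_def using fT by (intro Max_ge) auto
      have "n l \<in> T l"
      proof -
        have "n l \<in> insert 0 (T l)" unfolding n_def by (rule Max_in) (use fT in auto)
        moreover have "n l = 0 \<Longrightarrow> N = 0" using \<open>N \<le> n l\<close> by simp
        ultimately show ?thesis using NT by auto
      qed
      then have Cn: "C (n l) \<le> 2 ^ l" by (simp add: T_def)
      have "x * ((H / 2 ^ l) ^ Q l * M (Q l)) \<le> x * ((real (Suc (n l)) / 2 ^ l) ^ Q l * M (Q l))"
        using F0[OF x] H N \<open>N \<le> n l\<close> less_imp_le[OF M]
        by (intro mult_left_mono mult_right_mono power_mono divide_right_mono) auto
      also have "\<dots> \<le> C (n l) / 4 ^ l" unfolding Q_def by (rule C(2)[OF x])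
      also have "\<dots> \<le> 2 ^ l / 4 ^ l" using Cn by (rule divide_right_mono) simp
      also have "\<dots> = 1 / 2 ^ l" by (simp add: power_divide[symmetric] power_one_over)
      finally show ?thesis .
    qed
    \<comment> \<open>On a single shell the estimate with index 0 bounds all elements of
      \<open>F l\<close>, so some constant works; this is used for the finitely many shells below
      L.\<close>
    have "\<exists>Y\<ge>0. \<forall>x\<in>F l. x * ((H / 2 ^ l) ^ Q l * M (Q l)) \<le> Y" for l
    proof -
      define v where "v = (real (Suc 0) / 2 ^ l) ^ q 0 l * M (q 0 l)"
      have v: "v > 0" unfolding v_def using M by simp
      have "x * ((H / 2 ^ l) ^ Q l * M (Q l)) \<le> C 0 / 4 ^ l / v * ((H / 2 ^ l) ^ Q l * M (Q l))" if x: "x \<in> F l" for x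
      proof (rule mult_right_mono)
        show "x \<le> C 0 / 4 ^ l / v" using C(2)[OF x, of 0] v unfolding v_def[symmetric] by (simp add: le_divide_eq mult_ac)
        show "0 \<le> (H / 2 ^ l) ^ Q l * M (Q l)" using H less_imp_le[OF M] by simp
      qed
      moreover have "C 0 / 4 ^ l / v * ((H / 2 ^ l) ^ Q l * M (Q l)) \<ge> 0" using C(1) v H less_imp_le[OF M] by simp
      ultimately show ?thesis by blast
    qed
    then obtain Y where Y: "\<And>l. Y l \<ge> 0" "\<And>l x. x \<in> F l \<Longrightarrow> x * ((H / 2 ^ l) ^ Q l * M (Q l)) \<le> Y l" by metis
    define D where "D = 1 + (\<Sum>l<L. Y l * 2 ^ l)"
    have s0: "(\<Sum>l<L. Y l * 2 ^ l) \<ge> 0" using Y(1) by (intro sum_nonneg) simp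
    have "x * ((H / 2 ^ l) ^ Q l * M (Q l)) \<le> D / 2 ^ l" if x: "x \<in> F l" for l x
    proof (cases "l \<ge> L")
      case True
      then show ?thesis using big[OF True x] s0 unfolding D_def by (simp add: add_divide_distrib add_increasing2)
    next
      case False
      then have "Y l * 2 ^ l \<le> (\<Sum>l<L. Y l * 2 ^ l)" using Y(1) by (intro member_le_sum) auto
      then have "Y l \<le> D / 2 ^ l" unfolding D_def by (simp add: le_divide_eq)
      then show ?thesis using Y(2)[OF x] by linarith
    qed
    then show ?thesis using s0 unfolding D_def by (intro exI[of _ "1 + (\<Sum>l<L. Y l * 2 ^ l)"]) auto
  qed
  then show ?thesis by blast
qed


subsection \<open>The densities\<close>

text \<open>The direction in which the coefficient of frequency k is integrated by parts; the choice
  is meaningful outside the box of size 2 ^ l.\<close>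

definition large_coord :: "nat \<Rightarrow> ('d::finite \<Rightarrow> int) \<Rightarrow> 'd" where
  "large_coord l k = (SOME i. \<bar>k i\<bar> > 2 ^ l)"

lemma large_coord: "k \<notin> freq_box (2 ^ l) \<Longrightarrow> \<bar>k (large_coord l k)\<bar> > 2 ^ l"
  unfolding large_coord_def by (rule someI_ex) (auto simp: freq_box_iff not_le)

text \<open>For varying i these sets partition the frequencies at which \<open>shell_mult\<close>
  can be nonzero.\<close>

definition shell :: "nat \<Rightarrow> 'd \<Rightarrow> ('d::finite \<Rightarrow> int) set" where
  "shell l i = {k \<in> freq_box (10 * 2 ^ l) - freq_box (2 ^ l). large_coord l k = i}"

text \<open>The density \<open>rho1\<close> comes from the part of the function cut off by \<open>\<theta> = g i 0\<close>, after
  integrating by parts \<open>q\<close> times in a large coordinate \<open>i\<close> of the frequency and applying the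
  Leibniz rule; \<open>rho2\<close> comes from the remaining part, far from which the kernel is small.\<close>

definition rho1 :: "(nat \<Rightarrow> nat) \<Rightarrow> nat \<Rightarrow> real \<Rightarrow> (('d::finite \<Rightarrow> int) \<Rightarrow> complex) \<Rightarrow> nat \<Rightarrow> nat \<Rightarrow> ('d \<Rightarrow> nat \<Rightarrow> real^'d \<Rightarrow> real) \<Rightarrow> 'd \<Rightarrow> nat \<Rightarrow> real^'d \<Rightarrow> complex" where
  "rho1 w n \<tau> e l q g i a y = (\<Sum>k\<in>shell l i. of_real (shell_mult w n l k) * e k * of_real ((\<tau> / (2 * pi)) ^ CARD('d))
     / (\<i> * of_real \<tau> * of_int (k i)) ^ q * of_nat (q choose a) * of_real (g i (q - a) y) * wave \<tau> k (- y))"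

definition rho2 :: "(nat \<Rightarrow> nat) \<Rightarrow> nat \<Rightarrow> real \<Rightarrow> (('d::finite \<Rightarrow> int) \<Rightarrow> complex) \<Rightarrow> nat \<Rightarrow> (real^'d \<Rightarrow> real) \<Rightarrow> real^'d \<Rightarrow> complex" where
  "rho2 w n \<tau> e l \<theta> y = of_real (1 - \<theta> y) *
     (\<Sum>k\<in>freq_box (10 * 2 ^ l). of_real (shell_mult w n l k) * e k * of_real ((\<tau> / (2 * pi)) ^ CARD('d)) * wave \<tau> k (- y))"

text \<open>The Leibniz sum is reindexed by the order of the derivative that falls on \<phi>,
  because this order determines the multi-index to which the term contributes.\<close>

lemma leibniz_prod_restr:
  assumes "deriv_seq q A i g" "compact S" "\<And>x. x \<notin> S \<Longrightarrow> g 0 x = 0" "S \<subseteq> Ks" "Ks \<subseteq> \<Omega>"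
  shows "leibniz_prod \<Omega> g \<phi> i q y = (\<Sum>a\<le>q. of_nat (q choose a) * (of_real (g (q - a) y) * restr Ks (mderiv (pure i a) \<phi>) y))"
proof (cases "y \<in> Ks")
  case True
  then have "leibniz_prod \<Omega> g \<phi> i q y = (\<Sum>k\<le>q. of_nat (q choose k) * (of_real (g k y) * partials (replicate (q - k) i) \<phi> y))"
    using assms(5) by (auto simp: leibniz_prod_def)
  also have "\<dots> = (\<Sum>a\<le>q. of_nat (q choose a) * (of_real (g (q - a) y) * partials (replicate a i) \<phi> y))"
    by (rule sum.reindex_bij_witness[of _ "\<lambda>a. q - a" "\<lambda>k. q - k"]) (auto simp: binomial_symmetric[symmetric])
  finally show ?thesis using True by (simp add: restr_def mderiv_pure)
next
  case False
  then have "y \<notin> S" using assms(4) by blast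
  then have "g k y = 0" if "k \<le> q" for k
    using deriv_seq_zero_outside[OF assms(1) compact_imp_closed[OF assms(2)] assms(3) that] by blast
  then show ?thesis by (auto simp: leibniz_prod_def intro!: sum.neutral)
qed

text \<open>The far part stays undifferentiated, the near part is divided by (i \<tau> k_i) ^ q
  after integration by parts. In both, \<phi> enters only through its derivatives on
  \<open>Ks\<close>, and all other factors are collected in densities independent of \<phi>.\<close>

lemma density_term:
  fixes \<phi> :: "real^'d::finite \<Rightarrow> complex"
  assumes \<Omega>: "open \<Omega>" "smooth_on \<Omega> \<phi>" and S: "compact S" "S \<subseteq> Ks" and Ks: "compact Ks" "Ks \<subseteq> \<Omega>"
    and g: "\<And>i. deriv_seq q A i (g i)" "\<And>i. g i 0 = \<theta>" "\<And>x. x \<notin> S \<Longrightarrow> \<theta> x = 0" and \<tau>: "\<tau> > 0"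
  shows "(\<Sum>k\<in>freq_box (10 * 2 ^ l). of_real (shell_mult w n l k) * fourier_coeff \<tau> (restr Ks \<phi>) k * e k)
    = (LINT y|lborel. restr Ks \<phi> y * rho2 w n \<tau> e l \<theta> y)
    + (\<Sum>i\<in>UNIV. \<Sum>a\<le>q. LINT y|lborel. restr Ks (mderiv (pure i a) \<phi>) y * rho1 w n \<tau> e l q g i a y)"
proof -
  define gg where "gg = restr Ks \<phi>"
  define P where "P = complex_of_real ((\<tau> / (2 * pi)) ^ CARD('d))"
  define m where "m k = complex_of_real (shell_mult w n l k) * e k" for k
  have S\<Omega>: "S \<subseteq> \<Omega>" using S(2) Ks(2) by blast
  have g0: "\<And>i x. x \<notin> S \<Longrightarrow> g i 0 x = 0" using g(2,3) by simp
  note leibniz_prod = leibniz_prod_props[OF \<Omega> S(1) S\<Omega> g(1) g0]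
  have gcont: "continuous_on UNIV (g i j)" if "j \<le> q" for i j using g(1)[of i] that by (auto simp: deriv_seq_def)
  have cont: "continuous_on Ks (restr Ks (mderiv \<alpha> \<phi>))" for \<alpha>
    by (rule continuous_on_eq[OF continuous_on_subset[OF smooth_on_mderiv_continuous[OF \<Omega>(2)] Ks(2)]]) (simp add: restr_def)
  have igg: "integrable lborel gg"
    unfolding gg_def by (rule integrable_compact_support[OF Ks(1)]) (use cont[of "\<lambda>i. 0"] in \<open>auto simp: restr_def\<close>)
  have c1: "continuous_on UNIV (\<lambda>x. of_real (\<theta> x) * \<phi> x)"
  proof -
    have "leibniz_prod \<Omega> (g undefined) \<phi> undefined 0 = (\<lambda>x. of_real (\<theta> x) * \<phi> x)"
      using S\<Omega> g(2,3) by (auto simp: leibniz_prod_def fun_eq_iff)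
    then show ?thesis using leibniz_prod(2)[of 0 undefined] by simp
  qed
  have i1: "integrable lborel (\<lambda>x. of_real (\<theta> x) * \<phi> x)"
    by (rule integrable_compact_support[OF S(1) continuous_on_subset[OF c1]]) (use g(3) in auto)
  have i2: "integrable lborel (\<lambda>x. of_real (1 - \<theta> x) * gg x)"
  proof -
    have "(\<lambda>x. of_real (1 - \<theta> x) * gg x) = (\<lambda>x. gg x - of_real (\<theta> x) * \<phi> x)"
      using g(3) S(2) by (auto simp: gg_def restr_def fun_eq_iff algebra_simps)
    then show ?thesis using Bochner_Integration.integrable_diff[OF igg i1] by simp
  qed
  have ggs: "gg = (\<lambda>x. of_real (\<theta> x) * \<phi> x + of_real (1 - \<theta> x) * gg x)"
    using g(3) S(2) by (auto simp: gg_def restr_def fun_eq_iff algebra_simps)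
  have ckk: "fourier_coeff \<tau> gg k = fourier_coeff \<tau> (\<lambda>x. of_real (\<theta> x) * \<phi> x) k + fourier_coeff \<tau> (\<lambda>x. of_real (1 - \<theta> x) * gg x) k" for k
    by (subst ggs) (rule fourier_coeff_add[OF i1 i2])
  have A: "(\<Sum>k\<in>freq_box (10 * 2 ^ l). m k * fourier_coeff \<tau> (\<lambda>x. of_real (1 - \<theta> x) * gg x) k) = (LINT y|lborel. gg y * rho2 w n \<tau> e l \<theta> y)"
  proof -
    have "(LINT y|lborel. gg y * rho2 w n \<tau> e l \<theta> y)
        = (LINT y|lborel. (\<Sum>k\<in>freq_box (10 * 2 ^ l). m k * P * ((of_real (1 - \<theta> y) * gg y) * wave \<tau> k (- y))))"
      unfolding rho2_def m_def P_def by (simp add: sum_distrib_left mult_ac)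
    also have "\<dots> = (\<Sum>k\<in>freq_box (10 * 2 ^ l). m k * P * (LINT y|lborel. (of_real (1 - \<theta> y) * gg y) * wave \<tau> k (- y)))"
      by (subst Bochner_Integration.integral_sum[OF integrable_mult_right[OF integrable_ee[OF i2]]])
        (simp only: integral_mult_right_zero)
    finally show ?thesis unfolding fourier_coeff_def P_def by (simp add: mult_ac)
  qed
  have ii: "integrable lborel (\<lambda>y. restr Ks (mderiv (pure i a) \<phi>) y * (of_real (g i (q - a) y) * wave \<tau> k (- y)))" for i a k
  proof -
    have "continuous_on Ks (\<lambda>y. restr Ks (mderiv (pure i a) \<phi>) y * (of_real (g i (q - a) y) * wave \<tau> k (- y)))"
      by (intro continuous_intros cont continuous_on_subset[OF gcont]) auto
    then show ?thesis by (rule integrable_compact_support[OF Ks(1)]) (simp add: restr_def)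
  qed
  have ckk1: "fourier_coeff \<tau> (\<lambda>x. of_real (\<theta> x) * \<phi> x) k = (\<Sum>a\<le>q. P / (\<i> * of_real \<tau> * of_int (k i)) ^ q * of_nat (q choose a) *
      (LINT y|lborel. restr Ks (mderiv (pure i a) \<phi>) y * (of_real (g i (q - a) y) * wave \<tau> k (- y))))"
    if k: "k \<in> shell l i" for k i
  proof -
    have "k i \<noteq> 0" using k large_coord[of k l] by (auto simp: shell_def)
    then have nz: "(\<i> * of_real \<tau> * of_int (k i)) ^ q \<noteq> (0::complex)" using \<tau> by simp
    have "(\<i> * of_real \<tau> * of_int (k i)) ^ q * fourier_coeff \<tau> (\<lambda>x. of_real (\<theta> x) * \<phi> x) k = fourier_coeff \<tau> (leibniz_prod \<Omega> (g i) \<phi> i q) k"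
      using leibniz_prod_ck[OF \<Omega> S(1) S\<Omega> g(1) g0, of \<tau> i k] by (simp add: g(2))
    also have "\<dots> = P * (LINT y|lborel. (\<Sum>a\<le>q. of_nat (q choose a) * (restr Ks (mderiv (pure i a) \<phi>) y * (of_real (g i (q - a) y) * wave \<tau> k (- y)))))"
    proof -
      have "leibniz_prod \<Omega> (g i) \<phi> i q y = (\<Sum>a\<le>q. of_nat (q choose a) * (of_real (g i (q - a) y) * restr Ks (mderiv (pure i a) \<phi>) y))" for y
        by (rule leibniz_prod_restr[OF g(1) S(1) g0 S(2) Ks(2)])
      then show ?thesis unfolding fourier_coeff_def P_def by (simp only: sum_distrib_right sum_distrib_left mult_ac)
    qed
    also have "\<dots> = P * (\<Sum>a\<le>q. of_nat (q choose a) * (LINT y|lborel. restr Ks (mderiv (pure i a) \<phi>) y * (of_real (g i (q - a) y) * wave \<tau> k (- y))))"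
      by (subst Bochner_Integration.integral_sum[OF integrable_mult_right[OF ii]])
        (simp only: integral_mult_right_zero)
    finally have "fourier_coeff \<tau> (\<lambda>x. of_real (\<theta> x) * \<phi> x) k = P * (\<Sum>a\<le>q. of_nat (q choose a) * (LINT y|lborel. restr Ks (mderiv (pure i a) \<phi>) y * (of_real (g i (q - a) y) * wave \<tau> k (- y))))
        / (\<i> * of_real \<tau> * of_int (k i)) ^ q"
      using nz by (simp add: eq_divide_eq mult.commute)
    then show ?thesis by (simp add: sum_distrib_left sum_divide_distrib mult_ac)
  qed
  have fs: "finite (shell l i)" for i :: 'd
    unfolding shell_def by (rule finite_subset[of _ "freq_box (10 * 2 ^ l)"]) auto
  have "(\<Sum>k\<in>freq_box (10 * 2 ^ l). m k * fourier_coeff \<tau> (\<lambda>x. of_real (\<theta> x) * \<phi> x) k)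
      = (\<Sum>k\<in>freq_box (10 * 2 ^ l) - freq_box (2 ^ l). m k * fourier_coeff \<tau> (\<lambda>x. of_real (\<theta> x) * \<phi> x) k)"
    by (rule sum.mono_neutral_right) (auto simp: m_def shell_mult_eq_0)
  also have "\<dots> = (\<Sum>i\<in>UNIV. \<Sum>k\<in>shell l i. m k * fourier_coeff \<tau> (\<lambda>x. of_real (\<theta> x) * \<phi> x) k)"
    unfolding shell_def by (rule sum.group[symmetric]) auto
  also have "\<dots> = (\<Sum>i\<in>UNIV. \<Sum>a\<le>q. LINT y|lborel. restr Ks (mderiv (pure i a) \<phi>) y * rho1 w n \<tau> e l q g i a y)"
  proof (rule sum.cong[OF refl])
    fix i :: 'd
    have "(\<Sum>k\<in>shell l i. m k * fourier_coeff \<tau> (\<lambda>x. of_real (\<theta> x) * \<phi> x) k)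
        = (\<Sum>k\<in>shell l i. \<Sum>a\<le>q. m k * (P / (\<i> * of_real \<tau> * of_int (k i)) ^ q * of_nat (q choose a)) *
            (LINT y|lborel. restr Ks (mderiv (pure i a) \<phi>) y * (of_real (g i (q - a) y) * wave \<tau> k (- y))))"
      by (intro sum.cong refl) (simp only: ckk1 sum_distrib_left mult.assoc)
    also have "\<dots> = (\<Sum>a\<le>q. \<Sum>k\<in>shell l i. m k * (P / (\<i> * of_real \<tau> * of_int (k i)) ^ q * of_nat (q choose a)) *
            (LINT y|lborel. restr Ks (mderiv (pure i a) \<phi>) y * (of_real (g i (q - a) y) * wave \<tau> k (- y))))"
      by (rule sum.swap)
    also have "\<dots> = (\<Sum>a\<le>q. LINT y|lborel. restr Ks (mderiv (pure i a) \<phi>) y * rho1 w n \<tau> e l q g i a y)"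
    proof (rule sum.cong[OF refl])
      fix a
      have "(LINT y|lborel. restr Ks (mderiv (pure i a) \<phi>) y * rho1 w n \<tau> e l q g i a y)
          = (LINT y|lborel. (\<Sum>k\<in>shell l i. m k * (P / (\<i> * of_real \<tau> * of_int (k i)) ^ q * of_nat (q choose a)) *
              (restr Ks (mderiv (pure i a) \<phi>) y * (of_real (g i (q - a) y) * wave \<tau> k (- y)))))"
        unfolding rho1_def m_def P_def by (simp add: sum_distrib_left mult_ac)
      also have "\<dots> = (\<Sum>k\<in>shell l i. m k * (P / (\<i> * of_real \<tau> * of_int (k i)) ^ q * of_nat (q choose a)) *
            (LINT y|lborel. restr Ks (mderiv (pure i a) \<phi>) y * (of_real (g i (q - a) y) * wave \<tau> k (- y))))"
        by (subst Bochner_Integration.integral_sum[OF integrable_mult_right[OF ii]])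
          (simp only: integral_mult_right_zero)
      finally show "(\<Sum>k\<in>shell l i. m k * (P / (\<i> * of_real \<tau> * of_int (k i)) ^ q * of_nat (q choose a)) *
            (LINT y|lborel. restr Ks (mderiv (pure i a) \<phi>) y * (of_real (g i (q - a) y) * wave \<tau> k (- y))))
          = (LINT y|lborel. restr Ks (mderiv (pure i a) \<phi>) y * rho1 w n \<tau> e l q g i a y)" ..
    qed
    finally show "(\<Sum>k\<in>shell l i. m k * fourier_coeff \<tau> (\<lambda>x. of_real (\<theta> x) * \<phi> x) k)
        = (\<Sum>a\<le>q. LINT y|lborel. restr Ks (mderiv (pure i a) \<phi>) y * rho1 w n \<tau> e l q g i a y)" .
  qed
  finally have Bq: "(\<Sum>k\<in>freq_box (10 * 2 ^ l). m k * fourier_coeff \<tau> (\<lambda>x. of_real (\<theta> x) * \<phi> x) k)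
      = (\<Sum>i\<in>UNIV. \<Sum>a\<le>q. LINT y|lborel. restr Ks (mderiv (pure i a) \<phi>) y * rho1 w n \<tau> e l q g i a y)" .
  have "(\<Sum>k\<in>freq_box (10 * 2 ^ l). of_real (shell_mult w n l k) * fourier_coeff \<tau> gg k * e k)
      = (\<Sum>k\<in>freq_box (10 * 2 ^ l). m k * fourier_coeff \<tau> (\<lambda>x. of_real (\<theta> x) * \<phi> x) k)
      + (\<Sum>k\<in>freq_box (10 * 2 ^ l). m k * fourier_coeff \<tau> (\<lambda>x. of_real (1 - \<theta> x) * gg x) k)"
    unfolding sum.distrib[symmetric] by (intro sum.cong refl) (simp add: ckk m_def algebra_simps)
  from this[unfolded A Bq] show ?thesis unfolding gg_def by (simp only: add.commute)
qed

text \<open>The factor h ^ a / M a is extracted at the price of T ^ q, which the smallness of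
  \<open>e k\<close> pays for: X bounds the values of \<open>e\<close> with the enlarged parameter 6
  * T / \<tau>. Thus arbitrarily small h are reached with the same q.\<close>

lemma rho1_le:
  fixes y :: "real^'d::finite"
  assumes W: "weight_sequence M" "cond_M1 M" and F: "\<And>p. fact p \<le> C0 * H0 ^ p * M p" "C0 > 0" "H0 > 0"
    and \<tau>: "\<tau> > 0" and g: "deriv_seq q (C * (real q + 1)) i (g i)" "C \<ge> 0" and h: "h > 0" and a: "a \<le> q"
    and T: "1 \<le> T" "C * H0 \<le> T" "1 / h \<le> T"
    and X: "\<And>k. k \<in> freq_box (10 * 2 ^ l) \<Longrightarrow> (2 ^ l) ^ CARD('d) * cmod (e k) * ((6 * T / \<tau> / 2 ^ l) ^ q * M q) \<le> X" "X \<ge> 0"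
  shows "cmod (rho1 w n \<tau> e l q g i a y) \<le> 21 ^ CARD('d) * (\<tau> / (2 * pi)) ^ CARD('d) * (3 * C0) * X * (h ^ a / M a)"
proof -
  define P where "P = (\<tau> / (2 * pi)) ^ CARD('d)"
  define d where "d = CARD('d)"
  note M = weight_pos[OF W(1)]
  have P0: "P \<ge> 0" unfolding P_def using \<tau> by simp
  have T0: "T \<ge> 0" using T(1) by simp
  have each: "cmod (of_real (shell_mult w n l k) * e k * of_real P / (\<i> * of_real \<tau> * of_int (k i)) ^ q * of_nat (q choose a)
      * of_real (g i (q - a) y) * wave \<tau> k (- y)) \<le> P * (3 * C0) * (X / (2 ^ l) ^ d) * (h ^ a / M a)"
    if k: "k \<in> shell l i" for k
  proof -
    have kK: "k \<in> freq_box (10 * 2 ^ l)" using k by (simp add: shell_def)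
    have "2 ^ l < \<bar>k i\<bar>" using k large_coord[of k l] by (auto simp: shell_def)
    then have "real_of_int (2 ^ l) < real_of_int \<bar>k i\<bar>" by (simp only: of_int_less_iff)
    then have kl: "2 ^ l \<le> \<bar>real_of_int (k i)\<bar>" by simp
    have "cmod (of_real (shell_mult w n l k) * e k * of_real P / (\<i> * of_real \<tau> * of_int (k i)) ^ q * of_nat (q choose a)
        * of_real (g i (q - a) y) * wave \<tau> k (- y))
      = \<bar>shell_mult w n l k\<bar> * cmod (e k) * P / (\<tau> * \<bar>real_of_int (k i)\<bar>) ^ q * real (q choose a) * \<bar>g i (q - a) y\<bar>"
      using \<tau> P0 by (simp add: norm_mult norm_divide norm_power)
    also have "\<dots> \<le> 1 * cmod (e k) * P / (\<tau> * 2 ^ l) ^ q * 2 ^ q * (C * (real q + 1)) ^ (q - a)"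
    proof (intro mult_mono divide_mono mult_left_mono)
      show "(\<tau> * 2 ^ l) ^ q \<le> (\<tau> * \<bar>real_of_int (k i)\<bar>) ^ q"
        using \<tau> kl by (intro power_mono mult_left_mono) auto
      have "q choose a \<le> 2 ^ q" by (rule binomial_le_pow2)
      then show "real (q choose a) \<le> 2 ^ q" by (metis of_nat_le_iff of_nat_numeral of_nat_power)
      show "\<bar>g i (q - a) y\<bar> \<le> (C * (real q + 1)) ^ (q - a)" using g(1) by (auto simp: deriv_seq_def)
    qed (use P0 \<tau> shell_mult_le in auto)
    also have "\<dots> = cmod (e k) * P / (\<tau> * 2 ^ l) ^ q * 2 ^ q * ((C * (real q + 1)) ^ (q - a) * M a) / M a"
      using M[of a] by simp
    also have "\<dots> \<le> cmod (e k) * P / (\<tau> * 2 ^ l) ^ q * 2 ^ q * (3 * C0 * 3 ^ q * (T ^ q * h ^ a) * M q) / M a"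
    proof (intro divide_right_mono mult_left_mono)
      have "(C * (real q + 1)) ^ (q - a) * M a \<le> 3 * C0 * 3 ^ q * (C * H0) ^ (q - a) * M q"
        using weight_leibniz_term[OF W F g(2), of "q - a" a] a by simp
      also have "\<dots> \<le> 3 * C0 * 3 ^ q * (T ^ q * h ^ a) * M q"
      proof (intro mult_right_mono mult_left_mono)
        have "(C * H0) ^ (q - a) \<le> T ^ (q - a)" using T g(2) F(3) by (intro power_mono) auto
        also have "\<dots> = T ^ (q - a) * 1" by simp
        \<comment> \<open>T * h \<ge> 1 permits inserting the missing a powers of T, so that the
          total power T ^ q no longer depends on a.\<close>
        also have "\<dots> \<le> T ^ (q - a) * (T * h) ^ a"
        proof -
          have "1 \<le> T * h" using T(3) h by (simp add: divide_le_eq)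
          then show ?thesis using T0 by (intro mult_left_mono one_le_power) auto
        qed
        also have "\<dots> = T ^ q * h ^ a"
          using a by (simp add: power_mult_distrib power_add[symmetric] mult.assoc[symmetric])
        finally show "(C * H0) ^ (q - a) \<le> T ^ q * h ^ a" .
      qed (use F(2) less_imp_le[OF M] in auto)
      finally show "(C * (real q + 1)) ^ (q - a) * M a \<le> 3 * C0 * 3 ^ q * (T ^ q * h ^ a) * M q" .
    qed (use P0 \<tau> less_imp_le[OF M] in auto)
    also have "\<dots> = P * (3 * C0) * (cmod (e k) * ((6 * T / \<tau> / 2 ^ l) ^ q * M q)) * (h ^ a / M a)"
    proof -
      \<comment> \<open>In 6 = 2 * 3 the 2 comes from the binomial coefficient and the 3 from
        \<open>weight_leibniz_term\<close>.\<close>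
      have "6 * T / \<tau> / 2 ^ l = 2 * 3 * T / (\<tau> * 2 ^ l)" by simp
      then have "(6 * T / \<tau> / 2 ^ l) ^ q = 2 ^ q * 3 ^ q * T ^ q / (\<tau> * 2 ^ l) ^ q"
        by (simp only: power_divide power_mult_distrib)
      then show ?thesis by simp
    qed
    also have "\<dots> \<le> P * (3 * C0) * (X / (2 ^ l) ^ d) * (h ^ a / M a)"
    proof (intro mult_right_mono mult_left_mono)
      show "cmod (e k) * ((6 * T / \<tau> / 2 ^ l) ^ q * M q) \<le> X / (2 ^ l) ^ d"
        using X(1)[OF kK] unfolding d_def by (simp add: le_divide_eq mult_ac)
    qed (use P0 F(2) h less_imp_le[OF M] in auto)
    finally show ?thesis .
  qed
  have "cmod (rho1 w n \<tau> e l q g i a y) \<le> (\<Sum>k\<in>shell l i. P * (3 * C0) * (X / (2 ^ l) ^ d) * (h ^ a / M a))"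
    unfolding rho1_def P_def[symmetric] by (rule order_trans[OF norm_sum sum_mono[OF each]])
  also have "\<dots> \<le> (\<Sum>k\<in>(freq_box (10 * 2 ^ l) :: ('d \<Rightarrow> int) set). P * (3 * C0) * (X / (2 ^ l) ^ d) * (h ^ a / M a))"
    by (rule sum_mono2) (use P0 F(2) X(2) h less_imp_le[OF M] in \<open>auto simp: shell_def\<close>)
  also have "\<dots> = real ((2 * (10 * 2 ^ l) + 1) ^ d) * (P * (3 * C0) * (X / (2 ^ l) ^ d) * (h ^ a / M a))"
    by (simp add: card_KS d_def)
  also have "\<dots> \<le> (21 * 2 ^ l) ^ d * (P * (3 * C0) * (X / (2 ^ l) ^ d) * (h ^ a / M a))"
  proof (rule mult_right_mono)
    have "real (2 * (10 * 2 ^ l) + 1) \<le> 21 * 2 ^ l" using one_le_power[of "2::real" l] by simp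
    then show "real ((2 * (10 * 2 ^ l) + 1) ^ d) \<le> (21 * 2 ^ l) ^ d"
      unfolding of_nat_power by (rule power_mono) simp
  qed (use P0 F(2) X(2) h less_imp_le[OF M] in auto)
  also have "\<dots> = 21 ^ d * P * (3 * C0) * X * (h ^ a / M a)"
    by (simp add: power_mult_distrib)
  finally show ?thesis unfolding d_def P_def .
qed

section \<open>Choice of scales and the far part of the densities\<close>

lemma sup_norm_neighbourhood:
  fixes K :: "(real^'d::finite) set"
  assumes "compact K" "open V" "K \<subseteq> V"
  shows "\<exists>\<delta>>0. \<forall>x\<in>K. \<forall>y. (\<forall>i. \<bar>y $ i - x $ i\<bar> < 2 * \<delta>) \<longrightarrow> y \<in> V"
proof -
  obtain e where e: "e > 0" "(\<Union>x\<in>K. ball x e) \<subseteq> V"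
    using compact_subset_open_imp_ball_epsilon_subset[OF assms] by blast
  define d where "d = real CARD('d)"
  have d: "d > 0" unfolding d_def by simp
  have "y \<in> V" if x: "x \<in> K" and y: "\<And>i. \<bar>y $ i - x $ i\<bar> < 2 * (e / (2 * d))" for x y
  proof -
    have "norm (y - x) \<le> (\<Sum>i\<in>UNIV. \<bar>(y - x) $ i\<bar>)" by (rule norm_le_l1_cart)
    also have "\<dots> < (\<Sum>i\<in>(UNIV::'d set). e / d)" by (rule sum_strict_mono) (use y in auto)
    also have "\<dots> = e" using d by (simp add: d_def)
    finally have "y \<in> ball x e" by (simp add: dist_norm norm_minus_commute)
    then show ?thesis using e(2) x by blast
  qed
  then show ?thesis using e(1) d by (intro exI[of _ "e / (2 * d)"]) auto
qed

text \<open>The bound 1/8 makes differences of two points of K at most 1/4 in these units, the range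
  of the tail estimates.\<close>

lemma small_frequency_unit:
  fixes K :: "(real^'d::finite) set" and \<delta> :: "nat \<Rightarrow> real"
  assumes "compact K" "\<And>m. \<delta> m > 0"
  shows "\<exists>\<tau>>0. (\<forall>m\<le>n. \<tau> * \<delta> m \<le> 1) \<and> (\<forall>y\<in>K. \<forall>i. \<bar>\<tau> * y $ i\<bar> \<le> 1/8)"
proof -
  obtain b where b: "\<And>y. y \<in> K \<Longrightarrow> norm y \<le> b" "b > 0"
    using compact_imp_bounded[OF assms(1)] unfolding bounded_pos by blast
  define s where "s = 8 * b + (\<Sum>m\<le>n. \<delta> m)"
  have s0: "(\<Sum>m\<le>n. \<delta> m) \<ge> 0" using assms(2) by (intro sum_nonneg less_imp_le) auto
  have s: "s > 0" unfolding s_def using b s0 by linarith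
  have "1 / s * \<delta> m \<le> 1" if "m \<le> n" for m
  proof -
    have "\<delta> m \<le> (\<Sum>m\<le>n. \<delta> m)" using that assms(2) by (intro member_le_sum) (auto intro: less_imp_le)
    then have "\<delta> m \<le> s" unfolding s_def using b by linarith
    then show ?thesis using s by simp
  qed
  moreover have "\<bar>1 / s * y $ i\<bar> \<le> 1/8" if "y \<in> K" for y i
  proof -
    have "8 * \<bar>y $ i\<bar> \<le> s"
      unfolding s_def using b(1)[OF that] component_le_norm_cart[of y i] s0 by linarith
    then show ?thesis using s by (simp add: abs_mult field_simps)
  qed
  ultimately show ?thesis using s by (intro exI[of _ "1 / s"]) auto
qed

text \<open>Up to 1 - \<theta> y and a constant, \<open>rho2\<close> at y is the value of f at a
  difference of two kernels translated by y. Where \<theta> y \<noteq> 1, the point y is far from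
  the sets on which f is controlled, and there both kernels are small.\<close>

lemma rho2_le:
  fixes \<Omega> :: "(real^'d::finite) set" and y :: "real^'d" and K :: "nat \<Rightarrow> (real^'d) set"
  assumes W: "weight_sequence M" and \<Omega>: "open \<Omega>" and \<tau>: "\<tau> > 0" and f: "f \<in> top_dual (E_topology M \<Omega>)"
    and Cb: "Cb > 0" "\<And>\<phi> c. \<phi> \<in> E_open M \<Omega> \<Longrightarrow> c \<ge> 0 \<Longrightarrow> (\<And>m. m \<le> n \<Longrightarrow> derivs_le M (interior (K m)) (h m) c \<phi>) \<Longrightarrow> cmod (f \<phi>) \<le> Cb * c"
    and K: "\<And>m. K m \<subseteq> \<Omega>" and \<theta>: "0 \<le> \<theta> y" "\<theta> y \<le> 1" and C1: "C1 \<ge> 0"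
    and tail: "\<And>m x l \<alpha>. m \<le> n \<Longrightarrow> x \<in> interior (K m) \<Longrightarrow> \<theta> y \<noteq> 1 \<Longrightarrow>
      cmod (trig_kernel \<tau> (5 * 2 ^ l) (freq_cutoff w n l) \<alpha> (x - y)) \<le> C1 / 2 ^ l * (h m ^ mi_abs \<alpha> * M (mi_abs \<alpha>))"
    and h: "\<And>m. h m > 0"
  shows "cmod (rho2 w n \<tau> (\<lambda>k. f (wave_on \<Omega> \<tau> k)) l \<theta> y) \<le> (\<tau> / (2 * pi)) ^ CARD('d) * (Cb * (2 * C1)) / 2 ^ l"
proof -
  define P where "P = (\<tau> / (2 * pi)) ^ CARD('d)"
  have P0: "P \<ge> 0" unfolding P_def using \<tau> by simp
  define u where "u = trig_sum (10 * 2 ^ l) \<tau> (\<lambda>k. of_real (shell_mult w n l k) * wave \<tau> k (- y))"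
  have r: "rho2 w n \<tau> (\<lambda>k. f (wave_on \<Omega> \<tau> k)) l \<theta> y = of_real (1 - \<theta> y) * (of_real P * f (restr \<Omega> u))"
  proof -
    have "(\<Sum>k\<in>freq_box (10 * 2 ^ l). of_real (shell_mult w n l k) * f (wave_on \<Omega> \<tau> k) * of_real P * wave \<tau> k (- y)) = of_real P * f (restr \<Omega> u)"
      unfolding u_def dual_tri[OF W \<Omega> less_imp_le[OF \<tau>] f] sum_distrib_left
      by (rule sum.cong[OF refl]) (simp only: mult_ac)
    then show ?thesis unfolding rho2_def P_def by simp
  qed
  show ?thesis
  proof (cases "\<theta> y = 1")
    case True
    then show ?thesis unfolding r using P0 Cb(1) C1 unfolding P_def by simp
  next
    case False
    have mu: "mderiv \<alpha> u x = trig_kernel \<tau> (5 * 2 ^ Suc l) (freq_cutoff w n (Suc l)) \<alpha> (x - y) - trig_kernel \<tau> (5 * 2 ^ l) (freq_cutoff w n l) \<alpha> (x - y)" for \<alpha> x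
    proof -
      have "trig_sum (10 * 2 ^ l) \<tau> (\<lambda>k. of_real (box_mult w n l k) * wave \<tau> k (- y)) = trig_sum (5 * 2 ^ l) \<tau> (\<lambda>k. of_real (box_mult w n l k) * wave \<tau> k (- y))"
        by (rule trig_sum_extend) (auto simp: box_mult_eq_0)
      then show ?thesis
        unfolding u_def shell_mult_def of_real_diff left_diff_distrib mderiv_tri_diff mderiv_tri_shift[symmetric] box_mult_def
        by simp
    qed
    have "derivs_le M (interior (K m)) (h m) (2 * C1 / 2 ^ l) (restr \<Omega> u)" if m: "m \<le> n" for m
    proof -
      have "derivs_le M (interior (K m)) (h m) (2 * C1 / 2 ^ l) u"
        unfolding derivs_le_def
      proof (intro allI ballI)
        fix \<alpha> :: "'d multi_index" and x assume x: "x \<in> interior (K m)"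
        define X where "X = h m ^ mi_abs \<alpha> * M (mi_abs \<alpha>)"
        have X0: "X \<ge> 0" unfolding X_def using h[of m] less_imp_le[OF weight_pos[OF W]] by simp
        have "cmod (mderiv \<alpha> u x) \<le> C1 / 2 ^ Suc l * X + C1 / 2 ^ l * X"
          unfolding mu X_def by (rule order_trans[OF norm_triangle_ineq4 add_mono[OF tail[OF m x False] tail[OF m x False]]])
        also have "\<dots> \<le> C1 / 2 ^ l * X + C1 / 2 ^ l * X"
          using C1 X0 by (intro add_mono mult_right_mono divide_left_mono) auto
        also have "\<dots> = 2 * C1 / 2 ^ l * X" by simp
        finally show "cmod (mderiv \<alpha> u x) \<le> 2 * C1 / 2 ^ l * (h m ^ mi_abs \<alpha> * M (mi_abs \<alpha>))" unfolding X_def .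
      qed
      then show ?thesis using derivs_le_restr[OF _ \<Omega>] K interior_subset by blast
    qed
    then have fu: "cmod (f (restr \<Omega> u)) \<le> Cb * (2 * C1 / 2 ^ l)"
      using C1 unfolding u_def by (intro Cb(2) restr_tri_E_open[OF W \<Omega> less_imp_le[OF \<tau>]]) auto
    have "cmod (rho2 w n \<tau> (\<lambda>k. f (wave_on \<Omega> \<tau> k)) l \<theta> y) = (1 - \<theta> y) * (P * cmod (f (restr \<Omega> u)))"
      unfolding r norm_mult norm_of_real using \<theta> P0 by simp
    also have "\<dots> \<le> 1 * (P * (Cb * (2 * C1 / 2 ^ l)))"
      using \<theta> P0 fu by (intro mult_mono mult_left_mono) auto
    finally show ?thesis unfolding P_def by simp
  qed
qed

text \<open>The term for \<open>l = 0\<close> also contains the initial localized sum, so that the series over \<open>l\<close>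
  telescopes to the limit of the localized sums.\<close>

definition rho :: "(nat \<Rightarrow> nat) \<Rightarrow> nat \<Rightarrow> real \<Rightarrow> (('d::finite \<Rightarrow> int) \<Rightarrow> complex) \<Rightarrow> nat \<Rightarrow> nat \<Rightarrow> ('d \<Rightarrow> nat \<Rightarrow> real^'d \<Rightarrow> real) \<Rightarrow> (real^'d \<Rightarrow> real) \<Rightarrow> 'd multi_index \<Rightarrow> real^'d \<Rightarrow> complex" where
  "rho w n \<tau> e l q g \<theta> \<alpha> y =
     (\<Sum>i\<in>UNIV. \<Sum>a\<le>q. if pure i a = \<alpha> then rho1 w n \<tau> e l q g i a y else 0)
     + (if \<alpha> = (\<lambda>_. 0) then rho2 w n \<tau> e l \<theta> y
         + (if l = 0 then (\<Sum>k\<in>freq_box 5. of_real (box_mult w n 0 k) * e k * of_real ((\<tau> / (2 * pi)) ^ CARD('d)) * wave \<tau> k (- y)) else 0) else 0)"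

definition pures :: "nat \<Rightarrow> 'd::finite multi_index set" where
  "pures q = insert (\<lambda>_. 0) ((\<lambda>(i, a). pure i a) ` (UNIV \<times> {..q}))"

lemma finite_pures [simp]: "finite (pures q)"
  by (simp add: pures_def)

lemma rho_eq_0:
  assumes \<alpha>: "\<alpha> \<notin> pures q" shows "rho w n \<tau> e l q g \<theta> \<alpha> y = 0"
proof -
  have "pure i a \<noteq> \<alpha>" if "a \<le> q" for i a using that \<alpha> unfolding pures_def by force
  moreover have "\<alpha> \<noteq> (\<lambda>_. 0)" using \<alpha> unfolding pures_def by blast
  ultimately show ?thesis unfolding rho_def by simp
qed

lemma integrable_if_const:
  fixes F :: "'a \<Rightarrow> complex"
  shows "(c \<Longrightarrow> integrable M F) \<Longrightarrow> integrable M (\<lambda>y. if c then F y else 0)"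
  by (cases c) auto

lemma continuous_on_if_const:
  "(c \<Longrightarrow> continuous_on S F) \<Longrightarrow> continuous_on S (\<lambda>y. if c then F y else (0::complex))"
  by (cases c) auto

lemma continuous_rho1:
  assumes "\<And>j. j \<le> q \<Longrightarrow> continuous_on UNIV (g i j)" "a \<le> q"
  shows "continuous_on UNIV (rho1 w n \<tau> e l q g i a)"
  unfolding rho1_def[abs_def] by (intro continuous_intros assms) (use assms in auto)

lemma continuous_rho2:
  assumes "continuous_on UNIV \<theta>"
  shows "continuous_on UNIV (rho2 w n \<tau> e l \<theta>)"
  unfolding rho2_def[abs_def] by (intro continuous_intros assms)

lemma continuous_rho:
  assumes "\<And>i j. j \<le> q \<Longrightarrow> continuous_on UNIV (g i j)" "continuous_on UNIV \<theta>"
  shows "continuous_on UNIV (rho w n \<tau> e l q g \<theta> \<alpha>)"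
  unfolding rho_def[abs_def]
  by (intro continuous_on_add continuous_on_sum continuous_on_if_const continuous_rho1 continuous_rho2 assms
      continuous_on_mult continuous_on_const continuous_ee continuous_on_minus continuous_on_id) auto

text \<open>Summation over \<alpha> collects every pair (i, a) exactly once, although for a = 0 all
  directions share the same multi-index; this is why \<open>rho\<close> sums over the pairs with
  \<open>pure i a\<close> = \<alpha>.\<close>

lemma rho_term:
  fixes \<phi> :: "real^'d::finite \<Rightarrow> complex"
  assumes \<Omega>: "open \<Omega>" "smooth_on \<Omega> \<phi>" and S: "compact S" "S \<subseteq> Ks" and Ks: "compact Ks" "Ks \<subseteq> \<Omega>"
    and g: "\<And>i. deriv_seq q A i (g i)" "\<And>i. g i 0 = \<theta>" "\<And>x. x \<notin> S \<Longrightarrow> \<theta> x = 0" and \<tau>: "\<tau> > 0"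
  shows "(\<Sum>\<alpha>\<in>pures q. LINT y|lborel. restr Ks (mderiv \<alpha> \<phi>) y * rho w n \<tau> e l q g \<theta> \<alpha> y)
    = (\<Sum>k\<in>freq_box (10 * 2 ^ l). of_real (shell_mult w n l k) * fourier_coeff \<tau> (restr Ks \<phi>) k * e k)
    + (if l = 0 then (\<Sum>k\<in>freq_box 5. of_real (box_mult w n 0 k) * fourier_coeff \<tau> (restr Ks \<phi>) k * e k) else 0)"
proof -
  let ?D = "\<lambda>\<alpha>. restr Ks (mderiv \<alpha> \<phi>)"
  define R0 where "R0 y = (if l = 0 then (\<Sum>k\<in>freq_box 5. of_real (box_mult w n 0 k) * e k * of_real ((\<tau> / (2 * pi)) ^ CARD('d)) * wave \<tau> k (- y)) else 0)" for y
  have gc: "continuous_on UNIV (g i j)" if "j \<le> q" for i j using g(1)[of i] that by (auto simp: deriv_seq_def)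
  have \<theta>c: "continuous_on UNIV \<theta>" using gc[of 0 undefined] g(2) by simp
  have R0c: "continuous_on UNIV R0"
    unfolding R0_def[abs_def] by (intro continuous_on_if_const continuous_intros)
  have cont: "continuous_on Ks (?D \<alpha>)" for \<alpha>
    by (rule continuous_on_eq[OF continuous_on_subset[OF smooth_on_mderiv_continuous[OF \<Omega>(2)] Ks(2)]]) (simp add: restr_def)
  have int: "integrable lborel (\<lambda>y. ?D \<alpha> y * F y)" if "continuous_on UNIV F" for \<alpha> F
  proof (rule integrable_compact_support[OF Ks(1)])
    show "continuous_on Ks (\<lambda>y. ?D \<alpha> y * F y)"
      by (intro continuous_on_mult cont continuous_on_subset[OF that]) auto
  qed (simp add: restr_def)
  have i1: "integrable lborel (\<lambda>y. ?D \<alpha> y * rho1 w n \<tau> e l q g i a y)" if "a \<le> q" for \<alpha> i a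
    by (intro int continuous_rho1 gc that)
  have i2: "integrable lborel (\<lambda>y. ?D \<alpha> y * (rho2 w n \<tau> e l \<theta> y + R0 y))" for \<alpha>
    by (intro int continuous_on_add continuous_rho2 \<theta>c R0c)
  have one: "(LINT y|lborel. ?D \<alpha> y * rho w n \<tau> e l q g \<theta> \<alpha> y)
      = (\<Sum>i\<in>UNIV. \<Sum>a\<le>q. if pure i a = \<alpha> then LINT y|lborel. ?D \<alpha> y * rho1 w n \<tau> e l q g i a y else 0)
      + (if \<alpha> = (\<lambda>_. 0) then LINT y|lborel. ?D \<alpha> y * (rho2 w n \<tau> e l \<theta> y + R0 y) else 0)" for \<alpha>
  proof -
    have "(LINT y|lborel. ?D \<alpha> y * rho w n \<tau> e l q g \<theta> \<alpha> y)
        = (LINT y|lborel. (\<Sum>i\<in>UNIV. \<Sum>a\<le>q. if pure i a = \<alpha> then ?D \<alpha> y * rho1 w n \<tau> e l q g i a y else 0)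
            + (if \<alpha> = (\<lambda>_. 0) then ?D \<alpha> y * (rho2 w n \<tau> e l \<theta> y + R0 y) else 0))"
      unfolding rho_def R0_def[symmetric] 
      by (simp only: distrib_left[where b = "sum _ _"] sum_distrib_left, intro Bochner_Integration.integral_cong refl arg_cong2[where f="(+)"] sum.cong) auto
    also have "\<dots> = (LINT y|lborel. (\<Sum>i\<in>UNIV. \<Sum>a\<le>q. if pure i a = \<alpha> then ?D \<alpha> y * rho1 w n \<tau> e l q g i a y else 0))
            + (LINT y|lborel. (if \<alpha> = (\<lambda>_. 0) then ?D \<alpha> y * (rho2 w n \<tau> e l \<theta> y + R0 y) else 0))"
      by (rule Bochner_Integration.integral_add) (auto intro!: Bochner_Integration.integrable_sum integrable_if_const i1 i2)
    also have "(LINT y|lborel. (\<Sum>i\<in>UNIV. \<Sum>a\<le>q. if pure i a = \<alpha> then ?D \<alpha> y * rho1 w n \<tau> e l q g i a y else 0))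
        = (\<Sum>i\<in>UNIV. LINT y|lborel. (\<Sum>a\<le>q. if pure i a = \<alpha> then ?D \<alpha> y * rho1 w n \<tau> e l q g i a y else 0))"
      by (rule Bochner_Integration.integral_sum) (auto intro!: Bochner_Integration.integrable_sum integrable_if_const i1)
    also have "\<dots> = (\<Sum>i\<in>UNIV. \<Sum>a\<le>q. LINT y|lborel. (if pure i a = \<alpha> then ?D \<alpha> y * rho1 w n \<tau> e l q g i a y else 0))"
      by (intro sum.cong refl Bochner_Integration.integral_sum) (auto intro!: integrable_if_const i1)
    also have "\<dots> = (\<Sum>i\<in>UNIV. \<Sum>a\<le>q. if pure i a = \<alpha> then LINT y|lborel. ?D \<alpha> y * rho1 w n \<tau> e l q g i a y else 0)"
      by (intro sum.cong refl) auto
    also have "(LINT y|lborel. (if \<alpha> = (\<lambda>_. 0) then ?D \<alpha> y * (rho2 w n \<tau> e l \<theta> y + R0 y) else 0))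
        = (if \<alpha> = (\<lambda>_. 0) then LINT y|lborel. ?D \<alpha> y * (rho2 w n \<tau> e l \<theta> y + R0 y) else 0)"
      by auto
    finally show ?thesis .
  qed
  have "(\<Sum>\<alpha>\<in>pures q. LINT y|lborel. ?D \<alpha> y * rho w n \<tau> e l q g \<theta> \<alpha> y)
      = (\<Sum>\<alpha>\<in>pures q. \<Sum>i\<in>UNIV. \<Sum>a\<le>q. if pure i a = \<alpha> then LINT y|lborel. ?D \<alpha> y * rho1 w n \<tau> e l q g i a y else 0)
      + (\<Sum>\<alpha>\<in>pures q. if \<alpha> = (\<lambda>_. 0) then LINT y|lborel. ?D \<alpha> y * (rho2 w n \<tau> e l \<theta> y + R0 y) else 0)"
    unfolding one by (rule sum.distrib)
  also have "(\<Sum>\<alpha>\<in>pures q. if \<alpha> = (\<lambda>_. 0) then LINT y|lborel. ?D \<alpha> y * (rho2 w n \<tau> e l \<theta> y + R0 y) else 0)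
      = (LINT y|lborel. ?D (\<lambda>_. 0) y * (rho2 w n \<tau> e l \<theta> y + R0 y))"
    by (simp add: pures_def)
  also have "(\<Sum>\<alpha>\<in>pures q. \<Sum>i\<in>UNIV. \<Sum>a\<le>q. if pure i a = \<alpha> then LINT y|lborel. ?D \<alpha> y * rho1 w n \<tau> e l q g i a y else 0)
      = (\<Sum>i\<in>UNIV. \<Sum>\<alpha>\<in>pures q. \<Sum>a\<le>q. if pure i a = \<alpha> then LINT y|lborel. ?D \<alpha> y * rho1 w n \<tau> e l q g i a y else 0)"
    by (rule sum.swap)
  also have "\<dots> = (\<Sum>i\<in>UNIV. \<Sum>a\<le>q. \<Sum>\<alpha>\<in>pures q. if pure i a = \<alpha> then LINT y|lborel. ?D \<alpha> y * rho1 w n \<tau> e l q g i a y else 0)"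
    by (intro sum.cong refl sum.swap)
  also have "\<dots> = (\<Sum>i\<in>UNIV. \<Sum>a\<le>q. LINT y|lborel. ?D (pure i a) y * rho1 w n \<tau> e l q g i a y)"
  proof (intro sum.cong refl)
    fix i :: 'd and a assume "a \<in> {..q}"
    then have "pure i a \<in> pures q" unfolding pures_def by force
    then show "(\<Sum>\<alpha>\<in>pures q. if pure i a = \<alpha> then LINT y|lborel. ?D \<alpha> y * rho1 w n \<tau> e l q g i a y else 0)
        = (LINT y|lborel. ?D (pure i a) y * rho1 w n \<tau> e l q g i a y)"
      by (simp add: sum.delta')
  qed
  also have "(LINT y|lborel. ?D (\<lambda>_. 0) y * (rho2 w n \<tau> e l \<theta> y + R0 y))
      = (LINT y|lborel. restr Ks \<phi> y * rho2 w n \<tau> e l \<theta> y) + (LINT y|lborel. restr Ks \<phi> y * R0 y)"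
    using int[OF continuous_rho2[OF \<theta>c], of "\<lambda>_. 0"] int[OF R0c, of "\<lambda>_. 0"]
    by (simp add: distrib_left)
  also have "(LINT y|lborel. restr Ks \<phi> y * R0 y) = (if l = 0 then (\<Sum>k\<in>freq_box 5. of_real (box_mult w n 0 k) * fourier_coeff \<tau> (restr Ks \<phi>) k * e k) else 0)"
  proof (cases "l = 0")
    case True
    have ie: "integrable lborel (\<lambda>y. restr Ks \<phi> y * wave \<tau> k (- y))" for k
      using int[of "\<lambda>y. wave \<tau> k (- y)" "\<lambda>_. 0"] by (simp add: continuous_intros)
    have "(LINT y|lborel. restr Ks \<phi> y * R0 y) = (LINT y|lborel. (\<Sum>k\<in>freq_box 5. of_real (box_mult w n 0 k) * e k * of_real ((\<tau> / (2 * pi)) ^ CARD('d)) * (restr Ks \<phi> y * wave \<tau> k (- y))))"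
      using True by (simp only: R0_def if_True simp_thms sum_distrib_left mult_ac)
    also have "\<dots> = (\<Sum>k\<in>freq_box 5. of_real (box_mult w n 0 k) * e k * of_real ((\<tau> / (2 * pi)) ^ CARD('d)) * (LINT y|lborel. restr Ks \<phi> y * wave \<tau> k (- y)))"
      by (subst Bochner_Integration.integral_sum[OF integrable_mult_right[OF ie]]) (simp only: integral_mult_right_zero)
    finally show ?thesis using True by (simp only: fourier_coeff_def if_True simp_thms mult_ac)
  qed (simp add: R0_def)
  finally have "(\<Sum>\<alpha>\<in>pures q. LINT y|lborel. ?D \<alpha> y * rho w n \<tau> e l q g \<theta> \<alpha> y)
      = (\<Sum>i\<in>UNIV. \<Sum>a\<le>q. LINT y|lborel. ?D (pure i a) y * rho1 w n \<tau> e l q g i a y)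
      + ((LINT y|lborel. restr Ks \<phi> y * rho2 w n \<tau> e l \<theta> y)
      + (if l = 0 then (\<Sum>k\<in>freq_box 5. of_real (box_mult w n 0 k) * fourier_coeff \<tau> (restr Ks \<phi>) k * e k) else 0))" .
  moreover have "(\<Sum>k\<in>freq_box (10 * 2 ^ l). of_real (shell_mult w n l k) * fourier_coeff \<tau> (restr Ks \<phi>) k * e k)
    = (LINT y|lborel. restr Ks \<phi> y * rho2 w n \<tau> e l \<theta> y)
    + (\<Sum>i\<in>UNIV. \<Sum>a\<le>q. LINT y|lborel. restr Ks (mderiv (pure i a) \<phi>) y * rho1 w n \<tau> e l q g i a y)"
    by (rule density_term[OF \<Omega> S Ks g \<tau>])
  ultimately show ?thesis by (simp only: add_ac)
qed

text \<open>In each direction only the order a = |\<alpha>| can contribute, so summing over the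
  directions costs at most the factor CARD('d).\<close>

lemma rho_le:
  fixes y :: "real^'d::finite"
  assumes b1: "\<And>i a. a \<le> q \<Longrightarrow> cmod (rho1 w n \<tau> e l q g i a y) \<le> b1 * (h ^ a / M a)"
    and b2: "cmod (rho2 w n \<tau> e l \<theta> y) \<le> b2"
    and b3: "l = 0 \<Longrightarrow> (\<Sum>k\<in>(freq_box 5 :: ('d \<Rightarrow> int) set). cmod (e k)) * (\<tau> / (2 * pi)) ^ CARD('d) \<le> b3"
    and b0: "b1 \<ge> 0" "b2 \<ge> 0" "b3 \<ge> 0" and M: "\<And>p. M p > 0" "M 0 = 1" and h: "h > 0" and \<tau>: "\<tau> > 0"
  shows "cmod (rho w n \<tau> e l q g \<theta> \<alpha> y) \<le> (real CARD('d) * b1 + (b2 + b3)) * (h ^ mi_abs \<alpha> / M (mi_abs \<alpha>))"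
proof -
  define X where "X = h ^ mi_abs \<alpha> / M (mi_abs \<alpha>)"
  have X0: "X \<ge> 0" unfolding X_def using h M(1)[of "mi_abs \<alpha>"] by simp
  have "cmod (\<Sum>i\<in>UNIV. \<Sum>a\<le>q. if pure i a = \<alpha> then rho1 w n \<tau> e l q g i a y else 0) \<le> (\<Sum>i\<in>(UNIV::'d set). b1 * X)"
  proof (rule sum_norm_le)
    fix i :: 'd
    have "cmod (\<Sum>a\<le>q. if pure i a = \<alpha> then rho1 w n \<tau> e l q g i a y else 0) \<le> (\<Sum>a\<le>q. if a = mi_abs \<alpha> then b1 * X else 0)"
    proof (rule sum_norm_le)
      fix a assume a: "a \<in> {..q}"
      show "cmod (if pure i a = \<alpha> then rho1 w n \<tau> e l q g i a y else 0) \<le> (if a = mi_abs \<alpha> then b1 * X else 0)"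
      proof (cases "pure i a = \<alpha>")
        case True
        then have "a = mi_abs \<alpha>" by auto
        then show ?thesis using True b1[of a i] a by (simp add: X_def)
      qed (use b0 X0 in auto)
    qed
    also have "\<dots> \<le> b1 * X" using b0 X0 by (simp add: sum.delta)
    finally show "cmod (\<Sum>a\<le>q. if pure i a = \<alpha> then rho1 w n \<tau> e l q g i a y else 0) \<le> b1 * X" .
  qed
  moreover have "cmod (if \<alpha> = (\<lambda>_. 0) then rho2 w n \<tau> e l \<theta> y
         + (if l = 0 then (\<Sum>k\<in>freq_box 5. of_real (box_mult w n 0 k) * e k * of_real ((\<tau> / (2 * pi)) ^ CARD('d)) * wave \<tau> k (- y)) else 0) else 0) \<le> (b2 + b3) * X"
  proof (cases "\<alpha> = (\<lambda>_. 0)")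
    case True
    then have X1: "X = 1" unfolding X_def using M(2) by simp
    have "cmod (if l = 0 then (\<Sum>k\<in>freq_box 5. of_real (box_mult w n 0 k) * e k * of_real ((\<tau> / (2 * pi)) ^ CARD('d)) * wave \<tau> k (- y)) else 0) \<le> b3"
    proof (cases "l = 0")
      case l: True
      have "cmod (\<Sum>k\<in>freq_box 5. of_real (box_mult w n 0 k) * e k * of_real ((\<tau> / (2 * pi)) ^ CARD('d)) * wave \<tau> k (- y))
          \<le> (\<Sum>k\<in>(freq_box 5 :: ('d \<Rightarrow> int) set). cmod (e k) * (\<tau> / (2 * pi)) ^ CARD('d))"
      proof (rule sum_norm_le)
        fix k :: "'d \<Rightarrow> int"
        have "cmod (of_real (box_mult w n 0 k) * e k * of_real ((\<tau> / (2 * pi)) ^ CARD('d)) * wave \<tau> k (- y))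
            = \<bar>box_mult w n 0 k\<bar> * (cmod (e k) * (\<tau> / (2 * pi)) ^ CARD('d))"
          using \<tau> by (simp add: norm_mult norm_power norm_divide)
        also have "\<dots> \<le> cmod (e k) * (\<tau> / (2 * pi)) ^ CARD('d)"
          using box_mult_bounds[of w n 0 k] \<tau> by (intro mult_left_le_one_le) auto
        finally show "cmod (of_real (box_mult w n 0 k) * e k * of_real ((\<tau> / (2 * pi)) ^ CARD('d)) * wave \<tau> k (- y))
            \<le> cmod (e k) * (\<tau> / (2 * pi)) ^ CARD('d)" .
      qed
      then show ?thesis using b3[OF l] l by (simp add: sum_distrib_right)
    qed (use b0 in simp)
    with b2 show ?thesis
      unfolding X1 mult_1_right by (simp only: True if_True simp_thms) (rule order_trans[OF norm_triangle_ineq add_mono])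
  qed (use b0 X0 in simp)
  ultimately have "cmod (rho w n \<tau> e l q g \<theta> \<alpha> y) \<le> (\<Sum>i\<in>(UNIV::'d set). b1 * X) + (b2 + b3) * X"
    unfolding rho_def by (intro order_trans[OF norm_triangle_ineq add_mono])
  also have "\<dots> = (real CARD('d) * b1 + (b2 + b3)) * X" by (simp add: algebra_simps)
  finally show ?thesis unfolding X_def .
qed

subsection \<open>Representation by densities\<close>

text \<open>The data fixed before a functional, a rate or a unit of frequency enters. Neighbourhoods
  of width 2 * \<delta> m of K m stay inside the next set, and the constants \<open>Cc m\<close>
  serve all orders q.\<close>

locale roumieu_exhaustion =
  fixes M :: "nat \<Rightarrow> real" and \<Omega> :: "(real^'d::finite) set" and K :: "nat \<Rightarrow> (real^'d) set"
    and \<delta> Cc :: "nat \<Rightarrow> real" and C0 H0 A1 H1 :: real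
  assumes W: "weight_sequence M" "cond_M1 M"
    and F: "\<And>p. fact p \<le> C0 * H0 ^ p * M p" "C0 > 0" "H0 > 0"
    and sh: "\<And>p. M (p + (CARD('d) + 1)) \<le> A1 * H1 ^ p * M p" "A1 > 0" "H1 \<ge> 1"
    and \<Omega>: "open \<Omega>"
    and K: "\<And>n. regular_compact (K n)" "\<And>n. K n \<subseteq> \<Omega>" "\<And>n. K n \<subseteq> interior (K (Suc n))"
    and \<delta>: "\<And>m. \<delta> m > 0" "\<And>m x y. x \<in> K m \<Longrightarrow> (\<And>i. \<bar>y $ i - x $ i\<bar> < 2 * \<delta> m) \<Longrightarrow> y \<in> interior (K (Suc m))"
    and Cc: "\<And>m. Cc m \<ge> 0"
    and cut: "\<And>m q. \<exists>\<theta>. cutoff_class q (Cc m * (real q + 1)) \<theta> \<and> (\<forall>x. 0 \<le> \<theta> x \<and> \<theta> x \<le> 1) \<and>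
      (\<forall>x. (\<exists>y\<in>K m. \<forall>i. \<bar>x $ i - y $ i\<bar> \<le> \<delta> m) \<longrightarrow> \<theta> x = 1) \<and>
      (\<forall>x. (\<forall>y\<in>K m. \<exists>i. 2 * \<delta> m \<le> \<bar>x $ i - y $ i\<bar>) \<longrightarrow> \<theta> x = 0)"
begin

lemma Mpos: "M p > 0"
  by (rule weight_pos[OF W(1)])

lemma K_compact: "compact (K m)" and K_closure: "closure (interior (K m)) = K m"
  using K(1)[of m] by (auto simp: regular_compact_def)

lemma K_mono: "m \<le> n \<Longrightarrow> K m \<subseteq> K n"
  by (rule lift_Suc_mono_le) (use K(3) interior_subset in blast)+

text \<open>The least width that reaches the threshold 96 of the tail estimate at distance \<delta>
  m.\<close>

definition avg_width :: "real \<Rightarrow> nat \<Rightarrow> nat" where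
  "avg_width \<tau> m = nat \<lceil>96 / (\<tau> * \<delta> m)\<rceil>"

text \<open>The first summand is the rate at which the kernel tails are controlled, the second one the rate
  for the localized part of a function whose derivatives grow at rate \<open>g\<close>.\<close>

definition deriv_rate :: "nat \<Rightarrow> real \<Rightarrow> real" where
  "deriv_rate m g = H0 * (2 ^ (m + 2) * 97 * (5 * real CARD('d)) / \<delta> m) + 10 * H1 * (3 * (Cc m * H0 + g))"

lemma deriv_rate_pos: "g > 0 \<Longrightarrow> deriv_rate m g > 0"
  unfolding deriv_rate_def using \<delta>(1)[of m] F(3) sh(3) Cc[of m]
  by (intro add_nonneg_pos mult_pos_pos add_nonneg_pos mult_nonneg_nonneg divide_nonneg_pos) auto

lemma deriv_rate_bounds:
  assumes "g > 0"
  shows "H0 * (2 ^ (m + 2) * 97 * (5 * real CARD('d)) / \<delta> m) \<le> deriv_rate m g"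
    and "10 * H1 * (3 * (Cc m * H0 + g)) \<le> deriv_rate m g"
proof -
  have "0 \<le> 10 * H1 * (3 * (Cc m * H0 + g))"
    using assms F(3) sh(3) Cc[of m] by (intro mult_nonneg_nonneg add_nonneg_nonneg) auto
  moreover have "0 \<le> H0 * (2 ^ (m + 2) * 97 * (5 * real CARD('d)) / \<delta> m)"
    using \<delta>(1)[of m] F(3) by (intro mult_nonneg_nonneg divide_nonneg_pos) auto
  ultimately show "H0 * (2 ^ (m + 2) * 97 * (5 * real CARD('d)) / \<delta> m) \<le> deriv_rate m g"
    and "10 * H1 * (3 * (Cc m * H0 + g)) \<le> deriv_rate m g" unfolding deriv_rate_def by linarith+
qed

section \<open>Approximation along the exhaustion\<close>

lemma kernel_tail:
  assumes "\<tau> > 0" "\<tau> * \<delta> m \<le> 1" "m \<le> n" "g > 0"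
  shows "\<exists>C\<ge>0. \<forall>l \<alpha>. \<forall>z::real^'d. (\<forall>i. \<bar>\<tau> * z $ i\<bar> \<le> 1/4) \<longrightarrow> (\<exists>i. \<delta> m \<le> \<bar>z $ i\<bar>) \<longrightarrow>
    cmod (trig_kernel \<tau> (5 * 2 ^ l) (freq_cutoff (avg_width \<tau>) n l) \<alpha> z) \<le> C / 2 ^ l * (deriv_rate m g ^ mi_abs \<alpha> * M (mi_abs \<alpha>))"
  by (rule trig_kernel_tail_M[OF assms(1) \<delta>(1) assms(2) _ assms(3) Mpos F deriv_rate_bounds(1)[OF assms(4)]]) (simp add: avg_width_def)

text \<open>By the choice of \<delta> m, a point off K (Suc m) differs from every point of K m by at
  least 2 * \<delta> m in some coordinate.\<close>

lemma cutoff_supported: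
  "\<exists>\<theta>. cutoff_class q (Cc m * (real q + 1)) \<theta> \<and> (\<forall>x. 0 \<le> \<theta> x \<and> \<theta> x \<le> 1) \<and>
    (\<forall>x. (\<exists>y\<in>K m. \<forall>i. \<bar>x $ i - y $ i\<bar> \<le> \<delta> m) \<longrightarrow> \<theta> x = 1) \<and> (\<forall>x. x \<notin> K (Suc m) \<longrightarrow> \<theta> x = 0)"
proof -
  obtain \<theta> where \<theta>: "cutoff_class q (Cc m * (real q + 1)) \<theta>" "\<forall>x. 0 \<le> \<theta> x \<and> \<theta> x \<le> 1"
    "\<forall>x. (\<exists>y\<in>K m. \<forall>i. \<bar>x $ i - y $ i\<bar> \<le> \<delta> m) \<longrightarrow> \<theta> x = 1"
    "\<forall>x. (\<forall>y\<in>K m. \<exists>i. 2 * \<delta> m \<le> \<bar>x $ i - y $ i\<bar>) \<longrightarrow> \<theta> x = 0" using cut[of q m] by blast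
  have "\<theta> x = 0" if x: "x \<notin> K (Suc m)" for x
  proof -
    have "\<exists>i. 2 * \<delta> m \<le> \<bar>x $ i - y $ i\<bar>" if "y \<in> K m" for y
    proof (rule ccontr)
      assume "\<not> ?thesis"
      then have "x \<in> interior (K (Suc m))" by (intro \<delta>(2)[OF that]) (auto simp: not_le)
      then show False using x interior_subset by blast
    qed
    then show ?thesis using \<theta>(4) by blast
  qed
  then show ?thesis using \<theta>(1-3) by blast
qed

text \<open>Convergence on K m uses the growth of \<phi> on K (Suc m), where the cutoff is
  supported. One set of the exhaustion is lost, so the sums must be formed over a set of index above
  n.\<close>

lemma trig_approx_approx:
  assumes \<tau>: "\<tau> > 0" "\<tau> * \<delta> m \<le> 1" and small: "\<And>(y::real^'d) i. y \<in> K N \<Longrightarrow> \<bar>\<tau> * y $ i\<bar> \<le> 1/8"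
    and m: "m \<le> n" "n < N" and \<phi>: "smooth_on \<Omega> \<phi>" "derivs_le M (K (Suc m)) g c \<phi>" "c \<ge> 0" "g > 0"
  shows "\<exists>D\<ge>0. \<forall>l. derivs_le M (interior (K m)) (deriv_rate m g) (D / 2 ^ l) (\<lambda>x. \<phi> x - trig_approx (avg_width \<tau>) n \<tau> l (restr (K N) \<phi>) x)"
proof -
  obtain C1 where C1: "C1 \<ge> 0" "\<And>l \<alpha> (z::real^'d). (\<forall>i. \<bar>\<tau> * z $ i\<bar> \<le> 1/4) \<Longrightarrow> (\<exists>i. \<delta> m \<le> \<bar>z $ i\<bar>) \<Longrightarrow>
    cmod (trig_kernel \<tau> (5 * 2 ^ l) (freq_cutoff (avg_width \<tau>) n l) \<alpha> z) \<le> C1 / 2 ^ l * (deriv_rate m g ^ mi_abs \<alpha> * M (mi_abs \<alpha>))"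
    using kernel_tail[OF \<tau> m(1) \<phi>(4)] by blast
  have sub: "interior (K m) \<subseteq> K (Suc m)" using K(3)[of m] interior_subset by blast
  have cut': "\<exists>\<theta>. cutoff_class q (Cc m * (real q + 1)) \<theta> \<and> (\<forall>x. 0 \<le> \<theta> x \<and> \<theta> x \<le> 1) \<and>
      (\<forall>x. (\<exists>y\<in>interior (K m). \<forall>i. \<bar>x $ i - y $ i\<bar> \<le> \<delta> m) \<longrightarrow> \<theta> x = 1) \<and> (\<forall>x. x \<notin> K (Suc m) \<longrightarrow> \<theta> x = 0)" for q
  proof -
    obtain \<theta> where \<theta>: "cutoff_class q (Cc m * (real q + 1)) \<theta>" "\<forall>x. 0 \<le> \<theta> x \<and> \<theta> x \<le> 1"
      "\<forall>x. (\<exists>y\<in>K m. \<forall>i. \<bar>x $ i - y $ i\<bar> \<le> \<delta> m) \<longrightarrow> \<theta> x = 1" "\<forall>x. x \<notin> K (Suc m) \<longrightarrow> \<theta> x = 0"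
      using cutoff_supported[of q m] by blast
    have "\<theta> x = 1" if "y \<in> interior (K m)" "\<forall>i. \<bar>x $ i - y $ i\<bar> \<le> \<delta> m" for x y
      using that \<theta>(3) interior_subset by blast
    then show ?thesis using \<theta>(1,2,4) by blast
  qed
  have bp: "cmod (mderiv (pure i j) \<phi> x) \<le> c * (g ^ j * M j)" if "x \<in> K (Suc m)" for i j x
    using derivs_leD[OF \<phi>(2) that, of "pure i j"] by simp
  show ?thesis
    by (rule localized_convergence[OF W F sh \<tau>(1) C1 \<Omega> \<phi>(1) K_compact[of "Suc m"] K_mono[of "Suc m" N] K_compact[of N] K(2)[of N]
        small open_interior sub cut' Cc[of m] bp \<phi>(3,4) \<delta>(1)[of m] deriv_rate_bounds(2)[OF \<phi>(4)]]) (use m in auto)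
qed

lemma restr_Top_E_open: "\<tau> > 0 \<Longrightarrow> restr \<Omega> (trig_approx w n \<tau> l g) \<in> E_open M \<Omega>"
  unfolding trig_approx_def by (rule restr_tri_E_open[OF W(1) \<Omega>]) simp

lemma derivs_le_minus_restr:
  assumes "U \<subseteq> \<Omega>" "open U" "derivs_le M U h C (\<lambda>x. \<phi> x - T x)"
  shows "derivs_le M U h C (\<lambda>x. 1 * \<phi> x + (-1) * restr \<Omega> T x)"
proof -
  have "mderiv \<alpha> (\<lambda>x. 1 * \<phi> x + (-1) * restr \<Omega> T x) x = mderiv \<alpha> (\<lambda>x. \<phi> x - T x) x" if "x \<in> U" for \<alpha> x
    by (rule mderiv_cong_open[OF assms(2) _ that]) (use assms(1) in \<open>auto simp: restr_def\<close>)
  then show ?thesis using assms(3) unfolding derivs_le_def by simp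
qed

text \<open>The bound on f is assumed for exactly the rates in which the approximants converge on
  the finitely many sets concerned, so the error of f is geometric in l.\<close>

lemma dual_approx:
  assumes f: "f \<in> top_dual (E_topology M \<Omega>)"
    and Cb: "\<And>\<phi> c. \<phi> \<in> E_open M \<Omega> \<Longrightarrow> c \<ge> 0 \<Longrightarrow> (\<And>m. m \<le> n0 \<Longrightarrow> derivs_le M (interior (K m)) (deriv_rate m (g m)) c \<phi>) \<Longrightarrow> cmod (f \<phi>) \<le> Cb * c"
    and \<tau>: "\<tau> > 0" "\<And>m. m \<le> n0 \<Longrightarrow> \<tau> * \<delta> m \<le> 1" and small: "\<And>(y::real^'d) i. y \<in> K N \<Longrightarrow> \<bar>\<tau> * y $ i\<bar> \<le> 1/8"
    and n: "n0 \<le> n" "n < N" and \<phi>: "\<phi> \<in> E_open M \<Omega>" and g: "\<And>m. m \<le> n0 \<Longrightarrow> \<exists>c\<ge>0. derivs_le M (K (Suc m)) (g m) c \<phi>" "\<And>m. g m > 0"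
  shows "(\<lambda>l. f (restr \<Omega> (trig_approx (avg_width \<tau>) n \<tau> l (restr (K N) \<phi>)))) \<longlonglongrightarrow> f \<phi>"
proof -
  note \<phi>s = E_open_smooth[OF \<Omega> Mpos \<phi>]
  let ?T = "\<lambda>l. trig_approx (avg_width \<tau>) n \<tau> l (restr (K N) \<phi>)"
  have "\<exists>D\<ge>0. \<forall>l. derivs_le M (interior (K m)) (deriv_rate m (g m)) (D / 2 ^ l) (\<lambda>x. \<phi> x - ?T l x)" if m: "m \<le> n0" for m
  proof -
    obtain c where "c \<ge> 0" "derivs_le M (K (Suc m)) (g m) c \<phi>" using g(1)[OF m] by blast
    then show ?thesis using m n by (intro trig_approx_approx[OF \<tau>(1) \<tau>(2)[OF m] small _ _ \<phi>s _ _ g(2)]) auto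
  qed
  then obtain D where D: "\<And>m. m \<le> n0 \<Longrightarrow> D m \<ge> 0"
    "\<And>m l. m \<le> n0 \<Longrightarrow> derivs_le M (interior (K m)) (deriv_rate m (g m)) (D m / 2 ^ l) (\<lambda>x. \<phi> x - ?T l x)" by metis
  define DD where "DD = (\<Sum>m\<le>n0. D m)"
  have DD: "D m \<le> DD" if "m \<le> n0" for m unfolding DD_def using that D(1) by (intro member_le_sum) auto
  have DD0: "DD \<ge> 0" unfolding DD_def using D(1) by (intro sum_nonneg) auto
  have est: "cmod (f (restr \<Omega> (?T l)) - f \<phi>) \<le> Cb * DD * (1/2) ^ l" for l
  proof -
    have "derivs_le M (interior (K m)) (deriv_rate m (g m)) (DD / 2 ^ l) (\<lambda>x. 1 * \<phi> x + (-1) * restr \<Omega> (?T l) x)" if m: "m \<le> n0" for m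
    proof (rule derivs_le_minus_restr)
      show "derivs_le M (interior (K m)) (deriv_rate m (g m)) (DD / 2 ^ l) (\<lambda>x. \<phi> x - ?T l x)"
        by (rule derivs_le_mono[OF D(2)[OF m] order_refl deriv_rate_pos[OF g(2)] order_refl _ _ Mpos])
          (use D(1)[OF m] DD[OF m] in \<open>auto intro: divide_right_mono\<close>)
    qed (use K(2) interior_subset in blast)+
    then have "cmod (f (\<lambda>x. 1 * \<phi> x + (-1) * restr \<Omega> (?T l) x)) \<le> Cb * (DD / 2 ^ l)"
      using DD0 by (intro Cb E_open_lincomb[OF \<Omega> Mpos \<phi> restr_Top_E_open[OF \<tau>(1)]]) auto
    then show ?thesis
      unfolding dual_linear[OF f \<Omega> Mpos \<phi> restr_Top_E_open[OF \<tau>(1)]]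
      by (simp add: norm_minus_commute power_divide)
  qed
  have "(\<lambda>l. f (restr \<Omega> (?T l)) - f \<phi>) \<longlonglongrightarrow> 0"
  proof (rule Lim_null_comparison)
    show "(\<lambda>l. Cb * DD * (1/2) ^ l) \<longlonglongrightarrow> 0" by (intro tendsto_mult_right_zero LIMSEQ_power_zero) simp
  qed (use est in simp)
  then show ?thesis by (simp add: LIM_zero_iff)
qed

text \<open>The shell sums are differences of successive approximants and the extra term at l = 0 is
  the first approximant, so the partial sums telescope.\<close>

lemma dual_Top_sums:
  assumes f: "f \<in> top_dual (E_topology M \<Omega>)" and \<tau>: "\<tau> > 0"
    and lim: "(\<lambda>l. f (restr \<Omega> (trig_approx w n \<tau> l gg))) \<longlonglongrightarrow> L"
  shows "(\<lambda>l. (\<Sum>k\<in>freq_box (10 * 2 ^ l). of_real (shell_mult w n l k) * fourier_coeff \<tau> gg k * f (wave_on \<Omega> \<tau> k))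
    + (if l = 0 then (\<Sum>k\<in>freq_box 5. of_real (box_mult w n 0 k) * fourier_coeff \<tau> gg k * f (wave_on \<Omega> \<tau> k)) else 0)) sums L"
proof -
  let ?T = "\<lambda>l. f (restr \<Omega> (trig_approx w n \<tau> l gg))"
  note dt = dual_tri[OF W(1) \<Omega> less_imp_le[OF \<tau>] f]
  have ext: "trig_approx w n \<tau> l gg = trig_sum (10 * 2 ^ l) \<tau> (\<lambda>k. of_real (box_mult w n l k) * fourier_coeff \<tau> gg k)" for l
    unfolding trig_approx_def by (rule trig_sum_extend[symmetric]) (auto simp: box_mult_eq_0)
  have S: "(\<Sum>k\<in>freq_box (10 * 2 ^ l). of_real (shell_mult w n l k) * fourier_coeff \<tau> gg k * f (wave_on \<Omega> \<tau> k)) = ?T (Suc l) - ?T l" for l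
  proof -
    have "?T (Suc l) = (\<Sum>k\<in>freq_box (10 * 2 ^ l). of_real (box_mult w n (Suc l) k) * fourier_coeff \<tau> gg k * f (wave_on \<Omega> \<tau> k))"
      unfolding trig_approx_def dt by simp
    moreover have "?T l = (\<Sum>k\<in>freq_box (10 * 2 ^ l). of_real (box_mult w n l k) * fourier_coeff \<tau> gg k * f (wave_on \<Omega> \<tau> k))"
      unfolding ext dt ..
    ultimately show ?thesis
      by (simp add: shell_mult_def left_diff_distrib sum_subtractf)
  qed
  have Z: "(\<Sum>k\<in>freq_box 5. of_real (box_mult w n 0 k) * fourier_coeff \<tau> gg k * f (wave_on \<Omega> \<tau> k)) = ?T 0"
    unfolding trig_approx_def dt by simp
  have part: "(\<Sum>l<Suc L. (?T (Suc l) - ?T l) + (if l = 0 then ?T 0 else 0)) = ?T (Suc L)" for L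
    by (induction L) auto
  have "(\<lambda>L. \<Sum>l<Suc L. (?T (Suc l) - ?T l) + (if l = 0 then ?T 0 else 0)) \<longlonglongrightarrow> L"
    unfolding part using LIMSEQ_Suc[OF lim] .
  then show ?thesis unfolding S Z sums_def by (rule LIMSEQ_imp_Suc)
qed

lemma cutoff_system:
  "\<exists>\<theta> G. \<forall>q. (\<forall>i. G q i 0 = \<theta> q \<and> deriv_seq q (Cc m * (real q + 1)) i (G q i)) \<and>
     (\<forall>x. 0 \<le> \<theta> q x \<and> \<theta> q x \<le> 1) \<and>
     (\<forall>x. (\<exists>y\<in>K m. \<forall>i. \<bar>x $ i - y $ i\<bar> \<le> \<delta> m) \<longrightarrow> \<theta> q x = 1) \<and> (\<forall>x. x \<notin> K (Suc m) \<longrightarrow> \<theta> q x = 0)"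
proof -
  have "\<exists>\<theta> G. (\<forall>i. G i 0 = \<theta> \<and> deriv_seq q (Cc m * (real q + 1)) i (G i)) \<and>
     (\<forall>x. 0 \<le> \<theta> x \<and> \<theta> x \<le> 1) \<and>
     (\<forall>x. (\<exists>y\<in>K m. \<forall>i. \<bar>x $ i - y $ i\<bar> \<le> \<delta> m) \<longrightarrow> \<theta> x = 1) \<and> (\<forall>x. x \<notin> K (Suc m) \<longrightarrow> \<theta> x = 0)" for q
  proof -
    obtain \<theta> where \<theta>: "cutoff_class q (Cc m * (real q + 1)) \<theta>" "\<forall>x. 0 \<le> \<theta> x \<and> \<theta> x \<le> 1"
      "\<forall>x. (\<exists>y\<in>K m. \<forall>i. \<bar>x $ i - y $ i\<bar> \<le> \<delta> m) \<longrightarrow> \<theta> x = 1" "\<forall>x. x \<notin> K (Suc m) \<longrightarrow> \<theta> x = 0"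
      using cutoff_supported[of q m] by blast
    obtain G where "\<And>i. G i 0 = \<theta> \<and> deriv_seq q (Cc m * (real q + 1)) i (G i)"
      using \<theta>(1) unfolding cutoff_class_def by metis
    then show ?thesis using \<theta>(2-4) by blast
  qed
  then show ?thesis by metis
qed

lemma kernel_tail_uniform:
  assumes \<tau>: "\<tau> > 0" "\<And>m. m \<le> n \<Longrightarrow> \<tau> * \<delta> m \<le> 1" and g: "g > 0"
  shows "\<exists>C\<ge>0. \<forall>m\<le>n. \<forall>l \<alpha>. \<forall>z::real^'d. (\<forall>i. \<bar>\<tau> * z $ i\<bar> \<le> 1/4) \<longrightarrow> (\<exists>i. \<delta> m \<le> \<bar>z $ i\<bar>) \<longrightarrow>
    cmod (trig_kernel \<tau> (5 * 2 ^ l) (freq_cutoff (avg_width \<tau>) n l) \<alpha> z) \<le> C / 2 ^ l * (deriv_rate m g ^ mi_abs \<alpha> * M (mi_abs \<alpha>))"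
proof -
  have "\<exists>C\<ge>0. \<forall>l \<alpha>. \<forall>z::real^'d. (\<forall>i. \<bar>\<tau> * z $ i\<bar> \<le> 1/4) \<longrightarrow> (\<exists>i. \<delta> m \<le> \<bar>z $ i\<bar>) \<longrightarrow>
    cmod (trig_kernel \<tau> (5 * 2 ^ l) (freq_cutoff (avg_width \<tau>) n l) \<alpha> z) \<le> C / 2 ^ l * (deriv_rate m g ^ mi_abs \<alpha> * M (mi_abs \<alpha>))" if "m \<le> n" for m
    by (rule kernel_tail[OF \<tau>(1) \<tau>(2)[OF that] that g])
  then obtain C where C: "\<And>m. m \<le> n \<Longrightarrow> C m \<ge> 0" "\<And>m l \<alpha> (z::real^'d). m \<le> n \<Longrightarrow> (\<forall>i. \<bar>\<tau> * z $ i\<bar> \<le> 1/4) \<Longrightarrow> (\<exists>i. \<delta> m \<le> \<bar>z $ i\<bar>) \<Longrightarrow>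
    cmod (trig_kernel \<tau> (5 * 2 ^ l) (freq_cutoff (avg_width \<tau>) n l) \<alpha> z) \<le> C m / 2 ^ l * (deriv_rate m g ^ mi_abs \<alpha> * M (mi_abs \<alpha>))"
    by metis
  show ?thesis
  proof (intro exI[of _ "\<Sum>m\<le>n. C m"] conjI allI impI)
    show "0 \<le> (\<Sum>m\<le>n. C m)" using C(1) by (intro sum_nonneg) auto
    fix m l and \<alpha> :: "'d multi_index" and z :: "real^'d"
    assume m: "m \<le> n" and z: "\<forall>i. \<bar>\<tau> * z $ i\<bar> \<le> 1/4" "\<exists>i. \<delta> m \<le> \<bar>z $ i\<bar>"
    have "C m \<le> (\<Sum>m\<le>n. C m)" using m C(1) by (intro member_le_sum) auto
    moreover have "0 \<le> deriv_rate m g ^ mi_abs \<alpha> * M (mi_abs \<alpha>)"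
      using deriv_rate_pos[OF g, of m] Mpos[of "mi_abs \<alpha>"] by simp
    ultimately show "cmod (trig_kernel \<tau> (5 * 2 ^ l) (freq_cutoff (avg_width \<tau>) n l) \<alpha> z) \<le> (\<Sum>m\<le>n. C m) / 2 ^ l * (deriv_rate m g ^ mi_abs \<alpha> * M (mi_abs \<alpha>))"
      by (intro order_trans[OF C(2)[OF m z]] mult_right_mono divide_right_mono) auto
  qed
qed

lemma densities_exist:
  assumes M2: "cond_M2' M" and B: "B \<subseteq> top_dual (E_topology M \<Omega>)"
    and G: "\<And>h. (\<And>m. h m > 0) \<Longrightarrow> \<exists>n C. C > 0 \<and> (\<forall>f\<in>B. \<forall>\<phi>\<in>E_open M \<Omega>. \<forall>c\<ge>0.
      (\<forall>m\<le>n. derivs_le M (interior (K m)) (h m) c \<phi>) \<longrightarrow> cmod (f \<phi>) \<le> C * c)"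
  shows "\<exists>N A \<rho>. (\<forall>l. finite (A l)) \<and> (\<forall>f\<in>B. \<forall>l \<alpha>. continuous_on UNIV (\<rho> f l \<alpha>)) \<and>
    (\<forall>f\<in>B. \<forall>l \<alpha> y. \<alpha> \<notin> A l \<longrightarrow> \<rho> f l \<alpha> y = 0) \<and>
    (\<forall>h>0. \<exists>C\<ge>0. \<forall>f\<in>B. \<forall>l \<alpha>. \<forall>y\<in>K N. cmod (\<rho> f l \<alpha> y) \<le> C / 2 ^ l * (h ^ mi_abs \<alpha> / M (mi_abs \<alpha>))) \<and>
    (\<forall>f\<in>B. \<forall>\<phi>\<in>E_open M \<Omega>. (\<exists>c\<ge>0. \<forall>m. derivs_le M (K m) 1 c \<phi>) \<longrightarrow>
      (\<lambda>l. \<Sum>\<alpha>\<in>A l. LINT y|lborel. restr (K N) (mderiv \<alpha> \<phi>) y * \<rho> f l \<alpha> y) sums f \<phi>)"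
proof -
  \<comment> \<open>These rates dominate both the kernel tails, needed for \<open>rho2\<close>, and
    the convergence of approximants of functions of rate 1.\<close>
  have "\<exists>n C. C > 0 \<and> (\<forall>f\<in>B. \<forall>\<phi>\<in>E_open M \<Omega>. \<forall>c\<ge>0.
      (\<forall>m\<le>n. derivs_le M (interior (K m)) (deriv_rate m 1) c \<phi>) \<longrightarrow> cmod (f \<phi>) \<le> C * c)"
    by (rule G) (rule deriv_rate_pos[OF zero_less_one])
  then obtain n Cb where Cb0: "Cb > 0" "\<forall>f\<in>B. \<forall>\<phi>\<in>E_open M \<Omega>. \<forall>c\<ge>0.
      (\<forall>m\<le>n. derivs_le M (interior (K m)) (deriv_rate m 1) c \<phi>) \<longrightarrow> cmod (f \<phi>) \<le> Cb * c" by blast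
  have Cb: "Cb > 0" "\<And>f \<phi> c. f \<in> B \<Longrightarrow> \<phi> \<in> E_open M \<Omega> \<Longrightarrow> c \<ge> 0 \<Longrightarrow>
      (\<And>m. m \<le> n \<Longrightarrow> derivs_le M (interior (K m)) (deriv_rate m 1) c \<phi>) \<Longrightarrow> cmod (f \<phi>) \<le> Cb * c"
    using Cb0 by simp_all
  \<comment> \<open>The cutoff equals 1 near K n and is supported in the next set, which carries all
    densities.\<close>
  define Ks where "Ks = K (Suc n)"
  obtain \<tau> where \<tau>: "\<tau> > 0" "\<And>m. m \<le> n \<Longrightarrow> \<tau> * \<delta> m \<le> 1" "\<And>y i. y \<in> Ks \<Longrightarrow> \<bar>\<tau> * y $ i\<bar> \<le> 1/8"
    using small_frequency_unit[where \<delta>=\<delta> and n=n, OF K_compact[of "Suc n"] \<delta>(1)] unfolding Ks_def by blast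
  define w where "w = avg_width \<tau>"
  define e where "e f k = f (wave_on \<Omega> \<tau> k)" for f :: "(real^'d \<Rightarrow> complex) \<Rightarrow> complex" and k
  obtain A2 H2 where sh2: "\<And>p. M (p + (CARD('d) + 2)) \<le> A2 * H2 ^ p * M p" "A2 > 0" "H2 \<ge> 1"
    using weight_shift[OF W(1) M2] by metis
  \<comment> \<open>The weight (2 ^ l) ^ CARD('d) anticipates the number of frequencies over which
    \<open>rho1\<close> sums.\<close>
  define FF where "FF l = {(2 ^ l) ^ CARD('d) * cmod (e f k) |f k. f \<in> B \<and> k \<in> freq_box (10 * 2 ^ l)}" for l :: nat
  have "\<exists>q. \<forall>H>0. \<exists>C\<ge>0. \<forall>l. \<forall>x\<in>FF l. x * ((H / 2 ^ l) ^ q l * M (q l)) \<le> C / 2 ^ (l::nat)"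
  proof (rule diagonal_orders[OF Mpos])
    show "x \<ge> 0" if "x \<in> FF l" for l x using that by (auto simp: FF_def)
    fix N :: real assume N: "N > 0"
    have "\<exists>C\<ge>0. \<forall>l. \<exists>q. \<forall>f\<in>B. \<forall>k\<in>freq_box (10 * 2 ^ l).
      (2 ^ l) ^ CARD('d) * cmod (f (wave_on \<Omega> \<tau> k)) * ((N / 2 ^ l) ^ q * M q) \<le> C / 4 ^ l"
      by (rule exponential_growth[OF W(1) sh2 \<Omega> \<tau>(1) K(2) G N])
    then show "\<exists>C\<ge>0. \<forall>l. \<exists>q. \<forall>x\<in>FF l. x * ((N / 2 ^ l) ^ q * M q) \<le> C / 4 ^ l"
      unfolding FF_def e_def by fast
  qed
  then obtain q where q: "\<And>H. H > 0 \<Longrightarrow> \<exists>C\<ge>0. \<forall>l. \<forall>x\<in>FF l. x * ((H / 2 ^ l) ^ q l * M (q l)) \<le> C / 2 ^ (l::nat)"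
    by blast
  obtain \<theta> g where cs: "\<And>q. (\<forall>i. g q i 0 = \<theta> q \<and> deriv_seq q (Cc n * (real q + 1)) i (g q i)) \<and>
     (\<forall>x. 0 \<le> \<theta> q x \<and> \<theta> q x \<le> 1) \<and>
     (\<forall>x. (\<exists>y\<in>K n. \<forall>i. \<bar>x $ i - y $ i\<bar> \<le> \<delta> n) \<longrightarrow> \<theta> q x = 1) \<and> (\<forall>x. x \<notin> Ks \<longrightarrow> \<theta> q x = 0)"
    using cutoff_system[of n] unfolding Ks_def by metis
  have gs: "\<And>q i. deriv_seq q (Cc n * (real q + 1)) i (g q i)" "\<And>q i. g q i 0 = \<theta> q" "\<And>q x. x \<notin> Ks \<Longrightarrow> \<theta> q x = 0"
    using cs by simp_all
  have \<theta>: "\<And>q x. 0 \<le> \<theta> q x" "\<And>q x. \<theta> q x \<le> 1" using cs by simp_all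
  have \<theta>1: "\<theta> q x = 1" if "y \<in> K n" "\<And>i. \<bar>x $ i - y $ i\<bar> \<le> \<delta> n" for q x y
  proof -
    have "\<exists>y\<in>K n. \<forall>i. \<bar>x $ i - y $ i\<bar> \<le> \<delta> n"
      by (intro bexI[of _ y] allI that)
    then show ?thesis using cs[of q] by simp
  qed
  define \<rho> where "\<rho> f l = rho w n \<tau> (e f) l (q l) (g (q l)) (\<theta> (q l))" for f l
  have "\<exists>C\<ge>0. \<forall>m\<le>n. \<forall>l \<alpha>. \<forall>z::real^'d. (\<forall>i. \<bar>\<tau> * z $ i\<bar> \<le> 1/4) \<longrightarrow> (\<exists>i. \<delta> m \<le> \<bar>z $ i\<bar>) \<longrightarrow>
    cmod (trig_kernel \<tau> (5 * 2 ^ l) (freq_cutoff w n l) \<alpha> z) \<le> C / 2 ^ l * (deriv_rate m 1 ^ mi_abs \<alpha> * M (mi_abs \<alpha>))"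
    unfolding w_def by (rule kernel_tail_uniform[OF \<tau>(1,2) zero_less_one])
  then obtain C1 where C1': "C1 \<ge> 0" "\<forall>m\<le>n. \<forall>l \<alpha>. \<forall>z::real^'d. (\<forall>i. \<bar>\<tau> * z $ i\<bar> \<le> 1/4) \<longrightarrow> (\<exists>i. \<delta> m \<le> \<bar>z $ i\<bar>) \<longrightarrow>
    cmod (trig_kernel \<tau> (5 * 2 ^ l) (freq_cutoff w n l) \<alpha> z) \<le> C1 / 2 ^ l * (deriv_rate m 1 ^ mi_abs \<alpha> * M (mi_abs \<alpha>))"
    by (elim exE conjE) (rule that)
  have C1: "C1 \<ge> 0" "\<And>m l \<alpha> (z::real^'d). m \<le> n \<Longrightarrow> (\<forall>i. \<bar>\<tau> * z $ i\<bar> \<le> 1/4) \<Longrightarrow> (\<exists>i. \<delta> m \<le> \<bar>z $ i\<bar>) \<Longrightarrow>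
    cmod (trig_kernel \<tau> (5 * 2 ^ l) (freq_cutoff w n l) \<alpha> z) \<le> C1 / 2 ^ l * (deriv_rate m 1 ^ mi_abs \<alpha> * M (mi_abs \<alpha>))"
    using C1' by simp_all
  \<comment> \<open>For m < n, a point closer than \<delta> m to K m lies in K (Suc m) and so in K
    n, where \<theta> is 1; for m = n the plateau of \<theta> around K n is used directly.\<close>
  have far: "\<exists>i. \<delta> m \<le> \<bar>(x - y) $ i\<bar>" if m: "m \<le> n" and x: "x \<in> interior (K m)" and y: "\<theta> p y \<noteq> 1" for m x y p
  proof (rule ccontr)
    assume "\<not> ?thesis"
    then have d: "\<bar>y $ i - x $ i\<bar> < \<delta> m" for i by (auto simp: not_le abs_minus_commute)
    have xm: "x \<in> K m" using x interior_subset by blast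
    show False
    proof (cases "m = n")
      case True
      then show False using \<theta>1[of x y] xm d y less_imp_le by blast
    next
      case False
      have "\<bar>y $ i - x $ i\<bar> < 2 * \<delta> m" for i using d[of i] \<delta>(1)[of m] by linarith
      then have "y \<in> interior (K (Suc m))" by (rule \<delta>(2)[OF xm])
      then have "y \<in> K n" using False m K_mono[of "Suc m" n] interior_subset by fastforce
      then show False using \<theta>1[of y y] y less_imp_le[OF \<delta>(1)[of n]] by auto
    qed
  qed
  have fB: "f \<in> top_dual (E_topology M \<Omega>)" if "f \<in> B" for f using that B by blast
  define b2 where "b2 = (\<tau> / (2 * pi)) ^ CARD('d) * (Cb * (2 * C1))"
  have b20: "b2 \<ge> 0" unfolding b2_def using \<tau>(1) Cb(1) C1(1) by simp
  have r2: "cmod (rho2 w n \<tau> (e f) l (\<theta> p) y) \<le> b2 / 2 ^ l" if f: "f \<in> B" and y: "y \<in> Ks" for f l p y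
    unfolding e_def b2_def
  proof (rule rho2_le[OF W(1) \<Omega> \<tau>(1) fB[OF f] Cb(1) Cb(2)[OF f] K(2) \<theta>(1,2) C1(1) _ deriv_rate_pos[OF zero_less_one]])
    fix m l and \<alpha> :: "'d multi_index" and x :: "real^'d"
    assume m: "m \<le> n" and x: "x \<in> interior (K m)" and t: "\<theta> p y \<noteq> 1"
    have "x \<in> Ks" using x m K_mono[of m "Suc n"] interior_subset unfolding Ks_def by fastforce
    then have "\<bar>\<tau> * (x - y) $ i\<bar> \<le> 1/4" for i
      using \<tau>(3)[of x i] \<tau>(3)[OF y, of i] unfolding vector_minus_component right_diff_distrib by linarith
    then show "cmod (trig_kernel \<tau> (5 * 2 ^ l) (freq_cutoff w n l) \<alpha> (x - y)) \<le> C1 / 2 ^ l * (deriv_rate m 1 ^ mi_abs \<alpha> * M (mi_abs \<alpha>))"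
      by (intro C1(2)[OF m _ far[OF m x t]]) blast
  qed
  have bound: "\<exists>C\<ge>0. \<forall>f\<in>B. \<forall>l \<alpha>. \<forall>y\<in>Ks. cmod (\<rho> f l \<alpha> y) \<le> C / 2 ^ l * (h ^ mi_abs \<alpha> / M (mi_abs \<alpha>))" if h: "h > 0" for h
  proof -
    \<comment> \<open>Small h means large T; the orders q were chosen to serve every parameter 6 * T
      / \<tau>.\<close>
    define T where "T = max 1 (max (Cc n * H0) (1 / h))"
    have T: "1 \<le> T" "Cc n * H0 \<le> T" "1 / h \<le> T" unfolding T_def by auto
    have H: "6 * T / \<tau> > 0" using T(1) \<tau>(1) by simp
    obtain CH where CH: "CH \<ge> 0" "\<And>l x. x \<in> FF l \<Longrightarrow> x * ((6 * T / \<tau> / 2 ^ l) ^ q l * M (q l)) \<le> CH / 2 ^ l"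
      using q[OF H] by blast
    define c1 where "c1 = 21 ^ CARD('d) * (\<tau> / (2 * pi)) ^ CARD('d) * (3 * C0)"
    define Y where "Y = (6 * T / \<tau>) ^ q 0 * M (q 0)"
    have Y: "Y > 0" unfolding Y_def using H Mpos by (intro mult_pos_pos zero_less_power) auto
    \<comment> \<open>The box of size 5 lies in the box of size 10 of shell 0, so the bound for that
      shell, divided by Y, also controls the initial localized sum.\<close>
    define b3 where "b3 = real (card (freq_box 5 :: ('d \<Rightarrow> int) set)) * (CH / Y) * (\<tau> / (2 * pi)) ^ CARD('d)"
    have b30: "b3 \<ge> 0" unfolding b3_def using CH(1) Y \<tau>(1) by simp
    have c10: "c1 \<ge> 0" unfolding c1_def using \<tau>(1) F(2) by simp
    define C where "C = real CARD('d) * (c1 * CH) + (b2 + b3)"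
    show ?thesis
    proof (intro exI[of _ C] conjI ballI allI)
      show "C \<ge> 0" unfolding C_def using c10 CH(1) b20 b30 by simp
      fix f l and \<alpha> :: "'d multi_index" and y assume f: "f \<in> B" and y: "y \<in> Ks"
      have X: "(2 ^ l) ^ CARD('d) * cmod (e f k) * ((6 * T / \<tau> / 2 ^ l) ^ q l * M (q l)) \<le> CH / 2 ^ l"
        if "k \<in> freq_box (10 * 2 ^ l)" for k l
        by (rule CH(2)) (use f that in \<open>auto simp: FF_def\<close>)
      have r1: "cmod (rho1 w n \<tau> (e f) l (q l) (g (q l)) i a y) \<le> (c1 * CH / 2 ^ l) * (h ^ a / M a)" if a: "a \<le> q l" for i a
      proof -
        have "cmod (rho1 w n \<tau> (e f) l (q l) (g (q l)) i a y)
            \<le> 21 ^ CARD('d) * (\<tau> / (2 * pi)) ^ CARD('d) * (3 * C0) * (CH / 2 ^ l) * (h ^ a / M a)"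
          by (rule rho1_le[OF W F \<tau>(1) gs(1) Cc h a T X]) (use CH(1) in auto)
        then show ?thesis by (simp add: c1_def)
      qed
      have r3: "(\<Sum>k\<in>(freq_box 5 :: ('d \<Rightarrow> int) set). cmod (e f k)) * (\<tau> / (2 * pi)) ^ CARD('d) \<le> b3 / 2 ^ l" if "l = 0"
      proof -
        have "cmod (e f k) \<le> CH / Y" if k: "k \<in> freq_box 5" for k
        proof -
          have "k \<in> freq_box (10 * 2 ^ 0)" using k freq_box_mono[of 5 "10 * 2 ^ 0"] by auto
          from X[OF this] have "cmod (e f k) * Y \<le> CH" by (simp add: Y_def)
          then show ?thesis using Y by (simp add: pos_le_divide_eq)
        qed
        then have "(\<Sum>k\<in>(freq_box 5 :: ('d \<Rightarrow> int) set). cmod (e f k)) \<le> real (card (freq_box 5 :: ('d \<Rightarrow> int) set)) * (CH / Y)"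
          by (rule sum_bounded_above)
        then have "(\<Sum>k\<in>(freq_box 5 :: ('d \<Rightarrow> int) set). cmod (e f k)) * (\<tau> / (2 * pi)) ^ CARD('d) \<le> b3"
          unfolding b3_def using \<tau>(1) by (intro mult_right_mono) auto
        then show ?thesis using that by simp
      qed
      have "cmod (\<rho> f l \<alpha> y) \<le> (real CARD('d) * (c1 * CH / 2 ^ l) + (b2 / 2 ^ l + b3 / 2 ^ l)) * (h ^ mi_abs \<alpha> / M (mi_abs \<alpha>))"
        unfolding \<rho>_def
        by (rule rho_le[OF r1 r2[OF f y] r3 _ _ _ Mpos weight_0[OF W(1)] h \<tau>(1)]) (use c10 CH(1) b20 b30 in auto)
      also have "\<dots> = C / 2 ^ l * (h ^ mi_abs \<alpha> / M (mi_abs \<alpha>))" unfolding C_def by (simp add: add_divide_distrib)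
      finally show "cmod (\<rho> f l \<alpha> y) \<le> C / 2 ^ l * (h ^ mi_abs \<alpha> / M (mi_abs \<alpha>))" .
    qed
  qed
  have gc: "continuous_on UNIV (g p i j)" if "j \<le> p" for p i j using gs(1)[of p i] that by (simp add: deriv_seq_def)
  have cont: "continuous_on UNIV (\<rho> f l \<alpha>)" for f l \<alpha>
    unfolding \<rho>_def by (rule continuous_rho) (use gc gc[of 0 _ undefined] gs(2) in auto)
  have sums: "(\<lambda>l. \<Sum>\<alpha>\<in>pures (q l). LINT y|lborel. restr Ks (mderiv \<alpha> \<phi>) y * \<rho> f l \<alpha> y) sums f \<phi>"
    if f: "f \<in> B" and \<phi>: "\<phi> \<in> E_open M \<Omega>" and c: "c \<ge> 0" "\<And>m. derivs_le M (K m) 1 c \<phi>" for f \<phi> c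
  proof -
    have "(\<lambda>l. f (restr \<Omega> (trig_approx w n \<tau> l (restr Ks \<phi>)))) \<longlonglongrightarrow> f \<phi>"
      unfolding w_def Ks_def
      by (rule dual_approx[OF fB[OF f] Cb(2)[OF f] \<tau>(1,2) _ order_refl lessI \<phi>])
        (use \<tau>(3) c in \<open>auto simp: Ks_def\<close>)
    from dual_Top_sums[OF fB[OF f] \<tau>(1) this] show ?thesis
      unfolding \<rho>_def e_def
      by (subst rho_term[OF \<Omega> E_open_smooth[OF \<Omega> Mpos \<phi>] _ order_refl _ _ gs \<tau>(1)])
        (use K_compact[of "Suc n"] K(2)[of "Suc n"] in \<open>auto simp: Ks_def\<close>)
  qed
  show ?thesis
    using bound cont sums rho_eq_0 unfolding Ks_def
    by (intro exI[of _ "Suc n"] exI[of _ "\<lambda>l. pures (q l)"] exI[of _ \<rho>]) (auto simp: \<rho>_def)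
qed

lemma density_integral_diff:
  assumes "smooth_on \<Omega> \<phi>" "smooth_on \<Omega> \<psi>" "continuous_on UNIV r"
  shows "(LINT y|lborel. restr (K N) (mderiv \<alpha> (\<lambda>x. 1 * \<phi> x + (-1) * \<psi> x)) y * r y)
    = (LINT y|lborel. restr (K N) (mderiv \<alpha> \<phi>) y * r y) - (LINT y|lborel. restr (K N) (mderiv \<alpha> \<psi>) y * r y)"
proof -
  have int: "integrable lborel (\<lambda>y. restr (K N) (mderiv \<alpha> f) y * r y)" if f: "smooth_on \<Omega> f" for f
  proof (rule integrable_compact_support[OF K_compact])
    have "continuous_on (K N) (restr (K N) (mderiv \<alpha> f))"
      by (rule continuous_on_eq[OF continuous_on_subset[OF smooth_on_mderiv_continuous[OF f] K(2)]]) (simp add: restr_def)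
    then show "continuous_on (K N) (\<lambda>y. restr (K N) (mderiv \<alpha> f) y * r y)"
      by (intro continuous_on_mult continuous_on_subset[OF assms(3)]) auto
  qed (simp add: restr_def)
  have "restr (K N) (mderiv \<alpha> (\<lambda>x. 1 * \<phi> x + (-1) * \<psi> x)) y * r y
      = restr (K N) (mderiv \<alpha> \<phi>) y * r y - restr (K N) (mderiv \<alpha> \<psi>) y * r y" for y
  proof (cases "y \<in> K N")
    case True
    then have "y \<in> \<Omega>" using K(2) by blast
    then show ?thesis
      using smooth_on_lincomb(2)[OF \<Omega> assms(1,2), of y "mi_list \<alpha>" 1 "-1"]
      by (simp add: restr_def mderiv_eq left_diff_distrib)
  qed (simp add: restr_def)
  then show ?thesis
    by (simp only: Bochner_Integration.integral_diff[OF int[OF assms(1)] int[OF assms(2)]])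
qed

text \<open>Along the approximants P l, f (P l) tends to f \<phi> by a bound on f adapted to the
  rates of \<phi>. The density series of \<phi> - P l tends to zero because the densities are small
  for every h. Hence the series at \<phi> has the value f \<phi>.\<close>

lemma density_represents:
  assumes B: "B \<subseteq> top_dual (E_topology M \<Omega>)" "f \<in> B"
    and G: "\<And>h. (\<And>m. h m > 0) \<Longrightarrow> \<exists>n C. C > 0 \<and> (\<forall>f\<in>B. \<forall>\<phi>\<in>E_open M \<Omega>. \<forall>c\<ge>0.
      (\<forall>m\<le>n. derivs_le M (interior (K m)) (h m) c \<phi>) \<longrightarrow> cmod (f \<phi>) \<le> C * c)"
    and A: "\<And>l. finite (A l)" "\<And>l \<alpha> y. \<alpha> \<notin> A l \<Longrightarrow> \<rho> l \<alpha> y = 0"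
    and \<rho>: "\<And>l \<alpha>. continuous_on UNIV (\<rho> l \<alpha>)"
      "\<And>h. h > 0 \<Longrightarrow> \<exists>C\<ge>0. \<forall>l \<alpha>. \<forall>y\<in>K N. cmod (\<rho> l \<alpha> y) \<le> C / 2 ^ l * (h ^ mi_abs \<alpha> / M (mi_abs \<alpha>))"
    and sums: "\<And>\<phi> c. \<phi> \<in> E_open M \<Omega> \<Longrightarrow> c \<ge> 0 \<Longrightarrow> (\<And>m. derivs_le M (K m) 1 c \<phi>) \<Longrightarrow>
      (\<lambda>l. \<Sum>\<alpha>\<in>A l. LINT y|lborel. restr (K N) (mderiv \<alpha> \<phi>) y * \<rho> l \<alpha> y) sums f \<phi>"
    and \<phi>: "\<phi> \<in> E_open M \<Omega>"
  shows "((\<lambda>\<alpha>. LINT y|lborel. restr (K N) (mderiv \<alpha> \<phi>) y * (\<Sum>l. \<rho> l \<alpha> y)) has_sum f \<phi>) UNIV"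
proof -
  note \<phi>s = E_open_smooth[OF \<Omega> Mpos \<phi>]
  have f: "f \<in> top_dual (E_topology M \<Omega>)" using B by blast
  have "\<exists>g c. g > 0 \<and> c \<ge> 0 \<and> derivs_le M (K (Suc m)) g c \<phi>" for m
  proof -
    obtain h C where "h > 0" "C \<ge> 0" "derivs_le M (interior (K (Suc m))) h C \<phi>"
      using E_open_bd[OF \<Omega> Mpos \<phi> K(1)[of "Suc m"] K(2)[of "Suc m"]] by blast
    then show ?thesis
      using derivs_le_closure[OF \<phi>s, of "interior (K (Suc m))"] K(2)[of "Suc m"] unfolding K_closure by blast
  qed
  then obtain g c where gc: "\<And>m. g m > 0" "\<And>m. c m \<ge> 0" "\<And>m. derivs_le M (K (Suc m)) (g m) (c m) \<phi>" by metis
  \<comment> \<open>Second use of the bound on \<open>B\<close>, with rates dictated by \<phi>; the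
    resulting n0 may exceed the index belonging to the densities.\<close>
  have "\<exists>n C. C > 0 \<and> (\<forall>f\<in>B. \<forall>\<phi>\<in>E_open M \<Omega>. \<forall>c\<ge>0.
      (\<forall>m\<le>n. derivs_le M (interior (K m)) (deriv_rate m (g m)) c \<phi>) \<longrightarrow> cmod (f \<phi>) \<le> C * c)"
    by (rule G) (rule deriv_rate_pos[OF gc(1)])
  then obtain n0 Cb where Cb0: "\<forall>f\<in>B. \<forall>\<phi>\<in>E_open M \<Omega>. \<forall>c\<ge>0.
      (\<forall>m\<le>n0. derivs_le M (interior (K m)) (deriv_rate m (g m)) c \<phi>) \<longrightarrow> cmod (f \<phi>) \<le> Cb * c" by blast
  have Cb: "cmod (f \<phi>) \<le> Cb * c" if "\<phi> \<in> E_open M \<Omega>" "c \<ge> 0" "\<And>m. m \<le> n0 \<Longrightarrow> derivs_le M (interior (K m)) (deriv_rate m (g m)) c \<phi>" for \<phi> c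
    using Cb0 B(2) that by simp
  \<comment> \<open>The approximation has to be good on the sets that control f and on the set K N
    that carries the densities.\<close>
  define n where "n = max n0 N"
  obtain \<tau> where \<tau>: "\<tau> > 0" "\<And>m. m \<le> n \<Longrightarrow> \<tau> * \<delta> m \<le> 1" "\<And>y i. y \<in> K (Suc n) \<Longrightarrow> \<bar>\<tau> * y $ i\<bar> \<le> 1/8"
    using small_frequency_unit[where \<delta>=\<delta> and n=n, OF K_compact[of "Suc n"] \<delta>(1)] by blast
  define T where "T l = trig_approx (avg_width \<tau>) n \<tau> l (restr (K (Suc n)) \<phi>)" for l
  define P where "P l = restr \<Omega> (T l)" for l
  have P: "P l \<in> E_open M \<Omega>" for l unfolding P_def T_def by (rule restr_Top_E_open[OF \<tau>(1)])
  have lim: "(\<lambda>l. f (P l)) \<longlonglongrightarrow> f \<phi>"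
    unfolding P_def T_def
    by (rule dual_approx[OF f Cb \<tau>(1) \<tau>(2) \<tau>(3) _ lessI \<phi> _ gc(1)]) (use gc(2,3) in \<open>auto simp: n_def\<close>)
  have "\<exists>D\<ge>0. \<forall>l. derivs_le M (interior (K N)) (deriv_rate N (g N)) (D / 2 ^ l) (\<lambda>x. \<phi> x - T l x)"
    unfolding T_def
    by (rule trig_approx_approx[OF \<tau>(1) \<tau>(2) \<tau>(3) _ lessI \<phi>s gc(3) gc(2) gc(1)]) (simp_all add: n_def)
  then obtain D where D: "D \<ge> 0" "\<And>l. derivs_le M (interior (K N)) (deriv_rate N (g N)) (D / 2 ^ l) (\<lambda>x. \<phi> x - T l x)" by blast
  let ?\<psi> = "\<lambda>l x. 1 * \<phi> x + (-1) * P l x"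
  have \<psi>s: "smooth_on \<Omega> (?\<psi> l)" for l
    by (rule E_open_smooth[OF \<Omega> Mpos E_open_lincomb[OF \<Omega> Mpos \<phi> P]])
  have \<psi>b: "derivs_le M (K N) (deriv_rate N (g N)) (D / 2 ^ l) (?\<psi> l)" for l
  proof -
    have "derivs_le M (interior (K N)) (deriv_rate N (g N)) (D / 2 ^ l) (?\<psi> l)"
      unfolding P_def by (rule derivs_le_minus_restr[OF _ open_interior D(2)]) (use K(2) interior_subset in blast)
    then show ?thesis using derivs_le_closure[OF \<psi>s, of "interior (K N)"] K(2)[of N] unfolding K_closure by blast
  qed
  have \<rho>m: "\<rho> l \<alpha> \<in> borel_measurable borel" for l \<alpha> by (rule borel_measurable_continuous_onI[OF \<rho>(1)])
  have \<phi>b: "derivs_le M (K N) (g N) (c N) \<phi>"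
    by (rule derivs_le_mono[OF gc(3) K_mono gc(1) order_refl gc(2) order_refl Mpos]) simp
  obtain S where S: "((\<lambda>\<alpha>. LINT y|lborel. restr (K N) (mderiv \<alpha> \<phi>) y * (\<Sum>l. \<rho> l \<alpha> y)) has_sum S) UNIV"
    "(\<lambda>l. \<Sum>\<alpha>\<in>A l. LINT y|lborel. restr (K N) (mderiv \<alpha> \<phi>) y * \<rho> l \<alpha> y) sums S"
  proof -
    obtain C where C: "C \<ge> 0" "\<And>l \<alpha> y. y \<in> K N \<Longrightarrow> cmod (\<rho> l \<alpha> y) \<le> C / 2 ^ l * ((1 / (2 * g N)) ^ mi_abs \<alpha> / M (mi_abs \<alpha>))"
      using \<rho>(2)[of "1 / (2 * g N)"] gc(1)[of N] by auto
    have "\<exists>S. ((\<lambda>\<alpha>. LINT y|lborel. restr (K N) (mderiv \<alpha> \<phi>) y * (\<Sum>l. \<rho> l \<alpha> y)) has_sum S) UNIV \<and>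
      (\<lambda>l. \<Sum>\<alpha>\<in>A l. LINT y|lborel. restr (K N) (mderiv \<alpha> \<phi>) y * \<rho> l \<alpha> y) sums S \<and>
      cmod S \<le> c N * C * measure lborel (K N) * (2 * (\<Sum>\<^sub>\<infinity>\<alpha>::'d multi_index. (1/2::real) ^ mi_abs \<alpha>))"
      by (rule density_series[OF Mpos K_compact K(2) \<Omega> \<phi>s \<rho>m A C(2,1) gc(1) \<phi>b gc(2)])
    then show ?thesis using that by blast
  qed
  have hN: "deriv_rate N (g N) > 0" by (rule deriv_rate_pos[OF gc(1)])
  \<comment> \<open>The densities are estimated for the rate in which the error \<phi> - P l is
    small.\<close>
  obtain C where C: "C \<ge> 0" "\<And>l \<alpha> y. y \<in> K N \<Longrightarrow> cmod (\<rho> l \<alpha> y) \<le> C / 2 ^ l * ((1 / (2 * deriv_rate N (g N))) ^ mi_abs \<alpha> / M (mi_abs \<alpha>))"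
    using \<rho>(2)[of "1 / (2 * deriv_rate N (g N))"] hN by auto
  define X where "X = D * C * measure lborel (K N) * (2 * (\<Sum>\<^sub>\<infinity>\<alpha>::'d multi_index. (1/2::real) ^ mi_abs \<alpha>))"
  have est: "cmod (f (P l) - S) \<le> X * (1/2) ^ l" for l
  proof -
    have "\<exists>S. ((\<lambda>\<alpha>. LINT y|lborel. restr (K N) (mderiv \<alpha> (?\<psi> l)) y * (\<Sum>l. \<rho> l \<alpha> y)) has_sum S) UNIV \<and>
      (\<lambda>j. \<Sum>\<alpha>\<in>A j. LINT y|lborel. restr (K N) (mderiv \<alpha> (?\<psi> l)) y * \<rho> j \<alpha> y) sums S \<and>
      cmod S \<le> D / 2 ^ l * C * measure lborel (K N) * (2 * (\<Sum>\<^sub>\<infinity>\<alpha>::'d multi_index. (1/2::real) ^ mi_abs \<alpha>))"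
      by (rule density_series[OF Mpos K_compact K(2) \<Omega> \<psi>s \<rho>m A C(2,1) hN \<psi>b divide_nonneg_pos[OF D(1)]]) simp_all
    then obtain S' where S': "(\<lambda>j. \<Sum>\<alpha>\<in>A j. LINT y|lborel. restr (K N) (mderiv \<alpha> (?\<psi> l)) y * \<rho> j \<alpha> y) sums S'"
      "cmod S' \<le> D / 2 ^ l * C * measure lborel (K N) * (2 * (\<Sum>\<^sub>\<infinity>\<alpha>::'d multi_index. (1/2::real) ^ mi_abs \<alpha>))"
      by (elim exE conjE) (rule that)
    obtain c where c: "c \<ge> 0" "\<And>U. derivs_le M U 1 c (T l)"
      unfolding T_def trig_approx_def using trig_sum_bd[OF W(1) less_imp_le[OF \<tau>(1)]] by blast
    \<comment> \<open>P l has rate 1 on all sets of the exhaustion, with a constant depending on l,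
      so the representation for rate 1 applies whatever the period of P l is.\<close>
    have "(\<lambda>j. \<Sum>\<alpha>\<in>A j. LINT y|lborel. restr (K N) (mderiv \<alpha> (P l)) y * \<rho> j \<alpha> y) sums f (P l)"
      by (rule sums[OF P c(1)]) (simp add: P_def derivs_le_restr[OF K(2) \<Omega>] c(2))
    from sums_diff[OF S(2) this]
    have "(\<lambda>j. \<Sum>\<alpha>\<in>A j. LINT y|lborel. restr (K N) (mderiv \<alpha> (?\<psi> l)) y * \<rho> j \<alpha> y) sums (S - f (P l))"
      unfolding density_integral_diff[OF \<phi>s E_open_smooth[OF \<Omega> Mpos P] \<rho>(1)] sum_subtractf .
    then have "S' = S - f (P l)" by (rule sums_unique2[OF S'(1)])
    then show ?thesis using S'(2) by (simp add: X_def norm_minus_commute power_divide)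
  qed
  have "(\<lambda>l. f (P l) - S) \<longlonglongrightarrow> 0"
  proof (rule Lim_null_comparison)
    show "(\<lambda>l. X * (1/2) ^ l) \<longlonglongrightarrow> 0" by (intro tendsto_mult_right_zero LIMSEQ_power_zero) simp
  qed (use est in simp)
  then have "(\<lambda>l. f (P l)) \<longlonglongrightarrow> S" by (simp add: LIM_zero_iff)
  then have "S = f \<phi>" using lim by (rule LIMSEQ_unique)
  then show ?thesis using S(1) by simp
qed

end

theorem proposition4p7:
  fixes M :: "nat \<Rightarrow> real" and \<Omega> :: "(real^'d::finite) set"
    and B :: "((real^'d \<Rightarrow> complex) \<Rightarrow> complex) set"
  assumes "weight_sequence M" and "cond_M1 M" and "cond_M2' M" and "cond_QA M"
    and "fact_subset M"
    and "open \<Omega>"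
    and "vN_bounded (strong_dual_topology (E_topology M \<Omega>)) B"
  shows "\<exists>K. \<exists>\<mu> :: ((real^'d \<Rightarrow> complex) \<Rightarrow> complex) \<Rightarrow> 'd multi_index \<Rightarrow>
                    (real^'d \<Rightarrow> complex) \<Rightarrow> complex.
     compact K \<and> K \<subseteq> \<Omega> \<and>
     (\<forall>f\<in>B. \<forall>\<alpha>. \<mu> f \<alpha> \<in> C_dual K) \<and>
     (\<forall>h>0. bdd_above {C_dual_norm K (\<mu> f \<alpha>) * M (mi_abs \<alpha>) / h ^ mi_abs \<alpha> | f \<alpha>. f \<in> B}) \<and>
     (\<forall>f\<in>B. \<forall>\<phi>\<in>E_open M \<Omega>.
        ((\<lambda>\<alpha>. (-1) ^ mi_abs \<alpha> * \<mu> f \<alpha> (restr K (mderiv \<alpha> \<phi>))) has_sum f \<phi>) UNIV)"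
proof -
  note W = assms(1,2) and M2 = assms(3) and \<Omega> = assms(6)
  note Mpos = weight_pos[OF W(1)]
  obtain C0 H0 where F: "\<And>p. fact p \<le> C0 * H0 ^ p * M p" "C0 > 0" "H0 > 0"
    using assms(5) unfolding fact_subset_def by metis
  obtain A1 H1 where sh: "\<And>p. M (p + (CARD('d) + 1)) \<le> A1 * H1 ^ p * M p" "A1 > 0" "H1 \<ge> 1"
    using weight_shift[OF W(1) M2] by metis
  obtain K where K: "\<And>n::nat. regular_compact (K n)" "\<And>n. K n \<subseteq> \<Omega>" "\<And>n. K n \<subseteq> interior (K (Suc n))"
    "\<And>C. compact C \<Longrightarrow> C \<subseteq> \<Omega> \<Longrightarrow> \<exists>n. C \<subseteq> interior (K n)"
  proof (rule regular_exhaustion[OF \<Omega>])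
    fix K :: "nat \<Rightarrow> (real^'d) set"
    assume K: "\<And>n. regular_compact (K n)" "\<And>n. K n \<subseteq> \<Omega>" "\<And>n. K n \<subseteq> interior (K (Suc n))"
      "\<And>C. compact C \<Longrightarrow> C \<subseteq> \<Omega> \<Longrightarrow> \<exists>n. C \<subseteq> interior (K n)"
    show thesis by (rule that[of K]; fact K)
  qed
  have Kc: "compact (K m)" for m using K(1)[of m] unfolding regular_compact_def by blast
  have "\<exists>\<delta>>0. \<forall>x\<in>K m. \<forall>y. (\<forall>i. \<bar>y $ i - x $ i\<bar> < 2 * \<delta>) \<longrightarrow> y \<in> interior (K (Suc m))" for m
    by (rule sup_norm_neighbourhood[OF Kc open_interior K(3)])
  then obtain \<delta> where \<delta>: "\<And>m. \<delta> m > 0"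
    "\<And>m x y. x \<in> K m \<Longrightarrow> (\<And>i. \<bar>y $ i - x $ i\<bar> < 2 * \<delta> m) \<Longrightarrow> y \<in> interior (K (Suc m))" by metis
  have "\<exists>C\<ge>0. \<forall>q. \<exists>\<theta>. cutoff_class q (C * (real q + 1)) \<theta> \<and> (\<forall>x. 0 \<le> \<theta> x \<and> \<theta> x \<le> 1) \<and>
    (\<forall>x. (\<exists>y\<in>K m. \<forall>i. \<bar>x $ i - y $ i\<bar> \<le> \<delta> m) \<longrightarrow> \<theta> x = 1) \<and>
    (\<forall>x. (\<forall>y\<in>K m. \<exists>i. 2 * \<delta> m \<le> \<bar>x $ i - y $ i\<bar>) \<longrightarrow> \<theta> x = 0)" for m
    by (rule cutoff_exists[OF Kc \<delta>(1)])
  then obtain Cc where Cc: "\<And>m. Cc m \<ge> 0" "\<And>m q. \<exists>\<theta>. cutoff_class q (Cc m * (real q + 1)) \<theta> \<and> (\<forall>x. 0 \<le> \<theta> x \<and> \<theta> x \<le> 1) \<and>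
    (\<forall>x. (\<exists>y\<in>K m. \<forall>i. \<bar>x $ i - y $ i\<bar> \<le> \<delta> m) \<longrightarrow> \<theta> x = 1) \<and>
    (\<forall>x. (\<forall>y\<in>K m. \<exists>i. 2 * \<delta> m \<le> \<bar>x $ i - y $ i\<bar>) \<longrightarrow> \<theta> x = 0)" by metis
  have G: "\<exists>n C. C > 0 \<and> (\<forall>f\<in>B. \<forall>\<phi>\<in>E_open M \<Omega>. \<forall>c\<ge>0.
      (\<forall>m\<le>n. derivs_le M (interior (K m)) (h m) c \<phi>) \<longrightarrow> cmod (f \<phi>) \<le> C * c)" if "\<And>m. h m > 0" for h
    by (rule gliding_hump[where K=K and h=h, OF \<Omega> Mpos assms(7)]) (rule K that | assumption)+
  interpret roumieu_exhaustion M \<Omega> K \<delta> Cc C0 H0 A1 H1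
    by (unfold_locales; fact W F sh \<Omega> K(1-3) \<delta> Cc)
  have B: "B \<subseteq> top_dual (E_topology M \<Omega>)" by (rule strong_bounded_subset[OF assms(7)])
  have "\<exists>N A \<rho>. (\<forall>l. finite (A l)) \<and> (\<forall>f\<in>B. \<forall>l \<alpha>. continuous_on UNIV (\<rho> f l \<alpha>)) \<and>
    (\<forall>f\<in>B. \<forall>l \<alpha> y. \<alpha> \<notin> A l \<longrightarrow> \<rho> f l \<alpha> y = 0) \<and>
    (\<forall>h>0. \<exists>C\<ge>0. \<forall>f\<in>B. \<forall>l \<alpha>. \<forall>y\<in>K N. cmod (\<rho> f l \<alpha> y) \<le> C / 2 ^ l * (h ^ mi_abs \<alpha> / M (mi_abs \<alpha>))) \<and>
    (\<forall>f\<in>B. \<forall>\<phi>\<in>E_open M \<Omega>. (\<exists>c\<ge>0. \<forall>m. derivs_le M (K m) 1 c \<phi>) \<longrightarrow>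
      (\<lambda>l. \<Sum>\<alpha>\<in>A l. LINT y|lborel. restr (K N) (mderiv \<alpha> \<phi>) y * \<rho> f l \<alpha> y) sums f \<phi>)"
    by (rule densities_exist[OF M2 B G])
  then obtain N A \<rho> where \<rho>: "\<forall>l. finite (A l)" "\<forall>f\<in>B. \<forall>l \<alpha>. continuous_on UNIV (\<rho> f l \<alpha>)"
    "\<forall>f\<in>B. \<forall>l \<alpha> y. \<alpha> \<notin> A l \<longrightarrow> \<rho> f l \<alpha> y = 0"
    "\<forall>h>0. \<exists>C\<ge>0. \<forall>f\<in>B. \<forall>l \<alpha>. \<forall>y\<in>K N. cmod (\<rho> f l \<alpha> y) \<le> C / 2 ^ l * (h ^ mi_abs \<alpha> / M (mi_abs \<alpha>))"
    "\<forall>f\<in>B. \<forall>\<phi>\<in>E_open M \<Omega>. (\<exists>c\<ge>0. \<forall>m. derivs_le M (K m) 1 c \<phi>) \<longrightarrow>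
      (\<lambda>l. \<Sum>\<alpha>\<in>A l. LINT y|lborel. restr (K N) (mderiv \<alpha> \<phi>) y * \<rho> f l \<alpha> y) sums f \<phi>"
    by (elim exE conjE) (rule that)
  \<comment> \<open>For each \<alpha> the contributions of all shells add up to one bounded
    measurable density.\<close>
  define R where "R f \<alpha> y = (\<Sum>l. \<rho> f l \<alpha> y)" for f \<alpha> y
  have Rm: "R f \<alpha> \<in> borel_measurable borel" if "f \<in> B" for f \<alpha>
    unfolding R_def[abs_def]
    by (intro borel_measurable_suminf borel_measurable_continuous_onI) (use \<rho>(2) that in blast)
  have Rb: "\<exists>C\<ge>0. \<forall>f\<in>B. \<forall>\<alpha>. \<forall>y\<in>K N. cmod (R f \<alpha> y) \<le> C * (h ^ mi_abs \<alpha> / M (mi_abs \<alpha>))" if h: "h > 0" for h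
  proof -
    obtain C where C: "C \<ge> 0" "\<forall>f\<in>B. \<forall>l \<alpha>. \<forall>y\<in>K N. cmod (\<rho> f l \<alpha> y) \<le> C / 2 ^ l * (h ^ mi_abs \<alpha> / M (mi_abs \<alpha>))"
      using \<rho>(4) h by blast
    have "cmod (R f \<alpha> y) \<le> 2 * C * (h ^ mi_abs \<alpha> / M (mi_abs \<alpha>))" if "f \<in> B" "y \<in> K N" for f \<alpha> y
    proof -
      let ?Y = "C * (h ^ mi_abs \<alpha> / M (mi_abs \<alpha>))"
      have le: "cmod (\<rho> f l \<alpha> y) \<le> ?Y * (1/2) ^ l" for l
      proof -
        have "cmod (\<rho> f l \<alpha> y) \<le> C / 2 ^ l * (h ^ mi_abs \<alpha> / M (mi_abs \<alpha>))" using C(2) that by simp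
        then show ?thesis by (simp add: power_divide mult_ac)
      qed
      have "(\<lambda>l. ?Y * (1/2) ^ l) sums (?Y * 2)"
        using sums_mult[OF geometric_sums[of "1/2::real"], of ?Y] by simp
      then have "cmod (R f \<alpha> y) \<le> ?Y * 2"
        unfolding R_def using norm_suminf_le[of "\<lambda>l. \<rho> f l \<alpha> y", OF le] by (simp add: sums_iff)
      then show ?thesis by (simp add: mult_ac)
    qed
    then show ?thesis using C(1) by (intro exI[of _ "2 * C"]) auto
  qed
  \<comment> \<open>The sign compensates the factor (-1) ^ |\<alpha>| in the pairing with the
    derivative of a measure.\<close>
  define r where "r f \<alpha> y = (-1) ^ mi_abs \<alpha> * R f \<alpha> y" for f \<alpha> y
  have rm: "r f \<alpha> \<in> borel_measurable borel" if "f \<in> B" for f \<alpha>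
    unfolding r_def[abs_def] by (intro borel_measurable_times borel_measurable_const Rm[OF that])
  have nr: "cmod (r f \<alpha> y) = cmod (R f \<alpha> y)" for f \<alpha> y
    by (simp add: r_def norm_mult norm_power)
  have fin: "C * (h ^ p / M p) \<ge> 0" if "C \<ge> 0" "h > 0" for C h p
    using that Mpos[of p] by simp
  show ?thesis
  proof (intro exI[of _ "K N"] exI[of _ "\<lambda>f \<alpha>. dens (K N) (r f \<alpha>)"] conjI ballI allI impI Kc K(2))
    fix f \<alpha> assume f: "f \<in> B"
    obtain C where C: "C \<ge> 0" "\<And>y. y \<in> K N \<Longrightarrow> cmod (r f \<alpha> y) \<le> C * (1 ^ mi_abs \<alpha> / M (mi_abs \<alpha>))"
      using Rb[OF zero_less_one] f unfolding nr by blast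
    show "dens (K N) (r f \<alpha>) \<in> C_dual (K N)"
      by (rule dens_dual(1)[OF Kc rm[OF f] C(2) fin[OF C(1) zero_less_one]])
  next
    fix h :: real assume h: "h > 0"
    obtain C where C: "C \<ge> 0" "\<And>f \<alpha> y. f \<in> B \<Longrightarrow> y \<in> K N \<Longrightarrow> cmod (r f \<alpha> y) \<le> C * (h ^ mi_abs \<alpha> / M (mi_abs \<alpha>))"
      using Rb[OF h] unfolding nr by blast
    have "C_dual_norm (K N) (dens (K N) (r f \<alpha>)) * M (mi_abs \<alpha>) / h ^ mi_abs \<alpha> \<le> C * measure lborel (K N)" if f: "f \<in> B" for f \<alpha>
    proof -
      have "C_dual_norm (K N) (dens (K N) (r f \<alpha>)) \<le> C * (h ^ mi_abs \<alpha> / M (mi_abs \<alpha>)) * measure lborel (K N)"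
        by (rule dens_dual(2)[OF Kc rm[OF f] C(2)[OF f] fin[OF C(1) h]])
      then have "C_dual_norm (K N) (dens (K N) (r f \<alpha>)) * M (mi_abs \<alpha>) / h ^ mi_abs \<alpha>
          \<le> C * (h ^ mi_abs \<alpha> / M (mi_abs \<alpha>)) * measure lborel (K N) * M (mi_abs \<alpha>) / h ^ mi_abs \<alpha>"
        using h less_imp_le[OF Mpos] by (intro divide_right_mono mult_right_mono) auto
      also have "\<dots> = C * measure lborel (K N)" using h Mpos[of "mi_abs \<alpha>"] by simp
      finally show ?thesis .
    qed
    then show "bdd_above {C_dual_norm (K N) (dens (K N) (r f \<alpha>)) * M (mi_abs \<alpha>) / h ^ mi_abs \<alpha> | f \<alpha>. f \<in> B}"
      by (intro bdd_aboveI[of _ "C * measure lborel (K N)"]) blast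
  next
    fix f \<phi> assume f: "f \<in> B" and \<phi>: "\<phi> \<in> E_open M \<Omega>"
    have \<phi>s: "smooth_on \<Omega> \<phi>" by (rule E_open_smooth[OF \<Omega> Mpos \<phi>])
    have "((\<lambda>\<alpha>. LINT y|lborel. restr (K N) (mderiv \<alpha> \<phi>) y * R f \<alpha> y) has_sum f \<phi>) UNIV"
      unfolding R_def
    proof (rule density_represents[OF B f G _ _ _ _ _ \<phi>])
      show "\<exists>C\<ge>0. \<forall>l \<alpha>. \<forall>y\<in>K N. cmod (\<rho> f l \<alpha> y) \<le> C / 2 ^ l * (h ^ mi_abs \<alpha> / M (mi_abs \<alpha>))" if "h > 0" for h
        using \<rho>(4) f that by fast
      show "(\<lambda>l. \<Sum>\<alpha>\<in>A l. LINT y|lborel. restr (K N) (mderiv \<alpha> \<phi>) y * \<rho> f l \<alpha> y) sums f \<phi>"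
        if "\<phi> \<in> E_open M \<Omega>" "c \<ge> 0" "\<And>m. derivs_le M (K m) 1 c \<phi>" for \<phi> c
        using \<rho>(5) f that by blast
    qed (use \<rho>(1-3) f in auto)
    moreover have "(-1) ^ mi_abs \<alpha> * dens (K N) (r f \<alpha>) (restr (K N) (mderiv \<alpha> \<phi>))
        = (LINT y|lborel. restr (K N) (mderiv \<alpha> \<phi>) y * R f \<alpha> y)" for \<alpha>
    proof -
      have "continuous_on (K N) (restr (K N) (mderiv \<alpha> \<phi>))"
        by (rule continuous_on_eq[OF continuous_on_subset[OF smooth_on_mderiv_continuous[OF \<phi>s] K(2)]]) (simp add: restr_def)
      then have "dens (K N) (r f \<alpha>) (restr (K N) (mderiv \<alpha> \<phi>)) = (LINT y|lborel. restr (K N) (mderiv \<alpha> \<phi>) y * r f \<alpha> y)"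
        by (simp add: dens_def C_space_def restr_def)
      also have "\<dots> = (LINT y|lborel. (-1) ^ mi_abs \<alpha> * (restr (K N) (mderiv \<alpha> \<phi>) y * R f \<alpha> y))"
        by (simp only: r_def mult_ac)
      also have "\<dots> = (-1) ^ mi_abs \<alpha> * (LINT y|lborel. restr (K N) (mderiv \<alpha> \<phi>) y * R f \<alpha> y)"
        by (rule integral_mult_right_zero)
      finally show ?thesis by (simp flip: mult.assoc power_mult_distrib)
    qed
    ultimately show "((\<lambda>\<alpha>. (-1) ^ mi_abs \<alpha> * dens (K N) (r f \<alpha>) (restr (K N) (mderiv \<alpha> \<phi>))) has_sum f \<phi>) UNIV"
      by simp
  qed
qed

end
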